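(* Let $p>2$ and let $(x,f,h,g,S)$ satisfy assumptions (A1)–(A4) listed in the context. Then there exists at most one solution $(X,K)$ in $M^p_G([0,T])\times(M_I([0,T])\cap M^p_G([0,T]))$ to the reflected stochastic differential equation driven by $G$-Brownian motion $$X_t=x+\int_0^t f_s(X_s)\,ds+\int_0^t h_s(X_s)\,d\langle B\rangle_s+\int_0^t g_s(X_s)\,dB_s+K_t,\quad 0\le t\le T,\ \text{q.s.},$$ with obstacle $S$, where "solution" means that this equation and conditions (A5)–(A7) of the context hold.
   Context: $G$-framework. Fix $T>0$ and $0\le\underline\sigma\le\overline\sigma=1$. $\Omega$ is the space of continuous paths $\omega:[0,\infty)\to\mathbb R$ with $\omega_0=0$ (topology of locally uniform convergence), $B$ is the canonical process, $\Omega_t$ the space of paths stopped at $t$, and $L^0(\Omega_t)$ the space of $\mathcal B(\Omega_t)$-measurable real random variables. $C_{l,Lip}(\mathbb R^n)$ is the set of functions $\varphi$ with $|\varphi(x)-\varphi(y)|\le C(1+|x|^m+|y|^m)|x-y|$ for some $C,m$, and $L^0_{ip}(\Omega_t)=\{\varphi(B_{t_1},\dots,B_{t_n}): n\ge1,\,0\le t_1\le\dots\le t_n\le t,\,\varphi\in C_{l,Lip}(\mathbb R^n)\}$. The $G$-expectation $\mathbb E$ is the sublinear expectation on $L^0_{ip}(\Omega_T)$ (monotone, sub-additive, positively homogeneous, constant translatable) under which $B$ is a $G$-Brownian motion: $B_t-B_s$ is $G$-normal $\mathcal N(0,[(t-s)\underline\sigma^2,t-s])$, i.e. $\mathbb E[\varphi(x+B_t)]=u(t,x)$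 where $u$ is the viscosity solution of $\partial_t u=G(\partial^2_{xx}u)$, $u|_{t=0}=\varphi$, $G(a)=\frac12(a^+-\underline\sigma^2a^-)$; and $\mathbb E[\varphi(B_{t_1},\dots,B_{t_{n-1}},B_{t_n}-B_{t_{n-1}})]=\mathbb E[\psi(B_{t_1},\dots,B_{t_{n-1}})]$ with $\psi(x_1,\dots,x_{n-1})=\mathbb E[\varphi(x_1,\dots,x_{n-1},\sqrt{t_n-t_{n-1}}B_1)]$. $\mathcal P_G$ is the weakly compact family of probability measures on $(\Omega,\mathcal B(\Omega))$ representing it (Denis–Hu–Peng): $\mathbb E[X]=\bar{\mathbb E}[X]:=\sup_{\mathbb P\in\mathcal P_G}E^{\mathbb P}[X]$; $\bar{\mathbb E}$ is used for all measurable $X$ for which it makes sense. $\bar C(A)=\sup_{\mathbb P\in\mathcal P_G}\mathbb P(A)$; $A$ is polar if $\bar C(A)=0$; quasi-surely (q.s.) means outside a polar set. Spaces. For $p\ge1$, $L^p_G(\Omega_t)$ is the completion of $L^0_{ip}(\Omega_t)$ under $\bar{\mathbb E}[|\cdot|^p]^{1/p}$ (a space of random variables up to q.s. equality). $M^{p,0}_G([0,T])$ is the set of step processes $\eta_t=\sum_{k=0}^{N-1}\xi_k\mathbf 1_{[t_k,t_{k+1})}(t)$ with $0=t_0<\dots<t_N=T$ and $\xi_k\in L^p_G(\Omega_{t_k})$; $M^p_G([0,T])$ is its completion under $\|\eta\|=(\frac1T\int_0^T\bar{\mathbb E}[|\eta_t|^p]dt)^{1/p}$. Integrals. For $\eta\in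 M^{2,0}_G$, $\int_0^T\eta_s dB_s=\sum_k\xi_k(B_{t_{k+1}}-B_{t_k})$, extended continuously to $M^2_G([0,T])\to L^2_G(\Omega_T)$. $\langle B\rangle_t=B_t^2-2\int_0^tB_sdB_s$ is the quadratic variation. For $\eta\in M^{1,0}_G$, $\int_0^T\eta_s d\langle B\rangle_s=\sum_k\xi_k(\langle B\rangle_{t_{k+1}}-\langle B\rangle_{t_k})$, extended continuously to $M^1_G([0,T])\to L^1_G(\Omega_T)$. As processes, these integrals are taken in their q.s. continuous versions. Increasing processes. $M_c([0,T])$: processes whose paths are continuous on $[0,T]$ outside a polar set. $M_I([0,T])$: processes in $M_c([0,T])$ whose paths are increasing (nondecreasing) on $[0,T]$ outside a polar set. For $X\in M_c([0,T])$, $K\in M_I([0,T])$, $\int X\,dK$ is the pathwise Riemann–Stieltjes integral outside a polar set off which $X$ is continuous and $K$ is continuous and increasing, and $0$ on that polar set. Assumptions on the data, for a fixed $p>2$. (A1) $x\in\mathbb R$. (A2) $f,h,g:\Omega\times[0,T]\times\mathbb R\to\mathbb R$ are such that for each $y\in\mathbb R$, $f_\cdot(y),h_\cdot(y),g_\cdot(y)\in M^p_G([0,T])$. (A3) There is a constant $C_L$ such that for each $t\in[0,T]$ and $y,y'\in\mathbb R$, $|f_t(y)-f_t(y')|+|h_t(y)-h_t(y')|+|g_t(y)-g_t(y')|\le C_L|y-y'|$, q.s. (A4) The obstacle $S$ is a q.s. continuous $G$-Itô process, $S_t=S_0+\int_0^t a_sds+\int_0^t b_sd\langle B\rangle_s+\int_0^t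 c_sdB_s$ with $S_0\in\mathbb R$ and $a,b,c\in M^p_G([0,T])$, and $S_0\le x$. Solution conditions. (A5) $X\in M^p_G([0,T])$ and $X_t\ge S_t$, $0\le t\le T$, q.s. (A6) $K\in M_I([0,T])\cap M^p_G([0,T])$ and $K_0=0$, q.s. (A7) $\int_0^T(X_t-S_t)\,dK_t=0$, q.s.
   Formalization: In (A3) the exceptional polar set may depend on t but not on y, y'. If it may depend on y, y', then f_s(X_s) is ill-defined and uniqueness fails (e.g. g_t(y)=y on {y=X*_t}, t>0, else 0, with X*_t=exp(B_t−⟨B⟩_t/2), x=1, S=−1, lower volatility positive). *)

theory Defs
  imports "HOL-Probability.Probability"
begin

section \<open>Path space\<close>

text \<open>Paths live on the half-line from 0; the clause on negative times only makes the
  representing function unique.\<close>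

typedef path = "{\<omega> :: real \<Rightarrow> real. continuous_on {0..} \<omega> \<and> \<omega> 0 = 0 \<and> (\<forall>t<0. \<omega> t = 0)}"
  by (rule exI[of _ "\<lambda>_. 0"]) auto

definition canon :: "real \<Rightarrow> path \<Rightarrow> real" where
  "canon t \<omega> = Rep_path \<omega> t"

text \<open>The topology of locally uniform convergence.\<close>

instantiation path :: topological_space
begin

definition open_path :: "path set \<Rightarrow> bool" where
  "open_path U \<longleftrightarrow>
     (\<forall>\<omega>\<in>U. \<exists>r e. 0 \<le> r \<and> 0 < e \<and> {\<omega>'. \<forall>s\<in>{0..r}. \<bar>canon s \<omega>' - canon s \<omega>\<bar> < e} \<subseteq> U)"

instance
proof
  show "open (UNIV :: path set)"
    unfolding open_path_def by (auto intro: exI[of _ 0] exI[of _ 1])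
next
  fix U V :: "path set"
  assume U: "open U" and V: "open V"
  show "open (U \<inter> V)"
    unfolding open_path_def
  proof
    fix \<omega> assume w: "\<omega> \<in> U \<inter> V"
    obtain r e where 1: "0 \<le> r" "0 < e"
      "{\<omega>'. \<forall>s\<in>{0..r}. \<bar>canon s \<omega>' - canon s \<omega>\<bar> < e} \<subseteq> U"
      using U w unfolding open_path_def by blast
    obtain r' e' where 2: "0 \<le> r'" "0 < e'"
      "{\<omega>'. \<forall>s\<in>{0..r'}. \<bar>canon s \<omega>' - canon s \<omega>\<bar> < e'} \<subseteq> V"
      using V w unfolding open_path_def by blast
    have "{\<omega>'. \<forall>s\<in>{0..max r r'}. \<bar>canon s \<omega>' - canon s \<omega>\<bar> < min e e'} \<subseteq> U \<inter> V"
      using 1(3) 2(3) by fastforce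
    then show "\<exists>r e. 0 \<le> r \<and> 0 < e \<and>
        {\<omega>'. \<forall>s\<in>{0..r}. \<bar>canon s \<omega>' - canon s \<omega>\<bar> < e} \<subseteq> U \<inter> V"
      using 1 2 by (intro exI[of _ "max r r'"] exI[of _ "min e e'"]) auto
  qed
next
  fix \<U> :: "path set set"
  assume "\<forall>U\<in>\<U>. open U"
  then show "open (\<Union>\<U>)"
    unfolding open_path_def by (meson Union_iff Union_upper subset_trans)
qed

end

section \<open>Cylinder random variables\<close>

text \<open>A function on real n-space is encoded as a function of a sequence. The estimate below forces
  it to depend on the first \<open>n\<close> entries only.\<close>

definition C_lLip :: "nat \<Rightarrow> ((nat \<Rightarrow> real) \<Rightarrow> real) set" where
  "C_lLip n = {\<phi>. \<exists>C (m::nat). \<forall>x y. \<bar>\<phi> x - \<phi> y\<bar> \<le>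
      C * (1 + L2_set x {..<n} ^ m + L2_set y {..<n} ^ m) * L2_set (\<lambda>i. x i - y i) {..<n}}"

definition L_ip :: "real \<Rightarrow> (path \<Rightarrow> real) set" where
  "L_ip t = {X. \<exists>n \<tau> \<phi>. 1 \<le> n \<and> mono_on {..<n} \<tau> \<and> \<tau> ` {..<n} \<subseteq> {0..t} \<and> \<phi> \<in> C_lLip n \<and>
      X = (\<lambda>\<omega>. \<phi> (\<lambda>i. canon (\<tau> i) \<omega>))}"

definition L_ip_all :: "(path \<Rightarrow> real) set" where
  "L_ip_all = (\<Union>t\<in>{0..}. L_ip t)"

section \<open>The G-heat equation\<close>

definition G_fun :: "real \<Rightarrow> real \<Rightarrow> real" where
  "G_fun \<sigma> a = (max a 0 - \<sigma>\<^sup>2 * max (- a) 0) / 2"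

text \<open>\<open>C12 \<psi> \<psi>t \<psi>xx\<close>: the function \<open>\<psi>\<close> is once in time and twice in space continuously
  differentiable on the open upper half-plane, with the indicated derivatives.\<close>

definition C12 :: "(real \<Rightarrow> real \<Rightarrow> real) \<Rightarrow> (real \<Rightarrow> real \<Rightarrow> real) \<Rightarrow> (real \<Rightarrow> real \<Rightarrow> real) \<Rightarrow> bool" where
  "C12 \<psi> \<psi>t \<psi>xx \<longleftrightarrow> (\<exists>\<psi>x.
     (\<forall>t>0. \<forall>x. ((\<lambda>s. \<psi> s x) has_real_derivative \<psi>t t x) (at t) \<and>
               ((\<lambda>y. \<psi> t y) has_real_derivative \<psi>x t x) (at x) \<and>
               ((\<lambda>y. \<psi>x t y) has_real_derivative \<psi>xx t x) (at x)) \<and>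
     continuous_on ({0<..} \<times> UNIV) (\<lambda>(t, x). \<psi> t x) \<and>
     continuous_on ({0<..} \<times> UNIV) (\<lambda>(t, x). \<psi>t t x) \<and>
     continuous_on ({0<..} \<times> UNIV) (\<lambda>(t, x). \<psi>x t x) \<and>
     continuous_on ({0<..} \<times> UNIV) (\<lambda>(t, x). \<psi>xx t x))"

definition G_heat_viscosity_solution ::
    "real \<Rightarrow> (real \<Rightarrow> real) \<Rightarrow> (real \<Rightarrow> real \<Rightarrow> real) \<Rightarrow> bool" where
  "G_heat_viscosity_solution \<sigma> \<phi> u \<longleftrightarrow>
     continuous_on ({0..} \<times> UNIV) (\<lambda>(t, x). u t x) \<and>
     (\<forall>x. u 0 x = \<phi> x) \<and>
     (\<forall>\<psi> \<psi>t \<psi>xx t x. C12 \<psi> \<psi>t \<psi>xx \<longrightarrow> 0 < t \<longrightarrow>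
        (\<forall>\<^sub>F (s, y) in nhds (t, x). u s y - \<psi> s y \<le> u t x - \<psi> t x) \<longrightarrow>
        \<psi>t t x \<le> G_fun \<sigma> (\<psi>xx t x)) \<and>
     (\<forall>\<psi> \<psi>t \<psi>xx t x. C12 \<psi> \<psi>t \<psi>xx \<longrightarrow> 0 < t \<longrightarrow>
        (\<forall>\<^sub>F (s, y) in nhds (t, x). u s y - \<psi> s y \<ge> u t x - \<psi> t x) \<longrightarrow>
        \<psi>t t x \<ge> G_fun \<sigma> (\<psi>xx t x))"

section \<open>G-expectation and representing family of measures\<close>

definition sublinear_expectation :: "((path \<Rightarrow> real) \<Rightarrow> real) \<Rightarrow> bool" where
  "sublinear_expectation E \<longleftrightarrow>
     (\<forall>X\<in>L_ip_all. \<forall>Y\<in>L_ip_all. (\<forall>\<omega>. X \<omega> \<le> Y \<omega>) \<longrightarrow> E X \<le> E Y) \<and>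
     (\<forall>X\<in>L_ip_all. \<forall>Y\<in>L_ip_all. E (\<lambda>\<omega>. X \<omega> + Y \<omega>) \<le> E X + E Y) \<and>
     (\<forall>X\<in>L_ip_all. \<forall>c\<ge>0. E (\<lambda>\<omega>. c * X \<omega>) = c * E X) \<and>
     (\<forall>X\<in>L_ip_all. \<forall>c. E (\<lambda>\<omega>. X \<omega> + c) = E X + c)"

text \<open>The sublinear expectation under which the canonical process is a G-Brownian motion with
  volatility bounds \<open>\<sigma>\<close> and 1. Only its values on cylinder random variables matter.
  In the last clause the time points are \<open>\<tau> 0 \<le> \<dots> \<le> \<tau> m\<close>, so the last increment is the one
  from \<open>\<tau> (m - 1)\<close> to \<open>\<tau> m\<close>.\<close>

definition G_expectation :: "real \<Rightarrow> ((path \<Rightarrow> real) \<Rightarrow> real) \<Rightarrow> bool" where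
  "G_expectation \<sigma> E \<longleftrightarrow>
     sublinear_expectation E \<and>
     (\<forall>\<phi>. (\<lambda>v. \<phi> (v 0)) \<in> C_lLip 1 \<longrightarrow>
        (\<exists>u. G_heat_viscosity_solution \<sigma> \<phi> u \<and>
             (\<forall>s t x. 0 \<le> s \<longrightarrow> s \<le> t \<longrightarrow>
                E (\<lambda>\<omega>. \<phi> (x + (canon t \<omega> - canon s \<omega>))) = u (t - s) x))) \<and>
     (\<forall>m \<tau> \<phi>. 1 \<le> m \<longrightarrow> mono_on {..m} \<tau> \<longrightarrow> 0 \<le> \<tau> 0 \<longrightarrow> \<phi> \<in> C_lLip (Suc m) \<longrightarrow>
        E (\<lambda>\<omega>. \<phi> (\<lambda>i. if i < m then canon (\<tau> i) \<omega>
                       else canon (\<tau> m) \<omega> - canon (\<tau> (m - 1)) \<omega>)) =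
        E (\<lambda>\<omega>. (\<lambda>x. E (\<lambda>\<omega>'. \<phi> (\<lambda>i. if i < m then x i
                                      else sqrt (\<tau> m - \<tau> (m - 1)) * canon 1 \<omega>')))
                 (\<lambda>i. canon (\<tau> i) \<omega>)))"

definition path_laws :: "path measure set" where
  "path_laws = {P. prob_space P \<and> sets P = sets borel}"

definition weak_topology :: "path measure topology" where
  "weak_topology = topology_generated_by
     {{P \<in> path_laws. (\<integral>\<omega>. \<phi> \<omega> \<partial>P) \<in> U} | (\<phi> :: path \<Rightarrow> real) U.
        continuous_on UNIV \<phi> \<and> bounded (range \<phi>) \<and> open U}"

definition represents :: "path measure set \<Rightarrow> ((path \<Rightarrow> real) \<Rightarrow> real) \<Rightarrow> bool" where
  "represents PG E \<longleftrightarrow> compactin weak_topology PG \<and>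
     (\<forall>X\<in>L_ip_all. (\<forall>P\<in>PG. integrable P X) \<and>
        ereal (E X) = (SUP P\<in>PG. ereal (\<integral>\<omega>. X \<omega> \<partial>P)))"

section \<open>Quasi-sure analysis\<close>

definition capacity :: "path measure set \<Rightarrow> path set \<Rightarrow> ennreal" where
  "capacity PG A = (SUP P\<in>PG. emeasure P A)"

definition polar :: "path measure set \<Rightarrow> path set \<Rightarrow> bool" where
  "polar PG A \<longleftrightarrow> A \<in> sets borel \<and> capacity PG A = 0"

definition qs :: "path measure set \<Rightarrow> (path \<Rightarrow> bool) \<Rightarrow> bool" where
  "qs PG Q \<longleftrightarrow> (\<exists>A. polar PG A \<and> (\<forall>\<omega>. \<omega> \<notin> A \<longrightarrow> Q \<omega>))"

text \<open>Random variables are identified when they agree quasi-surely, so measurability is required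
  only up to modification on a polar set.\<close>

definition qs_measurable :: "path measure set \<Rightarrow> (path \<Rightarrow> real) \<Rightarrow> bool" where
  "qs_measurable PG X \<longleftrightarrow> (\<exists>Y\<in>borel_measurable borel. qs PG (\<lambda>\<omega>. X \<omega> = Y \<omega>))"

text \<open>The upper expectation of the \<open>p\<close>-th absolute power.\<close>

definition upper_moment :: "path measure set \<Rightarrow> real \<Rightarrow> (path \<Rightarrow> real) \<Rightarrow> ennreal" where
  "upper_moment PG p X = (SUP P\<in>PG. \<integral>\<^sup>+\<omega>. ennreal (\<bar>X \<omega>\<bar> powr p) \<partial>P)"

text \<open>The completions below are realised as the sets of all representatives of limits of Cauchy
  sequences. Convergence is expressed through \<open>p\<close>-th powers of the norms.\<close>

definition L_G :: "path measure set \<Rightarrow> real \<Rightarrow> real \<Rightarrow> (path \<Rightarrow> real) set" where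
  "L_G PG p t = {X. qs_measurable PG X \<and>
     (\<exists>Y. (\<forall>n. Y n \<in> L_ip t) \<and> (\<lambda>n. upper_moment PG p (\<lambda>\<omega>. Y n \<omega> - X \<omega>)) \<longlonglongrightarrow> 0)}"

text \<open>A step process is given by the number \<open>N\<close> of steps, the grid \<open>\<tau>\<close> and the values \<open>\<xi>\<close>.\<close>

definition step_data ::
    "path measure set \<Rightarrow> real \<Rightarrow> real \<Rightarrow> nat \<Rightarrow> (nat \<Rightarrow> real) \<Rightarrow> (nat \<Rightarrow> path \<Rightarrow> real) \<Rightarrow> bool" where
  "step_data PG p T N \<tau> \<xi> \<longleftrightarrow> \<tau> 0 = 0 \<and> \<tau> N = T \<and>
     (\<forall>k<N. \<tau> k < \<tau> (Suc k) \<and> \<xi> k \<in> L_G PG p (\<tau> k))"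

definition step_process ::
    "nat \<Rightarrow> (nat \<Rightarrow> real) \<Rightarrow> (nat \<Rightarrow> path \<Rightarrow> real) \<Rightarrow> real \<Rightarrow> path \<Rightarrow> real" where
  "step_process N \<tau> \<xi> t \<omega> = (\<Sum>k<N. \<xi> k \<omega> * indicator {\<tau> k..<\<tau> (Suc k)} t)"

text \<open>Convergence in the norm of \<open>M_G\<close>. The measurability clauses are needed because
  \<open>nn_integral\<close> is only a lower integral on functions that are not measurable.\<close>

definition M_G_tendsto :: "path measure set \<Rightarrow> real \<Rightarrow> real \<Rightarrow>
    (nat \<Rightarrow> real \<Rightarrow> path \<Rightarrow> real) \<Rightarrow> (real \<Rightarrow> path \<Rightarrow> real) \<Rightarrow> bool" where
  "M_G_tendsto PG p T H \<eta> \<longleftrightarrow>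
     (AE t in lebesgue_on {0..T}. qs_measurable PG (\<eta> t)) \<and>
     (\<forall>n. (\<lambda>t. upper_moment PG p (\<lambda>\<omega>. H n t \<omega> - \<eta> t \<omega>)) \<in> borel_measurable (lebesgue_on {0..T})) \<and>
     (\<lambda>n. ennreal (1 / T) *
        (\<integral>\<^sup>+t. upper_moment PG p (\<lambda>\<omega>. H n t \<omega> - \<eta> t \<omega>) \<partial>lebesgue_on {0..T})) \<longlonglongrightarrow> 0"

definition M_G :: "path measure set \<Rightarrow> real \<Rightarrow> real \<Rightarrow> (real \<Rightarrow> path \<Rightarrow> real) set" where
  "M_G PG p T = {\<eta>. \<exists>N \<tau> \<xi>. (\<forall>n. step_data PG p T (N n) (\<tau> n) (\<xi> n)) \<and>
      M_G_tendsto PG p T (\<lambda>n. step_process (N n) (\<tau> n) (\<xi> n)) \<eta>}"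

definition M_c :: "path measure set \<Rightarrow> real \<Rightarrow> (real \<Rightarrow> path \<Rightarrow> real) set" where
  "M_c PG T = {X. qs PG (\<lambda>\<omega>. continuous_on {0..T} (\<lambda>t. X t \<omega>))}"

definition M_I :: "path measure set \<Rightarrow> real \<Rightarrow> (real \<Rightarrow> path \<Rightarrow> real) set" where
  "M_I PG T = {K \<in> M_c PG T. qs PG (\<lambda>\<omega>. mono_on {0..T} (\<lambda>t. K t \<omega>))}"

section \<open>Integrals\<close>

text \<open>The integral over \<open>[0,t]\<close> of a step process against the integrator \<open>A\<close>.\<close>

definition step_integral :: "(real \<Rightarrow> path \<Rightarrow> real) \<Rightarrow>
    nat \<Rightarrow> (nat \<Rightarrow> real) \<Rightarrow> (nat \<Rightarrow> path \<Rightarrow> real) \<Rightarrow> real \<Rightarrow> path \<Rightarrow> real" where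
  "step_integral A N \<tau> \<xi> t \<omega> =
     (\<Sum>k<N. \<xi> k \<omega> * (A (min (\<tau> (Suc k)) t) \<omega> - A (min (\<tau> k) t) \<omega>))"

text \<open>Continuous extension from step processes: \<open>Y\<close> is (a version of) the integral of \<open>\<eta>\<close> over
  \<open>[0,t]\<close> against \<open>A\<close>. In particular \<open>\<eta> \<in> M_G PG q T\<close>. The exponent is \<open>q = 2\<close> for the canonical
  process and \<open>q = 1\<close> for its quadratic variation and for Lebesgue measure.\<close>

definition has_G_integral :: "path measure set \<Rightarrow> real \<Rightarrow> real \<Rightarrow> (real \<Rightarrow> path \<Rightarrow> real) \<Rightarrow>
    (real \<Rightarrow> path \<Rightarrow> real) \<Rightarrow> real \<Rightarrow> (path \<Rightarrow> real) \<Rightarrow> bool" where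
  "has_G_integral PG q T A \<eta> t Y \<longleftrightarrow> qs_measurable PG Y \<and>
     (\<exists>N \<tau> \<xi>. (\<forall>n. step_data PG q T (N n) (\<tau> n) (\<xi> n)) \<and>
        M_G_tendsto PG q T (\<lambda>n. step_process (N n) (\<tau> n) (\<xi> n)) \<eta> \<and>
        (\<lambda>n. upper_moment PG q (\<lambda>\<omega>. step_integral A (N n) (\<tau> n) (\<xi> n) t \<omega> - Y \<omega>)) \<longlonglongrightarrow> 0)"

definition G_integral_process :: "path measure set \<Rightarrow> real \<Rightarrow> real \<Rightarrow> (real \<Rightarrow> path \<Rightarrow> real) \<Rightarrow>
    (real \<Rightarrow> path \<Rightarrow> real) \<Rightarrow> (real \<Rightarrow> path \<Rightarrow> real) \<Rightarrow> bool" where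
  "G_integral_process PG q T A \<eta> I \<longleftrightarrow>
     I \<in> M_c PG T \<and> (\<forall>t\<in>{0..T}. has_G_integral PG q T A \<eta> t (I t))"

abbreviation dt_integral where
  "dt_integral PG T \<equiv> G_integral_process PG 1 T (\<lambda>t \<omega>. t)"

abbreviation dB_integral where
  "dB_integral PG T \<equiv> G_integral_process PG 2 T canon"

abbreviation dQV_integral where
  "dQV_integral PG T qv \<equiv> G_integral_process PG 1 T qv"

definition quadratic_variation :: "path measure set \<Rightarrow> real \<Rightarrow> (real \<Rightarrow> path \<Rightarrow> real) \<Rightarrow> bool" where
  "quadratic_variation PG T qv \<longleftrightarrow>
     (\<exists>J. dB_integral PG T canon J \<and> (\<forall>t \<omega>. qv t \<omega> = (canon t \<omega>)\<^sup>2 - 2 * J t \<omega>))"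

text \<open>The Riemann--Stieltjes integral of \<open>\<phi>\<close> against \<open>k\<close> over \<open>[a,b]\<close>, as limit over tagged
  partitions whose mesh tends to 0.\<close>

definition has_RS_integral ::
    "(real \<Rightarrow> real) \<Rightarrow> (real \<Rightarrow> real) \<Rightarrow> real \<Rightarrow> real \<Rightarrow> real \<Rightarrow> bool" where
  "has_RS_integral \<phi> k a b v \<longleftrightarrow>
     (\<forall>e>0. \<exists>d>0. \<forall>D. D tagged_division_of {a..b} \<longrightarrow> (\<forall>(x, J)\<in>D. diameter J < d) \<longrightarrow>
        \<bar>(\<Sum>(x, J)\<in>D. \<phi> x * (k (Sup J) - k (Inf J))) - v\<bar> < e)"

section \<open>The reflected equation\<close>

definition G_Ito_process :: "path measure set \<Rightarrow> real \<Rightarrow> real \<Rightarrow> (real \<Rightarrow> path \<Rightarrow> real) \<Rightarrow>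
    real \<Rightarrow> (real \<Rightarrow> path \<Rightarrow> real) \<Rightarrow> bool" where
  "G_Ito_process PG p T qv S0 S \<longleftrightarrow> S \<in> M_c PG T \<and>
     (\<exists>a\<in>M_G PG p T. \<exists>b\<in>M_G PG p T. \<exists>c\<in>M_G PG p T. \<exists>Ia Ib Ic.
        dt_integral PG T a Ia \<and> dQV_integral PG T qv b Ib \<and> dB_integral PG T c Ic \<and>
        qs PG (\<lambda>\<omega>. \<forall>t\<in>{0..T}. S t \<omega> = S0 + Ia t \<omega> + Ib t \<omega> + Ic t \<omega>))"

text \<open>For a coefficient \<open>f\<close>, \<open>f t y \<omega>\<close> is its value at time \<open>t\<close>, state \<open>y\<close> and path \<open>\<omega>\<close>.\<close>

definition reflected_GSDE_solution :: "path measure set \<Rightarrow> real \<Rightarrow> real \<Rightarrow> (real \<Rightarrow> path \<Rightarrow> real) \<Rightarrow>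
    real \<Rightarrow> (real \<Rightarrow> real \<Rightarrow> path \<Rightarrow> real) \<Rightarrow> (real \<Rightarrow> real \<Rightarrow> path \<Rightarrow> real) \<Rightarrow>
    (real \<Rightarrow> real \<Rightarrow> path \<Rightarrow> real) \<Rightarrow> (real \<Rightarrow> path \<Rightarrow> real) \<Rightarrow>
    (real \<Rightarrow> path \<Rightarrow> real) \<Rightarrow> (real \<Rightarrow> path \<Rightarrow> real) \<Rightarrow> bool" where
  "reflected_GSDE_solution PG p T qv x f h g S X K \<longleftrightarrow>
     (\<exists>If Ih Ig.
        dt_integral PG T (\<lambda>s \<omega>. f s (X s \<omega>) \<omega>) If \<and>
        dQV_integral PG T qv (\<lambda>s \<omega>. h s (X s \<omega>) \<omega>) Ih \<and>
        dB_integral PG T (\<lambda>s \<omega>. g s (X s \<omega>) \<omega>) Ig \<and>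
        qs PG (\<lambda>\<omega>. \<forall>t\<in>{0..T}. X t \<omega> = x + If t \<omega> + Ih t \<omega> + Ig t \<omega> + K t \<omega>)) \<and>
     X \<in> M_G PG p T \<and>
     qs PG (\<lambda>\<omega>. \<forall>t\<in>{0..T}. X t \<omega> \<ge> S t \<omega>) \<and>
     K \<in> M_I PG T \<inter> M_G PG p T \<and>
     qs PG (\<lambda>\<omega>. K 0 \<omega> = 0) \<and>
     qs PG (\<lambda>\<omega>. has_RS_integral (\<lambda>t. X t \<omega> - S t \<omega>) (\<lambda>t. K t \<omega>) 0 T 0)"

end

theory Submission
  imports Defs
begin

text \<open>Uniqueness holds under each representing measure \<open>P\<close> separately, and the exceptional sets can be
  collected into a single polar set.

  Fix \<open>P\<close> and let \<open>D = X - X'\<close>. Then \<open>D = V + N + K - K'\<close>, where \<open>V\<close> collects the differences of the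
  \<open>dt\<close>- and \<open>d\<langle>B\<rangle>\<close>-integrals and \<open>N\<close> is the difference of the \<open>dB\<close>-integrals; by the Lipschitz
  condition all integrands are bounded by \<open>C \<bar>D\<bar>\<close>. The classical argument applies Ito's formula to
  \<open>D\<^sup>2\<close> and localizes. Here \<open>D\<^sup>2\<close> is replaced by the bounded function \<open>\<phi>(D) = D\<^sup>2 / (1 + D\<^sup>2)\<close>, so that all
  expectations are finite from the start, and Ito's formula by a telescoping sum over uniform
  partitions. Since \<open>\<phi>\<close> is a concave function of the square, it satisfies
  \<open>\<phi>(x + u) \<le> \<phi>(x) + \<phi>'(x) u + (\<nu>(x) u)\<^sup>2\<close> with \<open>\<nu>(x) = 1 / (1 + x\<^sup>2)\<close> for all \<open>u\<close> (\<open>\<phi>_expansion\<close>).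
  Taking expectations, the linear terms in \<open>N\<close> vanish by orthogonality, and the quadratic ones and those
  in \<open>V\<close> are controlled by \<open>D\<close> itself because \<open>(\<nu>(x) x)\<^sup>2 \<le> \<phi>(x)\<close> and \<open>\<bar>\<phi>'(x) x\<bar> \<le> 2 \<phi>(x)\<close>. The
  reflections only help: where \<open>D > 0\<close>, the process \<open>X\<close> lies above the obstacle by at least \<open>D\<close>, so
  \<open>\<phi>'(D) dK \<le> 2 (X - S) dK\<close>, whose sums tend to 0 by minimality, and \<open>- \<phi>'(D) dK' \<le> 0\<close>; the case
  \<open>D < 0\<close> is symmetric (\<open>reflection_sums\<close>). In the limit \<open>E \<phi>(D\<^sub>t) \<le> C \<integral>\<^sub>0\<^sup>t E \<phi>(D\<^sub>r) dr\<close>, and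
  Gronwall's lemma gives \<open>D = 0\<close>. This part is the abstract theorem \<open>reflected_difference.D_eq_0\<close>. Then
  \<open>V\<close> and \<open>N\<close> vanish as well, and \<open>K = K'\<close> remains (\<open>solutions_agree_AE\<close>).

  Its hypotheses rest on three facts about \<open>P\<close>. First, increments of \<open>B\<close> are orthogonal to the past,
  with conditional second and fourth moments of order \<open>t - s\<close> and \<open>(t - s)\<^sup>2\<close>; all this follows from
  \<open>E\<^sup>P \<le> E\<close>, once \<open>E (\<plusminus> B\<^sub>1) = 0\<close> is read off the G-heat equation (\<open>E_linear_canon_1\<close>). The past
  is represented by the \<open>L\<^sup>2\<close>-closure \<open>HS P s\<close> of the cylinder random variables up to time \<open>s\<close>, and the
  integrals are handled through their approximating step processes (\<open>dominated_integral_B\<close>,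
  \<open>dominated_integral_Lipschitz\<close>). Second, \<open>\<langle>B\<rangle>\<close> is Lipschitz in time under \<open>P\<close>, because sums of squared
  increments concentrate below their largest possible mean (\<open>quadratic_variation_Lipschitz\<close>), so
  \<open>d\<langle>B\<rangle>\<close>-integrals are as good as \<open>dt\<close>-integrals. Third, an element of the completion \<open>M_G\<close> is adapted
  at almost every time and square integrable over time (\<open>M_G_square_integrable_adapted\<close>).

  For the passage from each \<open>P\<close> to quasi-sure equality, the solutions and integrals are replaced by versions that are
  continuous for every path and Borel measurable at every time (\<open>version_exists\<close>). The event that two such
  versions differ at some rational time is Borel and null under every \<open>P\<close>, hence polar
  (\<open>version_qs_eq\<close>).\<close>

section \<open>The algebra of cylinder random variables\<close>

definition norm1 :: "nat \<Rightarrow> (nat \<Rightarrow> real) \<Rightarrow> real" where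
  "norm1 n x = (\<Sum>i<n. \<bar>x i\<bar>)"

lemma norm1_nonneg [simp]: "0 \<le> norm1 n x"
  by (simp add: norm1_def sum_nonneg)

lemma norm1_coord: "i < n \<Longrightarrow> \<bar>x i\<bar> \<le> norm1 n x"
  unfolding norm1_def by (rule member_le_sum) auto

lemma norm1_L2_set: "L2_set x {..<n} \<le> norm1 n x" "norm1 n x \<le> n * L2_set x {..<n}"
proof -
  show "L2_set x {..<n} \<le> norm1 n x"
    unfolding norm1_def by (rule L2_set_le_sum_abs)
  have "norm1 n x \<le> (\<Sum>i<n. L2_set x {..<n})"
    unfolding norm1_def
  proof (rule sum_mono)
    fix i assume "i \<in> {..<n}"
    then show "\<bar>x i\<bar> \<le> L2_set x {..<n}"
      using member_le_L2_set[of "{..<n}" i "\<lambda>i. \<bar>x i\<bar>"] by (simp add: L2_set_def)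
  qed
  then show "norm1 n x \<le> n * L2_set x {..<n}" by simp
qed

text \<open>The same class of functions, described by a weight whose powers multiply. This is what makes
  the class an algebra by inspection.\<close>

lemma C_lLip_iff:
  "\<phi> \<in> C_lLip n \<longleftrightarrow>
    (\<exists>C\<ge>0. \<exists>m. \<forall>x y. \<bar>\<phi> x - \<phi> y\<bar> \<le> C * (1 + norm1 n x + norm1 n y) ^ m * norm1 n (\<lambda>i. x i - y i))"
  (is "_ \<longleftrightarrow> ?R")
proof
  assume "\<phi> \<in> C_lLip n"
  then obtain C and m :: nat where C: "\<And>x y. \<bar>\<phi> x - \<phi> y\<bar> \<le>
      C * (1 + L2_set x {..<n} ^ m + L2_set y {..<n} ^ m) * L2_set (\<lambda>i. x i - y i) {..<n}"
    unfolding C_lLip_def by blast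
  have "\<bar>\<phi> x - \<phi> y\<bar> \<le> (3 * \<bar>C\<bar>) * (1 + norm1 n x + norm1 n y) ^ m * norm1 n (\<lambda>i. x i - y i)" for x y
  proof -
    let ?W = "(1 + norm1 n x + norm1 n y) ^ m"
    have "1 \<le> ?W" by simp
    moreover have "L2_set x {..<n} ^ m \<le> ?W"
      by (rule power_mono) (use norm1_L2_set(1)[of x n] norm1_nonneg[of n y] in linarith, simp)
    moreover have "L2_set y {..<n} ^ m \<le> ?W"
      by (rule power_mono) (use norm1_L2_set(1)[of y n] norm1_nonneg[of n x] in linarith, simp)
    ultimately have W: "1 + L2_set x {..<n} ^ m + L2_set y {..<n} ^ m \<le> 3 * ?W" by linarith
    have "\<bar>\<phi> x - \<phi> y\<bar> \<le> \<bar>C\<bar> * (1 + L2_set x {..<n} ^ m + L2_set y {..<n} ^ m)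
        * L2_set (\<lambda>i. x i - y i) {..<n}"
      by (rule order_trans[OF C]) (intro mult_right_mono, auto)
    also have "\<dots> \<le> \<bar>C\<bar> * (3 * ?W) * norm1 n (\<lambda>i. x i - y i)"
      by (intro mult_mono W norm1_L2_set mult_nonneg_nonneg) auto
    finally show ?thesis by (simp add: mult_ac)
  qed
  then show ?R by (intro exI[of _ "3 * \<bar>C\<bar>"] conjI exI[of _ m]) auto
next
  assume ?R
  then obtain C m where C0: "C \<ge> 0" and
    C: "\<And>x y. \<bar>\<phi> x - \<phi> y\<bar> \<le> C * (1 + norm1 n x + norm1 n y) ^ m * norm1 n (\<lambda>i. x i - y i)"
    by blast
  let ?l = "\<lambda>x. L2_set x {..<n}"
  define N where "N = real n + 1"
  have N: "N \<ge> 1" "\<And>x. norm1 n x \<le> N * ?l x"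
  proof -
    fix x show "norm1 n x \<le> N * ?l x"
      using norm1_L2_set(2)[of n x] L2_set_nonneg[of x "{..<n}"] unfolding N_def distrib_right by linarith
  qed (simp add: N_def)
  have "\<bar>\<phi> x - \<phi> y\<bar> \<le> (C * (3 * N) ^ m * N) * (1 + ?l x ^ m + ?l y ^ m) * ?l (\<lambda>i. x i - y i)" for x y
  proof -
    define b where "b = Max {1, ?l x, ?l y}"
    have b: "1 \<le> b" "?l x \<le> b" "?l y \<le> b" "b \<in> {1, ?l x, ?l y}"
      unfolding b_def using Max_ge[of "{1, ?l x, ?l y}"] Max_in[of "{1, ?l x, ?l y}"] by blast+
    have "norm1 n x \<le> N * b" "norm1 n y \<le> N * b"
      using N b by (auto intro!: order_trans[OF N(2)] mult_left_mono)
    moreover have "1 \<le> N * b" using mult_mono[of 1 N 1 b] N(1) b(1) by simp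
    ultimately have "(1 + norm1 n x + norm1 n y) ^ m \<le> (3 * N * b) ^ m"
      by (intro power_mono) auto
    also have "\<dots> = (3 * N) ^ m * b ^ m" by (simp add: power_mult_distrib)
    also have "\<dots> \<le> (3 * N) ^ m * (1 + ?l x ^ m + ?l y ^ m)"
      using b(4) N(1) by (intro mult_left_mono) auto
    finally have 1: "(1 + norm1 n x + norm1 n y) ^ m \<le> (3 * N) ^ m * (1 + ?l x ^ m + ?l y ^ m)" .
    have "\<bar>\<phi> x - \<phi> y\<bar> \<le> C * ((3 * N) ^ m * (1 + ?l x ^ m + ?l y ^ m)) * (N * ?l (\<lambda>i. x i - y i))"
      by (rule order_trans[OF C])
        (intro mult_mono 1 N(2) mult_nonneg_nonneg; use C0 N(1) in \<open>auto intro!: add_nonneg_nonneg\<close>)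
    then show ?thesis by (simp add: mult_ac)
  qed
  then show "\<phi> \<in> C_lLip n" unfolding C_lLip_def by blast
qed

lemma C_lLip_cong:
  assumes "\<phi> \<in> C_lLip n" and "\<And>i. i < n \<Longrightarrow> x i = y i"
  shows "\<phi> x = \<phi> y"
proof -
  have "norm1 n (\<lambda>i. x i - y i) = 0" using assms(2) by (simp add: norm1_def)
  then show ?thesis using assms(1) unfolding C_lLip_iff
    by (metis abs_le_zero_iff eq_iff_diff_eq_0 mult_zero_right)
qed

lemma C_lLip_const: "(\<lambda>_. c) \<in> C_lLip n"
  unfolding C_lLip_iff by (auto intro!: exI[of _ 0])

lemma C_lLip_coord: "i < n \<Longrightarrow> (\<lambda>v. v i) \<in> C_lLip n"
  unfolding C_lLip_iff
  by (intro exI[of _ 1] conjI exI[of _ 0]) (auto simp: norm1_coord[of i n "\<lambda>i. _ i - _ i"])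

lemma C_lLip_growth:
  assumes "\<phi> \<in> C_lLip n"
  obtains A k where "A \<ge> 0" "\<And>x. \<bar>\<phi> x\<bar> \<le> A * (1 + norm1 n x) ^ k"
proof -
  obtain C m where C0: "C \<ge> 0" and
    C: "\<And>x y. \<bar>\<phi> x - \<phi> y\<bar> \<le> C * (1 + norm1 n x + norm1 n y) ^ m * norm1 n (\<lambda>i. x i - y i)"
    using assms(1) unfolding C_lLip_iff by blast
  have "\<bar>\<phi> x\<bar> \<le> (\<bar>\<phi> (\<lambda>_. 0)\<bar> + C) * (1 + norm1 n x) ^ Suc m" for x
  proof -
    have "norm1 n (\<lambda>_. 0) = 0" by (simp add: norm1_def)
    then have "\<bar>\<phi> x - \<phi> (\<lambda>_. 0)\<bar> \<le> C * (1 + norm1 n x) ^ m * norm1 n x"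
      using C[of x "\<lambda>_. 0"] by simp
    also have "\<dots> \<le> C * (1 + norm1 n x) ^ m * (1 + norm1 n x)"
      using C0 by (intro mult_left_mono) auto
    also have "\<dots> = C * (1 + norm1 n x) ^ Suc m" by simp
    finally have "\<bar>\<phi> x\<bar> \<le> \<bar>\<phi> (\<lambda>_. 0)\<bar> * 1 + C * (1 + norm1 n x) ^ Suc m" by linarith
    also have "\<dots> \<le> \<bar>\<phi> (\<lambda>_. 0)\<bar> * (1 + norm1 n x) ^ Suc m + C * (1 + norm1 n x) ^ Suc m"
      by (intro add_right_mono mult_left_mono one_le_power) auto
    finally show ?thesis by (simp add: algebra_simps)
  qed
  with C0 show thesis by (intro that[of "\<bar>\<phi> (\<lambda>_. 0)\<bar> + C" "Suc m"]) auto
qed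

lemma C_lLip_add:
  assumes "\<phi> \<in> C_lLip n" "\<psi> \<in> C_lLip n"
  shows "(\<lambda>v. \<phi> v + \<psi> v) \<in> C_lLip n"
proof -
  obtain C m where 1: "C \<ge> 0"
    "\<And>x y. \<bar>\<phi> x - \<phi> y\<bar> \<le> C * (1 + norm1 n x + norm1 n y) ^ m * norm1 n (\<lambda>i. x i - y i)"
    using assms(1) unfolding C_lLip_iff by blast
  obtain D k where 2: "D \<ge> 0"
    "\<And>x y. \<bar>\<psi> x - \<psi> y\<bar> \<le> D * (1 + norm1 n x + norm1 n y) ^ k * norm1 n (\<lambda>i. x i - y i)"
    using assms(2) unfolding C_lLip_iff by blast
  have "\<bar>(\<phi> x + \<psi> x) - (\<phi> y + \<psi> y)\<bar>
      \<le> (C + D) * (1 + norm1 n x + norm1 n y) ^ (m + k) * norm1 n (\<lambda>i. x i - y i)" for x y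
  proof -
    let ?w = "1 + norm1 n x + norm1 n y"
    have "?w \<ge> 1" by simp
    then have w: "?w ^ m \<le> ?w ^ (m + k)" "?w ^ k \<le> ?w ^ (m + k)"
      by (auto intro: power_increasing)
    have "\<bar>(\<phi> x + \<psi> x) - (\<phi> y + \<psi> y)\<bar> \<le> \<bar>\<phi> x - \<phi> y\<bar> + \<bar>\<psi> x - \<psi> y\<bar>" by linarith
    also have "\<dots> \<le> C * ?w ^ (m + k) * norm1 n (\<lambda>i. x i - y i) + D * ?w ^ (m + k) * norm1 n (\<lambda>i. x i - y i)"
      by (intro add_mono order_trans[OF 1(2)] order_trans[OF 2(2)] mult_right_mono mult_left_mono w 1 2) auto
    finally show ?thesis by (simp add: algebra_simps)
  qed
  with 1(1) 2(1) show ?thesis unfolding C_lLip_iff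
    by (intro exI[of _ "C + D"] conjI exI[of _ "m + k"]) auto
qed

lemma C_lLip_mult:
  assumes "\<phi> \<in> C_lLip n" "\<psi> \<in> C_lLip n"
  shows "(\<lambda>v. \<phi> v * \<psi> v) \<in> C_lLip n"
proof -
  obtain C m where 1: "C \<ge> 0"
    "\<And>x y. \<bar>\<phi> x - \<phi> y\<bar> \<le> C * (1 + norm1 n x + norm1 n y) ^ m * norm1 n (\<lambda>i. x i - y i)"
    using assms(1) unfolding C_lLip_iff by blast
  obtain D k where 2: "D \<ge> 0"
    "\<And>x y. \<bar>\<psi> x - \<psi> y\<bar> \<le> D * (1 + norm1 n x + norm1 n y) ^ k * norm1 n (\<lambda>i. x i - y i)"
    using assms(2) unfolding C_lLip_iff by blast
  obtain A a where A: "A \<ge> 0" "\<And>x. \<bar>\<phi> x\<bar> \<le> A * (1 + norm1 n x) ^ a"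
    using C_lLip_growth[OF assms(1)] by blast
  obtain B b where B: "B \<ge> 0" "\<And>x. \<bar>\<psi> x\<bar> \<le> B * (1 + norm1 n x) ^ b"
    using C_lLip_growth[OF assms(2)] by blast
  have "\<bar>\<phi> x * \<psi> x - \<phi> y * \<psi> y\<bar>
      \<le> (A * D + B * C) * (1 + norm1 n x + norm1 n y) ^ (a + k + b + m) * norm1 n (\<lambda>i. x i - y i)" for x y
  proof -
    let ?w = "1 + norm1 n x + norm1 n y" and ?d = "norm1 n (\<lambda>i. x i - y i)"
    have w1: "?w \<ge> 1" by simp
    have w: "?w ^ (a + k) \<le> ?w ^ (a + k + b + m)" "?w ^ (b + m) \<le> ?w ^ (a + k + b + m)"
      by (rule power_increasing[OF _ w1], simp)+
    have a: "\<bar>\<phi> x\<bar> \<le> A * ?w ^ a"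
      by (rule order_trans[OF A(2)]) (intro mult_left_mono power_mono A(1), auto)
    have b: "\<bar>\<psi> y\<bar> \<le> B * ?w ^ b"
      by (rule order_trans[OF B(2)]) (intro mult_left_mono power_mono B(1), auto)
    have "\<phi> x * \<psi> x - \<phi> y * \<psi> y = \<phi> x * (\<psi> x - \<psi> y) + \<psi> y * (\<phi> x - \<phi> y)"
      by (simp add: algebra_simps)
    then have "\<bar>\<phi> x * \<psi> x - \<phi> y * \<psi> y\<bar> \<le> \<bar>\<phi> x\<bar> * \<bar>\<psi> x - \<psi> y\<bar> + \<bar>\<psi> y\<bar> * \<bar>\<phi> x - \<phi> y\<bar>"
      by (metis abs_mult abs_triangle_ineq)
    also have "\<dots> \<le> (A * ?w ^ a) * (D * ?w ^ k * ?d) + (B * ?w ^ b) * (C * ?w ^ m * ?d)"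
      by (intro add_mono mult_mono a b 1 2) (use A B in auto)
    also have "\<dots> = (A * D * ?w ^ (a + k) + B * C * ?w ^ (b + m)) * ?d"
      by (simp add: power_add algebra_simps)
    also have "\<dots> \<le> (A * D * ?w ^ (a + k + b + m) + B * C * ?w ^ (a + k + b + m)) * ?d"
      by (intro mult_right_mono add_mono mult_left_mono w mult_nonneg_nonneg 1(1) 2(1) A(1) B(1)) auto
    finally show ?thesis by (simp add: algebra_simps)
  qed
  moreover have "A * D + B * C \<ge> 0" using 1 2 A B by simp
  ultimately show ?thesis unfolding C_lLip_iff by blast
qed

lemma C_lLip_lipschitz:
  assumes "\<phi> \<in> C_lLip n" and u: "\<And>a b :: real. \<bar>u a - u b\<bar> \<le> L * \<bar>a - b\<bar>"
  shows "(\<lambda>v. u (\<phi> v)) \<in> C_lLip n"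
proof -
  obtain C m where 1: "C \<ge> 0"
    "\<And>x y. \<bar>\<phi> x - \<phi> y\<bar> \<le> C * (1 + norm1 n x + norm1 n y) ^ m * norm1 n (\<lambda>i. x i - y i)"
    using assms(1) unfolding C_lLip_iff by blast
  have L: "L \<ge> 0" using order_trans[OF abs_ge_zero u[of 1 0]] by simp
  have "\<bar>u (\<phi> x) - u (\<phi> y)\<bar> \<le> (L * C) * (1 + norm1 n x + norm1 n y) ^ m * norm1 n (\<lambda>i. x i - y i)" for x y
    using order_trans[OF u mult_left_mono[OF 1(2) L]] by (simp add: mult_ac)
  then show ?thesis unfolding C_lLip_iff using L 1(1) by (intro exI[of _ "L * C"]) auto
qed

text \<open>Linear substitutions preserve polynomial growth because the norm of the new argument is bounded by a
  multiple of the old one; coordinate selections and increments are the instances of interest.\<close>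

lemma C_lLip_linear_subst:
  assumes "\<phi> \<in> C_lLip n" and c: "c \<ge> 0"
    and L: "\<And>i v. i < n \<Longrightarrow> \<bar>l i v\<bar> \<le> c * norm1 N v"
    and lin: "\<And>i v w. i < n \<Longrightarrow> l i v - l i w = l i (\<lambda>j. v j - w j)"
  shows "(\<lambda>v. \<phi> (\<lambda>i. l i v)) \<in> C_lLip N"
proof -
  obtain C m where 1: "C \<ge> 0"
    "\<And>x y. \<bar>\<phi> x - \<phi> y\<bar> \<le> C * (1 + norm1 n x + norm1 n y) ^ m * norm1 n (\<lambda>i. x i - y i)"
    using assms(1) unfolding C_lLip_iff by blast
  have nl: "norm1 n (\<lambda>i. l i v) \<le> (n * c) * norm1 N v" for v
  proof -
    have "norm1 n (\<lambda>i. l i v) \<le> (\<Sum>i<n. c * norm1 N v)"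
      unfolding norm1_def[of n] by (rule sum_mono) (auto intro: L)
    then show ?thesis by simp
  qed
  define M where "M = 1 + n * c"
  have M: "M \<ge> 1" using c by (simp add: M_def)
  have "\<bar>\<phi> (\<lambda>i. l i v) - \<phi> (\<lambda>i. l i w)\<bar>
      \<le> (C * M ^ m * (n * c)) * (1 + norm1 N v + norm1 N w) ^ m * norm1 N (\<lambda>i. v i - w i)" for v w
  proof -
    have "norm1 n (\<lambda>i. l i v - l i w) = norm1 n (\<lambda>i. l i (\<lambda>j. v j - w j))"
      unfolding norm1_def by (rule sum.cong) (auto simp: lin)
    then have a: "norm1 n (\<lambda>i. l i v - l i w) \<le> (n * c) * norm1 N (\<lambda>j. v j - w j)"
      using nl by simp
    have "1 + norm1 n (\<lambda>i. l i v) + norm1 n (\<lambda>i. l i w) \<le> 1 + (n * c) * norm1 N v + (n * c) * norm1 N w"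
      using nl[of v] nl[of w] by simp
    also have "\<dots> \<le> M * (1 + norm1 N v + norm1 N w)"
      using c by (simp add: M_def algebra_simps)
    finally have "(1 + norm1 n (\<lambda>i. l i v) + norm1 n (\<lambda>i. l i w)) ^ m \<le> M ^ m * (1 + norm1 N v + norm1 N w) ^ m"
      unfolding power_mult_distrib[symmetric] by (rule power_mono) auto
    then have "C * (1 + norm1 n (\<lambda>i. l i v) + norm1 n (\<lambda>i. l i w)) ^ m * norm1 n (\<lambda>i. l i v - l i w)
       \<le> C * (M ^ m * (1 + norm1 N v + norm1 N w) ^ m) * ((n * c) * norm1 N (\<lambda>j. v j - w j))"
      using a 1(1) M c by (intro mult_mono) auto
    with 1(2)[of "\<lambda>i. l i v" "\<lambda>i. l i w"] show ?thesis by (simp add: mult_ac)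
  qed
  moreover have "C * M ^ m * (n * c) \<ge> 0" using 1 M c by simp
  ultimately show ?thesis unfolding C_lLip_iff by blast
qed

lemma C_lLip_reindex:
  assumes "\<phi> \<in> C_lLip n" and "\<And>i. i < n \<Longrightarrow> j i < N"
  shows "(\<lambda>v. \<phi> (\<lambda>i. v (j i))) \<in> C_lLip N"
  by (rule C_lLip_linear_subst[OF assms(1), of 1]) (auto intro: norm1_coord assms)

lemma C_lLip_neg: "\<phi> \<in> C_lLip n \<Longrightarrow> (\<lambda>v. - \<phi> v) \<in> C_lLip n"
  by (rule C_lLip_lipschitz[where u = uminus and L = 1]) auto

lemma C_lLip_power: "\<phi> \<in> C_lLip n \<Longrightarrow> (\<lambda>v. \<phi> v ^ k) \<in> C_lLip n"
  by (induction k) (auto intro: C_lLip_const C_lLip_mult)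

lemma C_lLip_sub: "\<phi> \<in> C_lLip n \<Longrightarrow> \<psi> \<in> C_lLip n \<Longrightarrow> (\<lambda>v. \<phi> v - \<psi> v) \<in> C_lLip n"
  using C_lLip_add[OF _ C_lLip_neg, of \<phi> n \<psi>] by simp

lemma L_ipI:
  assumes "1 \<le> n" "mono_on {..<n} \<tau>" "\<tau> ` {..<n} \<subseteq> {0..t}" "\<phi> \<in> C_lLip n"
  shows "(\<lambda>\<omega>. \<phi> (\<lambda>i. canon (\<tau> i) \<omega>)) \<in> L_ip t"
  using assms unfolding L_ip_def by blast

lemma L_ip_mono: "s \<le> t \<Longrightarrow> L_ip s \<subseteq> L_ip t"
  unfolding L_ip_def by fastforce

lemma L_ip_subset_all: "0 \<le> t \<Longrightarrow> L_ip t \<subseteq> L_ip_all"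
  unfolding L_ip_all_def by auto

text \<open>Two cylinder random variables can be read off one common time grid, the union of their grids.
  The algebraic closure of \<open>C_lLip\<close> therefore passes to \<open>L_ip\<close>.\<close>

lemma L_ip_common_grid:
  assumes "X \<in> L_ip t" "Y \<in> L_ip t"
  obtains n \<tau> \<phi> \<psi> where "1 \<le> n" "mono_on {..<n} \<tau>" "\<tau> ` {..<n} \<subseteq> {0..t}" "\<phi> \<in> C_lLip n" "\<psi> \<in> C_lLip n"
    "X = (\<lambda>\<omega>. \<phi> (\<lambda>i. canon (\<tau> i) \<omega>))" "Y = (\<lambda>\<omega>. \<psi> (\<lambda>i. canon (\<tau> i) \<omega>))"
proof -
  obtain n \<tau> \<phi> where 1: "1 \<le> n" "\<tau> ` {..<n} \<subseteq> {0..t}" "\<phi> \<in> C_lLip n"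
      "X = (\<lambda>\<omega>. \<phi> (\<lambda>i. canon (\<tau> i) \<omega>))"
    using assms(1) unfolding L_ip_def by blast
  obtain n' \<tau>' \<phi>' where 2: "1 \<le> n'" "\<tau>' ` {..<n'} \<subseteq> {0..t}" "\<phi>' \<in> C_lLip n'"
      "Y = (\<lambda>\<omega>. \<phi>' (\<lambda>i. canon (\<tau>' i) \<omega>))"
    using assms(2) unfolding L_ip_def by blast
  define F where "F = \<tau> ` {..<n} \<union> \<tau>' ` {..<n'}"
  define \<sigma> where "\<sigma> = (!) (sorted_list_of_set F)"
  have fin: "finite F" and ne: "F \<noteq> {}" using 1(1) unfolding F_def by (auto simp: lessThan_empty_iff)
  have \<sigma>: "\<sigma> ` {..<card F} = F"
    using fin by (metis \<sigma>_def atLeast_upt length_sorted_list_of_set map_nth set_map set_sorted_list_of_set)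
  have mono: "mono_on {..<card F} \<sigma>"
    unfolding \<sigma>_def by (auto intro!: mono_onI sorted_nth_mono)
  have pick: "\<exists>j. \<forall>i<k. j i < card F \<and> \<sigma> (j i) = \<upsilon> i" if "\<upsilon> ` {..<k} \<subseteq> F" for k \<upsilon>
  proof (rule choice_iff'[THEN iffD1], intro allI impI)
    fix i assume "i < k"
    then have "\<upsilon> i \<in> \<sigma> ` {..<card F}" using that unfolding \<sigma> by auto
    then show "\<exists>m. m < card F \<and> \<sigma> m = \<upsilon> i" by auto
  qed
  obtain j where j: "\<And>i. i < n \<Longrightarrow> j i < card F" "\<And>i. i < n \<Longrightarrow> \<sigma> (j i) = \<tau> i"
    using pick[of \<tau> n] unfolding F_def by auto
  obtain j' where j': "\<And>i. i < n' \<Longrightarrow> j' i < card F" "\<And>i. i < n' \<Longrightarrow> \<sigma> (j' i) = \<tau>' i"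
    using pick[of \<tau>' n'] unfolding F_def by auto
  show thesis
  proof (rule that)
    show "1 \<le> card F" using fin ne by (simp add: Suc_leI card_gt_0_iff)
    show "\<sigma> ` {..<card F} \<subseteq> {0..t}" using 1(2) 2(2) unfolding \<sigma> unfolding F_def by auto
    show "X = (\<lambda>\<omega>. (\<lambda>v. \<phi> (\<lambda>i. v (j i))) (\<lambda>i. canon (\<sigma> i) \<omega>))"
      unfolding 1(4) by (auto intro!: ext C_lLip_cong[OF 1(3)] simp: j)
    show "Y = (\<lambda>\<omega>. (\<lambda>v. \<phi>' (\<lambda>i. v (j' i))) (\<lambda>i. canon (\<sigma> i) \<omega>))"
      unfolding 2(4) by (auto intro!: ext C_lLip_cong[OF 2(3)] simp: j')
  qed (auto intro: mono C_lLip_reindex 1 2 j j')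
qed

lemma L_ip_add:
  assumes "X \<in> L_ip t" "Y \<in> L_ip t"
  shows "(\<lambda>\<omega>. X \<omega> + Y \<omega>) \<in> L_ip t"
proof -
  obtain n \<tau> \<phi> \<psi> where *: "1 \<le> n" "mono_on {..<n} \<tau>" "\<tau> ` {..<n} \<subseteq> {0..t}"
    "\<phi> \<in> C_lLip n" "\<psi> \<in> C_lLip n"
    "X = (\<lambda>\<omega>. \<phi> (\<lambda>i. canon (\<tau> i) \<omega>))" "Y = (\<lambda>\<omega>. \<psi> (\<lambda>i. canon (\<tau> i) \<omega>))"
    using L_ip_common_grid[OF assms] by blast
  show ?thesis using L_ipI[OF *(1-3) C_lLip_add[OF *(4,5)]] unfolding *(6,7) .
qed

lemma L_ip_mult:
  assumes "X \<in> L_ip t" "Y \<in> L_ip t"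
  shows "(\<lambda>\<omega>. X \<omega> * Y \<omega>) \<in> L_ip t"
proof -
  obtain n \<tau> \<phi> \<psi> where *: "1 \<le> n" "mono_on {..<n} \<tau>" "\<tau> ` {..<n} \<subseteq> {0..t}"
    "\<phi> \<in> C_lLip n" "\<psi> \<in> C_lLip n"
    "X = (\<lambda>\<omega>. \<phi> (\<lambda>i. canon (\<tau> i) \<omega>))" "Y = (\<lambda>\<omega>. \<psi> (\<lambda>i. canon (\<tau> i) \<omega>))"
    using L_ip_common_grid[OF assms] by blast
  show ?thesis using L_ipI[OF *(1-3) C_lLip_mult[OF *(4,5)]] unfolding *(6,7) .
qed

lemma L_ip_lipschitz:
  assumes "X \<in> L_ip t" and u: "\<And>a b :: real. \<bar>u a - u b\<bar> \<le> L * \<bar>a - b\<bar>"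
  shows "(\<lambda>\<omega>. u (X \<omega>)) \<in> L_ip t"
proof -
  obtain n \<tau> \<phi> where *: "1 \<le> n" "mono_on {..<n} \<tau>" "\<tau> ` {..<n} \<subseteq> {0..t}" "\<phi> \<in> C_lLip n"
    "X = (\<lambda>\<omega>. \<phi> (\<lambda>i. canon (\<tau> i) \<omega>))"
    using assms(1) unfolding L_ip_def by blast
  show ?thesis using L_ipI[OF *(1-3) C_lLip_lipschitz[OF *(4) u]] unfolding *(5) .
qed

lemma L_ip_canon: "0 \<le> s \<Longrightarrow> s \<le> t \<Longrightarrow> canon s \<in> L_ip t"
  using L_ipI[of 1 "\<lambda>_. s" t "\<lambda>v. v 0"]
  by (auto simp: C_lLip_coord mono_on_def image_subset_iff)

lemma L_ip_const: "0 \<le> t \<Longrightarrow> (\<lambda>_. c) \<in> L_ip t"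
  using L_ipI[of 1 "\<lambda>_. 0" t "\<lambda>v. c"]
  by (auto simp: C_lLip_const mono_on_def image_subset_iff)

lemma L_ip_scale: "X \<in> L_ip t \<Longrightarrow> (\<lambda>\<omega>. c * X \<omega>) \<in> L_ip t"
  by (rule L_ip_lipschitz[where L = "\<bar>c\<bar>"]) (auto simp: abs_mult[symmetric] algebra_simps)

lemma L_ip_neg: "X \<in> L_ip t \<Longrightarrow> (\<lambda>\<omega>. - X \<omega>) \<in> L_ip t"
  using L_ip_scale[of X t "-1"] by simp

lemma L_ip_diff: "X \<in> L_ip t \<Longrightarrow> Y \<in> L_ip t \<Longrightarrow> (\<lambda>\<omega>. X \<omega> - Y \<omega>) \<in> L_ip t"
  using L_ip_add[OF _ L_ip_neg, of X t Y] by simp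

lemma L_ip_power: "0 \<le> t \<Longrightarrow> X \<in> L_ip t \<Longrightarrow> (\<lambda>\<omega>. X \<omega> ^ k) \<in> L_ip t"
  by (induction k) (auto intro: L_ip_const L_ip_mult)

section \<open>Increments of the canonical process under one representing measure\<close>

lemma canon_0 [simp]: "canon 0 \<omega> = 0"
  using Rep_path[of \<omega>] by (simp add: canon_def)

text \<open>An increment is a linear function of the path at two times.\<close>

lemma increment_L_ip:
  assumes "0 \<le> s" "s \<le> t" and b: "(\<lambda>v. b (v 0)) \<in> C_lLip 1"
  shows "(\<lambda>\<omega>. b (canon t \<omega> - canon s \<omega>)) \<in> L_ip t"
proof -
  have "\<bar>v 1 - v 0\<bar> \<le> norm1 2 v" for v
    by (simp add: norm1_def numeral_2_eq_2)
  then have "(\<lambda>v. b (v 1 - v 0)) \<in> C_lLip 2"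
    using C_lLip_linear_subst[OF b, of 1 "\<lambda>_ v. v 1 - v 0" 2] by simp
  moreover have "mono_on {..<2} (\<lambda>i::nat. if i = 0 then s else t)"
    using assms by (auto simp: mono_on_def)
  ultimately show ?thesis
    using L_ipI[of 2 "\<lambda>i. if i = 0 then s else t" t "\<lambda>v. b (v 1 - v 0)"] assms
    by (auto simp: image_subset_iff)
qed

text \<open>The moments of \<open>B\<^sub>1\<close> enter as constants in upper bounds, so they are kept abstract.\<close>

definition B_moment :: "((path \<Rightarrow> real) \<Rightarrow> real) \<Rightarrow> nat \<Rightarrow> real" where
  "B_moment E k = E (\<lambda>\<omega>. canon 1 \<omega> ^ k)"

locale G_framework =
  fixes \<sigma> :: real and E :: "(path \<Rightarrow> real) \<Rightarrow> real" and PG :: "path measure set"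
  assumes G_expectation: "G_expectation \<sigma> E" and represents: "represents PG E"
begin

lemma E_add_const: "X \<in> L_ip_all \<Longrightarrow> E (\<lambda>\<omega>. X \<omega> + c) = E X + c"
  and E_scale: "X \<in> L_ip_all \<Longrightarrow> 0 \<le> c \<Longrightarrow> E (\<lambda>\<omega>. c * X \<omega>) = c * E X"
  and E_mono: "X \<in> L_ip_all \<Longrightarrow> Y \<in> L_ip_all \<Longrightarrow> (\<And>\<omega>. X \<omega> \<le> Y \<omega>) \<Longrightarrow> E X \<le> E Y"
  using G_expectation unfolding G_expectation_def sublinear_expectation_def by blast+

lemma L_ip_all_I: "0 \<le> t \<Longrightarrow> X \<in> L_ip t \<Longrightarrow> X \<in> L_ip_all"
  using L_ip_subset_all by blast

lemma E_const [simp]: "E (\<lambda>_. c) = c"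
proof -
  have 0: "(\<lambda>_. 0) \<in> L_ip_all" using L_ip_const[of 0] L_ip_all_I by blast
  then have "E (\<lambda>_. 0) = 0" using E_scale[of "\<lambda>_. 0" 0] by simp
  then show ?thesis using E_add_const[OF 0, of c] by simp
qed

text \<open>The defining property of G-Brownian motion concerns the last increment of a list of times. The time
  grid of \<open>Y\<close> is extended by \<open>s\<close> and \<open>t\<close>, so that this increment runs from \<open>s\<close> to \<open>t\<close>.\<close>

lemma E_independent_increment:
  assumes Y: "Y \<in> L_ip s" and st: "0 \<le> s" "s \<le> t" and b: "(\<lambda>v. b (v 0)) \<in> C_lLip 1"
  shows "E (\<lambda>\<omega>. Y \<omega> * b (canon t \<omega> - canon s \<omega>)) =
    E (\<lambda>\<omega>. E (\<lambda>\<omega>'. Y \<omega> * b (sqrt (t - s) * canon 1 \<omega>')))"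
proof -
  obtain n \<tau> \<phi> where *: "1 \<le> n" "mono_on {..<n} \<tau>" "\<tau> ` {..<n} \<subseteq> {0..s}" "\<phi> \<in> C_lLip n"
    "Y = (\<lambda>\<omega>. \<phi> (\<lambda>i. canon (\<tau> i) \<omega>))"
    using Y unfolding L_ip_def by blast
  define \<tau>' where "\<tau>' i = (if i < n then \<tau> i else if i = n then s else t)" for i
  define m where "m = n + 1"
  define \<Phi> where "\<Phi> v = \<phi> v * b (v m)" for v
  have \<tau>s: "\<tau> i \<le> s" "0 \<le> \<tau> i" if "i < n" for i using *(3) that by auto
  have "mono_on {..m} \<tau>'"
  proof (rule mono_onI)
    fix i j assume "i \<in> {..m}" "j \<in> {..m}" "i \<le> j"
    then show "\<tau>' i \<le> \<tau>' j"
      using mono_onD[OF *(2), of i j] \<tau>s[of i] st by (auto simp: \<tau>'_def)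
  qed
  moreover have "0 \<le> \<tau>' 0" using *(1) \<tau>s[of 0] by (simp add: \<tau>'_def)
  moreover have "\<Phi> \<in> C_lLip (Suc m)"
    unfolding \<Phi>_def
    using C_lLip_reindex[OF *(4), of id "Suc m"] C_lLip_reindex[OF b, of "\<lambda>_. m" "Suc m"]
    by (intro C_lLip_mult) (auto simp: m_def)
  moreover have "1 \<le> m" by (simp add: m_def)
  ultimately have "E (\<lambda>\<omega>. \<Phi> (\<lambda>i. if i < m then canon (\<tau>' i) \<omega>
                       else canon (\<tau>' m) \<omega> - canon (\<tau>' (m - 1)) \<omega>)) =
        E (\<lambda>\<omega>. (\<lambda>x. E (\<lambda>\<omega>'. \<Phi> (\<lambda>i. if i < m then x i
                                      else sqrt (\<tau>' m - \<tau>' (m - 1)) * canon 1 \<omega>')))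
                 (\<lambda>i. canon (\<tau>' i) \<omega>))"
    using G_expectation unfolding G_expectation_def by blast
  moreover have "\<phi> (\<lambda>i. if i < m then canon (\<tau>' i) \<omega> else z) = Y \<omega>" for \<omega> z
    unfolding *(5) by (rule C_lLip_cong[OF *(4)]) (simp add: m_def \<tau>'_def)
  moreover have "\<tau>' m = t" "\<tau>' (m - 1) = s" by (auto simp: \<tau>'_def m_def)
  ultimately show ?thesis by (simp add: \<Phi>_def)
qed

lemma canon_power_L_ip: "0 \<le> t \<Longrightarrow> (\<lambda>\<omega>. canon t \<omega> ^ k) \<in> L_ip t"
  using L_ip_power[OF _ L_ip_canon[of t t]] by simp

text \<open>With \<open>e = E (a B\<^sub>1)\<close>, scaling turns the solution of the G-heat equation with the linear
  initial value \<open>a y\<close> into \<open>a y + e \<surd>t\<close>. It is smooth for \<open>t > 0\<close>, hence its own test function, and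
  since \<open>G_fun\<close> vanishes at 0 its time derivative does too. This forces \<open>e = 0\<close>.\<close>

lemma E_linear_canon_1:
  assumes "\<bar>a\<bar> = 1"
  shows "E (\<lambda>\<omega>. a * canon 1 \<omega>) = 0"
proof -
  define e where "e = E (\<lambda>\<omega>. a * canon 1 \<omega>)"
  have lin: "(\<lambda>v. a * v 0) \<in> C_lLip 1"
    by (rule C_lLip_mult[OF C_lLip_const C_lLip_coord]) simp
  have a1: "(\<lambda>\<omega>. a * canon 1 \<omega>) \<in> L_ip_all"
    using L_ip_scale[OF L_ip_canon[of 1 1], of a] L_ip_all_I[of 1] by simp
  obtain u where u: "G_heat_viscosity_solution \<sigma> (\<lambda>y. a * y) u"
    and ueq: "\<And>s t x. 0 \<le> s \<Longrightarrow> s \<le> t \<Longrightarrow> E (\<lambda>\<omega>. a * (x + (canon t \<omega> - canon s \<omega>))) = u (t - s) x"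
    using G_expectation lin unfolding G_expectation_def by blast
  have u_eq: "u t x = a * x + e * sqrt t" if "0 \<le> t" for t x
  proof -
    have "(\<lambda>\<omega>. a * canon t \<omega>) \<in> L_ip_all"
      using L_ip_scale[OF L_ip_canon[of t t], of a] L_ip_all_I[of t] that by simp
    then have "E (\<lambda>\<omega>. a * canon t \<omega> + a * x) = E (\<lambda>\<omega>. a * canon t \<omega>) + a * x"
      by (rule E_add_const)
    moreover have "E (\<lambda>\<omega>. a * canon t \<omega>) = e * sqrt t"
      using E_independent_increment[OF L_ip_const[of 0 1] _ that lin] E_scale[OF a1, of "sqrt t"] that
      by (simp add: e_def mult_ac)
    ultimately show ?thesis
      using ueq[of 0 t x] that by (simp add: algebra_simps)
  qed
  define \<psi> where "\<psi> t x = a * x + e * sqrt t" for t x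
  \<comment> \<open>The point \<open>(1, 0)\<close> serves as contact point from both sides, as \<open>u\<close> and \<open>\<psi>\<close> agree for positive times.\<close>
  have C: "C12 \<psi> (\<lambda>t x. e * (inverse (sqrt t) / 2)) (\<lambda>t x. 0)"
    unfolding C12_def \<psi>_def
    by (intro exI[of _ "\<lambda>t x. a"] conjI allI impI)
      (auto intro!: derivative_eq_intros continuous_intros simp: case_prod_beta)
  have ev: "\<forall>\<^sub>F (s, y) in nhds (1::real, 0::real). u s y = \<psi> s y"
    unfolding eventually_nhds
    by (intro exI[of _ "{0<..} \<times> UNIV"]) (auto intro!: open_Times simp: u_eq \<psi>_def)
  have le: "\<forall>\<^sub>F (s, y) in nhds (1::real, 0::real). u s y - \<psi> s y \<le> u 1 0 - \<psi> 1 0"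
    by (rule eventually_mono[OF ev]) (auto simp: u_eq \<psi>_def)
  have ge: "\<forall>\<^sub>F (s, y) in nhds (1::real, 0::real). u s y - \<psi> s y \<ge> u 1 0 - \<psi> 1 0"
    by (rule eventually_mono[OF ev]) (auto simp: u_eq \<psi>_def)
  have sub: "\<And>\<psi> \<psi>t \<psi>xx t x. C12 \<psi> \<psi>t \<psi>xx \<Longrightarrow> 0 < t \<Longrightarrow>
      (\<forall>\<^sub>F (s, y) in nhds (t, x). u s y - \<psi> s y \<le> u t x - \<psi> t x) \<Longrightarrow> \<psi>t t x \<le> G_fun \<sigma> (\<psi>xx t x)"
    and super: "\<And>\<psi> \<psi>t \<psi>xx t x. C12 \<psi> \<psi>t \<psi>xx \<Longrightarrow> 0 < t \<Longrightarrow>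
      (\<forall>\<^sub>F (s, y) in nhds (t, x). u s y - \<psi> s y \<ge> u t x - \<psi> t x) \<Longrightarrow> \<psi>t t x \<ge> G_fun \<sigma> (\<psi>xx t x)"
    using u unfolding G_heat_viscosity_solution_def by blast+
  have "e * (inverse (sqrt 1) / 2) \<le> G_fun \<sigma> 0"
    by (rule sub[OF C _ le]) simp
  moreover have "e * (inverse (sqrt 1) / 2) \<ge> G_fun \<sigma> 0"
    by (rule super[OF C _ ge]) simp
  ultimately show ?thesis by (simp add: G_fun_def e_def)
qed

text \<open>The representing measures are laws on the path space because a compact set lies in the underlying
  space of its topology.\<close>

lemma PG_props:
  assumes "P \<in> PG"
  shows "prob_space P" "sets P = sets borel" "space P = UNIV"
proof -
  have "PG \<subseteq> topspace weak_topology"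
    using represents unfolding represents_def by (simp add: compactin_subset_topspace)
  then have "P \<in> path_laws"
    using assms unfolding weak_topology_def topology_generated_by_topspace by auto
  then show "prob_space P" "sets P = sets borel"
    by (auto simp: path_laws_def)
  then show "space P = UNIV" using sets_eq_imp_space_eq[of P borel] by simp
qed

lemma L_ip_integrable: "P \<in> PG \<Longrightarrow> 0 \<le> t \<Longrightarrow> X \<in> L_ip t \<Longrightarrow> integrable P X"
  using represents L_ip_all_I unfolding represents_def by blast

lemma integral_le_E:
  assumes "P \<in> PG" "X \<in> L_ip_all"
  shows "(\<integral>\<omega>. X \<omega> \<partial>P) \<le> E X"
proof -
  have "ereal (\<integral>\<omega>. X \<omega> \<partial>P) \<le> (SUP P\<in>PG. ereal (\<integral>\<omega>. X \<omega> \<partial>P))"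
    by (rule SUP_upper[OF assms(1)])
  then show ?thesis
    using represents assms(2) unfolding represents_def by (metis ereal_less_eq(3))
qed

lemma L_ip_increment:
  assumes "Y \<in> L_ip s" "0 \<le> s" "s \<le> t" "(\<lambda>v. b (v 0)) \<in> C_lLip 1"
  shows "(\<lambda>\<omega>. Y \<omega> * b (canon t \<omega> - canon s \<omega>)) \<in> L_ip t"
  by (rule L_ip_mult[OF subsetD[OF L_ip_mono assms(1)] increment_L_ip]) (use assms in auto)

text \<open>The representation only bounds expectations from above. Centring \<open>b\<close> so that the inner
  expectation vanishes is what makes the bound useful for each single measure.\<close>

lemma integral_increment_le:
  assumes P: "P \<in> PG" and Y: "Y \<in> L_ip s" and st: "0 \<le> s" "s \<le> t"
    and b: "(\<lambda>v. b (v 0)) \<in> C_lLip 1"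
    and z: "\<And>\<omega>. E (\<lambda>\<omega>'. Y \<omega> * b (sqrt (t - s) * canon 1 \<omega>')) = 0"
  shows "(\<integral>\<omega>. Y \<omega> * b (canon t \<omega> - canon s \<omega>) \<partial>P) \<le> 0"
proof -
  have "(\<integral>\<omega>. Y \<omega> * b (canon t \<omega> - canon s \<omega>) \<partial>P) \<le> E (\<lambda>\<omega>. Y \<omega> * b (canon t \<omega> - canon s \<omega>))"
    using st by (intro integral_le_E[OF P] L_ip_all_I[of t] L_ip_increment Y b) auto
  also have "\<dots> = 0" unfolding E_independent_increment[OF Y st b] z by simp
  finally show ?thesis .
qed

text \<open>The sign of \<open>Y\<close> is absorbed into \<open>B\<^sub>1\<close>, since positive homogeneity lets only nonnegative factors out of
  \<open>E\<close>. This is why both signs of the linear moment have to vanish.\<close>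

lemma integral_increment_le_0:
  assumes P: "P \<in> PG" and Y: "Y \<in> L_ip s" and st: "0 \<le> s" "s \<le> t"
  shows "(\<integral>\<omega>. Y \<omega> * (canon t \<omega> - canon s \<omega>) \<partial>P) \<le> 0"
proof (rule integral_increment_le[OF P Y st, where b = "\<lambda>z. z"])
  show "(\<lambda>v. v 0) \<in> C_lLip 1" by (rule C_lLip_coord) simp
  fix \<omega>
  define r where "r = Y \<omega> * sqrt (t - s)"
  have "(\<lambda>\<omega>. sgn r * canon 1 \<omega>) \<in> L_ip_all"
    using L_ip_scale[OF L_ip_canon[of 1 1], of "sgn r"] L_ip_all_I[of 1] by simp
  then have "E (\<lambda>\<omega>'. \<bar>r\<bar> * (sgn r * canon 1 \<omega>')) = \<bar>r\<bar> * E (\<lambda>\<omega>'. sgn r * canon 1 \<omega>')"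
    by (rule E_scale) simp
  also have "\<dots> = 0" using E_linear_canon_1[of "sgn r"] by (cases "r = 0") (auto simp: abs_sgn_eq)
  finally show "E (\<lambda>\<omega>'. Y \<omega> * (sqrt (t - s) * canon 1 \<omega>')) = 0"
    by (simp add: r_def mult.assoc[symmetric] abs_mult_sgn)
qed

lemma integral_increment:
  assumes P: "P \<in> PG" and Y: "Y \<in> L_ip s" and st: "0 \<le> s" "s \<le> t"
  shows "(\<integral>\<omega>. Y \<omega> * (canon t \<omega> - canon s \<omega>) \<partial>P) = 0"
proof (rule antisym)
  show "(\<integral>\<omega>. Y \<omega> * (canon t \<omega> - canon s \<omega>) \<partial>P) \<ge> 0"
    using integral_increment_le_0[OF P L_ip_neg[OF Y] st] by simp
qed (rule integral_increment_le_0[OF assms])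

text \<open>Conditionally on the past the even moments of an increment are at most those under \<open>E\<close>, which scale
  like powers of the length of the time interval.\<close>

lemma integral_increment_power:
  assumes P: "P \<in> PG" and Y: "Y \<in> L_ip s" "\<And>\<omega>. 0 \<le> Y \<omega>" and st: "0 \<le> s" "s \<le> t"
  shows "(\<integral>\<omega>. Y \<omega> * ((canon t \<omega> - canon s \<omega>) ^ (2 * k) - B_moment E (2 * k) * (t - s) ^ k) \<partial>P) \<le> 0"
proof (rule integral_increment_le[OF P Y(1) st, where b = "\<lambda>z. z ^ (2 * k) - B_moment E (2 * k) * (t - s) ^ k"])
  show "(\<lambda>v. v 0 ^ (2 * k) - B_moment E (2 * k) * (t - s) ^ k) \<in> C_lLip 1"
    by (intro C_lLip_sub C_lLip_power C_lLip_coord C_lLip_const) simp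
  fix \<omega>
  define r where "r = Y \<omega> * (t - s) ^ k"
  have r: "r \<ge> 0" using Y(2) st by (simp add: r_def)
  have B: "(\<lambda>\<omega>. canon 1 \<omega> ^ (2 * k)) \<in> L_ip 1"
    using canon_power_L_ip[of 1] by simp
  have sq: "sqrt (t - s) ^ (2 * k) = (t - s) ^ k" using st by (simp add: power_mult)
  have "E (\<lambda>\<omega>'. Y \<omega> * ((sqrt (t - s) * canon 1 \<omega>') ^ (2 * k) - B_moment E (2 * k) * (t - s) ^ k))
     = E (\<lambda>\<omega>'. r * canon 1 \<omega>' ^ (2 * k) + - (r * B_moment E (2 * k)))"
    by (simp add: r_def algebra_simps power_mult_distrib sq sq[unfolded mult.commute[of 2 k]])
  also have "\<dots> = E (\<lambda>\<omega>'. r * canon 1 \<omega>' ^ (2 * k)) + - (r * B_moment E (2 * k))"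
    by (intro E_add_const L_ip_all_I[of 1] L_ip_scale B) simp
  also have "E (\<lambda>\<omega>'. r * canon 1 \<omega>' ^ (2 * k)) = r * E (\<lambda>\<omega>'. canon 1 \<omega>' ^ (2 * k))"
    by (intro E_scale L_ip_all_I[of 1] B r) simp
  finally show "E (\<lambda>\<omega>'. Y \<omega> * ((sqrt (t - s) * canon 1 \<omega>') ^ (2 * k) - B_moment E (2 * k) * (t - s) ^ k)) = 0"
    by (simp add: B_moment_def)
qed

lemma B_moment_even_nonneg: "0 \<le> B_moment E (2 * k)"
proof -
  have "E (\<lambda>_. 0) \<le> E (\<lambda>\<omega>. canon 1 \<omega> ^ (2 * k))"
    using L_ip_const[of 1] canon_power_L_ip[of 1]
    by (intro E_mono L_ip_all_I[of 1]) (auto simp: zero_le_even_power)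
  then show ?thesis by (simp add: B_moment_def)
qed

end

section \<open>Square integrable adapted random variables\<close>

definition N2 :: "'a measure \<Rightarrow> ('a \<Rightarrow> real) \<Rightarrow> ennreal" where
  "N2 M Z = (\<integral>\<^sup>+\<omega>. ennreal ((Z \<omega>)\<^sup>2) \<partial>M)"

text \<open>The squared norm satisfies the triangle inequality up to a factor. Working with squares throughout
  keeps all bounds inside the extended nonnegative reals.\<close>

lemma ennreal_sq_add_le: "ennreal ((a + b)\<^sup>2) \<le> 2 * ennreal (a\<^sup>2) + 2 * ennreal (b\<^sup>2)"
proof -
  have "(a + b)\<^sup>2 \<le> 2 * a\<^sup>2 + 2 * b\<^sup>2"
    using zero_le_power2[of "a - b"] by (simp add: power2_eq_square algebra_simps)
  then have "ennreal ((a + b)\<^sup>2) \<le> ennreal (2 * a\<^sup>2 + 2 * b\<^sup>2)" by (rule ennreal_leI)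
  also have "\<dots> = 2 * ennreal (a\<^sup>2) + 2 * ennreal (b\<^sup>2)"
    by (simp add: ennreal_plus ennreal_mult')
  finally show ?thesis .
qed

lemma ennreal_tendsto_0_le:
  assumes "\<And>n. a n \<le> b n" and "b \<longlonglongrightarrow> (0 :: ennreal)"
  shows "a \<longlonglongrightarrow> 0"
  by (rule tendsto_sandwich[OF _ _ tendsto_const assms(2)]) (simp_all add: assms(1))

lemma ennreal_tendsto_0_le2:
  assumes le: "\<And>n. a n \<le> x * b n + y * c n" and lim: "b \<longlonglongrightarrow> (0 :: ennreal)" "c \<longlonglongrightarrow> 0"
    and fin: "x < \<infinity>" "y < \<infinity>"
  shows "a \<longlonglongrightarrow> 0"
proof (rule ennreal_tendsto_0_le[OF le])
  have "(\<lambda>n. x * b n + y * c n) \<longlonglongrightarrow> x * 0 + y * 0"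
    using fin by (intro tendsto_add tendsto_mult_ennreal lim tendsto_const) auto
  then show "(\<lambda>n. x * b n + y * c n) \<longlonglongrightarrow> 0" by simp
qed

lemma ennreal_tendsto_0_scaled:
  assumes "\<And>n. a n \<le> x * b n" and "b \<longlonglongrightarrow> (0 :: ennreal)" and "x < \<infinity>"
  shows "a \<longlonglongrightarrow> 0"
  using ennreal_tendsto_0_le2[of a x b 0 b] assms by simp

lemma ennreal_twice_finite: "x < \<infinity> \<Longrightarrow> y < \<infinity> \<Longrightarrow> 2 * x + 2 * y < (\<infinity> :: ennreal)"
  by (simp add: ennreal_mult_less_top)

lemma N2_add:
  assumes [measurable]: "Z \<in> borel_measurable M" "W \<in> borel_measurable M"
  shows "N2 M (\<lambda>\<omega>. Z \<omega> + W \<omega>) \<le> 2 * N2 M Z + 2 * N2 M W"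
proof -
  have "N2 M (\<lambda>\<omega>. Z \<omega> + W \<omega>) \<le> (\<integral>\<^sup>+\<omega>. 2 * ennreal ((Z \<omega>)\<^sup>2) + 2 * ennreal ((W \<omega>)\<^sup>2) \<partial>M)"
    unfolding N2_def by (intro nn_integral_mono ennreal_sq_add_le)
  then show ?thesis by (simp add: N2_def nn_integral_add nn_integral_cmult)
qed

lemma N2_uminus [simp]: "N2 M (\<lambda>\<omega>. - Z \<omega>) = N2 M Z"
  by (simp add: N2_def)

lemma N2_diff:
  assumes "Z \<in> borel_measurable M" "W \<in> borel_measurable M"
  shows "N2 M (\<lambda>\<omega>. Z \<omega> - W \<omega>) \<le> 2 * N2 M Z + 2 * N2 M W"
  using N2_add[of Z M "\<lambda>\<omega>. - W \<omega>"] assms by simp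

lemma N2_triangle:
  assumes "Z \<in> borel_measurable M" "W \<in> borel_measurable M" "Y \<in> borel_measurable M"
  shows "N2 M (\<lambda>\<omega>. Z \<omega> - W \<omega>) \<le> 2 * N2 M (\<lambda>\<omega>. Z \<omega> - Y \<omega>) + 2 * N2 M (\<lambda>\<omega>. Y \<omega> - W \<omega>)"
  using N2_add[of "\<lambda>\<omega>. Z \<omega> - Y \<omega>" M "\<lambda>\<omega>. Y \<omega> - W \<omega>"] assms by simp

lemma N2_commute: "N2 M (\<lambda>\<omega>. Z \<omega> - W \<omega>) = N2 M (\<lambda>\<omega>. W \<omega> - Z \<omega>)"
  by (simp add: N2_def power2_commute)

lemma N2_cong_AE: "AE \<omega> in M. Z \<omega> = W \<omega> \<Longrightarrow> N2 M Z = N2 M W"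
  unfolding N2_def by (rule nn_integral_cong_AE) auto

lemma N2_le_scaled:
  assumes [measurable]: "W \<in> borel_measurable M" and le: "AE \<omega> in M. \<bar>Z \<omega>\<bar> \<le> R * \<bar>W \<omega>\<bar>"
  shows "N2 M Z \<le> ennreal (R\<^sup>2) * N2 M W"
proof -
  have "N2 M Z \<le> (\<integral>\<^sup>+\<omega>. ennreal (R\<^sup>2) * ennreal ((W \<omega>)\<^sup>2) \<partial>M)"
    unfolding N2_def
  proof (rule nn_integral_mono_AE, rule eventually_mono[OF le])
    fix \<omega> assume "\<bar>Z \<omega>\<bar> \<le> R * \<bar>W \<omega>\<bar>"
    then have "\<bar>Z \<omega>\<bar>\<^sup>2 \<le> (R * \<bar>W \<omega>\<bar>)\<^sup>2" by (rule power_mono) simp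
    then show "ennreal ((Z \<omega>)\<^sup>2) \<le> ennreal (R\<^sup>2) * ennreal ((W \<omega>)\<^sup>2)"
      by (simp add: power_mult_distrib ennreal_mult[symmetric] ennreal_leI)
  qed
  then show ?thesis by (simp add: N2_def nn_integral_cmult)
qed

lemma N2_finite_iff:
  assumes [measurable]: "Z \<in> borel_measurable M"
  shows "N2 M Z < \<infinity> \<longleftrightarrow> integrable M (\<lambda>\<omega>. (Z \<omega>)\<^sup>2)"
  by (simp add: N2_def integrable_iff_bounded)

lemma integrable_mult_N2:
  assumes [measurable]: "Z \<in> borel_measurable M" "W \<in> borel_measurable M"
    and fin: "N2 M Z < \<infinity>" "N2 M W < \<infinity>"
  shows "integrable M (\<lambda>\<omega>. Z \<omega> * W \<omega>)"
proof (rule Bochner_Integration.integrable_bound)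
  show "integrable M (\<lambda>\<omega>. (Z \<omega>)\<^sup>2 + (W \<omega>)\<^sup>2)"
    using fin by (intro Bochner_Integration.integrable_add) (simp_all add: N2_finite_iff[symmetric])
  have "\<bar>a * b\<bar> \<le> a\<^sup>2 + b\<^sup>2" for a b :: real
    using sum_squares_bound[of "\<bar>a\<bar>" "\<bar>b\<bar>"] mult_nonneg_nonneg[of "\<bar>a\<bar>" "\<bar>b\<bar>"]
    unfolding abs_mult power2_abs by linarith
  then show "AE \<omega> in M. norm (Z \<omega> * W \<omega>) \<le> norm ((Z \<omega>)\<^sup>2 + (W \<omega>)\<^sup>2)"
    by simp
qed simp

lemma N2_finite_limit:
  assumes [measurable]: "Z \<in> borel_measurable M" "\<And>n. Y n \<in> borel_measurable M"
    and "\<And>n. N2 M (Y n) < \<infinity>" and lim: "(\<lambda>n. N2 M (\<lambda>\<omega>. Z \<omega> - Y n \<omega>)) \<longlonglongrightarrow> 0"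
  shows "N2 M Z < \<infinity>"
proof -
  obtain n where n: "N2 M (\<lambda>\<omega>. Z \<omega> - Y n \<omega>) < 1"
    using order_tendstoD(2)[OF lim, of 1] by (auto simp: eventually_sequentially)
  have "N2 M Z \<le> 2 * N2 M (\<lambda>\<omega>. Z \<omega> - Y n \<omega>) + 2 * N2 M (Y n)"
    using N2_add[of "\<lambda>\<omega>. Z \<omega> - Y n \<omega>" M "Y n"] by simp
  also have "\<dots> < \<infinity>"
    using n assms(3)[of n] by (intro ennreal_twice_finite) (auto intro: less_trans)
  finally show ?thesis .
qed

lemma integral_mult_tendsto_N2:
  assumes [measurable]: "Z \<in> borel_measurable M" "\<And>n. Y n \<in> borel_measurable M" "W \<in> borel_measurable M"
    and Y: "\<And>n. N2 M (Y n) < \<infinity>" and W: "N2 M W < \<infinity>"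
    and lim: "(\<lambda>n. N2 M (\<lambda>\<omega>. Z \<omega> - Y n \<omega>)) \<longlonglongrightarrow> 0"
  shows "(\<lambda>n. \<integral>\<omega>. Y n \<omega> * W \<omega> \<partial>M) \<longlonglongrightarrow> (\<integral>\<omega>. Z \<omega> * W \<omega> \<partial>M)"
proof -
  have Z: "N2 M Z < \<infinity>" using N2_finite_limit[OF assms(1,2) Y lim] .
  define A where "A n = (\<integral>\<^sup>+\<omega>. ennreal \<bar>Z \<omega> - Y n \<omega>\<bar> * ennreal \<bar>W \<omega>\<bar> \<partial>M)" for n
  have sq: "(ennreal \<bar>x\<bar>)\<^sup>2 = ennreal (x\<^sup>2)" for x by (simp add: ennreal_power)
  have "(A n)\<^sup>2 \<le> N2 M W * N2 M (\<lambda>\<omega>. Z \<omega> - Y n \<omega>)" for n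
    using Cauchy_Schwarz_nn_integral[of "\<lambda>\<omega>. ennreal \<bar>Z \<omega> - Y n \<omega>\<bar>" M "\<lambda>\<omega>. ennreal \<bar>W \<omega>\<bar>"]
    by (simp add: A_def N2_def sq mult.commute)
  then have A2: "(\<lambda>n. (A n)\<^sup>2) \<longlonglongrightarrow> 0"
    by (rule ennreal_tendsto_0_scaled[OF _ lim W])
  have A: "A \<longlonglongrightarrow> 0"
  proof (rule order_tendstoI)
    fix e :: ennreal assume "0 < e"
    then have "0 < e\<^sup>2" by (simp add: zero_less_iff_neq_zero)
    from order_tendstoD(2)[OF A2 this] show "\<forall>\<^sub>F n in sequentially. A n < e"
      by (rule eventually_mono) (metis linorder_not_le power_mono zero_le)
  qed auto
  have eq: "ennreal \<bar>(\<integral>\<omega>. Y n \<omega> * W \<omega> \<partial>M) - (\<integral>\<omega>. Z \<omega> * W \<omega> \<partial>M)\<bar> \<le> A n" for n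
  proof -
    have "(\<integral>\<omega>. Y n \<omega> * W \<omega> \<partial>M) - (\<integral>\<omega>. Z \<omega> * W \<omega> \<partial>M) = (\<integral>\<omega>. Y n \<omega> * W \<omega> - Z \<omega> * W \<omega> \<partial>M)"
      by (intro Bochner_Integration.integral_diff[symmetric] integrable_mult_N2 Y W Z) auto
    also have "ennreal \<bar>\<dots>\<bar> \<le> (\<integral>\<^sup>+\<omega>. ennreal (norm (Y n \<omega> * W \<omega> - Z \<omega> * W \<omega>)) \<partial>M)"
      using integral_norm_bound_ennreal[of M "\<lambda>\<omega>. Y n \<omega> * W \<omega> - Z \<omega> * W \<omega>"]
        integrable_mult_N2[of "Y n" M W] integrable_mult_N2[of Z M W] Y W Z by simp
    also have "\<dots> = A n"
      unfolding A_def
      by (intro nn_integral_cong)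
        (simp add: ennreal_mult[symmetric] abs_mult[symmetric] left_diff_distrib abs_minus_commute)
    finally show ?thesis .
  qed
  have "(\<lambda>n. ennreal \<bar>(\<integral>\<omega>. Y n \<omega> * W \<omega> \<partial>M) - (\<integral>\<omega>. Z \<omega> * W \<omega> \<partial>M)\<bar>) \<longlonglongrightarrow> ennreal 0"
    unfolding ennreal_0 by (rule ennreal_tendsto_0_le[OF eq A])
  then have "(\<lambda>n. \<bar>(\<integral>\<omega>. Y n \<omega> * W \<omega> \<partial>M) - (\<integral>\<omega>. Z \<omega> * W \<omega> \<partial>M)\<bar>) \<longlonglongrightarrow> 0"
    by (subst (asm) tendsto_ennreal_iff) auto
  then show ?thesis
    using LIM_zero_cancel tendsto_rabs_zero_iff by blast
qed

text \<open>The \<open>L\<^sup>2\<close>-closure of the cylinder random variables of the past plays the role of the square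
  integrable random variables that are measurable with respect to the past. Identities and bounds that
  hold for cylinder random variables extend to it by continuity.\<close>

definition HS :: "path measure \<Rightarrow> real \<Rightarrow> (path \<Rightarrow> real) set" where
  "HS P s = {Z \<in> borel_measurable P.
     \<forall>e>0. \<exists>Y\<in>L_ip s. N2 P (\<lambda>\<omega>. Z \<omega> - Y \<omega>) \<le> ennreal e}"

definition clip :: "real \<Rightarrow> real \<Rightarrow> real" where
  "clip R x = max (- R) (min R x)"

lemma clip_lipschitz: "\<bar>clip R a - clip R b\<bar> \<le> 1 * \<bar>a - b\<bar>"
  by (auto simp: clip_def)

lemma clip_bound: "0 \<le> R \<Longrightarrow> \<bar>clip R x\<bar> \<le> R"
  by (auto simp: clip_def)

lemma clip_id: "\<bar>x\<bar> \<le> R \<Longrightarrow> clip R x = x"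
  by (auto simp: clip_def)

locale G_measure = G_framework +
  fixes P :: "path measure"
  assumes P_in: "P \<in> PG"
begin

sublocale prob_space P
  by (rule PG_props(1)[OF P_in])

lemmas sets_P [measurable_cong] = PG_props(2)[OF P_in]
lemmas space_P [simp] = PG_props(3)[OF P_in]

definition c2 :: real where "c2 = B_moment E 2"
definition c4 :: real where "c4 = B_moment E 4"

lemma c2_nonneg [simp]: "0 \<le> c2" and c4_nonneg [simp]: "0 \<le> c4"
  using B_moment_even_nonneg[of 1] B_moment_even_nonneg[of 2] by (auto simp: c2_def c4_def)

lemma L_ip_nonneg_time: "Y \<in> L_ip s \<Longrightarrow> 0 \<le> s"
  unfolding L_ip_def by (fastforce simp: image_subset_iff)

lemma L_ip_P_integrable: "Y \<in> L_ip s \<Longrightarrow> integrable P Y"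
  by (rule L_ip_integrable[OF P_in L_ip_nonneg_time])

lemma L_ip_measurable: "Y \<in> L_ip s \<Longrightarrow> Y \<in> borel_measurable P"
  by (rule borel_measurable_integrable[OF L_ip_P_integrable])

lemma canon_measurable [measurable]: "0 \<le> t \<Longrightarrow> canon t \<in> borel_measurable P"
  by (rule L_ip_measurable[OF L_ip_canon[of t t]]) auto

lemma L_ip_N2:
  assumes Y: "Y \<in> L_ip s"
  shows "N2 P Y < \<infinity>"
  unfolding N2_finite_iff[OF L_ip_measurable[OF Y]]
  by (rule L_ip_P_integrable[OF L_ip_power[OF L_ip_nonneg_time[OF Y] Y]])

lemma increment_in_L_ip: "0 \<le> s \<Longrightarrow> s \<le> t \<Longrightarrow> (\<lambda>\<omega>. canon t \<omega> - canon s \<omega>) \<in> L_ip t"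
  by (intro L_ip_diff L_ip_canon) auto

lemma L_ip_times_increment:
  assumes Y: "Y \<in> L_ip s" and st: "s \<le> t"
  shows "(\<lambda>\<omega>. Y \<omega> * (canon t \<omega> - canon s \<omega>)) \<in> L_ip t"
  by (rule L_ip_mult[OF subsetD[OF L_ip_mono[OF st] Y] increment_in_L_ip[OF L_ip_nonneg_time[OF Y] st]])

text \<open>The square of a cylinder random variable is a nonnegative cylinder random variable of the past, so
  the conditional bound on the second moment applies to it.\<close>

lemma N2_L_ip_increment:
  assumes Y: "Y \<in> L_ip s" and st: "s \<le> t"
  shows "N2 P (\<lambda>\<omega>. Y \<omega> * (canon t \<omega> - canon s \<omega>)) \<le> ennreal (c2 * (t - s)) * N2 P Y"
proof -
  have s: "0 \<le> s" "0 \<le> t" using L_ip_nonneg_time[OF Y] st by auto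
  have i: "integrable P (\<lambda>\<omega>. (Y \<omega> * (canon t \<omega> - canon s \<omega>))\<^sup>2)" "integrable P (\<lambda>\<omega>. (Y \<omega>)\<^sup>2)"
    using L_ip_P_integrable[OF L_ip_power[OF _ L_ip_times_increment[OF Y st], of 2]]
      L_ip_P_integrable[OF L_ip_power[OF _ Y, of 2]] s by auto
  have "(\<integral>\<omega>. (Y \<omega>)\<^sup>2 * ((canon t \<omega> - canon s \<omega>) ^ (2 * 1) - c2 * (t - s) ^ 1) \<partial>P) \<le> 0"
    using integral_increment_power[OF P_in L_ip_power[OF _ Y, of 2] _ _ st, of 1] s by (simp add: c2_def)
  also have "(\<integral>\<omega>. (Y \<omega>)\<^sup>2 * ((canon t \<omega> - canon s \<omega>) ^ (2 * 1) - c2 * (t - s) ^ 1) \<partial>P)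
     = (\<integral>\<omega>. (Y \<omega> * (canon t \<omega> - canon s \<omega>))\<^sup>2 - c2 * (t - s) * (Y \<omega>)\<^sup>2 \<partial>P)"
    by (simp add: power2_eq_square algebra_simps)
  also have "\<dots> = (\<integral>\<omega>. (Y \<omega> * (canon t \<omega> - canon s \<omega>))\<^sup>2 \<partial>P) - c2 * (t - s) * (\<integral>\<omega>. (Y \<omega>)\<^sup>2 \<partial>P)"
    using i by simp
  finally have "(\<integral>\<omega>. (Y \<omega> * (canon t \<omega> - canon s \<omega>))\<^sup>2 \<partial>P) \<le> c2 * (t - s) * (\<integral>\<omega>. (Y \<omega>)\<^sup>2 \<partial>P)"
    by simp
  then have "ennreal (\<integral>\<omega>. (Y \<omega> * (canon t \<omega> - canon s \<omega>))\<^sup>2 \<partial>P) \<le> ennreal (c2 * (t - s) * (\<integral>\<omega>. (Y \<omega>)\<^sup>2 \<partial>P))"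
    by (rule ennreal_leI)
  then show ?thesis
    unfolding N2_def using st by (simp add: nn_integral_eq_integral i ennreal_mult')
qed

lemma HS_measurable [measurable_dest]: "Z \<in> HS P s \<Longrightarrow> Z \<in> borel_measurable P"
  by (simp add: HS_def)

lemma L_ip_HS: "Y \<in> L_ip s \<Longrightarrow> Y \<in> HS P s"
  unfolding HS_def using L_ip_measurable by (auto intro!: bexI[of _ Y] simp: N2_def)

lemma HS_seq:
  assumes "Z \<in> HS P s"
  obtains Y where "\<And>n. Y n \<in> L_ip s" "(\<lambda>n. N2 P (\<lambda>\<omega>. Z \<omega> - Y n \<omega>)) \<longlonglongrightarrow> 0"
proof -
  have "\<forall>n. \<exists>Y\<in>L_ip s. N2 P (\<lambda>\<omega>. Z \<omega> - Y \<omega>) \<le> ennreal (1 / Suc n)"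
    using assms unfolding HS_def by auto
  then obtain Y where Y: "\<And>n. Y n \<in> L_ip s" "\<And>n. N2 P (\<lambda>\<omega>. Z \<omega> - Y n \<omega>) \<le> ennreal (1 / Suc n)"
    by metis
  have "(\<lambda>n. ennreal (1 / Suc n)) \<longlonglongrightarrow> ennreal 0"
    by (intro tendsto_ennrealI LIMSEQ_Suc[OF lim_1_over_n])
  then have "(\<lambda>n. N2 P (\<lambda>\<omega>. Z \<omega> - Y n \<omega>)) \<longlonglongrightarrow> 0"
    unfolding ennreal_0 by (rule ennreal_tendsto_0_le[OF Y(2)])
  with Y(1) show thesis by (rule that)
qed

lemma HS_closed:
  assumes [measurable]: "Z \<in> borel_measurable P" and Y: "\<And>n. Y n \<in> HS P s"
    and lim: "(\<lambda>n. N2 P (\<lambda>\<omega>. Z \<omega> - Y n \<omega>)) \<longlonglongrightarrow> 0"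
  shows "Z \<in> HS P s"
  unfolding HS_def
proof (intro CollectI conjI allI impI)
  fix e :: real assume e: "0 < e"
  note [measurable] = HS_measurable[OF Y]
  have e4: "0 < ennreal (e / 4)" "0 < e / 4" using e by simp_all
  obtain n where n: "N2 P (\<lambda>\<omega>. Z \<omega> - Y n \<omega>) < ennreal (e / 4)"
    using eventually_happens'[OF sequentially_bot order_tendstoD(2)[OF lim e4(1)]] by blast
  obtain W where W: "W \<in> L_ip s" "N2 P (\<lambda>\<omega>. Y n \<omega> - W \<omega>) \<le> ennreal (e / 4)"
    using Y[of n] e4(2) unfolding HS_def by blast
  note [measurable] = L_ip_measurable[OF W(1)]
  have "N2 P (\<lambda>\<omega>. Z \<omega> - W \<omega>) \<le> 2 * N2 P (\<lambda>\<omega>. Z \<omega> - Y n \<omega>) + 2 * N2 P (\<lambda>\<omega>. Y n \<omega> - W \<omega>)"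
    by (rule N2_triangle) auto
  also have "\<dots> \<le> 2 * ennreal (e / 4) + 2 * ennreal (e / 4)"
    using n W(2) by (intro add_mono mult_left_mono) auto
  also have "\<dots> = ennreal e"
    using e by (simp add: ennreal_plus[symmetric] ennreal_mult'[symmetric] flip: ennreal_numeral del: ennreal_plus)
  finally show "\<exists>Y\<in>L_ip s. N2 P (\<lambda>\<omega>. Z \<omega> - Y \<omega>) \<le> ennreal e" using W(1) by blast
qed simp

lemma HS_closedI:
  assumes "Z \<in> borel_measurable P" and "\<And>n. Y n \<in> L_ip s"
    and "(\<lambda>n. N2 P (\<lambda>\<omega>. Z \<omega> - Y n \<omega>)) \<longlonglongrightarrow> 0"
  shows "Z \<in> HS P s"
  using HS_closed[OF assms(1) L_ip_HS[OF assms(2)] assms(3)] .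

lemma HS_N2:
  assumes Z: "Z \<in> HS P s"
  shows "N2 P Z < \<infinity>"
proof -
  obtain Y where Y: "\<And>n. Y n \<in> L_ip s" "(\<lambda>n. N2 P (\<lambda>\<omega>. Z \<omega> - Y n \<omega>)) \<longlonglongrightarrow> 0"
    using HS_seq[OF Z] by blast
  show ?thesis
    by (rule N2_finite_limit[OF HS_measurable[OF Z] L_ip_measurable[OF Y(1)] L_ip_N2[OF Y(1)] Y(2)])
qed

lemma HS_cong_AE:
  assumes "Z \<in> HS P s" "W \<in> borel_measurable P" "AE \<omega> in P. Z \<omega> = W \<omega>"
  shows "W \<in> HS P s"
proof (rule HS_closed[OF assms(2), of "\<lambda>_. Z"])
  have "N2 P (\<lambda>\<omega>. W \<omega> - Z \<omega>) = N2 P (\<lambda>\<omega>. 0)"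
    using assms(3) by (intro N2_cong_AE) auto
  then show "(\<lambda>n. N2 P (\<lambda>\<omega>. W \<omega> - Z \<omega>)) \<longlonglongrightarrow> 0" by (simp add: N2_def)
qed (rule assms(1))

lemma HS_mono: "s \<le> t \<Longrightarrow> HS P s \<subseteq> HS P t"
  unfolding HS_def using L_ip_mono[of s t] by blast

lemma HS_lipschitz:
  assumes Z: "Z \<in> HS P s" and u: "\<And>a b :: real. \<bar>u a - u b\<bar> \<le> L * \<bar>a - b\<bar>"
    and [measurable]: "u \<in> borel_measurable borel"
  shows "(\<lambda>\<omega>. u (Z \<omega>)) \<in> HS P s"
proof -
  obtain Y where Y: "\<And>n. Y n \<in> L_ip s" "(\<lambda>n. N2 P (\<lambda>\<omega>. Z \<omega> - Y n \<omega>)) \<longlonglongrightarrow> 0"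
    using HS_seq[OF Z] by blast
  note [measurable] = HS_measurable[OF Z] L_ip_measurable[OF Y(1)]
  show ?thesis
  proof (rule HS_closedI)
    show "(\<lambda>\<omega>. u (Y n \<omega>)) \<in> L_ip s" for n by (rule L_ip_lipschitz[OF Y(1) u])
    have "N2 P (\<lambda>\<omega>. u (Z \<omega>) - u (Y n \<omega>)) \<le> ennreal (L\<^sup>2) * N2 P (\<lambda>\<omega>. Z \<omega> - Y n \<omega>)" for n
      by (intro N2_le_scaled AE_I2 u) simp
    then show "(\<lambda>n. N2 P (\<lambda>\<omega>. u (Z \<omega>) - u (Y n \<omega>))) \<longlonglongrightarrow> 0"
      by (rule ennreal_tendsto_0_scaled[OF _ Y(2)]) simp
  qed simp
qed

lemma HS_add:
  assumes Z: "Z \<in> HS P s" and W: "W \<in> HS P s"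
  shows "(\<lambda>\<omega>. Z \<omega> + W \<omega>) \<in> HS P s"
proof -
  obtain Y where Y: "\<And>n. Y n \<in> L_ip s" "(\<lambda>n. N2 P (\<lambda>\<omega>. Z \<omega> - Y n \<omega>)) \<longlonglongrightarrow> 0"
    using HS_seq[OF Z] by blast
  obtain V where V: "\<And>n. V n \<in> L_ip s" "(\<lambda>n. N2 P (\<lambda>\<omega>. W \<omega> - V n \<omega>)) \<longlonglongrightarrow> 0"
    using HS_seq[OF W] by blast
  note [measurable] = HS_measurable[OF Z] HS_measurable[OF W] L_ip_measurable[OF Y(1)] L_ip_measurable[OF V(1)]
  show ?thesis
  proof (rule HS_closedI)
    show "(\<lambda>\<omega>. Y n \<omega> + V n \<omega>) \<in> L_ip s" for n by (rule L_ip_add[OF Y(1) V(1)])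
    have "N2 P (\<lambda>\<omega>. Z \<omega> + W \<omega> - (Y n \<omega> + V n \<omega>))
        \<le> 2 * N2 P (\<lambda>\<omega>. Z \<omega> - Y n \<omega>) + 2 * N2 P (\<lambda>\<omega>. W \<omega> - V n \<omega>)" for n
      using N2_add[of "\<lambda>\<omega>. Z \<omega> - Y n \<omega>" P "\<lambda>\<omega>. W \<omega> - V n \<omega>"] by (simp add: algebra_simps)
    then show "(\<lambda>n. N2 P (\<lambda>\<omega>. Z \<omega> + W \<omega> - (Y n \<omega> + V n \<omega>))) \<longlonglongrightarrow> 0"
      by (rule ennreal_tendsto_0_le2[OF _ Y(2) V(2)]) simp_all
  qed simp
qed

lemma HS_scale: "Z \<in> HS P s \<Longrightarrow> (\<lambda>\<omega>. a * Z \<omega>) \<in> HS P s"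
  by (rule HS_lipschitz[where u = "\<lambda>x. a * x" and L = "\<bar>a\<bar>"])
    (auto simp: abs_mult[symmetric] algebra_simps)

lemma HS_diff: "Z \<in> HS P s \<Longrightarrow> W \<in> HS P s \<Longrightarrow> (\<lambda>\<omega>. Z \<omega> - W \<omega>) \<in> HS P s"
  using HS_add[OF _ HS_scale, of Z s W "-1"] by simp

lemma HS_const: "0 \<le> s \<Longrightarrow> (\<lambda>_. a) \<in> HS P s"
  by (intro L_ip_HS L_ip_const)

text \<open>Truncation approximates in \<open>L\<^sup>2\<close> by dominated convergence and, being a Lipschitz function, stays within
  the closure.\<close>

lemma clip_approx:
  assumes [measurable]: "Y \<in> borel_measurable P" and fin: "N2 P Y < \<infinity>"
  shows "(\<lambda>n. N2 P (\<lambda>\<omega>. Y \<omega> - clip (real n) (Y \<omega>))) \<longlonglongrightarrow> 0"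
proof -
  have "(\<lambda>n. \<integral>\<^sup>+\<omega>. ennreal ((Y \<omega> - clip (real n) (Y \<omega>))\<^sup>2) \<partial>P) \<longlonglongrightarrow> (\<integral>\<^sup>+\<omega>. 0 \<partial>P)"
  proof (rule nn_integral_dominated_convergence)
    show "(\<integral>\<^sup>+\<omega>. ennreal ((Y \<omega>)\<^sup>2) \<partial>P) < \<infinity>" using fin by (simp add: N2_def)
    have "\<bar>Y \<omega> - clip (real n) (Y \<omega>)\<bar> \<le> \<bar>Y \<omega>\<bar>" for n \<omega> by (auto simp: clip_def)
    then show "AE \<omega> in P. ennreal ((Y \<omega> - clip (real n) (Y \<omega>))\<^sup>2) \<le> ennreal ((Y \<omega>)\<^sup>2)" for n
      by (intro AE_I2 ennreal_leI) (simp add: abs_le_square_iff)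
    show "AE \<omega> in P. (\<lambda>n. ennreal ((Y \<omega> - clip (real n) (Y \<omega>))\<^sup>2)) \<longlonglongrightarrow> 0"
    proof (rule AE_I2)
      fix \<omega>
      obtain N :: nat where "\<bar>Y \<omega>\<bar> \<le> N" using real_arch_simple by blast
      then have "\<forall>\<^sub>F n in sequentially. ennreal ((Y \<omega> - clip (real n) (Y \<omega>))\<^sup>2) = 0"
        by (intro eventually_sequentiallyI[of N]) (simp add: clip_id)
      then show "(\<lambda>n. ennreal ((Y \<omega> - clip (real n) (Y \<omega>))\<^sup>2)) \<longlonglongrightarrow> 0"
        by (rule tendsto_eventually)
    qed
  qed (auto simp: clip_def)
  then show ?thesis by (simp add: N2_def)
qed

text \<open>A product with a bounded factor stays in the closure. Approximate the other factor first, by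
  a bounded cylinder random variable, and the bounded factor afterwards.\<close>

lemma HS_mult_bounded:
  assumes Z: "Z \<in> HS P s" and W: "W \<in> HS P s" and bd: "\<And>\<omega>. \<bar>Z \<omega>\<bar> \<le> M"
  shows "(\<lambda>\<omega>. Z \<omega> * W \<omega>) \<in> HS P s"
proof -
  note [measurable] = HS_measurable[OF Z] HS_measurable[OF W]
  obtain Y where Y: "\<And>n. Y n \<in> L_ip s" "(\<lambda>n. N2 P (\<lambda>\<omega>. Z \<omega> - Y n \<omega>)) \<longlonglongrightarrow> 0"
    using HS_seq[OF Z] by blast
  note [measurable] = L_ip_measurable[OF Y(1)]
  \<comment> \<open>First for bounded cylinder factors, then for all cylinder factors by truncation, then for the closure.\<close>
  have bdd: "(\<lambda>\<omega>. Z \<omega> * V \<omega>) \<in> HS P s" if V: "V \<in> L_ip s" and R: "\<And>\<omega>. \<bar>V \<omega>\<bar> \<le> R" for V R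
  proof (rule HS_closedI)
    note [measurable] = L_ip_measurable[OF V]
    show "(\<lambda>\<omega>. Y n \<omega> * V \<omega>) \<in> L_ip s" for n by (rule L_ip_mult[OF Y(1) V])
    show "(\<lambda>n. N2 P (\<lambda>\<omega>. Z \<omega> * V \<omega> - Y n \<omega> * V \<omega>)) \<longlonglongrightarrow> 0"
      by (rule ennreal_tendsto_0_scaled[OF _ Y(2)], rule N2_le_scaled[where R = R])
        (auto intro!: AE_I2 mult_right_mono R simp: left_diff_distrib[symmetric] abs_mult mult.commute[of "\<bar>_ - _\<bar>"])
    show "(\<lambda>\<omega>. Z \<omega> * V \<omega>) \<in> borel_measurable P" by simp
  qed
  have Lip: "(\<lambda>\<omega>. Z \<omega> * V \<omega>) \<in> HS P s" if V: "V \<in> L_ip s" for V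
  proof (rule HS_closed)
    note [measurable] = L_ip_measurable[OF V]
    show "(\<lambda>\<omega>. Z \<omega> * clip (real n) (V \<omega>)) \<in> HS P s" for n
      by (rule bdd[OF L_ip_lipschitz[OF V clip_lipschitz] clip_bound]) simp
    show "(\<lambda>n. N2 P (\<lambda>\<omega>. Z \<omega> * V \<omega> - Z \<omega> * clip (real n) (V \<omega>))) \<longlonglongrightarrow> 0"
      by (rule ennreal_tendsto_0_scaled[OF _ clip_approx[OF _ L_ip_N2[OF V]]], rule N2_le_scaled[where R = M])
        (auto intro!: AE_I2 mult_right_mono bd simp: right_diff_distrib[symmetric] abs_mult clip_def)
    show "(\<lambda>\<omega>. Z \<omega> * V \<omega>) \<in> borel_measurable P" by simp
  qed
  obtain V where V: "\<And>n. V n \<in> L_ip s" "(\<lambda>n. N2 P (\<lambda>\<omega>. W \<omega> - V n \<omega>)) \<longlonglongrightarrow> 0"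
    using HS_seq[OF W] by blast
  note [measurable] = L_ip_measurable[OF V(1)]
  show ?thesis
  proof (rule HS_closed)
    show "(\<lambda>\<omega>. Z \<omega> * V n \<omega>) \<in> HS P s" for n by (rule Lip[OF V(1)])
    show "(\<lambda>n. N2 P (\<lambda>\<omega>. Z \<omega> * W \<omega> - Z \<omega> * V n \<omega>)) \<longlonglongrightarrow> 0"
      by (rule ennreal_tendsto_0_scaled[OF _ V(2)], rule N2_le_scaled[where R = M])
        (auto intro!: AE_I2 mult_right_mono bd simp: right_diff_distrib[symmetric] abs_mult)
  qed simp
qed

lemma HS_nonneg_time: "Z \<in> HS P s \<Longrightarrow> 0 \<le> s"
  by (erule HS_seq) (rule L_ip_nonneg_time)

lemma HS_monoD: "Z \<in> HS P s \<Longrightarrow> s \<le> t \<Longrightarrow> Z \<in> HS P t"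
  using HS_mono by blast

text \<open>The bound for cylinder random variables survives the passage to the closure by Fatou's lemma
  along an almost surely convergent subsequence. The factor 2 comes from the triangle inequality in
  squared form.\<close>

lemma HS_increment_N2:
  assumes Z: "Z \<in> HS P s" and st: "s \<le> t"
  shows "N2 P (\<lambda>\<omega>. Z \<omega> * (canon t \<omega> - canon s \<omega>)) \<le> ennreal (2 * c2 * (t - s)) * N2 P Z"
proof -
  have s: "0 \<le> s" "0 \<le> t" using HS_nonneg_time[OF Z] st by auto
  obtain Y where Y: "\<And>n. Y n \<in> L_ip s" "(\<lambda>n. N2 P (\<lambda>\<omega>. Z \<omega> - Y n \<omega>)) \<longlonglongrightarrow> 0"
    using HS_seq[OF Z] by blast
  note [measurable] = HS_measurable[OF Z] L_ip_measurable[OF Y(1)] canon_measurable[OF s(1)] canon_measurable[OF s(2)]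
  have fin: "N2 P (\<lambda>\<omega>. Z \<omega> - Y n \<omega>) < \<infinity>" for n
    by (rule HS_N2[OF HS_diff[OF Z L_ip_HS[OF Y(1)]]])
  have "(\<lambda>n. ennreal (\<integral>\<omega>. norm ((Z \<omega> - Y n \<omega>)\<^sup>2) \<partial>P)) \<longlonglongrightarrow> ennreal 0"
    using Y(2) N2_finite_iff[of "\<lambda>\<omega>. Z \<omega> - Y _ \<omega>" P] fin
    by (simp add: N2_def nn_integral_eq_integral)
  then have "(\<lambda>n. \<integral>\<omega>. norm ((Z \<omega> - Y n \<omega>)\<^sup>2) \<partial>P) \<longlonglongrightarrow> 0"
    by (subst (asm) tendsto_ennreal_iff) auto
  moreover have "integrable P (\<lambda>\<omega>. (Z \<omega> - Y n \<omega>)\<^sup>2)" for n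
    using N2_finite_iff[of "\<lambda>\<omega>. Z \<omega> - Y n \<omega>" P] fin by simp
  ultimately obtain r :: "nat \<Rightarrow> nat" where r: "strict_mono r"
    "AE \<omega> in P. (\<lambda>n. (Z \<omega> - Y (r n) \<omega>)\<^sup>2) \<longlonglongrightarrow> 0"
    using tendsto_L1_AE_subseq[of P "\<lambda>n \<omega>. (Z \<omega> - Y n \<omega>)\<^sup>2"] by blast
  let ?d = "\<lambda>\<omega>. canon t \<omega> - canon s \<omega>"
  have "AE \<omega> in P. ennreal ((Z \<omega> * ?d \<omega>)\<^sup>2) = liminf (\<lambda>n. ennreal ((Y (r n) \<omega> * ?d \<omega>)\<^sup>2))"
    using r(2)
  proof eventually_elim
    fix \<omega> assume "(\<lambda>n. (Z \<omega> - Y (r n) \<omega>)\<^sup>2) \<longlonglongrightarrow> 0"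
    then have "(\<lambda>n. sqrt ((Z \<omega> - Y (r n) \<omega>)\<^sup>2)) \<longlonglongrightarrow> sqrt 0" by (rule tendsto_real_sqrt)
    then have "(\<lambda>n. Z \<omega> - Y (r n) \<omega>) \<longlonglongrightarrow> 0"
      by (simp add: tendsto_rabs_zero_iff)
    then have "(\<lambda>n. Z \<omega> - (Z \<omega> - Y (r n) \<omega>)) \<longlonglongrightarrow> Z \<omega> - 0"
      by (intro tendsto_diff tendsto_const)
    then have "(\<lambda>n. Y (r n) \<omega>) \<longlonglongrightarrow> Z \<omega>" by simp
    then have "(\<lambda>n. ennreal ((Y (r n) \<omega> * ?d \<omega>)\<^sup>2)) \<longlonglongrightarrow> ennreal ((Z \<omega> * ?d \<omega>)\<^sup>2)"
      by (intro tendsto_ennrealI tendsto_power tendsto_mult tendsto_const)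
    then show "ennreal ((Z \<omega> * ?d \<omega>)\<^sup>2) = liminf (\<lambda>n. ennreal ((Y (r n) \<omega> * ?d \<omega>)\<^sup>2))"
      by (intro lim_imp_Liminf[symmetric]) auto
  qed
  then have "N2 P (\<lambda>\<omega>. Z \<omega> * ?d \<omega>) = (\<integral>\<^sup>+\<omega>. liminf (\<lambda>n. ennreal ((Y (r n) \<omega> * ?d \<omega>)\<^sup>2)) \<partial>P)"
    unfolding N2_def by (rule nn_integral_cong_AE)
  also have "\<dots> \<le> liminf (\<lambda>n. N2 P (\<lambda>\<omega>. Y (r n) \<omega> * ?d \<omega>))"
    unfolding N2_def by (rule nn_integral_liminf) simp
  also have "\<dots> \<le> liminf (\<lambda>n. ennreal (c2 * (t - s)) * (2 * N2 P (\<lambda>\<omega>. Z \<omega> - Y (r n) \<omega>) + 2 * N2 P Z))"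
  proof (rule Liminf_mono, rule always_eventually, rule allI)
    fix n
    have "N2 P (Y (r n)) \<le> 2 * N2 P (\<lambda>\<omega>. Y (r n) \<omega> - Z \<omega>) + 2 * N2 P Z"
      using N2_add[of "\<lambda>\<omega>. Y (r n) \<omega> - Z \<omega>" P Z] by simp
    then show "N2 P (\<lambda>\<omega>. Y (r n) \<omega> * ?d \<omega>)
        \<le> ennreal (c2 * (t - s)) * (2 * N2 P (\<lambda>\<omega>. Z \<omega> - Y (r n) \<omega>) + 2 * N2 P Z)"
      unfolding N2_commute[of P Z]
      by (rule order_trans[OF N2_L_ip_increment[OF Y(1) st] mult_left_mono]) simp
  qed
  also have "\<dots> = ennreal (c2 * (t - s)) * (2 * 0 + 2 * N2 P Z)"
    using HS_N2[OF Z] by (intro lim_imp_Liminf tendsto_mult_ennreal tendsto_add tendsto_const LIMSEQ_subseq_LIMSEQ[OF Y(2) r(1), unfolded comp_def])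
      (auto simp: ennreal_mult_eq_top_iff)
  also have "\<dots> = ennreal (2 * (c2 * (t - s))) * N2 P Z"
    unfolding ennreal_mult'[of 2, simplified] by (simp add: mult_ac)
  finally show ?thesis by (simp add: mult_ac)
qed

lemma HS_times_increment:
  assumes Z: "Z \<in> HS P s" and st: "s \<le> t"
  shows "(\<lambda>\<omega>. Z \<omega> * (canon t \<omega> - canon s \<omega>)) \<in> HS P t"
proof -
  have s: "0 \<le> s" "0 \<le> t" using HS_nonneg_time[OF Z] st by auto
  obtain Y where Y: "\<And>n. Y n \<in> L_ip s" "(\<lambda>n. N2 P (\<lambda>\<omega>. Z \<omega> - Y n \<omega>)) \<longlonglongrightarrow> 0"
    using HS_seq[OF Z] by blast
  note [measurable] = HS_measurable[OF Z] canon_measurable[OF s(1)] canon_measurable[OF s(2)]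
  show ?thesis
  proof (rule HS_closedI)
    show "(\<lambda>\<omega>. Y n \<omega> * (canon t \<omega> - canon s \<omega>)) \<in> L_ip t" for n
      by (rule L_ip_times_increment[OF Y(1) st])
    show "(\<lambda>n. N2 P (\<lambda>\<omega>. Z \<omega> * (canon t \<omega> - canon s \<omega>) - Y n \<omega> * (canon t \<omega> - canon s \<omega>))) \<longlonglongrightarrow> 0"
      unfolding left_diff_distrib[symmetric]
      by (rule ennreal_tendsto_0_scaled[OF HS_increment_N2[OF HS_diff[OF Z L_ip_HS[OF Y(1)]] st] Y(2)]) simp
  qed simp
qed

lemma HS_increment_mean:
  assumes Z: "Z \<in> HS P s" and st: "s \<le> t"
  shows "(\<integral>\<omega>. Z \<omega> * (canon t \<omega> - canon s \<omega>) \<partial>P) = 0"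
proof -
  have s: "0 \<le> s" "0 \<le> t" using HS_nonneg_time[OF Z] st by auto
  obtain Y where Y: "\<And>n. Y n \<in> L_ip s" "(\<lambda>n. N2 P (\<lambda>\<omega>. Z \<omega> - Y n \<omega>)) \<longlonglongrightarrow> 0"
    using HS_seq[OF Z] by blast
  have "(\<lambda>n. \<integral>\<omega>. Y n \<omega> * (canon t \<omega> - canon s \<omega>) \<partial>P) \<longlonglongrightarrow> (\<integral>\<omega>. Z \<omega> * (canon t \<omega> - canon s \<omega>) \<partial>P)"
    using s st
    by (intro integral_mult_tendsto_N2 HS_measurable[OF Z] L_ip_measurable[OF Y(1)] L_ip_N2[OF Y(1)] Y(2)
        L_ip_N2[OF increment_in_L_ip] L_ip_measurable[OF increment_in_L_ip])
  moreover have "(\<integral>\<omega>. Y n \<omega> * (canon t \<omega> - canon s \<omega>) \<partial>P) = 0" for n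
    by (rule integral_increment[OF P_in Y(1) s(1) st])
  ultimately show ?thesis by (simp add: LIMSEQ_const_iff)
qed

lemma HS_increment_orthogonal:
  assumes S: "S \<in> HS P s" and Z: "Z \<in> HS P s" and st: "s \<le> t"
  shows "(\<integral>\<omega>. S \<omega> * (Z \<omega> * (canon t \<omega> - canon s \<omega>)) \<partial>P) = 0"
proof -
  have s: "0 \<le> s" "0 \<le> t" using HS_nonneg_time[OF Z] st by auto
  let ?d = "\<lambda>\<omega>. canon t \<omega> - canon s \<omega>"
  \<comment> \<open>For bounded \<open>Z\<close> the product \<open>S Z\<close> belongs to the closure, so it is orthogonal to the increment.\<close>
  define V where "V n \<omega> = clip (real n) (Z \<omega>)" for n \<omega>
  have V: "V n \<in> HS P s" for n
    unfolding V_def[abs_def]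
    by (rule HS_lipschitz[OF Z clip_lipschitz]) (simp add: clip_def[abs_def])
  have lim: "(\<lambda>n. N2 P (\<lambda>\<omega>. Z \<omega> - V n \<omega>)) \<longlonglongrightarrow> 0"
    unfolding V_def by (rule clip_approx[OF HS_measurable[OF Z] HS_N2[OF Z]])
  have VS: "(\<lambda>\<omega>. V n \<omega> * S \<omega>) \<in> HS P s" for n
    by (rule HS_mult_bounded[OF V S, of _ "real n"]) (simp add: V_def clip_bound)
  note [measurable] = HS_measurable[OF HS_times_increment[OF Z st]] HS_measurable[OF HS_times_increment[OF V st]]
    HS_measurable[OF S]
  have lim': "(\<lambda>n. N2 P (\<lambda>\<omega>. Z \<omega> * ?d \<omega> - V n \<omega> * ?d \<omega>)) \<longlonglongrightarrow> 0"
    unfolding left_diff_distrib[symmetric]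
    by (rule ennreal_tendsto_0_scaled[OF HS_increment_N2[OF HS_diff[OF Z V] st] lim]) simp
  have "(\<lambda>n. \<integral>\<omega>. (V n \<omega> * ?d \<omega>) * S \<omega> \<partial>P) \<longlonglongrightarrow> (\<integral>\<omega>. (Z \<omega> * ?d \<omega>) * S \<omega> \<partial>P)"
    by (intro integral_mult_tendsto_N2 lim' HS_N2[OF S] HS_N2[OF HS_times_increment[OF V st]]) simp_all
  moreover have "(\<integral>\<omega>. (V n \<omega> * ?d \<omega>) * S \<omega> \<partial>P) = 0" for n
    using HS_increment_mean[OF VS st, of n] by (simp add: mult_ac)
  ultimately show ?thesis by (simp add: LIMSEQ_const_iff mult_ac)
qed

text \<open>Discrete stochastic integrals: adapted, centred, and with one half of the Ito isometry.\<close>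

lemma stochastic_sum:
  assumes \<tau>: "\<And>j. j < m \<Longrightarrow> \<tau> j \<le> \<tau> (Suc j)" and 0: "0 \<le> \<tau> 0" and \<zeta>: "\<And>j. j < m \<Longrightarrow> \<zeta> j \<in> HS P (\<tau> j)"
  defines "S \<equiv> (\<lambda>\<omega>. \<Sum>j<m. \<zeta> j \<omega> * (canon (\<tau> (Suc j)) \<omega> - canon (\<tau> j) \<omega>))"
  shows "S \<in> HS P (\<tau> m)" and "(\<integral>\<omega>. S \<omega> \<partial>P) = 0"
    and "N2 P S \<le> (\<Sum>j<m. ennreal (2 * c2 * (\<tau> (Suc j) - \<tau> j)) * N2 P (\<zeta> j))"
proof -
  define U where "U k \<omega> = (\<Sum>j<k. \<zeta> j \<omega> * (canon (\<tau> (Suc j)) \<omega> - canon (\<tau> j) \<omega>))" for k \<omega>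
  have "U k \<in> HS P (\<tau> k) \<and> (\<integral>\<omega>. U k \<omega> \<partial>P) = 0 \<and>
    N2 P (U k) \<le> (\<Sum>j<k. ennreal (2 * c2 * (\<tau> (Suc j) - \<tau> j)) * N2 P (\<zeta> j))" if "k \<le> m" for k
    using that
  proof (induction k)
    case 0
    then show ?case using HS_const[OF assms(2), of 0] by (simp add: U_def[abs_def] N2_def)
  next
    case (Suc k)
    then have IH: "U k \<in> HS P (\<tau> k)" "(\<integral>\<omega>. U k \<omega> \<partial>P) = 0"
      "N2 P (U k) \<le> (\<Sum>j<k. ennreal (2 * c2 * (\<tau> (Suc j) - \<tau> j)) * N2 P (\<zeta> j))"
      and st: "\<tau> k \<le> \<tau> (Suc k)" and Z: "\<zeta> k \<in> HS P (\<tau> k)"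
      using \<tau>[of k] \<zeta>[of k] by auto
    define I where "I \<omega> = \<zeta> k \<omega> * (canon (\<tau> (Suc k)) \<omega> - canon (\<tau> k) \<omega>)" for \<omega>
    have I: "I \<in> HS P (\<tau> (Suc k))" unfolding I_def[abs_def] by (rule HS_times_increment[OF Z st])
    have Sk: "U k \<in> HS P (\<tau> (Suc k))" by (rule HS_monoD[OF IH(1) st])
    have eq: "U (Suc k) = (\<lambda>\<omega>. U k \<omega> + I \<omega>)" by (rule ext) (unfold U_def I_def, rule sum.lessThan_Suc)
    note [measurable] = HS_measurable[OF I] HS_measurable[OF Sk]
    note fin = HS_N2[OF I] HS_N2[OF Sk]
    have int: "integrable P I" "integrable P (U k)"
      "integrable P (\<lambda>\<omega>. (I \<omega>)\<^sup>2)" "integrable P (\<lambda>\<omega>. (U k \<omega>)\<^sup>2)" "integrable P (\<lambda>\<omega>. U k \<omega> * I \<omega>)"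
    proof -
      show sq: "integrable P (\<lambda>\<omega>. (I \<omega>)\<^sup>2)" "integrable P (\<lambda>\<omega>. (U k \<omega>)\<^sup>2)"
        using fin N2_finite_iff[of I P] N2_finite_iff[of "U k" P] by simp_all
      show "integrable P I" by (rule square_integrable_imp_integrable[OF _ sq(1)]) simp
      show "integrable P (U k)" by (rule square_integrable_imp_integrable[OF _ sq(2)]) simp
      show "integrable P (\<lambda>\<omega>. U k \<omega> * I \<omega>)" using fin by (intro integrable_mult_N2) simp_all
    qed
    have "(\<integral>\<omega>. U k \<omega> * I \<omega> \<partial>P) = 0"
      unfolding I_def by (rule HS_increment_orthogonal[OF IH(1) Z st])
    moreover have "(U k \<omega> + I \<omega>)\<^sup>2 = (U k \<omega>)\<^sup>2 + (I \<omega>)\<^sup>2 + 2 * (U k \<omega> * I \<omega>)" for \<omega>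
      by (simp add: power2_eq_square algebra_simps)
    ultimately have "(\<integral>\<omega>. (U (Suc k) \<omega>)\<^sup>2 \<partial>P) = (\<integral>\<omega>. (U k \<omega>)\<^sup>2 \<partial>P) + (\<integral>\<omega>. (I \<omega>)\<^sup>2 \<partial>P)"
      "integrable P (\<lambda>\<omega>. (U (Suc k) \<omega>)\<^sup>2)"
      using int unfolding eq by simp_all
    then have "N2 P (U (Suc k)) = N2 P (U k) + N2 P I"
      using int by (simp add: N2_def nn_integral_eq_integral ennreal_plus)
    also have "\<dots> \<le> (\<Sum>j<k. ennreal (2 * c2 * (\<tau> (Suc j) - \<tau> j)) * N2 P (\<zeta> j)) +
        ennreal (2 * c2 * (\<tau> (Suc k) - \<tau> k)) * N2 P (\<zeta> k)"
      unfolding I_def by (intro add_mono IH(3) HS_increment_N2[OF Z st])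
    finally have n: "N2 P (U (Suc k)) \<le> (\<Sum>j<Suc k. ennreal (2 * c2 * (\<tau> (Suc j) - \<tau> j)) * N2 P (\<zeta> j))"
      by simp
    have "(\<integral>\<omega>. I \<omega> \<partial>P) = 0" unfolding I_def by (rule HS_increment_mean[OF Z st])
    then have mean: "(\<integral>\<omega>. U (Suc k) \<omega> \<partial>P) = 0"
      using int IH(2) unfolding eq by simp
    have "U (Suc k) \<in> HS P (\<tau> (Suc k))" unfolding eq by (rule HS_add[OF Sk I])
    with mean n show ?case by (intro conjI)
  qed
  from this[OF order_refl] show "S \<in> HS P (\<tau> m)" and "(\<integral>\<omega>. S \<omega> \<partial>P) = 0"
    and "N2 P S \<le> (\<Sum>j<m. ennreal (2 * c2 * (\<tau> (Suc j) - \<tau> j)) * N2 P (\<zeta> j))"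
    unfolding S_def U_def[abs_def] by blast+
qed

end

section \<open>Step processes on refined grids\<close>

definition grid :: "nat \<Rightarrow> (nat \<Rightarrow> real) \<Rightarrow> real \<Rightarrow> real \<Rightarrow> bool" where
  "grid M \<sigma> a b \<longleftrightarrow> \<sigma> 0 = a \<and> \<sigma> M = b \<and> (\<forall>j<M. \<sigma> j < \<sigma> (Suc j))"

lemma grid_strict_mono:
  assumes "grid M \<sigma> a b" "i < j" "j \<le> M"
  shows "\<sigma> i < \<sigma> j"
  using assms(2,3)
proof (induction j)
  case (Suc j)
  then have "\<sigma> j < \<sigma> (Suc j)" using assms(1) by (auto simp: grid_def)
  with Suc show ?case by (cases "i = j") auto
qed simp

lemma grid_mono:
  assumes "grid M \<sigma> a b" "i \<le> j" "j \<le> M"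
  shows "\<sigma> i \<le> \<sigma> j"
  using grid_strict_mono[OF assms(1), of i j] assms(2,3) by (cases "i = j") auto

lemma grid_bounds:
  assumes "grid M \<sigma> a b" "j \<le> M"
  shows "a \<le> \<sigma> j" "\<sigma> j \<le> b"
  using grid_mono[OF assms(1), of 0 j] grid_mono[OF assms(1), of j M] assms by (auto simp: grid_def)

lemma grid_exists:
  assumes "finite F" "a < b"
  obtains M \<sigma> where "grid M \<sigma> a b" "F \<inter> {a..b} \<subseteq> \<sigma> ` {..M}"
proof -
  define D where "D = insert a (insert b (F \<inter> {a..b}))"
  define \<sigma> where "\<sigma> = (!) (sorted_list_of_set D)"
  define M where "M = card D - 1"
  have fin: "finite D" and D: "a \<in> D" "b \<in> D" "D \<subseteq> {a..b}" using assms by (auto simp: D_def)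
  have cD: "card D = Suc M" using fin D(1) by (simp add: M_def) (metis Suc_pred card_gt_0_iff empty_iff)
  have \<sigma>: "\<sigma> ` {..M} = D"
  proof -
    have "\<sigma> ` {..<card D} = D"
      using fin by (metis \<sigma>_def atLeast_upt length_sorted_list_of_set map_nth set_map set_sorted_list_of_set)
    then show ?thesis by (simp add: cD lessThan_Suc_atMost)
  qed
  have mono: "\<sigma> i < \<sigma> j" if "i < j" "j \<le> M" for i j
    unfolding \<sigma>_def using sorted_wrt_nth_less[OF strict_sorted_list_of_set, of i j D] that cD by simp
  have "\<sigma> 0 = a"
  proof -
    obtain i where "i \<le> M" "\<sigma> i = a" using D(1) \<sigma> by force
    moreover have "\<sigma> 0 \<in> D" using \<sigma> by auto
    ultimately show ?thesis using mono[of 0 i] D(3) by (cases "i = 0") force+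
  qed
  moreover have "\<sigma> M = b"
  proof -
    obtain i where i: "i \<le> M" "\<sigma> i = b" using D(2) \<sigma> by force
    moreover have "\<sigma> M \<in> D" using \<sigma> by auto
    ultimately show ?thesis using mono[of i M] D(3) by (cases "i = M") force+
  qed
  ultimately have "grid M \<sigma> a b" unfolding grid_def using mono by auto
  with \<sigma> show thesis using that[of M \<sigma>] by (auto simp: D_def)
qed

lemma grid_cell:
  assumes "grid M \<sigma> a b" "a \<le> r" "r < b"
  obtains j where "j < M" "\<sigma> j \<le> r" "r < \<sigma> (Suc j)"
proof -
  define i where "i = (LEAST i. r < \<sigma> i)"
  have ex: "r < \<sigma> M" "\<not> r < \<sigma> 0" using assms by (simp_all add: grid_def)
  have i: "r < \<sigma> i" "i \<le> M"
    unfolding i_def by (rule LeastI[of "\<lambda>i. r < \<sigma> i", OF ex(1)], rule Least_le[of "\<lambda>i. r < \<sigma> i", OF ex(1)])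
  have "i \<noteq> 0" using i(1) ex(2) by metis
  then obtain j where j: "i = Suc j" by (cases i) auto
  then have "\<not> r < \<sigma> j" using not_less_Least[of j "\<lambda>i. r < \<sigma> i"] by (simp add: i_def)
  with i j show thesis by (intro that[of j]) auto
qed

lemma grid_step_value:
  assumes g: "grid M \<sigma> a b" and i: "i < M" "r \<in> {\<sigma> i..<\<sigma> (Suc i)}"
  shows "(\<Sum>j<M. x j * indicator {\<sigma> j..<\<sigma> (Suc j)} r) = (x i :: 'a :: comm_semiring_1)"
proof -
  have "indicator {\<sigma> j..<\<sigma> (Suc j)} r = (if j = i then 1 else 0 :: 'a)" if "j < M" for j
  proof -
    have "\<not> (\<sigma> j \<le> r \<and> r < \<sigma> (Suc j))" if ne: "j \<noteq> i"
    proof -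
      consider "Suc j \<le> i" | "Suc i \<le> j" using ne by linarith
      then show ?thesis
      proof cases
        case 1
        have "\<sigma> (Suc j) \<le> \<sigma> i" using 1 i(1) by (intro grid_mono[OF g]) auto
        with i show ?thesis by auto
      next
        case 2
        have "\<sigma> (Suc i) \<le> \<sigma> j" using 2 \<open>j < M\<close> by (intro grid_mono[OF g]) auto
        with i show ?thesis by auto
      qed
    qed
    then show ?thesis using i by (cases "j = i") (auto simp: indicator_def)
  qed
  then have "(\<Sum>j<M. x j * indicator {\<sigma> j..<\<sigma> (Suc j)} r) = (\<Sum>j<M. if j = i then x i else 0)"
    by (intro sum.cong) auto
  then show ?thesis using i(1) by simp
qed

lemma step_process_cell:
  assumes g: "grid N \<tau> 0 T" and r: "r \<in> {0..<T}"
  obtains k where "k < N" "\<tau> k \<le> r" "step_process N \<tau> \<zeta> r = \<zeta> k"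
proof -
  have "0 \<le> r" "r < T" using r by auto
  then obtain k where k: "k < N" "\<tau> k \<le> r" "r < \<tau> (Suc k)" by (rule grid_cell[OF g])
  have "step_process N \<tau> \<zeta> r \<omega> = \<zeta> k \<omega>" for \<omega>
    unfolding step_process_def by (rule grid_step_value[OF g k(1)]) (use k in simp)
  with k show thesis by (intro that[of k] ext) auto
qed

text \<open>\<open>step_on F A G J\<close>: the function \<open>G\<close> of time is constant between consecutive points of the finite
  set \<open>F\<close>, and \<open>J\<close> is its elementary integral against \<open>A\<close>, computed on any grid refining \<open>F\<close>. Stated
  for all grids at once, the notion is linear in \<open>(G, J)\<close> without any merging of grids.\<close>

definition step_on :: "real set \<Rightarrow> (real \<Rightarrow> path \<Rightarrow> real) \<Rightarrow> (real \<Rightarrow> path \<Rightarrow> real) \<Rightarrow>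
    (real \<Rightarrow> path \<Rightarrow> real) \<Rightarrow> bool" where
  "step_on F A G J \<longleftrightarrow> finite F \<and>
    (\<forall>M \<sigma> a b. grid M \<sigma> a b \<longrightarrow> F \<inter> {a..b} \<subseteq> \<sigma> ` {..M} \<longrightarrow>
      (\<forall>j<M. \<forall>r\<in>{\<sigma> j..<\<sigma> (Suc j)}. G r = G (\<sigma> j)) \<and>
      (\<forall>\<omega>. J b \<omega> - J a \<omega> = (\<Sum>j<M. G (\<sigma> j) \<omega> * (A (\<sigma> (Suc j)) \<omega> - A (\<sigma> j) \<omega>))))"

lemma step_on_diff:
  assumes "step_on F A G J" "step_on F' A G' J'"
  shows "step_on (F \<union> F') A (\<lambda>t \<omega>. G t \<omega> - G' t \<omega>) (\<lambda>t \<omega>. J t \<omega> - J' t \<omega>)"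
  unfolding step_on_def
proof (intro conjI allI impI ballI)
  show "finite (F \<union> F')" using assms by (simp add: step_on_def)
next
  fix M \<sigma> a b j r
  assume g: "grid M \<sigma> a b" "(F \<union> F') \<inter> {a..b} \<subseteq> \<sigma> ` {..M}" "j < M" "r \<in> {\<sigma> j..<\<sigma> (Suc j)}"
  then have "G r = G (\<sigma> j)" "G' r = G' (\<sigma> j)"
    using assms unfolding step_on_def by (meson Int_mono Un_upper1 Un_upper2 order_refl order_trans)+
  then show "(\<lambda>\<omega>. G r \<omega> - G' r \<omega>) = (\<lambda>\<omega>. G (\<sigma> j) \<omega> - G' (\<sigma> j) \<omega>)" by simp
next
  fix M \<sigma> a b \<omega>
  assume g: "grid M \<sigma> a b" "(F \<union> F') \<inter> {a..b} \<subseteq> \<sigma> ` {..M}"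
  then have "J b \<omega> - J a \<omega> = (\<Sum>j<M. G (\<sigma> j) \<omega> * (A (\<sigma> (Suc j)) \<omega> - A (\<sigma> j) \<omega>))"
    "J' b \<omega> - J' a \<omega> = (\<Sum>j<M. G' (\<sigma> j) \<omega> * (A (\<sigma> (Suc j)) \<omega> - A (\<sigma> j) \<omega>))"
    using assms unfolding step_on_def by (meson Int_mono Un_upper1 Un_upper2 order_refl order_trans)+
  then show "(J b \<omega> - J' b \<omega>) - (J a \<omega> - J' a \<omega>)
      = (\<Sum>j<M. (G (\<sigma> j) \<omega> - G' (\<sigma> j) \<omega>) * (A (\<sigma> (Suc j)) \<omega> - A (\<sigma> j) \<omega>))"
    by (simp add: left_diff_distrib sum_subtractf)
qed

text \<open>The increments of \<open>A\<close> over the cells to the left of \<open>v\<close> telescope, provided that \<open>v\<close> is a grid point or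
  outside the interval.\<close>

lemma grid_telescope:
  fixes A :: "real \<Rightarrow> real"
  assumes g: "grid M \<sigma> a b" and v: "v \<in> \<sigma> ` {..M} \<or> v \<le> a \<or> b \<le> v"
  shows "(\<Sum>j<M. of_bool (\<sigma> j < v) * (A (\<sigma> (Suc j)) - A (\<sigma> j))) = A (min v b) - A (min v a)"
proof -
  have all: "(\<Sum>j<i. A (\<sigma> (Suc j)) - A (\<sigma> j)) = A (\<sigma> i) - A a" for i
    using sum_lessThan_telescope[of "\<lambda>j. A (\<sigma> j)" i] g by (simp add: grid_def)
  have ab: "a \<le> b" using grid_bounds[OF g, of 0] by simp
  consider "v \<le> a" | "b \<le> v" | i where "i \<le> M" "v = \<sigma> i" using v by auto
  then show ?thesis
  proof cases
    case 1
    then have "of_bool (\<sigma> j < v) = (0::real)" if "j < M" for j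
      using grid_bounds(1)[OF g, of j] that by simp
    then show ?thesis using 1 ab by (simp add: min_absorb1)
  next
    case 2
    have "of_bool (\<sigma> j < v) = (1::real)" if "j < M" for j
      using grid_strict_mono[OF g, of j M] that 2 g by (simp add: grid_def)
    then have "(\<Sum>j<M. of_bool (\<sigma> j < v) * (A (\<sigma> (Suc j)) - A (\<sigma> j))) = (\<Sum>j<M. A (\<sigma> (Suc j)) - A (\<sigma> j))"
      by (intro sum.cong) auto
    then show ?thesis using all[of M] 2 ab g by (simp add: min_absorb2 grid_def)
  next
    case 3
    have "of_bool (\<sigma> j < v) = (if j < i then 1 else 0 :: real)" if "j < M" for j
      using grid_strict_mono[OF g, of j i] grid_mono[OF g, of i j] that 3 by (auto simp: not_less)
    then have "(\<Sum>j<M. of_bool (\<sigma> j < v) * (A (\<sigma> (Suc j)) - A (\<sigma> j)))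
        = (\<Sum>j<M. if j < i then A (\<sigma> (Suc j)) - A (\<sigma> j) else 0)"
      by (intro sum.cong) auto
    also have "\<dots> = (\<Sum>j<i. A (\<sigma> (Suc j)) - A (\<sigma> j))"
      using 3(1) by (intro sum.mono_neutral_cong_right) auto
    finally show ?thesis using all[of i] grid_bounds[OF g 3(1)] 3 by (simp add: min_absorb1 min_absorb2)
  qed
qed

text \<open>An indicator of a cell of the coarse grid is a difference of two indicators of half-lines, whose
  integrals on the fine grid telescope.\<close>

lemma step_process_step_on:
  assumes mono: "\<And>k. k < N \<Longrightarrow> \<tau> k \<le> \<tau> (Suc k)"
  shows "step_on (\<tau> ` {..N}) A (step_process N \<tau> \<xi>) (step_integral A N \<tau> \<xi>)"
  unfolding step_on_def
proof (intro conjI allI impI ballI)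
  fix M \<sigma> a b
  assume g: "grid M \<sigma> a b" and F: "\<tau> ` {..N} \<inter> {a..b} \<subseteq> \<sigma> ` {..M}"
  have pt: "\<tau> k \<in> \<sigma> ` {..M} \<or> \<tau> k \<le> a \<or> b \<le> \<tau> k" if "k \<le> N" for k
    using F that by (cases "a \<le> \<tau> k \<and> \<tau> k \<le> b") auto
  {
    fix j r assume j: "j < M" and r: "r \<in> {\<sigma> j..<\<sigma> (Suc j)}"
    have le: "\<tau> k \<le> r \<longleftrightarrow> \<tau> k \<le> \<sigma> j" if "k \<le> N" for k
    proof
      assume kr: "\<tau> k \<le> r"
      show "\<tau> k \<le> \<sigma> j"
      proof (cases "\<tau> k \<in> \<sigma> ` {..M}")
        case True
        then obtain i where i: "i \<le> M" "\<tau> k = \<sigma> i" by auto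
        then have "\<not> Suc j \<le> i" using grid_mono[OF g, of "Suc j" i] kr r by auto
        then show ?thesis using grid_mono[OF g, of i j] i j by simp
      next
        case False
        then have "\<tau> k \<le> a"
          using pt[OF that] kr r grid_bounds(2)[OF g, of "Suc j"] j by auto
        then show ?thesis using grid_bounds(1)[OF g, of j] j by simp
      qed
    qed (use r in auto)
    have "indicator {\<tau> k..<\<tau> (Suc k)} r = (indicator {\<tau> k..<\<tau> (Suc k)} (\<sigma> j) :: real)" if "k < N" for k
      using le[of k] le[of "Suc k"] that by (auto simp: indicator_def not_le[symmetric])
    then show "step_process N \<tau> \<xi> r = step_process N \<tau> \<xi> (\<sigma> j)"
      by (auto simp: step_process_def fun_eq_iff intro!: sum.cong)
  }
  fix \<omega>
  let ?A = "\<lambda>t. A t \<omega>"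
  let ?g = "\<lambda>v. \<Sum>j<M. of_bool (\<sigma> j < v) * (?A (\<sigma> (Suc j)) - ?A (\<sigma> j))"
  have ind: "indicator {u..<v} x = of_bool (x < v) - (of_bool (x < u) :: real)" if "u \<le> v" for u v x :: real
    using that by (auto simp: indicator_def)
  have "(\<Sum>j<M. step_process N \<tau> \<xi> (\<sigma> j) \<omega> * (?A (\<sigma> (Suc j)) - ?A (\<sigma> j)))
      = (\<Sum>j<M. \<Sum>k<N. \<xi> k \<omega> * (indicator {\<tau> k..<\<tau> (Suc k)} (\<sigma> j) * (?A (\<sigma> (Suc j)) - ?A (\<sigma> j))))"
    unfolding step_process_def sum_distrib_right by (simp only: mult_ac)
  also have "\<dots> = (\<Sum>k<N. \<Sum>j<M. \<xi> k \<omega> * (indicator {\<tau> k..<\<tau> (Suc k)} (\<sigma> j) * (?A (\<sigma> (Suc j)) - ?A (\<sigma> j))))"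
    by (rule sum.swap)
  also have "\<dots> = (\<Sum>k<N. \<xi> k \<omega> * (?g (\<tau> (Suc k)) - ?g (\<tau> k)))"
  proof (rule sum.cong[OF refl])
    fix k assume "k \<in> {..<N}"
    then show "(\<Sum>j<M. \<xi> k \<omega> * (indicator {\<tau> k..<\<tau> (Suc k)} (\<sigma> j) * (?A (\<sigma> (Suc j)) - ?A (\<sigma> j))))
        = \<xi> k \<omega> * (?g (\<tau> (Suc k)) - ?g (\<tau> k))"
      using mono[of k]
      by (simp add: ind sum_distrib_left[symmetric] left_diff_distrib sum_subtractf)
  qed
  also have "\<dots> = (\<Sum>k<N. \<xi> k \<omega> * (A (min (\<tau> (Suc k)) b) \<omega> - A (min (\<tau> k) b) \<omega>) -
      \<xi> k \<omega> * (A (min (\<tau> (Suc k)) a) \<omega> - A (min (\<tau> k) a) \<omega>))"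
  proof (rule sum.cong[OF refl])
    fix k assume "k \<in> {..<N}"
    then have k: "k \<le> N" "Suc k \<le> N" by auto
    show "\<xi> k \<omega> * (?g (\<tau> (Suc k)) - ?g (\<tau> k)) =
      \<xi> k \<omega> * (A (min (\<tau> (Suc k)) b) \<omega> - A (min (\<tau> k) b) \<omega>) -
      \<xi> k \<omega> * (A (min (\<tau> (Suc k)) a) \<omega> - A (min (\<tau> k) a) \<omega>)"
      unfolding grid_telescope[OF g pt[OF k(1)], of ?A] grid_telescope[OF g pt[OF k(2)], of ?A]
      by (simp add: algebra_simps)
  qed
  also have "\<dots> = step_integral A N \<tau> \<xi> b \<omega> - step_integral A N \<tau> \<xi> a \<omega>"
    by (simp add: step_integral_def sum_subtractf)
  finally show "step_integral A N \<tau> \<xi> b \<omega> - step_integral A N \<tau> \<xi> a \<omega> =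
    (\<Sum>j<M. step_process N \<tau> \<xi> (\<sigma> j) \<omega> * (A (\<sigma> (Suc j)) \<omega> - A (\<sigma> j) \<omega>))" by simp
qed simp

section \<open>Integrators and their approximating step processes\<close>

lemma ico_lebesgue [measurable]: "{a..<b :: real} \<in> sets lebesgue"
  by (rule sets_completionI_sets) simp

lemma cell_indicator_sum:
  fixes \<Phi> :: "real \<Rightarrow> 'a :: comm_semiring_1"
  assumes g: "grid M \<sigma> a b" and const: "\<And>j r. j < M \<Longrightarrow> r \<in> {\<sigma> j..<\<sigma> (Suc j)} \<Longrightarrow> \<Phi> r = \<Phi> (\<sigma> j)"
  shows "\<Phi> r * indicator {a..<b} r = (\<Sum>j<M. \<Phi> (\<sigma> j) * indicator {\<sigma> j..<\<sigma> (Suc j)} r)"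
proof (cases "a \<le> r \<and> r < b")
  case True
  then have r: "a \<le> r" "r < b" by auto
  obtain i where i: "i < M" "\<sigma> i \<le> r" "r < \<sigma> (Suc i)" by (rule grid_cell[OF g r])
  have "(\<Sum>j<M. \<Phi> (\<sigma> j) * indicator {\<sigma> j..<\<sigma> (Suc j)} r) = \<Phi> (\<sigma> i)"
    by (rule grid_step_value[OF g i(1)]) (use i in simp)
  also have "\<dots> = \<Phi> r" using const[of i r] i by simp
  finally show ?thesis using True by simp
next
  case False
  then have "indicator {\<sigma> j..<\<sigma> (Suc j)} r = (0 :: 'a)" if "j < M" for j
    using grid_bounds[OF g, of j] grid_bounds[OF g, of "Suc j"] that by (auto simp: indicator_def)
  then show ?thesis using False by simp
qed

text \<open>Right sides of isometries for elementary integrals become time integrals.\<close>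

lemma cell_nn_integral:
  assumes g: "grid M \<sigma> a b" and const: "\<And>j r. j < M \<Longrightarrow> r \<in> {\<sigma> j..<\<sigma> (Suc j)} \<Longrightarrow> \<Phi> r = \<Phi> (\<sigma> j)"
  shows "(\<integral>\<^sup>+r. \<Phi> r * indicator {a..<b} r \<partial>lebesgue) = (\<Sum>j<M. ennreal (\<sigma> (Suc j) - \<sigma> j) * \<Phi> (\<sigma> j))"
proof -
  have one: "\<Phi> r * indicator {a..<b} r = (\<Sum>j<M. \<Phi> (\<sigma> j) * indicator {\<sigma> j..<\<sigma> (Suc j)} r)" for r
    by (rule cell_indicator_sum[of M \<sigma> a b \<Phi>, OF g const])
  have "(\<integral>\<^sup>+r. \<Phi> r * indicator {a..<b} r \<partial>lebesgue)
      = (\<Sum>j<M. \<integral>\<^sup>+r. \<Phi> (\<sigma> j) * indicator {\<sigma> j..<\<sigma> (Suc j)} r \<partial>lebesgue)"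
    unfolding one by (rule nn_integral_sum) simp
  also have "\<dots> = (\<Sum>j<M. ennreal (\<sigma> (Suc j) - \<sigma> j) * \<Phi> (\<sigma> j))"
  proof (rule sum.cong[OF refl])
    fix j assume "j \<in> {..<M}"
    then have "\<sigma> j \<le> \<sigma> (Suc j)" using grid_mono[OF g, of j "Suc j"] by simp
    then show "(\<integral>\<^sup>+r. \<Phi> (\<sigma> j) * indicator {\<sigma> j..<\<sigma> (Suc j)} r \<partial>lebesgue)
        = ennreal (\<sigma> (Suc j) - \<sigma> j) * \<Phi> (\<sigma> j)"
      by (simp add: nn_integral_cmult_indicator mult.commute)
  qed
  finally show ?thesis .
qed

lemma step_on_gridE:
  assumes "step_on F A G J" and "a < b"
  obtains M \<sigma> where "grid M \<sigma> a b" "\<forall>j<M. \<forall>r\<in>{\<sigma> j..<\<sigma> (Suc j)}. G r = G (\<sigma> j)"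
    "\<forall>\<omega>. J b \<omega> - J a \<omega> = (\<Sum>j<M. G (\<sigma> j) \<omega> * (A (\<sigma> (Suc j)) \<omega> - A (\<sigma> j) \<omega>))"
proof -
  have fin: "finite F" using assms(1) by (simp add: step_on_def)
  obtain M \<sigma> where *: "grid M \<sigma> a b" "F \<inter> {a..b} \<subseteq> \<sigma> ` {..M}"
    by (rule grid_exists[OF fin assms(2)])
  then have "(\<forall>j<M. \<forall>r\<in>{\<sigma> j..<\<sigma> (Suc j)}. G r = G (\<sigma> j)) \<and>
      (\<forall>\<omega>. J b \<omega> - J a \<omega> = (\<Sum>j<M. G (\<sigma> j) \<omega> * (A (\<sigma> (Suc j)) \<omega> - A (\<sigma> j) \<omega>)))"
    using assms(1) unfolding step_on_def by blast
  then show thesis by (intro that[OF *(1)]) blast+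
qed

definition Lq :: "'a measure \<Rightarrow> real \<Rightarrow> ('a \<Rightarrow> real) \<Rightarrow> ennreal" where
  "Lq M q Z = (\<integral>\<^sup>+\<omega>. ennreal (\<bar>Z \<omega>\<bar> powr q) \<partial>M)"

lemma Lq_1: "Lq M 1 Z = (\<integral>\<^sup>+\<omega>. ennreal \<bar>Z \<omega>\<bar> \<partial>M)"
  by (simp add: Lq_def)

lemma Lq_2: "Lq M 2 Z = N2 M Z"
  by (simp add: Lq_def N2_def)

lemma Lq_cong_AE: "AE \<omega> in M. Z \<omega> = W \<omega> \<Longrightarrow> Lq M q Z = Lq M q W"
  unfolding Lq_def by (rule nn_integral_cong_AE) auto

lemma Lq_commute: "Lq M q (\<lambda>\<omega>. Z \<omega> - W \<omega>) = Lq M q (\<lambda>\<omega>. W \<omega> - Z \<omega>)"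
  by (simp add: Lq_def abs_minus_commute)

lemma Lq_le_add:
  assumes q: "q = 1 \<or> q = 2" and [measurable]: "Z \<in> borel_measurable M" "W \<in> borel_measurable M"
    and le: "AE \<omega> in M. \<bar>V \<omega>\<bar> \<le> \<bar>Z \<omega>\<bar> + \<bar>W \<omega>\<bar>"
  shows "Lq M q V \<le> 2 * Lq M q Z + 2 * Lq M q W"
  using q
proof
  assume q: "q = 1"
  have "Lq M q V \<le> (\<integral>\<^sup>+\<omega>. ennreal \<bar>Z \<omega>\<bar> + ennreal \<bar>W \<omega>\<bar> \<partial>M)"
    unfolding q Lq_1 using le by (intro nn_integral_mono_AE) (auto elim!: eventually_mono simp: ennreal_plus[symmetric] ennreal_leI simp del: ennreal_plus)
  also have "\<dots> = Lq M q Z + Lq M q W" unfolding q Lq_1 by (rule nn_integral_add) auto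
  also have "\<dots> \<le> 2 * Lq M q Z + 2 * Lq M q W"
    by (intro add_mono) (auto simp: mult_2)
  finally show ?thesis .
next
  assume q: "q = 2"
  have "N2 M V \<le> ennreal (1\<^sup>2) * N2 M (\<lambda>\<omega>. \<bar>Z \<omega>\<bar> + \<bar>W \<omega>\<bar>)"
    by (rule N2_le_scaled) (use le in auto)
  also have "\<dots> \<le> 2 * N2 M (\<lambda>\<omega>. \<bar>Z \<omega>\<bar>) + 2 * N2 M (\<lambda>\<omega>. \<bar>W \<omega>\<bar>)"
    using N2_add[of "\<lambda>\<omega>. \<bar>Z \<omega>\<bar>" M "\<lambda>\<omega>. \<bar>W \<omega>\<bar>"] by simp
  finally show ?thesis unfolding q Lq_2 by (simp add: N2_def)
qed

lemma Lq_triangle: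
  assumes "q = 1 \<or> q = 2" and [measurable]: "Z \<in> borel_measurable M" "W \<in> borel_measurable M" "Y \<in> borel_measurable M"
  shows "Lq M q (\<lambda>\<omega>. Z \<omega> - W \<omega>) \<le> 2 * Lq M q (\<lambda>\<omega>. Z \<omega> - Y \<omega>) + 2 * Lq M q (\<lambda>\<omega>. Y \<omega> - W \<omega>)"
  by (rule Lq_le_add[OF assms(1)]) auto

text \<open>Below the threshold \<open>z\<^sup>2 \<le> d\<close> the first term suffices; above it \<open>\<bar>z\<bar>\<^sup>p = z\<^sup>2 (z\<^sup>2)\<^bsup>p/2-1\<^esup>\<close> is at least
  \<open>z\<^sup>2 d\<^bsup>p/2-1\<^esup>\<close>. Compared with Jensen's inequality this avoids \<open>p\<close>-th roots of extended reals.\<close>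

lemma square_le_power:
  fixes z d p :: real
  assumes d: "0 < d" and p: "2 \<le> p"
  shows "z\<^sup>2 \<le> d + d powr (1 - p / 2) * \<bar>z\<bar> powr p"
proof (cases "z\<^sup>2 \<le> d")
  case True
  then show ?thesis by (smt (verit) mult_nonneg_nonneg powr_ge_zero)
next
  case False
  then have z: "d < z\<^sup>2" "z \<noteq> 0" using d by auto
  have "\<bar>z\<bar> powr p = (\<bar>z\<bar> powr 2) powr (p / 2)" unfolding powr_powr by simp
  also have "\<bar>z\<bar> powr 2 = z\<^sup>2" using z(2) by (simp add: powr_numeral)
  also have "(z\<^sup>2) powr (p / 2) = z\<^sup>2 * (z\<^sup>2) powr (p / 2 - 1)"
    using z(2) by (simp add: powr_diff)
  finally have eq: "\<bar>z\<bar> powr p = z\<^sup>2 * (z\<^sup>2) powr (p / 2 - 1)" .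
  have "d powr (p / 2 - 1) \<le> (z\<^sup>2) powr (p / 2 - 1)"
    using d z p by (intro powr_mono2) auto
  then have "d powr (1 - p / 2) * d powr (p / 2 - 1) \<le> d powr (1 - p / 2) * (z\<^sup>2) powr (p / 2 - 1)"
    by (rule mult_left_mono) simp
  moreover have "d powr (1 - p / 2) * d powr (p / 2 - 1) = 1"
    using d by (simp add: powr_add[symmetric])
  ultimately have "1 \<le> d powr (1 - p / 2) * (z\<^sup>2) powr (p / 2 - 1)" by simp
  then have "z\<^sup>2 * 1 \<le> z\<^sup>2 * (d powr (1 - p / 2) * (z\<^sup>2) powr (p / 2 - 1))"
    by (rule mult_left_mono) simp
  then show ?thesis using d unfolding eq by (simp add: mult_ac)
qed

context G_framework
begin

lemma qs_AE:
  assumes "P \<in> PG" "qs PG Q"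
  shows "AE \<omega> in P. Q \<omega>"
proof -
  obtain A where A: "A \<in> sets borel" "capacity PG A = 0" "\<And>\<omega>. \<omega> \<notin> A \<Longrightarrow> Q \<omega>"
    using assms(2) unfolding qs_def polar_def by blast
  have "emeasure P A \<le> capacity PG A" unfolding capacity_def by (rule SUP_upper[OF assms(1)])
  then have "A \<in> null_sets P" using A PG_props(2)[OF assms(1)] by (simp add: null_sets_def)
  then show ?thesis by (rule AE_I') (use A(3) in auto)
qed

lemma Lq_le_upper_moment: "P \<in> PG \<Longrightarrow> Lq P q Z \<le> upper_moment PG q Z"
  unfolding Lq_def upper_moment_def by (rule SUP_upper)

lemma qs_measurableE:
  assumes "qs_measurable PG X"
  obtains Y where "Y \<in> borel_measurable borel" "\<And>P. P \<in> PG \<Longrightarrow> AE \<omega> in P. X \<omega> = Y \<omega>"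
proof -
  obtain Y where Y: "Y \<in> borel_measurable borel" "qs PG (\<lambda>\<omega>. X \<omega> = Y \<omega>)"
    using assms unfolding qs_measurable_def by blast
  show thesis by (rule that[OF Y(1) qs_AE[OF _ Y(2)]])
qed

lemma M_G_tendsto_qs_measurable:
  assumes "M_G_tendsto PG q T H \<eta>"
  shows "AE r in lebesgue. r \<in> {0..T} \<longrightarrow> qs_measurable PG (\<eta> r)"
proof -
  have "AE r in lebesgue_on {0..T}. qs_measurable PG (\<eta> r)"
    using assms unfolding M_G_tendsto_def by blast
  then show ?thesis by (subst (asm) AE_restrict_space_iff) auto
qed

lemma upper_moment_tendsto_Lq:
  assumes "P \<in> PG" "(\<lambda>n. upper_moment PG q (Z n)) \<longlonglongrightarrow> 0"
  shows "(\<lambda>n. Lq P q (Z n)) \<longlonglongrightarrow> 0"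
  by (rule ennreal_tendsto_0_le[OF Lq_le_upper_moment[OF assms(1)] assms(2)])

end

context G_measure
begin

lemma borel_measurable_P: "X \<in> borel_measurable borel \<Longrightarrow> X \<in> borel_measurable P"
  using measurable_cong_sets[OF sets_P refl] by auto

lemma N2_le_Lq:
  assumes [measurable]: "Z \<in> borel_measurable P" and d: "0 < d" and p: "2 \<le> p"
  shows "N2 P Z \<le> ennreal d + ennreal (d powr (1 - p / 2)) * Lq P p Z"
proof -
  have "N2 P Z \<le> (\<integral>\<^sup>+\<omega>. ennreal d + ennreal (d powr (1 - p / 2)) * ennreal (\<bar>Z \<omega>\<bar> powr p) \<partial>P)"
    unfolding N2_def
  proof (rule nn_integral_mono)
    fix \<omega>
    have "ennreal ((Z \<omega>)\<^sup>2) \<le> ennreal (d + d powr (1 - p / 2) * \<bar>Z \<omega>\<bar> powr p)"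
      by (rule ennreal_leI[OF square_le_power[OF d p]])
    then show "ennreal ((Z \<omega>)\<^sup>2) \<le> ennreal d + ennreal (d powr (1 - p / 2)) * ennreal (\<bar>Z \<omega>\<bar> powr p)"
      using d by (simp add: ennreal_plus ennreal_mult)
  qed
  also have "\<dots> = ennreal d + ennreal (d powr (1 - p / 2)) * Lq P p Z"
    unfolding Lq_def by (simp add: nn_integral_add nn_integral_cmult emeasure_space_1[unfolded space_P])
  finally show ?thesis .
qed

lemma N2_small:
  assumes e: "0 < e" and p: "2 \<le> p"
  obtains d where "0 < d" "\<forall>Z\<in>borel_measurable P. Lq P p Z \<le> ennreal d \<longrightarrow> N2 P Z \<le> ennreal e"
proof
  define c where "c = (e / 2) powr (1 - p / 2)"
  have c: "0 < c" using e by (simp add: c_def)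
  show "0 < e / (2 * c)" using e c by simp
  show "\<forall>Z\<in>borel_measurable P. Lq P p Z \<le> ennreal (e / (2 * c)) \<longrightarrow> N2 P Z \<le> ennreal e"
  proof (intro ballI impI)
    fix Z assume Z: "Z \<in> borel_measurable P" and le: "Lq P p Z \<le> ennreal (e / (2 * c))"
    have "N2 P Z \<le> ennreal (e / 2) + ennreal c * Lq P p Z"
      using N2_le_Lq[OF Z _ p, of "e / 2"] e by (simp add: c_def)
    also have "\<dots> \<le> ennreal (e / 2) + ennreal c * ennreal (e / (2 * c))"
      by (intro add_left_mono mult_left_mono le) simp
    also have "ennreal c * ennreal (e / (2 * c)) = ennreal (e / 2)"
      using c e by (simp add: ennreal_mult'[symmetric])
    also have "ennreal (e / 2) + ennreal (e / 2) = ennreal e"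
      using e by (simp add: ennreal_plus[symmetric] del: ennreal_plus)
    finally show "N2 P Z \<le> ennreal e" .
  qed
qed

lemma HS_closed_eps:
  assumes Z: "Z \<in> borel_measurable P" and ap: "\<And>e. 0 < e \<Longrightarrow> \<exists>W\<in>HS P s. N2 P (\<lambda>\<omega>. Z \<omega> - W \<omega>) \<le> ennreal e"
  shows "Z \<in> HS P s"
proof -
  have "\<forall>n. \<exists>W\<in>HS P s. N2 P (\<lambda>\<omega>. Z \<omega> - W \<omega>) \<le> ennreal (1 / Suc n)" using ap by simp
  then obtain W where W: "\<And>n. W n \<in> HS P s" "\<And>n. N2 P (\<lambda>\<omega>. Z \<omega> - W n \<omega>) \<le> ennreal (1 / Suc n)"
    by metis
  have "(\<lambda>n. ennreal (1 / Suc n)) \<longlonglongrightarrow> ennreal 0"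
    by (intro tendsto_ennrealI LIMSEQ_Suc[OF lim_1_over_n])
  then have "(\<lambda>n. N2 P (\<lambda>\<omega>. Z \<omega> - W n \<omega>)) \<longlonglongrightarrow> 0"
    unfolding ennreal_0 by (rule ennreal_tendsto_0_le[OF W(2)])
  then show ?thesis by (rule HS_closed[OF Z W(1)])
qed

text \<open>Integrals against Brownian motion live on the exponent 2 and need the past; for those against
  Lipschitz integrators, with exponent 1, measurability suffices. A common notion allows one treatment
  of both, and of the processes in \<open>M_G\<close> with larger exponents.\<close>

definition adapted :: "real \<Rightarrow> real \<Rightarrow> (path \<Rightarrow> real) set" where
  "adapted q r = (if 2 \<le> q then HS P r else borel_measurable P)"

lemma adapted_measurable [measurable_dest]: "Z \<in> adapted q r \<Longrightarrow> Z \<in> borel_measurable P"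
  by (auto simp: adapted_def split: if_splits intro: HS_measurable)

lemma adapted_diff: "Z \<in> adapted q r \<Longrightarrow> W \<in> adapted q r \<Longrightarrow> (\<lambda>\<omega>. Z \<omega> - W \<omega>) \<in> adapted q r"
  by (auto simp: adapted_def HS_diff split: if_splits)

lemma adapted_mono: "Z \<in> adapted q r \<Longrightarrow> r \<le> s \<Longrightarrow> Z \<in> adapted q s"
  by (auto simp: adapted_def HS_monoD split: if_splits)

text \<open>What an integrator has to provide: continuity of the elementary integral with respect to the
  norm of the integrand, over every interval.\<close>

definition integrator :: "real \<Rightarrow> real \<Rightarrow> (real \<Rightarrow> path \<Rightarrow> real) \<Rightarrow> bool" where
  "integrator T q A \<longleftrightarrow> (q = 1 \<or> q = 2) \<and> (\<forall>t\<in>{0..T}. A t \<in> borel_measurable P) \<and>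
    (\<exists>c. \<forall>F G J a b. step_on F A G J \<longrightarrow> (\<forall>r\<in>{0..<T}. G r \<in> adapted q r) \<longrightarrow> 0 \<le> a \<longrightarrow> a < b \<longrightarrow> b \<le> T \<longrightarrow>
      Lq P q (\<lambda>\<omega>. J b \<omega> - J a \<omega>) \<le> ennreal c * (\<integral>\<^sup>+r. Lq P q (G r) * indicator {a..<b} r \<partial>lebesgue))"

text \<open>Multiplying by a bounded factor from the past turns one elementary integral into another, so the
  properties of discrete stochastic integrals apply to the product.\<close>

lemma elementary_integral_B:
  assumes st: "step_on F canon G J" and G: "\<And>r. r \<in> {0..<T} \<Longrightarrow> G r \<in> HS P r"
    and ab: "0 \<le> a" "a < b" "b \<le> T" and Z: "Z \<in> HS P a" "\<And>\<omega>. \<bar>Z \<omega>\<bar> \<le> R"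
  shows "(\<lambda>\<omega>. Z \<omega> * (J b \<omega> - J a \<omega>)) \<in> HS P b"
    and "(\<integral>\<omega>. Z \<omega> * (J b \<omega> - J a \<omega>) \<partial>P) = 0"
    and "N2 P (\<lambda>\<omega>. Z \<omega> * (J b \<omega> - J a \<omega>))
      \<le> ennreal (2 * c2) * (\<integral>\<^sup>+r. N2 P (\<lambda>\<omega>. Z \<omega> * G r \<omega>) * indicator {a..<b} r \<partial>lebesgue)"
proof -
  obtain M \<tau> where g: "grid M \<tau> a b" and cell: "\<forall>j<M. \<forall>r\<in>{\<tau> j..<\<tau> (Suc j)}. G r = G (\<tau> j)"
    and J: "\<forall>\<omega>. J b \<omega> - J a \<omega> = (\<Sum>j<M. G (\<tau> j) \<omega> * (canon (\<tau> (Suc j)) \<omega> - canon (\<tau> j) \<omega>))"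
    by (rule step_on_gridE[OF st ab(2)])
  note cell = cell[rule_format] and J = J[rule_format]
  have \<tau>: "\<tau> j < \<tau> (Suc j)" "a \<le> \<tau> j" "\<tau> j < T" if "j < M" for j
    using g that grid_bounds[OF g, of j] grid_bounds[OF g, of "Suc j"] ab unfolding grid_def by fastforce+
  have ZG: "(\<lambda>\<omega>. Z \<omega> * G (\<tau> j) \<omega>) \<in> HS P (\<tau> j)" if "j < M" for j
    using \<tau>[OF that] ab by (intro HS_mult_bounded[OF HS_monoD[OF Z(1)] G Z(2)]) auto
  have \<tau>0: "\<tau> 0 = a" "\<tau> M = b" using g by (auto simp: grid_def)
  have le: "\<tau> j \<le> \<tau> (Suc j)" if "j < M" for j using \<tau>[OF that] by simp
  have pos: "0 \<le> \<tau> 0" using \<tau>0 ab by simp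
  define \<zeta> where "\<zeta> j \<omega> = Z \<omega> * G (\<tau> j) \<omega>" for j \<omega>
  define S where "S \<omega> = (\<Sum>j<M. \<zeta> j \<omega> * (canon (\<tau> (Suc j)) \<omega> - canon (\<tau> j) \<omega>))" for \<omega>
  have \<zeta>: "\<zeta> j \<in> HS P (\<tau> j)" if "j < M" for j
    unfolding \<zeta>_def[abs_def] by (rule ZG[OF that])
  note S = stochastic_sum[of M \<tau> \<zeta>, OF le pos \<zeta>, folded S_def]
  have eq: "(\<lambda>\<omega>. Z \<omega> * (J b \<omega> - J a \<omega>)) = S"
    by (rule ext) (simp add: J S_def \<zeta>_def sum_distrib_left mult.assoc)
  show "(\<lambda>\<omega>. Z \<omega> * (J b \<omega> - J a \<omega>)) \<in> HS P b"
    unfolding eq using S(1) by (simp only: \<tau>0)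
  show "(\<integral>\<omega>. Z \<omega> * (J b \<omega> - J a \<omega>) \<partial>P) = 0"
    unfolding eq by (rule S(2))
  have "(\<integral>\<^sup>+r. N2 P (\<lambda>\<omega>. Z \<omega> * G r \<omega>) * indicator {a..<b} r \<partial>lebesgue)
      = (\<Sum>j<M. ennreal (\<tau> (Suc j) - \<tau> j) * N2 P (\<zeta> j))"
    unfolding \<zeta>_def by (rule cell_nn_integral[OF g]) (drule (1) cell, simp)
  moreover have "ennreal (2 * c2 * d) = ennreal (2 * c2) * ennreal d" for d
    by (rule ennreal_mult') simp
  ultimately have "(\<Sum>j<M. ennreal (2 * c2 * (\<tau> (Suc j) - \<tau> j)) * N2 P (\<zeta> j))
      = ennreal (2 * c2) * (\<integral>\<^sup>+r. N2 P (\<lambda>\<omega>. Z \<omega> * G r \<omega>) * indicator {a..<b} r \<partial>lebesgue)"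
    by (simp only: sum_distrib_left mult.assoc)
  then show "N2 P (\<lambda>\<omega>. Z \<omega> * (J b \<omega> - J a \<omega>))
      \<le> ennreal (2 * c2) * (\<integral>\<^sup>+r. N2 P (\<lambda>\<omega>. Z \<omega> * G r \<omega>) * indicator {a..<b} r \<partial>lebesgue)"
    using S(3) unfolding eq by (simp only:)
qed

lemma integrator_B: "integrator T 2 canon"
  unfolding integrator_def
proof (intro conjI ballI exI[of _ "2 * c2"] allI impI)
  fix F G J a b
  assume st: "step_on F canon G J" and G: "\<forall>r\<in>{0..<T}. G r \<in> adapted 2 r" and ab: "0 \<le> a" "a < b" "b \<le> T"
  have 1: "(\<lambda>_. 1) \<in> HS P a" by (rule HS_const[OF ab(1)])
  have "N2 P (\<lambda>\<omega>. 1 * (J b \<omega> - J a \<omega>))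
      \<le> ennreal (2 * c2) * (\<integral>\<^sup>+r. N2 P (\<lambda>\<omega>. 1 * G r \<omega>) * indicator {a..<b} r \<partial>lebesgue)"
    using G by (intro elementary_integral_B(3)[OF st _ ab 1, of 1]) (auto simp: adapted_def)
  then show "Lq P 2 (\<lambda>\<omega>. J b \<omega> - J a \<omega>)
      \<le> ennreal (2 * c2) * (\<integral>\<^sup>+r. Lq P 2 (G r) * indicator {a..<b} r \<partial>lebesgue)"
    by (simp add: Lq_2)
qed simp_all

lemma elementary_integral_Lipschitz:
  assumes st: "step_on F A G J" and ab: "0 \<le> a" "a < b" "b \<le> T"
    and A: "\<And>s t. 0 \<le> s \<Longrightarrow> s \<le> t \<Longrightarrow> t \<le> T \<Longrightarrow> \<bar>A t \<omega> - A s \<omega>\<bar> \<le> c * (t - s)"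
  shows "ennreal \<bar>J b \<omega> - J a \<omega>\<bar> \<le> ennreal c * (\<integral>\<^sup>+r. ennreal \<bar>G r \<omega>\<bar> * indicator {a..<b} r \<partial>lebesgue)"
proof -
  obtain M \<tau> where g: "grid M \<tau> a b" and cell: "\<forall>j<M. \<forall>r\<in>{\<tau> j..<\<tau> (Suc j)}. G r = G (\<tau> j)"
    and J: "\<forall>\<omega>. J b \<omega> - J a \<omega> = (\<Sum>j<M. G (\<tau> j) \<omega> * (A (\<tau> (Suc j)) \<omega> - A (\<tau> j) \<omega>))"
    by (rule step_on_gridE[OF st ab(2)])
  note cell = cell[rule_format] and J = J[rule_format]
  have "\<bar>A b \<omega> - A a \<omega>\<bar> \<le> c * (b - a)" using A[of a b] ab by simp
  then have c: "0 \<le> c" using ab by (smt (verit) mult_neg_pos)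
  have le: "\<tau> j \<le> \<tau> (Suc j)" if "j < M" for j using g that by (auto simp: grid_def less_imp_le)
  have "\<bar>J b \<omega> - J a \<omega>\<bar> \<le> (\<Sum>j<M. \<bar>G (\<tau> j) \<omega>\<bar> * (c * (\<tau> (Suc j) - \<tau> j)))"
    unfolding J
  proof (rule order_trans[OF sum_abs sum_mono])
    fix j assume "j \<in> {..<M}"
    then have "\<bar>A (\<tau> (Suc j)) \<omega> - A (\<tau> j) \<omega>\<bar> \<le> c * (\<tau> (Suc j) - \<tau> j)"
      using grid_bounds[OF g, of j] grid_bounds[OF g, of "Suc j"] ab le[of j] by (intro A) auto
    then show "\<bar>G (\<tau> j) \<omega> * (A (\<tau> (Suc j)) \<omega> - A (\<tau> j) \<omega>)\<bar> \<le> \<bar>G (\<tau> j) \<omega>\<bar> * (c * (\<tau> (Suc j) - \<tau> j))"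
      unfolding abs_mult by (rule mult_left_mono) simp
  qed
  then have "ennreal \<bar>J b \<omega> - J a \<omega>\<bar> \<le> ennreal (\<Sum>j<M. \<bar>G (\<tau> j) \<omega>\<bar> * (c * (\<tau> (Suc j) - \<tau> j)))"
    by (rule ennreal_leI)
  also have "\<dots> = (\<Sum>j<M. ennreal (\<bar>G (\<tau> j) \<omega>\<bar> * (c * (\<tau> (Suc j) - \<tau> j))))"
    using c le by (intro sum_ennreal[symmetric]) auto
  also have "\<dots> = (\<Sum>j<M. ennreal c * (ennreal (\<tau> (Suc j) - \<tau> j) * ennreal \<bar>G (\<tau> j) \<omega>\<bar>))"
    using c le by (intro sum.cong refl) (simp add: ennreal_mult'[symmetric] ennreal_mult''[symmetric] mult_ac)
  also have "\<dots> = ennreal c * (\<integral>\<^sup>+r. ennreal \<bar>G r \<omega>\<bar> * indicator {a..<b} r \<partial>lebesgue)"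
    unfolding sum_distrib_left[symmetric]
    by (subst cell_nn_integral[OF g], drule (1) cell, simp, simp)
  finally show ?thesis .
qed

lemma integrator_Lipschitz:
  assumes A: "AE \<omega> in P. \<forall>s t. 0 \<le> s \<longrightarrow> s \<le> t \<longrightarrow> t \<le> T \<longrightarrow> \<bar>A t \<omega> - A s \<omega>\<bar> \<le> c * (t - s)"
    and meas: "\<And>t. t \<in> {0..T} \<Longrightarrow> A t \<in> borel_measurable P"
  shows "integrator T 1 A"
  unfolding integrator_def
proof (intro conjI ballI exI[of _ c] allI impI)
  fix F G J a b
  assume st: "step_on F A G J" and G: "\<forall>r\<in>{0..<T}. G r \<in> adapted 1 r" and ab: "0 \<le> a" "a < b" "b \<le> T"
  obtain M \<tau> where g: "grid M \<tau> a b" and cell: "\<forall>j<M. \<forall>r\<in>{\<tau> j..<\<tau> (Suc j)}. G r = G (\<tau> j)"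
    by (rule step_on_gridE[OF st ab(2)])
  note cell = cell[rule_format]
  have \<tau>: "\<tau> j \<in> {0..<T}" if "j < M" for j
    using grid_bounds[OF g, of j] grid_strict_mono[OF g, of j M] g that ab by (auto simp: grid_def)
  note [measurable] = adapted_measurable[OF G[rule_format, OF \<tau>]]
  have "Lq P 1 (\<lambda>\<omega>. J b \<omega> - J a \<omega>)
      \<le> (\<integral>\<^sup>+\<omega>. ennreal c * (\<Sum>j<M. ennreal (\<tau> (Suc j) - \<tau> j) * ennreal \<bar>G (\<tau> j) \<omega>\<bar>) \<partial>P)"
    unfolding Lq_1
  proof (rule nn_integral_mono_AE, rule eventually_mono[OF A])
    fix \<omega> assume "\<forall>s t. 0 \<le> s \<longrightarrow> s \<le> t \<longrightarrow> t \<le> T \<longrightarrow> \<bar>A t \<omega> - A s \<omega>\<bar> \<le> c * (t - s)"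
    then have "ennreal \<bar>J b \<omega> - J a \<omega>\<bar> \<le> ennreal c * (\<integral>\<^sup>+r. ennreal \<bar>G r \<omega>\<bar> * indicator {a..<b} r \<partial>lebesgue)"
      by (intro elementary_integral_Lipschitz[OF st ab]) auto
    also have "(\<integral>\<^sup>+r. ennreal \<bar>G r \<omega>\<bar> * indicator {a..<b} r \<partial>lebesgue)
        = (\<Sum>j<M. ennreal (\<tau> (Suc j) - \<tau> j) * ennreal \<bar>G (\<tau> j) \<omega>\<bar>)"
      by (rule cell_nn_integral[OF g]) (drule (1) cell, simp)
    finally show "ennreal \<bar>J b \<omega> - J a \<omega>\<bar> \<le> ennreal c * (\<Sum>j<M. ennreal (\<tau> (Suc j) - \<tau> j) * ennreal \<bar>G (\<tau> j) \<omega>\<bar>)" .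
  qed
  also have "\<dots> = ennreal c * (\<Sum>j<M. ennreal (\<tau> (Suc j) - \<tau> j) * Lq P 1 (G (\<tau> j)))"
  proof -
    have m: "(\<lambda>\<omega>. ennreal (\<tau> (Suc j) - \<tau> j) * ennreal \<bar>G (\<tau> j) \<omega>\<bar>) \<in> borel_measurable P" if "j \<in> {..<M}" for j
      using that by simp
    have "(\<integral>\<^sup>+\<omega>. (\<Sum>j<M. ennreal (\<tau> (Suc j) - \<tau> j) * ennreal \<bar>G (\<tau> j) \<omega>\<bar>) \<partial>P)
        = (\<Sum>j<M. ennreal (\<tau> (Suc j) - \<tau> j) * Lq P 1 (G (\<tau> j)))"
      by (subst nn_integral_sum) (use m in \<open>auto simp: Lq_1 intro!: sum.cong nn_integral_cmult\<close>)
    moreover have "(\<lambda>\<omega>. \<Sum>j<M. ennreal (\<tau> (Suc j) - \<tau> j) * ennreal \<bar>G (\<tau> j) \<omega>\<bar>) \<in> borel_measurable P"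
      by (intro borel_measurable_sum m)
    ultimately show ?thesis by (simp add: nn_integral_cmult)
  qed
  also have "(\<Sum>j<M. ennreal (\<tau> (Suc j) - \<tau> j) * Lq P 1 (G (\<tau> j))) = (\<integral>\<^sup>+r. Lq P 1 (G r) * indicator {a..<b} r \<partial>lebesgue)"
    by (rule cell_nn_integral[OF g, symmetric]) (drule (1) cell, simp)
  finally show "Lq P 1 (\<lambda>\<omega>. J b \<omega> - J a \<omega>) \<le> ennreal c * (\<integral>\<^sup>+r. Lq P 1 (G r) * indicator {a..<b} r \<partial>lebesgue)" .
qed (use meas in simp_all)

text \<open>Approximations of \<open>\<eta>\<close> by adapted step processes \<open>G n\<close> with elementary integrals \<open>J n\<close>. The bounds
  \<open>e n\<close> come from the upper expectation and do not depend on the measure.\<close>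

definition approx :: "real \<Rightarrow> real \<Rightarrow> (real \<Rightarrow> path \<Rightarrow> real) \<Rightarrow> (nat \<Rightarrow> real \<Rightarrow> path \<Rightarrow> real) \<Rightarrow>
    (nat \<Rightarrow> real \<Rightarrow> path \<Rightarrow> real) \<Rightarrow> (nat \<Rightarrow> real \<Rightarrow> ennreal) \<Rightarrow> bool" where
  "approx T q A G J e \<longleftrightarrow>
     (\<forall>n. \<exists>F. step_on F A (G n) (J n)) \<and> (\<forall>n. \<forall>r\<in>{0..<T}. G n r \<in> adapted q r) \<and>
     (\<forall>n \<omega>. J n 0 \<omega> = 0) \<and> (\<forall>n. \<forall>t\<in>{0..T}. J n t \<in> borel_measurable P) \<and>
     (\<forall>n. e n \<in> borel_measurable lebesgue) \<and> (\<lambda>n. \<integral>\<^sup>+r. e n r \<partial>lebesgue) \<longlonglongrightarrow> 0"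

definition AE_measurable :: "(path \<Rightarrow> real) \<Rightarrow> bool" where
  "AE_measurable X \<longleftrightarrow> (\<exists>Y\<in>borel_measurable P. AE \<omega> in P. X \<omega> = Y \<omega>)"

lemma qs_measurable_AE: "qs_measurable PG X \<Longrightarrow> AE_measurable X"
  unfolding AE_measurable_def
  by (erule qs_measurableE) (blast intro: borel_measurable_P P_in)

text \<open>Convergence of \<open>q\<close>-th upper moments implies \<open>L\<^sup>2\<close>-convergence under \<open>P\<close> when \<open>q \<ge> 2\<close>.\<close>

lemma L_G_version:
  assumes \<xi>: "\<xi> \<in> L_G PG q s"
  shows "\<exists>\<zeta>\<in>adapted q s. AE \<omega> in P. \<xi> \<omega> = \<zeta> \<omega>"
proof -
  obtain Y where Y: "\<And>n. Y n \<in> L_ip s" "(\<lambda>n. upper_moment PG q (\<lambda>\<omega>. Y n \<omega> - \<xi> \<omega>)) \<longlonglongrightarrow> 0"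
    and m: "qs_measurable PG \<xi>"
    using \<xi> unfolding L_G_def by blast
  obtain \<zeta> where \<zeta>: "\<zeta> \<in> borel_measurable P" "AE \<omega> in P. \<xi> \<omega> = \<zeta> \<omega>"
    using qs_measurable_AE[OF m] unfolding AE_measurable_def by blast
  have lim: "(\<lambda>n. Lq P q (\<lambda>\<omega>. \<zeta> \<omega> - Y n \<omega>)) \<longlonglongrightarrow> 0"
  proof -
    have "Lq P q (\<lambda>\<omega>. Y n \<omega> - \<xi> \<omega>) = Lq P q (\<lambda>\<omega>. \<zeta> \<omega> - Y n \<omega>)" for n
      unfolding Lq_commute[of P q \<zeta>] by (rule Lq_cong_AE) (use \<zeta>(2) in auto)
    then show ?thesis using upper_moment_tendsto_Lq[OF P_in Y(2)] by simp
  qed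
  have "\<zeta> \<in> HS P s" if p: "2 \<le> q"
  proof (rule HS_closed_eps[OF \<zeta>(1)])
    fix e :: real assume e: "0 < e"
    obtain d where d: "0 < d" "\<forall>Z\<in>borel_measurable P. Lq P q Z \<le> ennreal d \<longrightarrow> N2 P Z \<le> ennreal e"
      by (rule N2_small[OF e p])
    have "0 < ennreal d" using d(1) by simp
    then obtain n where n: "Lq P q (\<lambda>\<omega>. \<zeta> \<omega> - Y n \<omega>) < ennreal d"
      using eventually_happens'[OF sequentially_bot order_tendstoD(2)[OF lim]] by blast
    have "(\<lambda>\<omega>. \<zeta> \<omega> - Y n \<omega>) \<in> borel_measurable P" using \<zeta>(1) L_ip_measurable[OF Y(1)] by simp
    then have "N2 P (\<lambda>\<omega>. \<zeta> \<omega> - Y n \<omega>) \<le> ennreal e" using d(2) n by (simp add: less_imp_le)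
    then show "\<exists>W\<in>HS P s. N2 P (\<lambda>\<omega>. \<zeta> \<omega> - W \<omega>) \<le> ennreal e" using L_ip_HS[OF Y(1)] by blast
  qed
  then have "\<zeta> \<in> adapted q s" using \<zeta>(1) by (simp add: adapted_def)
  with \<zeta>(2) show ?thesis by blast
qed

text \<open>The values of the approximating step processes are replaced by adapted versions, and the error of
  the approximation by a bound that is measurable in time.\<close>

lemma M_G_tendsto_approx:
  assumes sd: "\<And>n. step_data PG q T (N n) (\<tau> n) (\<xi> n)"
    and Mt: "M_G_tendsto PG q T (\<lambda>n. step_process (N n) (\<tau> n) (\<xi> n)) \<eta>" and T: "0 < T"
  obtains \<zeta> e where "\<forall>n. \<forall>k<N n. \<zeta> n k \<in> adapted q (\<tau> n k)" "\<forall>n. AE \<omega> in P. \<forall>k<N n. \<xi> n k \<omega> = \<zeta> n k \<omega>"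
    "\<forall>n. e n \<in> borel_measurable lebesgue" "(\<lambda>n. \<integral>\<^sup>+r. e n r \<partial>lebesgue) \<longlonglongrightarrow> 0"
    "\<forall>n. \<forall>r\<in>{0..<T}. Lq P q (\<lambda>\<omega>. step_process (N n) (\<tau> n) (\<zeta> n) r \<omega> - \<eta> r \<omega>) \<le> e n r"
proof -
  have "\<forall>n k. \<exists>\<zeta>. k < N n \<longrightarrow> \<zeta> \<in> adapted q (\<tau> n k) \<and> (AE \<omega> in P. \<xi> n k \<omega> = \<zeta> \<omega>)"
    using sd L_G_version unfolding step_data_def by blast
  then obtain \<zeta> where \<zeta>: "\<And>n k. k < N n \<Longrightarrow> \<zeta> n k \<in> adapted q (\<tau> n k)"
      "\<And>n k. k < N n \<Longrightarrow> AE \<omega> in P. \<xi> n k \<omega> = \<zeta> n k \<omega>"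
    by metis
  have AE\<zeta>: "AE \<omega> in P. \<forall>k<N n. \<xi> n k \<omega> = \<zeta> n k \<omega>" for n
    using \<zeta>(2) by (simp add: AE_all_countable)
  let ?err = "\<lambda>n r. upper_moment PG q (\<lambda>\<omega>. step_process (N n) (\<tau> n) (\<xi> n) r \<omega> - \<eta> r \<omega>)"
  define e where "e n r = ?err n r * indicator {0..T} r" for n r
  have "e n \<in> borel_measurable lebesgue" for n
  proof -
    have "?err n \<in> borel_measurable (lebesgue_on {0..T})"
      using Mt unfolding M_G_tendsto_def by blast
    then show ?thesis
      unfolding e_def[abs_def] by (subst (asm) borel_measurable_restrict_space_iff_ennreal) auto
  qed
  moreover have "(\<lambda>n. \<integral>\<^sup>+r. e n r \<partial>lebesgue) \<longlonglongrightarrow> 0"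
  proof -
    have eq: "(\<integral>\<^sup>+r. e n r \<partial>lebesgue) = ennreal T * (ennreal (1 / T) * (\<integral>\<^sup>+r. ?err n r \<partial>lebesgue_on {0..T}))" for n
      unfolding e_def using T
      by (simp add: nn_integral_restrict_space mult.assoc[symmetric] ennreal_mult'[symmetric])
    have lim: "(\<lambda>n. ennreal (1 / T) * (\<integral>\<^sup>+r. ?err n r \<partial>lebesgue_on {0..T})) \<longlonglongrightarrow> 0"
      using Mt unfolding M_G_tendsto_def by blast
    show ?thesis by (rule ennreal_tendsto_0_scaled[OF eq_refl[OF eq] lim]) simp
  qed
  moreover have "Lq P q (\<lambda>\<omega>. step_process (N n) (\<tau> n) (\<zeta> n) r \<omega> - \<eta> r \<omega>) \<le> e n r" if r: "r \<in> {0..<T}" for n r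
  proof -
    have "AE \<omega> in P. step_process (N n) (\<tau> n) (\<zeta> n) r \<omega> - \<eta> r \<omega> = step_process (N n) (\<tau> n) (\<xi> n) r \<omega> - \<eta> r \<omega>"
      using AE\<zeta>[of n] by eventually_elim (simp add: step_process_def)
    then have "Lq P q (\<lambda>\<omega>. step_process (N n) (\<tau> n) (\<zeta> n) r \<omega> - \<eta> r \<omega>) = Lq P q (\<lambda>\<omega>. step_process (N n) (\<tau> n) (\<xi> n) r \<omega> - \<eta> r \<omega>)"
      by (rule Lq_cong_AE)
    also have "\<dots> \<le> e n r" unfolding e_def using r Lq_le_upper_moment[OF P_in] by simp
    finally show ?thesis .
  qed
  ultimately show thesis using \<zeta>(1) AE\<zeta> by (intro that[of \<zeta> e]) auto
qed

text \<open>Under \<open>P\<close> the integrator may be replaced by a version that agrees with it almost surely.\<close>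

lemma has_G_integral_approx:
  assumes int: "has_G_integral PG q T A \<eta> t Y" and A': "integrator T q A'"
    and AA': "AE \<omega> in P. \<forall>t\<in>{0..T}. A t \<omega> = A' t \<omega>" and t: "t \<in> {0..T}" and T: "0 < T"
  obtains G J e where "approx T q A' G J e"
    "\<forall>n. \<forall>r\<in>{0..<T}. Lq P q (\<lambda>\<omega>. G n r \<omega> - \<eta> r \<omega>) \<le> e n r"
    "(\<lambda>n. Lq P q (\<lambda>\<omega>. J n t \<omega> - Y \<omega>)) \<longlonglongrightarrow> 0"
proof -
  obtain N \<tau> \<xi> where sd: "\<And>n. step_data PG q T (N n) (\<tau> n) (\<xi> n)"
    and Mt: "M_G_tendsto PG q T (\<lambda>n. step_process (N n) (\<tau> n) (\<xi> n)) \<eta>"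
    and Y: "(\<lambda>n. upper_moment PG q (\<lambda>\<omega>. step_integral A (N n) (\<tau> n) (\<xi> n) t \<omega> - Y \<omega>)) \<longlonglongrightarrow> 0"
    using int unfolding has_G_integral_def by blast
  have grid: "grid (N n) (\<tau> n) 0 T" for n
    using sd[of n] by (simp add: step_data_def grid_def)
  have \<tau>: "0 \<le> \<tau> n k" "\<tau> n k \<le> T" if "k \<le> N n" for n k using grid_bounds[OF grid that] by auto
  obtain \<zeta> e where \<zeta>: "\<forall>n. \<forall>k<N n. \<zeta> n k \<in> adapted q (\<tau> n k)"
    and AE\<zeta>: "\<forall>n. AE \<omega> in P. \<forall>k<N n. \<xi> n k \<omega> = \<zeta> n k \<omega>"
    and e: "\<forall>n. e n \<in> borel_measurable lebesgue" "(\<lambda>n. \<integral>\<^sup>+r. e n r \<partial>lebesgue) \<longlonglongrightarrow> 0"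
    and err: "\<forall>n. \<forall>r\<in>{0..<T}. Lq P q (\<lambda>\<omega>. step_process (N n) (\<tau> n) (\<zeta> n) r \<omega> - \<eta> r \<omega>) \<le> e n r"
    by (rule M_G_tendsto_approx[OF sd Mt T])
  define G where "G n = step_process (N n) (\<tau> n) (\<zeta> n)" for n
  define J where "J n = step_integral A' (N n) (\<tau> n) (\<zeta> n)" for n
  have A'm: "A' t \<in> borel_measurable P" if "t \<in> {0..T}" for t
    using A' that by (simp add: integrator_def)
  show thesis
  proof (rule that[of G J e])
    show "approx T q A' G J e"
      unfolding approx_def
    proof (intro conjI allI ballI)
      fix n
      show "\<exists>F. step_on F A' (G n) (J n)"
        unfolding G_def J_def
        by (rule exI, rule step_process_step_on) (rule grid_mono[OF grid], auto)
      show "J n 0 \<omega> = 0" for \<omega>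
        unfolding J_def step_integral_def by (rule sum.neutral) (use \<tau> in \<open>simp add: min_absorb2\<close>)
      show "J n t \<in> borel_measurable P" if "t \<in> {0..T}" for t
      proof -
        have "min (\<tau> n k) t \<in> {0..T}" if "k \<le> N n" for k
          using \<tau>[OF that] \<open>t \<in> {0..T}\<close> by auto
        note [measurable] = A'm[OF this] adapted_measurable[OF \<zeta>[rule_format]]
        show ?thesis unfolding J_def step_integral_def[abs_def] by measurable
      qed
      show "G n r \<in> adapted q r" if r: "r \<in> {0..<T}" for r
      proof -
        obtain k where "k < N n" "\<tau> n k \<le> r" "G n r = \<zeta> n k"
          unfolding G_def by (rule step_process_cell[OF grid r])
        then show ?thesis using adapted_mono[of "\<zeta> n k" q "\<tau> n k" r] \<zeta> by simp
      qed
    qed (use e in auto)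
  next
    show "\<forall>n. \<forall>r\<in>{0..<T}. Lq P q (\<lambda>\<omega>. G n r \<omega> - \<eta> r \<omega>) \<le> e n r" using err unfolding G_def .
  next
    have "AE \<omega> in P. J n t \<omega> - Y \<omega> = step_integral A (N n) (\<tau> n) (\<xi> n) t \<omega> - Y \<omega>" for n
      using AE\<zeta>[rule_format, of n] AA'
    proof eventually_elim
      case (elim \<omega>)
      have "min (\<tau> n k) t \<in> {0..T}" if "k \<le> N n" for k
        using \<tau>[OF that] t by auto
      then have "A (min (\<tau> n k) t) \<omega> = A' (min (\<tau> n k) t) \<omega>" if "k \<le> N n" for k
        using elim(2) that by blast
      then show ?case
        using elim(1) unfolding J_def step_integral_def by (intro arg_cong2[of _ _ _ _ "(-)"] sum.cong refl) auto
    qed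
    then have "Lq P q (\<lambda>\<omega>. J n t \<omega> - Y \<omega>) = Lq P q (\<lambda>\<omega>. step_integral A (N n) (\<tau> n) (\<xi> n) t \<omega> - Y \<omega>)" for n
      by (rule Lq_cong_AE)
    then show "(\<lambda>n. Lq P q (\<lambda>\<omega>. J n t \<omega> - Y \<omega>)) \<longlonglongrightarrow> 0"
      using upper_moment_tendsto_Lq[OF P_in Y] by simp
  qed
qed

definition AE_time_measurable :: "real \<Rightarrow> (real \<Rightarrow> path \<Rightarrow> real) \<Rightarrow> bool" where
  "AE_time_measurable T \<eta> \<longleftrightarrow> (AE r in lebesgue. r \<in> {0..T} \<longrightarrow> AE_measurable (\<eta> r))"

lemma has_G_integral_AE_time_measurable:
  assumes "has_G_integral PG q T A \<eta> t Y"
  shows "AE_time_measurable T \<eta>"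
proof -
  obtain H where "M_G_tendsto PG q T H \<eta>" using assms unfolding has_G_integral_def by blast
  then show ?thesis
    unfolding AE_time_measurable_def
    by (intro eventually_mono[OF M_G_tendsto_qs_measurable]) (auto intro: qs_measurable_AE)
qed

lemma AE_measurable_diff: "AE_measurable X \<Longrightarrow> Y \<in> borel_measurable P \<Longrightarrow> AE_measurable (\<lambda>\<omega>. Y \<omega> - X \<omega>)"
  unfolding AE_measurable_def by (erule bexE, rule_tac x = "\<lambda>\<omega>. Y \<omega> - Ya \<omega>" in bexI) auto

lemma Lq_le_add_AE_measurable:
  assumes q: "q = 1 \<or> q = 2" and Z: "AE_measurable Z" and W: "AE_measurable W"
    and le: "AE \<omega> in P. \<bar>V \<omega>\<bar> \<le> \<bar>Z \<omega>\<bar> + \<bar>W \<omega>\<bar>"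
  shows "Lq P q V \<le> 2 * Lq P q Z + 2 * Lq P q W"
proof -
  obtain Z' where Z': "Z' \<in> borel_measurable P" "AE \<omega> in P. Z \<omega> = Z' \<omega>"
    using Z unfolding AE_measurable_def by blast
  obtain W' where W': "W' \<in> borel_measurable P" "AE \<omega> in P. W \<omega> = W' \<omega>"
    using W unfolding AE_measurable_def by blast
  have "AE \<omega> in P. \<bar>V \<omega>\<bar> \<le> \<bar>Z' \<omega>\<bar> + \<bar>W' \<omega>\<bar>"
    using le Z'(2) W'(2) by eventually_elim simp
  then show ?thesis
    unfolding Lq_cong_AE[OF Z'(2)] Lq_cong_AE[OF W'(2)] by (rule Lq_le_add[OF q Z'(1) W'(1)])
qed

text \<open>Two approximations of the same integrand have the same limit at every time. Hence one
  sequence of step processes computes the integral at all times simultaneously.\<close>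

lemma approx_same_limit:
  assumes A: "integrator T q A" and ap: "approx T q A G J e" "approx T q A G' J' e'"
    and e: "\<And>n r. r \<in> {0..<T} \<Longrightarrow> Lq P q (\<lambda>\<omega>. G n r \<omega> - \<eta> r \<omega>) \<le> e n r"
    and e': "\<And>n r. r \<in> {0..<T} \<Longrightarrow> Lq P q (\<lambda>\<omega>. G' n r \<omega> - \<eta> r \<omega>) \<le> e' n r"
    and \<eta>: "AE_time_measurable T \<eta>" and t: "t \<in> {0..T}"
  shows "(\<lambda>n. Lq P q (\<lambda>\<omega>. J n t \<omega> - J' n t \<omega>)) \<longlonglongrightarrow> 0"
proof (cases "t = 0")
  case True
  then show ?thesis using ap by (simp add: approx_def Lq_def)
next
  case False
  have q: "q = 1 \<or> q = 2" using A by (simp add: integrator_def)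
  obtain c where c: "\<And>F G J a b. step_on F A G J \<Longrightarrow> \<forall>r\<in>{0..<T}. G r \<in> adapted q r \<Longrightarrow> 0 \<le> a \<Longrightarrow> a < b \<Longrightarrow> b \<le> T \<Longrightarrow>
      Lq P q (\<lambda>\<omega>. J b \<omega> - J a \<omega>) \<le> ennreal c * (\<integral>\<^sup>+r. Lq P q (G r) * indicator {a..<b} r \<partial>lebesgue)"
    using A unfolding integrator_def by blast
  have em [measurable]: "e n \<in> borel_measurable lebesgue" "e' n \<in> borel_measurable lebesgue" for n
    using ap by (auto simp: approx_def)
  have G: "G n r \<in> adapted q r" "G' n r \<in> adapted q r" if "r \<in> {0..<T}" for n r
    using ap that by (auto simp: approx_def)
  have "Lq P q (\<lambda>\<omega>. J n t \<omega> - J' n t \<omega>)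
      \<le> ennreal (2 * c) * (\<integral>\<^sup>+r. e n r \<partial>lebesgue) + ennreal (2 * c) * (\<integral>\<^sup>+r. e' n r \<partial>lebesgue)" for n
  proof -
    obtain F F' where "step_on F A (G n) (J n)" "step_on F' A (G' n) (J' n)"
      using ap unfolding approx_def by blast
    from step_on_diff[OF this]
    have "Lq P q (\<lambda>\<omega>. (J n t \<omega> - J' n t \<omega>) - (J n 0 \<omega> - J' n 0 \<omega>))
        \<le> ennreal c * (\<integral>\<^sup>+r. Lq P q (\<lambda>\<omega>. G n r \<omega> - G' n r \<omega>) * indicator {0..<t} r \<partial>lebesgue)"
      by (rule c) (use False t G in \<open>auto intro: adapted_diff\<close>)
    moreover have "J n 0 \<omega> = 0" "J' n 0 \<omega> = 0" for \<omega> using ap by (auto simp: approx_def)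
    moreover have "(\<integral>\<^sup>+r. Lq P q (\<lambda>\<omega>. G n r \<omega> - G' n r \<omega>) * indicator {0..<t} r \<partial>lebesgue)
        \<le> (\<integral>\<^sup>+r. 2 * e n r + 2 * e' n r \<partial>lebesgue)"
    proof (rule nn_integral_mono_AE, rule eventually_mono[OF \<eta>[unfolded AE_time_measurable_def]])
      fix r assume m: "r \<in> {0..T} \<longrightarrow> AE_measurable (\<eta> r)"
      show "Lq P q (\<lambda>\<omega>. G n r \<omega> - G' n r \<omega>) * indicator {0..<t} r \<le> 2 * e n r + 2 * e' n r"
      proof (cases "r \<in> {0..<t}")
        case True
        then have r: "r \<in> {0..<T}" using t by auto
        have "Lq P q (\<lambda>\<omega>. G n r \<omega> - G' n r \<omega>)
            \<le> 2 * Lq P q (\<lambda>\<omega>. G n r \<omega> - \<eta> r \<omega>) + 2 * Lq P q (\<lambda>\<omega>. G' n r \<omega> - \<eta> r \<omega>)"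
          by (rule Lq_le_add_AE_measurable[OF q])
            (use m r G[OF r] in \<open>auto intro!: AE_measurable_diff adapted_measurable\<close>)
        also have "\<dots> \<le> 2 * e n r + 2 * e' n r"
          by (intro add_mono mult_left_mono e e' r) auto
        finally show ?thesis using True by simp
      qed simp
    qed
    ultimately have "Lq P q (\<lambda>\<omega>. J n t \<omega> - J' n t \<omega>) \<le> ennreal c * (\<integral>\<^sup>+r. 2 * e n r + 2 * e' n r \<partial>lebesgue)"
      by (auto elim!: order_trans intro!: mult_left_mono)
    also have "\<dots> = ennreal (2 * c) * (\<integral>\<^sup>+r. e n r \<partial>lebesgue) + ennreal (2 * c) * (\<integral>\<^sup>+r. e' n r \<partial>lebesgue)"
      unfolding ennreal_mult'[of 2, simplified]
      by (simp add: nn_integral_add nn_integral_cmult distrib_left mult_ac)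
    finally show ?thesis .
  qed
  then show ?thesis
    by (rule ennreal_tendsto_0_le2) (use ap in \<open>simp_all add: approx_def\<close>)
qed

lemma integral_process_approx:
  assumes int: "\<And>t. t \<in> {0..T} \<Longrightarrow> has_G_integral PG q T A \<eta> t (I t)" and A': "integrator T q A'"
    and AA': "AE \<omega> in P. \<forall>t\<in>{0..T}. A t \<omega> = A' t \<omega>" and T: "0 < T"
    and I': "\<And>t. t \<in> {0..T} \<Longrightarrow> I' t \<in> borel_measurable P" "\<And>t. t \<in> {0..T} \<Longrightarrow> AE \<omega> in P. I t \<omega> = I' t \<omega>"
  obtains G J e where "approx T q A' G J e"
    "\<forall>n. \<forall>r\<in>{0..<T}. Lq P q (\<lambda>\<omega>. G n r \<omega> - \<eta> r \<omega>) \<le> e n r"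
    "\<forall>t\<in>{0..T}. (\<lambda>n. Lq P q (\<lambda>\<omega>. J n t \<omega> - I' t \<omega>)) \<longlonglongrightarrow> 0"
proof -
  have T': "T \<in> {0..T}" using T by simp
  have q: "q = 1 \<or> q = 2" using A' by (simp add: integrator_def)
  obtain G J e where ap: "approx T q A' G J e"
    and e: "\<forall>n. \<forall>r\<in>{0..<T}. Lq P q (\<lambda>\<omega>. G n r \<omega> - \<eta> r \<omega>) \<le> e n r"
    by (rule has_G_integral_approx[OF int[OF T'] A' AA' T' T])
  note \<eta> = has_G_integral_AE_time_measurable[OF int[OF T']]
  have "(\<lambda>n. Lq P q (\<lambda>\<omega>. J n t \<omega> - I' t \<omega>)) \<longlonglongrightarrow> 0" if t: "t \<in> {0..T}" for t
  proof -
    obtain G' J' e' where ap': "approx T q A' G' J' e'"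
      and e': "\<forall>n. \<forall>r\<in>{0..<T}. Lq P q (\<lambda>\<omega>. G' n r \<omega> - \<eta> r \<omega>) \<le> e' n r"
      and lim: "(\<lambda>n. Lq P q (\<lambda>\<omega>. J' n t \<omega> - I t \<omega>)) \<longlonglongrightarrow> 0"
      by (rule has_G_integral_approx[OF int[OF t] A' AA' t T])
    have "Lq P q (\<lambda>\<omega>. J' n t \<omega> - I t \<omega>) = Lq P q (\<lambda>\<omega>. J' n t \<omega> - I' t \<omega>)" for n
      by (rule Lq_cong_AE) (use I'(2)[OF t] in auto)
    with lim have lim: "(\<lambda>n. Lq P q (\<lambda>\<omega>. J' n t \<omega> - I' t \<omega>)) \<longlonglongrightarrow> 0" by simp
    have "Lq P q (\<lambda>\<omega>. J n t \<omega> - I' t \<omega>)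
        \<le> 2 * Lq P q (\<lambda>\<omega>. J n t \<omega> - J' n t \<omega>) + 2 * Lq P q (\<lambda>\<omega>. J' n t \<omega> - I' t \<omega>)" for n
      by (rule Lq_triangle[OF q]) (use ap ap' t I'(1) in \<open>auto simp: approx_def\<close>)
    then show ?thesis
      by (rule ennreal_tendsto_0_le2[OF _ approx_same_limit[OF A' ap ap' e[rule_format] e'[rule_format] \<eta> t] lim]) simp_all
  qed
  then show thesis by (intro that[OF ap e] ballI)
qed

text \<open>\<open>N\<close> is an integral of some integrand dominated by \<open>C \<bar>D\<bar>\<close>. The domination is imposed on the approximating step
  processes, up to an error that vanishes in norm: nothing is known about the joint measurability of
  the integrand itself.\<close>

definition dominated_integral :: "real \<Rightarrow> real \<Rightarrow> (real \<Rightarrow> path \<Rightarrow> real) \<Rightarrow> real \<Rightarrow>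
    (real \<Rightarrow> path \<Rightarrow> real) \<Rightarrow> (real \<Rightarrow> path \<Rightarrow> real) \<Rightarrow> bool" where
  "dominated_integral T q A C D N \<longleftrightarrow> (\<exists>G J e. approx T q A G J e \<and>
     (\<forall>n. AE r in lebesgue. r \<in> {0..<T} \<longrightarrow> Lq P q (\<lambda>\<omega>. max 0 (\<bar>G n r \<omega>\<bar> - C * \<bar>D r \<omega>\<bar>)) \<le> e n r) \<and>
     (\<forall>t\<in>{0..T}. (\<lambda>n. Lq P q (\<lambda>\<omega>. J n t \<omega> - N t \<omega>)) \<longlonglongrightarrow> 0))"

text \<open>On the approximations, \<open>\<bar>G - G'\<bar>\<close> exceeds \<open>C \<bar>D\<bar>\<close> by at most \<open>\<bar>G - \<eta>\<bar> + \<bar>G' - \<eta>'\<bar>\<close>, which is small in norm.\<close>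

lemma approx_difference:
  assumes A: "integrator T q A" and ap: "approx T q A G J e" "approx T q A G' J' e'"
    and e: "\<forall>n. \<forall>r\<in>{0..<T}. Lq P q (\<lambda>\<omega>. G n r \<omega> - \<eta> r \<omega>) \<le> e n r"
    and e': "\<forall>n. \<forall>r\<in>{0..<T}. Lq P q (\<lambda>\<omega>. G' n r \<omega> - \<eta>' r \<omega>) \<le> e' n r"
    and lim: "\<forall>t\<in>{0..T}. (\<lambda>n. Lq P q (\<lambda>\<omega>. J n t \<omega> - I t \<omega>)) \<longlonglongrightarrow> 0"
    and lim': "\<forall>t\<in>{0..T}. (\<lambda>n. Lq P q (\<lambda>\<omega>. J' n t \<omega> - I' t \<omega>)) \<longlonglongrightarrow> 0"
    and \<eta>: "AE_time_measurable T \<eta>" "AE_time_measurable T \<eta>'"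
    and I: "\<And>t. t \<in> {0..T} \<Longrightarrow> I t \<in> borel_measurable P" "\<And>t. t \<in> {0..T} \<Longrightarrow> I' t \<in> borel_measurable P"
    and dom: "\<And>r. r \<in> {0..T} \<Longrightarrow> AE \<omega> in P. \<bar>\<eta> r \<omega> - \<eta>' r \<omega>\<bar> \<le> C * \<bar>D r \<omega>\<bar>"
  shows "dominated_integral T q A C D (\<lambda>t \<omega>. I t \<omega> - I' t \<omega>)"
proof -
  have q: "q = 1 \<or> q = 2" using A by (simp add: integrator_def)
  have em [measurable]: "e n \<in> borel_measurable lebesgue" "e' n \<in> borel_measurable lebesgue" for n
    using ap by (auto simp: approx_def)
  have G: "G n r \<in> adapted q r" "G' n r \<in> adapted q r" if "r \<in> {0..<T}" for n r
    using ap that by (auto simp: approx_def)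
  have Jm: "J n t \<in> borel_measurable P" "J' n t \<in> borel_measurable P" if "t \<in> {0..T}" for n t
    using ap that by (auto simp: approx_def)
  let ?G = "\<lambda>n r \<omega>. G n r \<omega> - G' n r \<omega>" and ?J = "\<lambda>n t \<omega>. J n t \<omega> - J' n t \<omega>"
  let ?e = "\<lambda>n r. 2 * e n r + 2 * e' n r"
  have "approx T q A ?G ?J ?e"
    unfolding approx_def
  proof (intro conjI allI ballI)
    fix n
    obtain F F' where "step_on F A (G n) (J n)" "step_on F' A (G' n) (J' n)"
      using ap unfolding approx_def by blast
    from step_on_diff[OF this] show "\<exists>F. step_on F A (?G n) (?J n)" by (rule exI)
    show "?G n r \<in> adapted q r" if "r \<in> {0..<T}" for r using G[OF that] by (rule adapted_diff)
    show "?J n 0 \<omega> = 0" for \<omega> using ap by (simp add: approx_def)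
    show "?J n t \<in> borel_measurable P" if "t \<in> {0..T}" for t using Jm[OF that] by simp
    show "?e n \<in> borel_measurable lebesgue" by simp
  next
    have eq: "(\<integral>\<^sup>+r. ?e n r \<partial>lebesgue) = 2 * (\<integral>\<^sup>+r. e n r \<partial>lebesgue) + 2 * (\<integral>\<^sup>+r. e' n r \<partial>lebesgue)" for n
      by (simp add: nn_integral_add nn_integral_cmult)
    show "(\<lambda>n. \<integral>\<^sup>+r. ?e n r \<partial>lebesgue) \<longlonglongrightarrow> 0"
      by (rule ennreal_tendsto_0_le2[OF eq_refl[OF eq]]) (use ap in \<open>simp_all add: approx_def\<close>)
  qed
  moreover have "AE r in lebesgue. r \<in> {0..<T} \<longrightarrow>
      Lq P q (\<lambda>\<omega>. max 0 (\<bar>?G n r \<omega>\<bar> - C * \<bar>D r \<omega>\<bar>)) \<le> ?e n r" for n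
    using \<eta>[unfolded AE_time_measurable_def]
  proof eventually_elim
    case (elim r)
    show ?case
    proof
      assume r: "r \<in> {0..<T}"
      have "AE \<omega> in P. \<bar>max 0 (\<bar>?G n r \<omega>\<bar> - C * \<bar>D r \<omega>\<bar>)\<bar> \<le> \<bar>G n r \<omega> - \<eta> r \<omega>\<bar> + \<bar>G' n r \<omega> - \<eta>' r \<omega>\<bar>"
        using dom[of r] r by (auto elim!: eventually_mono)
      then have "Lq P q (\<lambda>\<omega>. max 0 (\<bar>?G n r \<omega>\<bar> - C * \<bar>D r \<omega>\<bar>))
          \<le> 2 * Lq P q (\<lambda>\<omega>. G n r \<omega> - \<eta> r \<omega>) + 2 * Lq P q (\<lambda>\<omega>. G' n r \<omega> - \<eta>' r \<omega>)"
        by (intro Lq_le_add_AE_measurable[OF q])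
          (use elim r G[OF r] in \<open>auto intro!: AE_measurable_diff adapted_measurable\<close>)
      also have "\<dots> \<le> ?e n r" using e e' r by (intro add_mono mult_left_mono) auto
      finally show "Lq P q (\<lambda>\<omega>. max 0 (\<bar>?G n r \<omega>\<bar> - C * \<bar>D r \<omega>\<bar>)) \<le> ?e n r" .
    qed
  qed
  moreover have "(\<lambda>n. Lq P q (\<lambda>\<omega>. ?J n t \<omega> - (I t \<omega> - I' t \<omega>))) \<longlonglongrightarrow> 0" if t: "t \<in> {0..T}" for t
  proof (rule ennreal_tendsto_0_le2[OF _ lim[rule_format, OF t] lim'[rule_format, OF t]])
    show "Lq P q (\<lambda>\<omega>. ?J n t \<omega> - (I t \<omega> - I' t \<omega>))
        \<le> 2 * Lq P q (\<lambda>\<omega>. J n t \<omega> - I t \<omega>) + 2 * Lq P q (\<lambda>\<omega>. J' n t \<omega> - I' t \<omega>)" for n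
      by (rule Lq_le_add[OF q]) (use Jm[OF t] I[OF t] in auto)
  qed simp_all
  ultimately show ?thesis
    unfolding dominated_integral_def
    by (intro exI[of _ ?G] exI[of _ ?J] exI[of _ ?e] conjI) blast+
qed

text \<open>Each statement is proved for the approximating elementary integrals and passed to the limit. The
  constant is \<open>2 * c2\<close> from the elementary isometry, times 2 for separating \<open>C D\<close> from the excess of the
  approximation, times 2 for the distance between \<open>N\<close> and its approximation.\<close>

lemma dominated_integral_B:
  assumes N: "dominated_integral T 2 canon C D N"
    and Nm: "\<And>t. t \<in> {0..T} \<Longrightarrow> N t \<in> borel_measurable P"
    and D [measurable]: "(\<lambda>(r, \<omega>). D r \<omega>) \<in> borel_measurable (borel \<Otimes>\<^sub>M P)"
    and ab: "0 \<le> a" "a < b" "b \<le> T" and Z: "Z \<in> HS P a" "\<And>\<omega>. \<bar>Z \<omega>\<bar> \<le> R"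
  shows "N2 P (\<lambda>\<omega>. N b \<omega> - N a \<omega>) < \<infinity>"
    and "(\<integral>\<omega>. Z \<omega> * (N b \<omega> - N a \<omega>) \<partial>P) = 0"
    and "N2 P (\<lambda>\<omega>. Z \<omega> * (N b \<omega> - N a \<omega>))
      \<le> ennreal (8 * c2 * C\<^sup>2) * (\<integral>\<^sup>+r. N2 P (\<lambda>\<omega>. Z \<omega> * D r \<omega>) * indicator {a..<b} r \<partial>lebesgue)"
proof -
  obtain G J e where ap: "approx T 2 canon G J e"
    and ex: "\<And>n. AE r in lebesgue. r \<in> {0..<T} \<longrightarrow> Lq P 2 (\<lambda>\<omega>. max 0 (\<bar>G n r \<omega>\<bar> - C * \<bar>D r \<omega>\<bar>)) \<le> e n r"
    and lim: "\<And>t. t \<in> {0..T} \<Longrightarrow> (\<lambda>n. Lq P 2 (\<lambda>\<omega>. J n t \<omega> - N t \<omega>)) \<longlonglongrightarrow> 0"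
    using N unfolding dominated_integral_def by auto
  have mem: "a \<in> {0..T}" "b \<in> {0..T}" using ab by auto
  have em [measurable]: "e n \<in> borel_measurable lebesgue" for n using ap by (auto simp: approx_def)
  have G: "G n r \<in> HS P r" if "r \<in> {0..<T}" for n r
    using ap that by (auto simp: approx_def adapted_def)
  have [measurable]: "J n a \<in> borel_measurable P" "J n b \<in> borel_measurable P" for n
    using ap mem by (auto simp: approx_def)
  note [measurable] = Nm[OF mem(1)] Nm[OF mem(2)] HS_measurable[OF Z(1)]
  define DJ where "DJ n \<omega> = J n b \<omega> - J n a \<omega>" for n \<omega>
  define DN where "DN \<omega> = N b \<omega> - N a \<omega>" for \<omega>
  have [measurable]: "DJ n \<in> borel_measurable P" "DN \<in> borel_measurable P" for n
    by (simp_all add: DJ_def[abs_def] DN_def[abs_def])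
  have Dr [measurable]: "D r \<in> borel_measurable P" for r
    using measurable_Pair2[OF D, of r] by simp
  have DN_lim: "(\<lambda>n. N2 P (\<lambda>\<omega>. DN \<omega> - DJ n \<omega>)) \<longlonglongrightarrow> 0"
  proof (rule ennreal_tendsto_0_le2[OF _ lim[OF mem(1)] lim[OF mem(2)]])
    show "N2 P (\<lambda>\<omega>. DN \<omega> - DJ n \<omega>) \<le> 2 * Lq P 2 (\<lambda>\<omega>. J n a \<omega> - N a \<omega>) + 2 * Lq P 2 (\<lambda>\<omega>. J n b \<omega> - N b \<omega>)" for n
      unfolding Lq_2[symmetric] by (rule Lq_le_add) (auto simp: DN_def DJ_def)
  qed simp_all
  have R: "0 \<le> R" using order_trans[OF abs_ge_zero Z(2)] .
  have Zfin: "N2 P Z < \<infinity>" by (rule HS_N2[OF Z(1)])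
  have one: "(\<lambda>_. 1) \<in> HS P a" by (rule HS_const[OF ab(1)])
  have st: "\<exists>F. step_on F canon (G n) (J n)" for n using ap by (simp add: approx_def)
  have DJ2: "N2 P (DJ n) < \<infinity>" for n
  proof -
    obtain F where "step_on F canon (G n) (J n)" using st by blast
    from HS_N2[OF elementary_integral_B(1)[OF this G ab one, of 1]]
    show ?thesis by (simp add: DJ_def[abs_def])
  qed
  have DNfin: "N2 P DN < \<infinity>"
    by (rule N2_finite_limit[OF _ _ DJ2 DN_lim]) simp_all
  then show "N2 P (\<lambda>\<omega>. N b \<omega> - N a \<omega>) < \<infinity>" by (simp add: DN_def[abs_def])
  have "(\<lambda>n. \<integral>\<omega>. DJ n \<omega> * Z \<omega> \<partial>P) \<longlonglongrightarrow> (\<integral>\<omega>. DN \<omega> * Z \<omega> \<partial>P)"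
    by (rule integral_mult_tendsto_N2[OF _ _ _ DJ2 Zfin DN_lim]) simp_all
  moreover have "(\<integral>\<omega>. DJ n \<omega> * Z \<omega> \<partial>P) = 0" for n
  proof -
    obtain F where F: "step_on F canon (G n) (J n)" using st by blast
    have "(\<integral>\<omega>. Z \<omega> * (J n b \<omega> - J n a \<omega>) \<partial>P) = 0"
      by (rule elementary_integral_B(2)[OF F G ab Z]) auto
    then show ?thesis by (simp add: DJ_def mult.commute)
  qed
  ultimately have "(\<integral>\<omega>. DN \<omega> * Z \<omega> \<partial>P) = 0" by (simp add: LIMSEQ_const_iff)
  then show "(\<integral>\<omega>. Z \<omega> * (N b \<omega> - N a \<omega>) \<partial>P) = 0" by (simp add: DN_def mult.commute)
  define Q where "Q = (\<integral>\<^sup>+r. N2 P (\<lambda>\<omega>. Z \<omega> * D r \<omega>) * indicator {a..<b} r \<partial>lebesgue)"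
  have Qm: "(\<lambda>r. N2 P (\<lambda>\<omega>. Z \<omega> * D r \<omega>) * indicator {a..<b} r) \<in> borel_measurable lebesgue"
    unfolding N2_def by (rule measurable_completion) measurable
  have "N2 P (\<lambda>\<omega>. Z \<omega> * DN \<omega>) \<le> ennreal (8 * c2 * C\<^sup>2) * Q +
      (ennreal (8 * c2 * R\<^sup>2) * (\<integral>\<^sup>+r. e n r \<partial>lebesgue) + ennreal (2 * R\<^sup>2) * N2 P (\<lambda>\<omega>. DN \<omega> - DJ n \<omega>))" for n
  proof -
    obtain F where F: "step_on F canon (G n) (J n)" using st by blast
    define X where "X r \<omega> = max 0 (\<bar>G n r \<omega>\<bar> - C * \<bar>D r \<omega>\<bar>)" for r \<omega>
    have "(\<integral>\<^sup>+r. N2 P (\<lambda>\<omega>. Z \<omega> * G n r \<omega>) * indicator {a..<b} r \<partial>lebesgue)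
      \<le> (\<integral>\<^sup>+r. ennreal (2 * C\<^sup>2) * (N2 P (\<lambda>\<omega>. Z \<omega> * D r \<omega>) * indicator {a..<b} r) + ennreal (2 * R\<^sup>2) * e n r \<partial>lebesgue)"
    proof (rule nn_integral_mono_AE, rule eventually_mono[OF ex[of n]])
      fix r assume e: "r \<in> {0..<T} \<longrightarrow> Lq P 2 (\<lambda>\<omega>. max 0 (\<bar>G n r \<omega>\<bar> - C * \<bar>D r \<omega>\<bar>)) \<le> e n r"
      show "N2 P (\<lambda>\<omega>. Z \<omega> * G n r \<omega>) * indicator {a..<b} r
        \<le> ennreal (2 * C\<^sup>2) * (N2 P (\<lambda>\<omega>. Z \<omega> * D r \<omega>) * indicator {a..<b} r) + ennreal (2 * R\<^sup>2) * e n r"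
      proof (cases "r \<in> {a..<b}")
        case True
        then have r: "r \<in> {0..<T}" using ab by auto
        note [measurable] = HS_measurable[OF G[OF r]]
        have X [measurable]: "X r \<in> borel_measurable P" unfolding X_def[abs_def] by measurable
        have "N2 P (\<lambda>\<omega>. Z \<omega> * G n r \<omega>) \<le> 2 * Lq P 2 (\<lambda>\<omega>. C * (Z \<omega> * D r \<omega>)) + 2 * Lq P 2 (\<lambda>\<omega>. Z \<omega> * X r \<omega>)"
          unfolding Lq_2[symmetric]
        proof (rule Lq_le_add)
          show "AE \<omega> in P. \<bar>Z \<omega> * G n r \<omega>\<bar> \<le> \<bar>C * (Z \<omega> * D r \<omega>)\<bar> + \<bar>Z \<omega> * X r \<omega>\<bar>"
          proof (rule AE_I2)
            fix \<omega>
            have "\<bar>G n r \<omega>\<bar> \<le> \<bar>C\<bar> * \<bar>D r \<omega>\<bar> + X r \<omega>"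
              using mult_right_mono[OF abs_ge_self[of C], of "\<bar>D r \<omega>\<bar>"] unfolding X_def by linarith
            then have "\<bar>Z \<omega>\<bar> * \<bar>G n r \<omega>\<bar> \<le> \<bar>Z \<omega>\<bar> * (\<bar>C\<bar> * \<bar>D r \<omega>\<bar> + X r \<omega>)"
              by (rule mult_left_mono) simp
            moreover have "\<bar>X r \<omega>\<bar> = X r \<omega>" by (simp add: X_def)
            ultimately show "\<bar>Z \<omega> * G n r \<omega>\<bar> \<le> \<bar>C * (Z \<omega> * D r \<omega>)\<bar> + \<bar>Z \<omega> * X r \<omega>\<bar>"
              by (simp add: abs_mult algebra_simps)
          qed
        qed simp_all
        also have "\<dots> \<le> 2 * (ennreal (C\<^sup>2) * N2 P (\<lambda>\<omega>. Z \<omega> * D r \<omega>)) + 2 * (ennreal (R\<^sup>2) * N2 P (X r))"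
          unfolding Lq_2
          by (intro add_mono mult_left_mono N2_le_scaled[where R = "\<bar>C\<bar>", simplified] N2_le_scaled)
            (auto simp: abs_mult intro!: AE_I2 mult_right_mono Z(2))
        also have "\<dots> \<le> 2 * (ennreal (C\<^sup>2) * N2 P (\<lambda>\<omega>. Z \<omega> * D r \<omega>)) + 2 * (ennreal (R\<^sup>2) * e n r)"
          using e r unfolding X_def Lq_2 by (intro add_mono mult_left_mono) auto
        finally show ?thesis
          using True by (simp add: ennreal_mult'[of 2, simplified] mult.assoc)
      qed simp
    qed
    also have "\<dots> = ennreal (2 * C\<^sup>2) * Q + ennreal (2 * R\<^sup>2) * (\<integral>\<^sup>+r. e n r \<partial>lebesgue)"
      unfolding Q_def using Qm by (simp add: nn_integral_add nn_integral_cmult)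
    finally have 1: "(\<integral>\<^sup>+r. N2 P (\<lambda>\<omega>. Z \<omega> * G n r \<omega>) * indicator {a..<b} r \<partial>lebesgue)
      \<le> ennreal (2 * C\<^sup>2) * Q + ennreal (2 * R\<^sup>2) * (\<integral>\<^sup>+r. e n r \<partial>lebesgue)" .
    have "N2 P (\<lambda>\<omega>. Z \<omega> * DJ n \<omega>) \<le> ennreal (2 * c2) * (\<integral>\<^sup>+r. N2 P (\<lambda>\<omega>. Z \<omega> * G n r \<omega>) * indicator {a..<b} r \<partial>lebesgue)"
      unfolding DJ_def by (rule elementary_integral_B(3)[OF F G ab Z]) auto
    also have "\<dots> \<le> ennreal (2 * c2) * (ennreal (2 * C\<^sup>2) * Q + ennreal (2 * R\<^sup>2) * (\<integral>\<^sup>+r. e n r \<partial>lebesgue))"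
      by (rule mult_left_mono[OF 1]) simp
    finally have 2: "N2 P (\<lambda>\<omega>. Z \<omega> * DJ n \<omega>) \<le> \<dots>" .
    have "N2 P (\<lambda>\<omega>. Z \<omega> * DN \<omega>) \<le> 2 * Lq P 2 (\<lambda>\<omega>. Z \<omega> * DJ n \<omega>) + 2 * Lq P 2 (\<lambda>\<omega>. Z \<omega> * (DN \<omega> - DJ n \<omega>))"
      unfolding Lq_2[symmetric]
    proof (rule Lq_le_add)
      have "\<bar>Z \<omega> * DN \<omega>\<bar> \<le> \<bar>Z \<omega> * DJ n \<omega>\<bar> + \<bar>Z \<omega> * (DN \<omega> - DJ n \<omega>)\<bar>" for \<omega>
        using abs_triangle_ineq[of "Z \<omega> * DJ n \<omega>" "Z \<omega> * (DN \<omega> - DJ n \<omega>)"] by (simp add: algebra_simps)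
      then show "AE \<omega> in P. \<bar>Z \<omega> * DN \<omega>\<bar> \<le> \<bar>Z \<omega> * DJ n \<omega>\<bar> + \<bar>Z \<omega> * (DN \<omega> - DJ n \<omega>)\<bar>" by simp
    qed simp_all
    also have "\<dots> \<le> 2 * (ennreal (2 * c2) * (ennreal (2 * C\<^sup>2) * Q + ennreal (2 * R\<^sup>2) * (\<integral>\<^sup>+r. e n r \<partial>lebesgue)))
        + 2 * (ennreal (R\<^sup>2) * N2 P (\<lambda>\<omega>. DN \<omega> - DJ n \<omega>))"
      unfolding Lq_2
      by (intro add_mono mult_left_mono 2 N2_le_scaled) (auto simp: abs_mult intro!: AE_I2 mult_right_mono Z(2))
    also have "\<dots> = ennreal (8 * c2 * C\<^sup>2) * Q +
      (ennreal (8 * c2 * R\<^sup>2) * (\<integral>\<^sup>+r. e n r \<partial>lebesgue) + ennreal (2 * R\<^sup>2) * N2 P (\<lambda>\<omega>. DN \<omega> - DJ n \<omega>))"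
    proof -
      have *: "2 * (ennreal (2 * c2) * (ennreal (2 * u) * x)) = ennreal (8 * c2 * u) * x" if "0 \<le> u" for u x
      proof -
        have "2 * (ennreal (2 * c2) * (ennreal (2 * u) * x)) = (ennreal 2 * ennreal (2 * c2) * ennreal (2 * u)) * x"
          by (simp add: mult.assoc)
        also have "ennreal 2 * ennreal (2 * c2) * ennreal (2 * u) = ennreal (2 * (2 * c2) * (2 * u))"
          using that by (simp only: ennreal_mult[symmetric] c2_nonneg mult_nonneg_nonneg zero_le_numeral)
        finally show ?thesis by (simp add: mult_ac)
      qed
      have split: "2 * (u * (x + y)) + 2 * (ennreal (R\<^sup>2) * z)
          = 2 * (u * x) + (2 * (u * y) + ennreal (2 * R\<^sup>2) * z)" for u x y z :: ennreal
        by (simp add: distrib_left ennreal_mult'[of 2, simplified] add.assoc mult.assoc)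
      show ?thesis unfolding split *[OF zero_le_power2] ..
    qed
    finally show ?thesis .
  qed
  note bound = this
  have "(\<lambda>n. ennreal (8 * c2 * R\<^sup>2) * (\<integral>\<^sup>+r. e n r \<partial>lebesgue) + ennreal (2 * R\<^sup>2) * N2 P (\<lambda>\<omega>. DN \<omega> - DJ n \<omega>)) \<longlonglongrightarrow> 0"
    by (rule ennreal_tendsto_0_le2[OF order_refl _ DN_lim]) (use ap in \<open>simp_all add: approx_def\<close>)
  from tendsto_add[OF tendsto_const this, of "ennreal (8 * c2 * C\<^sup>2) * Q"]
  have "N2 P (\<lambda>\<omega>. Z \<omega> * DN \<omega>) \<le> ennreal (8 * c2 * C\<^sup>2) * Q + 0"
    by (rule LIMSEQ_le_const) (use bound in blast)
  then show "N2 P (\<lambda>\<omega>. Z \<omega> * (N b \<omega> - N a \<omega>))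
      \<le> ennreal (8 * c2 * C\<^sup>2) * (\<integral>\<^sup>+r. N2 P (\<lambda>\<omega>. Z \<omega> * D r \<omega>) * indicator {a..<b} r \<partial>lebesgue)"
    by (simp add: DN_def Q_def)
qed

lemma step_joint_measurable:
  assumes st: "step_on F A G J" and ab: "0 \<le> a" "a < b" "b \<le> T"
    and G: "\<And>r. r \<in> {0..<T} \<Longrightarrow> G r \<in> borel_measurable P"
  shows "(\<lambda>(r, \<omega>). G r \<omega> * indicator {a..<b} r) \<in> borel_measurable (borel \<Otimes>\<^sub>M P)"
proof -
  obtain M \<tau> where g: "grid M \<tau> a b" and cell: "\<forall>j<M. \<forall>r\<in>{\<tau> j..<\<tau> (Suc j)}. G r = G (\<tau> j)"
    by (rule step_on_gridE[OF st ab(2)])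
  have \<tau>: "\<tau> j \<in> {0..<T}" if "j < M" for j
    using grid_bounds[OF g, of j] grid_strict_mono[OF g, of j M] g that ab by (auto simp: grid_def)
  have "G r \<omega> * indicator {a..<b} r = (\<Sum>j<M. G (\<tau> j) \<omega> * indicator {\<tau> j..<\<tau> (Suc j)} r)" for r \<omega>
    by (rule cell_indicator_sum[OF g, of "\<lambda>r. G r \<omega>"]) (drule (1) cell[rule_format], simp)
  moreover have "(\<lambda>(r, \<omega>). \<Sum>j<M. G (\<tau> j) \<omega> * indicator {\<tau> j..<\<tau> (Suc j)} r) \<in> borel_measurable (borel \<Otimes>\<^sub>M P)"
    unfolding case_prod_beta
  proof (rule borel_measurable_sum)
    fix j assume "j \<in> {..<M}"
    then have [measurable]: "G (\<tau> j) \<in> borel_measurable P" using G \<tau> by auto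
    show "(\<lambda>x. G (\<tau> j) (snd x) * indicator {\<tau> j..<\<tau> (Suc j)} (fst x)) \<in> borel_measurable (borel \<Otimes>\<^sub>M P)"
      by measurable
  qed
  ultimately show ?thesis by simp
qed

text \<open>For a Lipschitz integrator the domination can be read pathwise. Fubini's theorem transfers the
  vanishing error from the norm to the paths.\<close>

lemma dominated_integral_Lipschitz:
  assumes V: "dominated_integral T 1 A C D V" and C: "0 \<le> C" and c: "0 \<le> c"
    and Vm: "\<And>t. t \<in> {0..T} \<Longrightarrow> V t \<in> borel_measurable P"
    and A: "AE \<omega> in P. \<forall>s t. 0 \<le> s \<longrightarrow> s \<le> t \<longrightarrow> t \<le> T \<longrightarrow> \<bar>A t \<omega> - A s \<omega>\<bar> \<le> c * (t - s)"
    and D [measurable]: "(\<lambda>(r, \<omega>). D r \<omega>) \<in> borel_measurable (borel \<Otimes>\<^sub>M P)"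
    and ab: "0 \<le> a" "a < b" "b \<le> T"
  shows "AE \<omega> in P. ennreal \<bar>V b \<omega> - V a \<omega>\<bar>
    \<le> ennreal (c * C) * (\<integral>\<^sup>+r. ennreal \<bar>D r \<omega>\<bar> * indicator {a..<b} r \<partial>lborel)"
proof -
  obtain G J e where ap: "approx T 1 A G J e"
    and ex: "\<And>n. AE r in lebesgue. r \<in> {0..<T} \<longrightarrow> Lq P 1 (\<lambda>\<omega>. max 0 (\<bar>G n r \<omega>\<bar> - C * \<bar>D r \<omega>\<bar>)) \<le> e n r"
    and lim: "\<And>t. t \<in> {0..T} \<Longrightarrow> (\<lambda>n. Lq P 1 (\<lambda>\<omega>. J n t \<omega> - V t \<omega>)) \<longlonglongrightarrow> 0"
    using V unfolding dominated_integral_def by auto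
  have mem: "a \<in> {0..T}" "b \<in> {0..T}" using ab by auto
  have em [measurable]: "e n \<in> borel_measurable lebesgue" for n using ap by (auto simp: approx_def)
  have G: "G n r \<in> borel_measurable P" if "r \<in> {0..<T}" for n r
    using ap that by (auto simp: approx_def adapted_def)
  have [measurable]: "J n a \<in> borel_measurable P" "J n b \<in> borel_measurable P" for n
    using ap mem by (auto simp: approx_def)
  note [measurable] = Vm[OF mem(1)] Vm[OF mem(2)]
  define DJ where "DJ n \<omega> = J n b \<omega> - J n a \<omega>" for n \<omega>
  define DV where "DV \<omega> = V b \<omega> - V a \<omega>" for \<omega>
  have [measurable]: "DJ n \<in> borel_measurable P" "DV \<in> borel_measurable P" for n
    by (simp_all add: DJ_def[abs_def] DV_def[abs_def])
  define Q where "Q \<omega> = (\<integral>\<^sup>+r. ennreal \<bar>D r \<omega>\<bar> * indicator {a..<b} r \<partial>lborel)" for \<omega>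
  define X where "X n r \<omega> = ennreal (max 0 (\<bar>G n r \<omega>\<bar> - C * \<bar>D r \<omega>\<bar>)) * indicator {a..<b} r" for n r \<omega>
  define W where "W n \<omega> = (\<integral>\<^sup>+r. X n r \<omega> \<partial>lborel)" for n \<omega>
  interpret LP: pair_sigma_finite lborel P ..
  have [measurable_cong]: "sets (lborel \<Otimes>\<^sub>M P) = sets (borel \<Otimes>\<^sub>M P)"
    by (rule sets_pair_measure_cong) auto
  have Dl [measurable]: "(\<lambda>(r, \<omega>). D r \<omega>) \<in> borel_measurable (lborel \<Otimes>\<^sub>M P)"
    using D by (simp add: measurable_def cong: measurable_cong_sets)
  have Dsec [measurable]: "(\<lambda>r. D r \<omega>) \<in> borel_measurable borel" for \<omega>
    using measurable_Pair1[OF D, of \<omega>] by simp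
  have Qm [measurable]: "Q \<in> borel_measurable P"
    unfolding Q_def by measurable
  have Gj: "(\<lambda>(r, \<omega>). G n r \<omega> * indicator {a..<b} r) \<in> borel_measurable (borel \<Otimes>\<^sub>M P)" for n
  proof -
    obtain F where "step_on F A (G n) (J n)" using ap unfolding approx_def by blast
    from step_joint_measurable[OF this ab G] show ?thesis .
  qed
  have Xeq: "X n r \<omega> = ennreal (max 0 (\<bar>G n r \<omega> * indicator {a..<b} r\<bar> - C * \<bar>D r \<omega>\<bar>)) * indicator {a..<b} r" for n r \<omega>
    by (simp add: X_def indicator_def)
  have Xm [measurable]: "(\<lambda>(r, \<omega>). X n r \<omega>) \<in> borel_measurable (lborel \<Otimes>\<^sub>M P)" for n
  proof -
    have [measurable]: "(\<lambda>(r, \<omega>). G n r \<omega> * indicator {a..<b} r) \<in> borel_measurable (lborel \<Otimes>\<^sub>M P)"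
      using Gj[of n] by (simp cong: measurable_cong_sets)
    show ?thesis unfolding Xeq by measurable
  qed
  have Wm [measurable]: "W n \<in> borel_measurable P" for n
    unfolding W_def by measurable
  have W_le: "(\<integral>\<^sup>+\<omega>. W n \<omega> \<partial>P) \<le> (\<integral>\<^sup>+r. e n r \<partial>lebesgue)" for n
  proof -
    have "(\<integral>\<^sup>+\<omega>. W n \<omega> \<partial>P) = (\<integral>\<^sup>+r. (\<integral>\<^sup>+\<omega>. X n r \<omega> \<partial>P) \<partial>lborel)"
      unfolding W_def using LP.Fubini'[OF Xm] by simp
    also have "\<dots> = (\<integral>\<^sup>+r. (\<integral>\<^sup>+\<omega>. X n r \<omega> \<partial>P) \<partial>lebesgue)"
      by (simp add: nn_integral_completion)
    also have "\<dots> \<le> (\<integral>\<^sup>+r. e n r \<partial>lebesgue)"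
    proof (rule nn_integral_mono_AE, rule eventually_mono[OF ex[of n]])
      fix r assume "r \<in> {0..<T} \<longrightarrow> Lq P 1 (\<lambda>\<omega>. max 0 (\<bar>G n r \<omega>\<bar> - C * \<bar>D r \<omega>\<bar>)) \<le> e n r"
      then show "(\<integral>\<^sup>+\<omega>. X n r \<omega> \<partial>P) \<le> e n r"
        using ab by (auto simp: X_def Lq_1 indicator_def)
    qed
    finally show ?thesis .
  qed
  have W_lim: "(\<lambda>n. \<integral>\<^sup>+\<omega>. W n \<omega> \<partial>P) \<longlonglongrightarrow> 0"
    by (rule ennreal_tendsto_0_le[OF W_le]) (use ap in \<open>simp add: approx_def\<close>)
  have DV_lim: "(\<lambda>n. Lq P 1 (\<lambda>\<omega>. DV \<omega> - DJ n \<omega>)) \<longlonglongrightarrow> 0"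
  proof (rule ennreal_tendsto_0_le2[OF _ lim[OF mem(1)] lim[OF mem(2)]])
    show "Lq P 1 (\<lambda>\<omega>. DV \<omega> - DJ n \<omega>) \<le> 2 * Lq P 1 (\<lambda>\<omega>. J n a \<omega> - V a \<omega>) + 2 * Lq P 1 (\<lambda>\<omega>. J n b \<omega> - V b \<omega>)" for n
      by (rule Lq_le_add) (auto simp: DV_def DJ_def)
  qed simp_all
  have path: "AE \<omega> in P. ennreal \<bar>DV \<omega>\<bar> - ennreal (c * C) * Q \<omega> \<le> ennreal \<bar>DV \<omega> - DJ n \<omega>\<bar> + ennreal c * W n \<omega>" for n
  proof -
    obtain F where F: "step_on F A (G n) (J n)" using ap unfolding approx_def by blast
    show ?thesis
    proof (rule eventually_mono[OF A])
      fix \<omega> assume "\<forall>s t. 0 \<le> s \<longrightarrow> s \<le> t \<longrightarrow> t \<le> T \<longrightarrow> \<bar>A t \<omega> - A s \<omega>\<bar> \<le> c * (t - s)"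
      then have "ennreal \<bar>DJ n \<omega>\<bar> \<le> ennreal c * (\<integral>\<^sup>+r. ennreal \<bar>G n r \<omega>\<bar> * indicator {a..<b} r \<partial>lebesgue)"
        unfolding DJ_def by (intro elementary_integral_Lipschitz[OF F ab]) auto
      also have "(\<integral>\<^sup>+r. ennreal \<bar>G n r \<omega>\<bar> * indicator {a..<b} r \<partial>lebesgue)
          \<le> (\<integral>\<^sup>+r. ennreal C * (ennreal \<bar>D r \<omega>\<bar> * indicator {a..<b} r) + X n r \<omega> \<partial>lborel)"
        unfolding nn_integral_completion
      proof (rule nn_integral_mono)
        fix r
        have "\<bar>G n r \<omega>\<bar> \<le> C * \<bar>D r \<omega>\<bar> + max 0 (\<bar>G n r \<omega>\<bar> - C * \<bar>D r \<omega>\<bar>)" by simp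
        then have "ennreal \<bar>G n r \<omega>\<bar> \<le> ennreal (C * \<bar>D r \<omega>\<bar> + max 0 (\<bar>G n r \<omega>\<bar> - C * \<bar>D r \<omega>\<bar>))"
          by (rule ennreal_leI)
        also have "\<dots> = ennreal C * ennreal \<bar>D r \<omega>\<bar> + ennreal (max 0 (\<bar>G n r \<omega>\<bar> - C * \<bar>D r \<omega>\<bar>))"
          using C by (subst ennreal_plus) (auto simp: ennreal_mult')
        finally show "ennreal \<bar>G n r \<omega>\<bar> * indicator {a..<b} r
            \<le> ennreal C * (ennreal \<bar>D r \<omega>\<bar> * indicator {a..<b} r) + X n r \<omega>"
          by (auto simp: X_def indicator_def)
      qed
      also have "\<dots> = ennreal C * Q \<omega> + W n \<omega>"
      proof -
        have [measurable]: "(\<lambda>r. X n r \<omega>) \<in> borel_measurable lborel"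
          using measurable_Pair1[OF Xm[of n], of \<omega>] by simp
        show ?thesis unfolding Q_def W_def by (simp add: nn_integral_add nn_integral_cmult)
      qed
      finally have J: "ennreal \<bar>DJ n \<omega>\<bar> \<le> ennreal c * (ennreal C * Q \<omega> + W n \<omega>)"
        by (simp add: mult_left_mono)
      have "ennreal \<bar>DV \<omega>\<bar> \<le> ennreal (\<bar>DV \<omega> - DJ n \<omega>\<bar> + \<bar>DJ n \<omega>\<bar>)"
        by (rule ennreal_leI) linarith
      also have "\<dots> = ennreal \<bar>DV \<omega> - DJ n \<omega>\<bar> + ennreal \<bar>DJ n \<omega>\<bar>" by simp
      also have "\<dots> \<le> ennreal \<bar>DV \<omega> - DJ n \<omega>\<bar> + ennreal c * (ennreal C * Q \<omega> + W n \<omega>)"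
        by (rule add_left_mono[OF J])
      also have "\<dots> = ennreal (c * C) * Q \<omega> + (ennreal \<bar>DV \<omega> - DJ n \<omega>\<bar> + ennreal c * W n \<omega>)"
        using C c by (simp add: ennreal_mult distrib_left mult.assoc add_ac)
      finally show "ennreal \<bar>DV \<omega>\<bar> - ennreal (c * C) * Q \<omega> \<le> ennreal \<bar>DV \<omega> - DJ n \<omega>\<bar> + ennreal c * W n \<omega>"
        unfolding ennreal_minus_le_iff by simp
    qed
  qed
  have "(\<integral>\<^sup>+\<omega>. ennreal \<bar>DV \<omega>\<bar> - ennreal (c * C) * Q \<omega> \<partial>P) \<le> 1 * Lq P 1 (\<lambda>\<omega>. DV \<omega> - DJ n \<omega>) + ennreal c * (\<integral>\<^sup>+\<omega>. W n \<omega> \<partial>P)" for n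
  proof -
    have "(\<integral>\<^sup>+\<omega>. ennreal \<bar>DV \<omega>\<bar> - ennreal (c * C) * Q \<omega> \<partial>P) \<le> (\<integral>\<^sup>+\<omega>. ennreal \<bar>DV \<omega> - DJ n \<omega>\<bar> + ennreal c * W n \<omega> \<partial>P)"
      by (rule nn_integral_mono_AE[OF path])
    also have "\<dots> = 1 * Lq P 1 (\<lambda>\<omega>. DV \<omega> - DJ n \<omega>) + ennreal c * (\<integral>\<^sup>+\<omega>. W n \<omega> \<partial>P)"
      by (simp add: nn_integral_add nn_integral_cmult Lq_1)
    finally show ?thesis .
  qed
  then have "(\<lambda>n::nat. \<integral>\<^sup>+\<omega>. ennreal \<bar>DV \<omega>\<bar> - ennreal (c * C) * Q \<omega> \<partial>P) \<longlonglongrightarrow> 0"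
    by (rule ennreal_tendsto_0_le2[OF _ DV_lim W_lim]) simp_all
  then have "(\<integral>\<^sup>+\<omega>. ennreal \<bar>DV \<omega>\<bar> - ennreal (c * C) * Q \<omega> \<partial>P) = 0"
    by (simp add: LIMSEQ_const_iff)
  then have "AE \<omega> in P. ennreal \<bar>DV \<omega>\<bar> - ennreal (c * C) * Q \<omega> = 0"
    by (subst (asm) nn_integral_0_iff_AE) auto
  then show ?thesis
    by (rule eventually_mono) (simp add: diff_eq_0_iff_ennreal DV_def Q_def)
qed

end

section \<open>A bounded substitute for the square\<close>

text \<open>The square is replaced by the bounded function \<open>\<phi>\<close>, and \<open>\<phi>'\<close> is its derivative; \<open>\<nu> = 1 - \<phi>\<close> is the weight of
  the quadratic term in the expansion of \<open>\<phi>\<close>.\<close>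

definition \<nu> :: "real \<Rightarrow> real" where "\<nu> x = 1 / (1 + x\<^sup>2)"
definition \<phi> :: "real \<Rightarrow> real" where "\<phi> x = x\<^sup>2 / (1 + x\<^sup>2)"
definition \<phi>' :: "real \<Rightarrow> real" where "\<phi>' x = 2 * x / (1 + x\<^sup>2)\<^sup>2"

lemma one_plus_sq: "0 < 1 + (x :: real)\<^sup>2" "1 + x\<^sup>2 \<noteq> 0"
  by (simp_all add: add_pos_nonneg add_nonneg_eq_0_iff)

lemma \<phi>_nonneg: "0 \<le> \<phi> x" and \<phi>_le_1: "\<phi> x \<le> 1" and \<phi>_0 [simp]: "\<phi> 0 = 0"
  and \<phi>_eq_0_iff: "\<phi> x = 0 \<longleftrightarrow> x = 0"
  using one_plus_sq[of x] by (auto simp: \<phi>_def)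

lemma \<nu>_pos: "0 < \<nu> x" and \<nu>_le_1: "\<nu> x \<le> 1"
  using one_plus_sq[of x] by (auto simp: \<nu>_def)

lemma \<phi>_eq: "\<phi> x = 1 - \<nu> x" and \<phi>'_eq: "\<phi>' x = 2 * x * (\<nu> x)\<^sup>2"
  using one_plus_sq[of x] by (simp_all add: \<phi>_def \<nu>_def \<phi>'_def field_simps)

lemma \<phi>_deriv: "(\<phi> has_real_derivative \<phi>' x) (at x)"
proof -
  have "((\<lambda>x. x\<^sup>2 / (1 + x\<^sup>2)) has_real_derivative
      (2 * x * (1 + x\<^sup>2) - x\<^sup>2 * (2 * x)) / ((1 + x\<^sup>2) * (1 + x\<^sup>2))) (at x)"
    using one_plus_sq[of x] by (auto intro!: derivative_eq_intros)
  moreover have "(2 * x * (1 + x\<^sup>2) - x\<^sup>2 * (2 * x)) / ((1 + x\<^sup>2) * (1 + x\<^sup>2)) = \<phi>' x"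
    by (simp add: \<phi>'_def power2_eq_square algebra_simps)
  ultimately show ?thesis by (simp add: \<phi>_def[abs_def])
qed

lemma \<nu>_deriv: "(\<nu> has_real_derivative - \<phi>' x) (at x)"
proof -
  have "((\<lambda>x. 1 - \<phi> x) has_real_derivative - \<phi>' x) (at x)"
    by (auto intro!: derivative_eq_intros \<phi>_deriv)
  then show ?thesis by (simp add: \<phi>_eq)
qed

lemma abs_\<phi>'_le_1: "\<bar>\<phi>' x\<bar> \<le> 1"
proof -
  let ?s = "1 + x\<^sup>2"
  have "2 * \<bar>x\<bar> \<le> ?s" using zero_le_power2[of "\<bar>x\<bar> - 1"] by (simp add: power2_eq_square algebra_simps)
  also have "\<dots> \<le> ?s\<^sup>2" using mult_left_mono[of 1 ?s ?s] by (simp add: power2_eq_square)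
  finally show ?thesis using one_plus_sq[of x] by (simp add: \<phi>'_def abs_mult)
qed

lemma \<phi>'_deriv: "(\<phi>' has_real_derivative (2 - 6 * x\<^sup>2) / (1 + x\<^sup>2) ^ 3) (at x)"
proof -
  have "((\<lambda>x. 2 * x / (1 + x\<^sup>2)\<^sup>2) has_real_derivative
      (2 * (1 + x\<^sup>2)\<^sup>2 - 2 * x * (2 * (1 + x\<^sup>2) * (2 * x))) / ((1 + x\<^sup>2)\<^sup>2 * (1 + x\<^sup>2)\<^sup>2)) (at x)"
    using one_plus_sq[of x] by (auto intro!: derivative_eq_intros)
  moreover have "(2 * s\<^sup>2 - 2 * x * (2 * s * (2 * x))) / (s\<^sup>2 * s\<^sup>2) = (2 * s - 8 * x\<^sup>2) / s ^ 3" if "s \<noteq> 0" for s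
    using that by (simp add: divide_simps) (simp add: power2_eq_square power3_eq_cube power4_eq_xxxx algebra_simps)
  from this[OF one_plus_sq(2)[of x]]
  have "(2 * (1 + x\<^sup>2)\<^sup>2 - 2 * x * (2 * (1 + x\<^sup>2) * (2 * x))) / ((1 + x\<^sup>2)\<^sup>2 * (1 + x\<^sup>2)\<^sup>2) = (2 - 6 * x\<^sup>2) / (1 + x\<^sup>2) ^ 3"
    by simp
  ultimately show ?thesis by (simp add: \<phi>'_def[abs_def])
qed

lemma lipschitz_of_deriv:
  fixes f f' :: "real \<Rightarrow> real"
  assumes "\<And>x. (f has_real_derivative f' x) (at x)" "\<And>x. \<bar>f' x\<bar> \<le> L"
  shows "\<bar>f a - f b\<bar> \<le> L * \<bar>a - b\<bar>"
  using field_differentiable_bound[of UNIV f f' L a b] assms by (auto simp: has_field_derivative_at_within)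

lemma \<phi>'_lipschitz: "\<bar>\<phi>' a - \<phi>' b\<bar> \<le> 2 * \<bar>a - b\<bar>"
proof (rule lipschitz_of_deriv[OF \<phi>'_deriv])
  fix x :: real
  have "\<bar>2 - 6 * x\<^sup>2\<bar> \<le> 2 + 6 * x\<^sup>2" using zero_le_power2[of x] by linarith
  also have "\<dots> \<le> 2 * (1 + x\<^sup>2) ^ 3"
  proof -
    have "(1 + y) ^ 3 = 1 + 3 * y + 3 * y\<^sup>2 + y ^ 3" for y :: real
      by (simp add: power3_eq_cube power2_eq_square algebra_simps)
    moreover have "0 \<le> 3 * (x\<^sup>2)\<^sup>2 + (x\<^sup>2) ^ 3" by simp
    ultimately show ?thesis by simp
  qed
  finally show "\<bar>(2 - 6 * x\<^sup>2) / (1 + x\<^sup>2) ^ 3\<bar> \<le> 2"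
    using one_plus_sq[of x] by (simp add: abs_divide divide_le_eq)
qed

lemma \<nu>_lipschitz: "\<bar>\<nu> a - \<nu> b\<bar> \<le> 1 * \<bar>a - b\<bar>"
  by (rule lipschitz_of_deriv[OF \<nu>_deriv]) (simp add: abs_\<phi>'_le_1)

lemma \<phi>_continuous: "continuous_on A \<phi>" "continuous_on A \<phi>'" "continuous_on A \<nu>"
  using one_plus_sq(2) by (auto simp: \<phi>_def[abs_def] \<phi>'_def[abs_def] \<nu>_def[abs_def] intro!: continuous_intros)

lemma \<phi>_measurable [measurable]: "\<phi> \<in> borel_measurable borel" "\<phi>' \<in> borel_measurable borel" "\<nu> \<in> borel_measurable borel"
  by (intro borel_measurable_continuous_onI \<phi>_continuous)+

text \<open>\<open>\<phi>\<close> is a concave function of the square. This gives a second order expansion with a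
  one-sided remainder for increments of arbitrary size, so that second moments of the martingale
  part suffice.\<close>

lemma \<phi>_expansion: "\<phi> (x + u) \<le> \<phi> x + \<phi>' x * u + (\<nu> x * u)\<^sup>2"
proof -
  define s where "s = 1 + x\<^sup>2"
  define s' where "s' = 1 + (x + u)\<^sup>2"
  have s: "0 < s" "0 < s'" using one_plus_sq[of x] one_plus_sq[of "x + u"] by (auto simp: s_def s'_def)
  have "0 \<le> (s' - s)\<^sup>2 / (s\<^sup>2 * s')" using s by simp
  also have "\<dots> = (s' - s) / s\<^sup>2 - (1 / s - 1 / s')"
    using s by (simp add: divide_simps) (simp add: power2_eq_square algebra_simps)
  finally have "1 / s - 1 / s' \<le> (s' - s) / s\<^sup>2" by simp
  moreover have "s' - s = 2 * x * u + u\<^sup>2" by (simp add: s_def s'_def power2_eq_square algebra_simps)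
  ultimately have "1 / s - 1 / s' \<le> 2 * x / s\<^sup>2 * u + (1 / s * u)\<^sup>2"
    by (simp add: add_divide_distrib power_mult_distrib power_divide)
  then show ?thesis by (simp add: \<phi>_eq \<nu>_def \<phi>'_def s_def s'_def)
qed

text \<open>For the part of finite variation a first order expansion suffices. The derivative may be taken at a
  point \<open>x\<close> away from \<open>z\<close>, because \<open>\<phi>'\<close> is Lipschitz and bounded; the minimum in the error makes it
  dominated by \<open>\<bar>d\<bar>\<close> and small for small increments.\<close>

lemma \<phi>_increment: "\<phi> (z + d) - \<phi> z \<le> \<phi>' x * d + 2 * \<bar>d\<bar> * min 1 (\<bar>z - x\<bar> + \<bar>d\<bar>)"
proof (cases "d = 0")
  case False
  have "\<exists>\<xi>. \<bar>\<xi> - z\<bar> \<le> \<bar>d\<bar> \<and> \<phi> (z + d) - \<phi> z = \<phi>' \<xi> * d"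
  proof (cases "0 < d")
    case True
    then obtain \<xi> where "z < \<xi>" "\<xi> < z + d" "\<phi> (z + d) - \<phi> z = (z + d - z) * \<phi>' \<xi>"
      using MVT2[of z "z + d" \<phi> \<phi>'] \<phi>_deriv by auto
    with True show ?thesis by (intro exI[of _ \<xi>]) auto
  next
    case F: False
    with False obtain \<xi> where "z + d < \<xi>" "\<xi> < z" "\<phi> z - \<phi> (z + d) = (z - (z + d)) * \<phi>' \<xi>"
      using MVT2[of "z + d" z \<phi> \<phi>'] \<phi>_deriv by auto
    with F show ?thesis by (intro exI[of _ \<xi>]) (auto simp: algebra_simps)
  qed
  then obtain \<xi> where \<xi>: "\<bar>\<xi> - z\<bar> \<le> \<bar>d\<bar>" "\<phi> (z + d) - \<phi> z = \<phi>' \<xi> * d" by blast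
  have "\<bar>\<phi>' \<xi> - \<phi>' x\<bar> \<le> 2 * min 1 (\<bar>z - x\<bar> + \<bar>d\<bar>)"
  proof -
    have "\<bar>\<xi> - x\<bar> \<le> \<bar>z - x\<bar> + \<bar>d\<bar>" using \<xi>(1) by linarith
    then have "\<bar>\<phi>' \<xi> - \<phi>' x\<bar> \<le> 2 * (\<bar>z - x\<bar> + \<bar>d\<bar>)"
      by (intro order_trans[OF \<phi>'_lipschitz] mult_left_mono) auto
    moreover have "\<bar>\<phi>' \<xi> - \<phi>' x\<bar> \<le> 2"
      using abs_\<phi>'_le_1[of \<xi>] abs_\<phi>'_le_1[of x] by linarith
    ultimately show ?thesis by (simp add: min_def)
  qed
  then have "\<bar>(\<phi>' \<xi> - \<phi>' x) * d\<bar> \<le> 2 * min 1 (\<bar>z - x\<bar> + \<bar>d\<bar>) * \<bar>d\<bar>"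
    unfolding abs_mult by (rule mult_right_mono) simp
  moreover have "\<phi> (z + d) - \<phi> z = \<phi>' x * d + (\<phi>' \<xi> - \<phi>' x) * d" using \<xi>(2) by (simp add: algebra_simps)
  ultimately show ?thesis by (simp add: mult_ac)
qed simp

lemma \<nu>_sq_le: "(\<nu> x * x)\<^sup>2 \<le> \<phi> x" and \<phi>'_le: "\<bar>\<phi>' x\<bar> * \<bar>x\<bar> \<le> 2 * \<phi> x"
proof -
  have "\<phi> x = x\<^sup>2 * \<nu> x" by (simp add: \<phi>_def \<nu>_def)
  moreover have "x\<^sup>2 * (\<nu> x)\<^sup>2 \<le> x\<^sup>2 * \<nu> x"
    using mult_left_mono[OF \<nu>_le_1[of x], of "\<nu> x"] \<nu>_pos[of x]
    by (intro mult_left_mono) (auto simp: power2_eq_square)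
  ultimately show 1: "(\<nu> x * x)\<^sup>2 \<le> \<phi> x" by (simp add: power_mult_distrib mult.commute)
  have "\<bar>\<phi>' x\<bar> * \<bar>x\<bar> = 2 * (\<nu> x * x)\<^sup>2"
    by (simp add: \<phi>'_eq abs_mult power2_eq_square mult_ac)
  with 1 show "\<bar>\<phi>' x\<bar> * \<bar>x\<bar> \<le> 2 * \<phi> x" by simp
qed

section \<open>Uniform partitions\<close>

definition upart :: "real \<Rightarrow> nat \<Rightarrow> nat \<Rightarrow> real" where
  "upart t m i = real i * t / Suc m"

definition left_point :: "real \<Rightarrow> nat \<Rightarrow> real \<Rightarrow> real" where
  "left_point t m r = of_int \<lfloor>r * Suc m / t\<rfloor> * t / Suc m"

lemma upart_grid: "0 < t \<Longrightarrow> grid (Suc m) (upart t m) 0 t"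
  by (auto simp: grid_def upart_def divide_strict_right_mono)

lemma upart_mesh: "upart t m (Suc i) - upart t m i = t / Suc m"
  by (simp add: upart_def diff_divide_distrib[symmetric] algebra_simps)

lemma left_point_cell:
  assumes "0 < t" "r \<in> {upart t m i..<upart t m (Suc i)}"
  shows "left_point t m r = upart t m i"
proof -
  have "real i \<le> r * Suc m / t" "r * Suc m / t < real (Suc i)"
    using assms by (auto simp: upart_def divide_simps)
  then have "\<lfloor>r * Suc m / t\<rfloor> = int i" by (intro floor_unique) auto
  then show ?thesis by (simp add: left_point_def upart_def)
qed

lemma left_point_tendsto: "0 < t \<Longrightarrow> (\<lambda>m. left_point t m r) \<longlonglongrightarrow> r"
proof -
  assume t: "0 < t"
  have "\<bar>left_point t m r - r\<bar> \<le> t / Suc m" for m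
  proof -
    define x where "x = r * Suc m / t"
    have r: "r = x * t / Suc m" using t by (simp add: x_def)
    have "left_point t m r - r = (of_int \<lfloor>x\<rfloor> - x) * (t / Suc m)"
      unfolding left_point_def x_def[symmetric] by (simp add: r left_diff_distrib diff_divide_distrib)
    moreover have "\<bar>of_int \<lfloor>x\<rfloor> - x\<bar> \<le> 1" by linarith
    then have "\<bar>of_int \<lfloor>x\<rfloor> - x\<bar> * \<bar>t / Suc m\<bar> \<le> 1 * \<bar>t / Suc m\<bar>"
      by (rule mult_right_mono) simp
    ultimately show ?thesis using t by (simp add: abs_mult)
  qed
  moreover have "(\<lambda>m. t / Suc m) \<longlonglongrightarrow> 0"
    using LIMSEQ_Suc[OF lim_const_over_n[of t]] by simp
  ultimately have "(\<lambda>m. left_point t m r - r) \<longlonglongrightarrow> 0"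
    by (intro Lim_null_comparison[of "\<lambda>m. left_point t m r - r" "\<lambda>m. t / Suc m"]) auto
  then show ?thesis by (rule LIM_zero_cancel)
qed

lemma left_point_measurable [measurable]: "left_point t m \<in> borel_measurable borel"
  unfolding left_point_def[abs_def] by measurable

text \<open>Integrands frozen at the left end point of each cell are rewritten with the left grid point of the
  integration variable, which tends to that variable as the mesh tends to 0.\<close>

lemma sum_cells_nn_integral:
  fixes \<Phi> :: "real \<Rightarrow> real \<Rightarrow> ennreal"
  assumes t: "0 < t" and m: "\<And>i. i < Suc m \<Longrightarrow> \<Phi> (upart t m i) \<in> borel_measurable lborel"
  shows "(\<Sum>i<Suc m. \<integral>\<^sup>+r. \<Phi> (upart t m i) r * indicator {upart t m i..<upart t m (Suc i)} r \<partial>lborel)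
    = (\<integral>\<^sup>+r. \<Phi> (left_point t m r) r * indicator {0..<t} r \<partial>lborel)"
proof -
  have "\<Phi> (left_point t m r) r * indicator {0..<t} r =
      (\<Sum>i<Suc m. \<Phi> (upart t m i) r * indicator {upart t m i..<upart t m (Suc i)} r)" for r
  proof -
    have "1 * indicator {0..<t} r = (\<Sum>i<Suc m. 1 * indicator {upart t m i..<upart t m (Suc i)} r :: ennreal)"
      by (rule cell_indicator_sum[OF upart_grid[OF t], where \<Phi> = "\<lambda>_. 1"]) simp
    then have "\<Phi> (left_point t m r) r * indicator {0..<t} r
        = (\<Sum>i<Suc m. \<Phi> (left_point t m r) r * indicator {upart t m i..<upart t m (Suc i)} r)"
      by (simp only: mult_1_left sum_distrib_left)
    also have "\<dots> = (\<Sum>i<Suc m. \<Phi> (upart t m i) r * indicator {upart t m i..<upart t m (Suc i)} r)"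
    proof (rule sum.cong[OF refl])
      fix i
      show "\<Phi> (left_point t m r) r * indicator {upart t m i..<upart t m (Suc i)} r
          = \<Phi> (upart t m i) r * indicator {upart t m i..<upart t m (Suc i)} r"
        using left_point_cell[OF t, of r m i] by (cases "r \<in> {upart t m i..<upart t m (Suc i)}") auto
    qed
    finally show ?thesis .
  qed
  then show ?thesis by (simp only:) (subst nn_integral_sum, use m in auto)
qed

text \<open>Iterating the inequality \<open>k\<close> times, starting from the bound 1, gives \<open>y t \<le> (c t)\<^sup>k / k!\<close>.\<close>

lemma ennreal_gronwall:
  fixes y :: "real \<Rightarrow> ennreal"
  assumes le: "\<And>t. 0 \<le> t \<Longrightarrow> t < T \<Longrightarrow> y t \<le> ennreal c * (\<integral>\<^sup>+r. y r * indicator {0..<t} r \<partial>lborel)"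
    and bd: "\<And>t. y t \<le> 1" and c: "0 \<le> c" and t: "0 \<le> t" "t < T"
  shows "y t = 0"
proof -
  have it: "y t \<le> ennreal ((c * t) ^ k / fact k)" if "0 \<le> t" "t < T" for k t
    using that
  proof (induction k arbitrary: t)
    case 0
    then show ?case using bd by simp
  next
    case (Suc k)
    have "(\<integral>\<^sup>+r. y r * indicator {0..<t} r \<partial>lborel)
        \<le> (\<integral>\<^sup>+r. ennreal ((c * r) ^ k / fact k) * indicator {0..t} r \<partial>lborel)"
      using Suc by (intro nn_integral_mono) (auto simp: indicator_def)
    also have "\<dots> = ennreal (c ^ k * t ^ Suc k / fact (Suc k) - c ^ k * 0 ^ Suc k / fact (Suc k))"
    proof (rule nn_integral_FTC_Icc)
      show "((\<lambda>r. c ^ k * r ^ Suc k / fact (Suc k)) has_real_derivative (c * x) ^ k / fact k) (at x)" for x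
      proof -
        have "((\<lambda>r. c ^ k * r ^ Suc k / fact (Suc k)) has_real_derivative
            c ^ k * (real (Suc k) * x ^ (Suc k - Suc 0)) / fact (Suc k)) (at x)"
          by (intro DERIV_cdivide DERIV_cmult DERIV_pow)
        then show ?thesis by (simp add: power_mult_distrib fact_Suc divide_simps del: of_nat_Suc)
      qed
    qed (use c Suc in auto)
    finally have "y t \<le> ennreal c * ennreal (c ^ k * t ^ Suc k / fact (Suc k))"
      using le[OF Suc.prems] by (auto elim!: order_trans intro!: mult_left_mono)
    also have "\<dots> = ennreal ((c * t) ^ Suc k / fact (Suc k))"
      using c Suc.prems by (simp add: ennreal_mult[symmetric] power_mult_distrib mult_ac)
    finally show ?case .
  qed
  have "(\<lambda>k. (c * t) ^ k / fact k) \<longlonglongrightarrow> 0"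
    using summable_LIMSEQ_zero[OF summable_exp[of "c * t"]] by (simp add: divide_inverse mult.commute)
  then have "(\<lambda>k. ennreal ((c * t) ^ k / fact k)) \<longlonglongrightarrow> ennreal 0" by (rule tendsto_ennrealI)
  then have "y t \<le> ennreal 0" by (rule LIMSEQ_le_const) (use it[OF t] in blast)
  then show ?thesis by simp
qed

section \<open>The estimate for the difference of two solutions\<close>

lemma ennreal_integral_le:
  assumes f: "integrable M f" and B: "B \<in> borel_measurable M" "AE x in M. 0 \<le> B x" and le: "AE x in M. f x \<le> B x"
  shows "ennreal (\<integral>x. f x \<partial>M) \<le> (\<integral>\<^sup>+x. ennreal (B x) \<partial>M)"
proof (cases "(\<integral>\<^sup>+x. ennreal (B x) \<partial>M) < \<infinity>")
  case True
  have int: "integrable M B"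
    by (rule integrableI_nonneg[OF B True])
  have "ennreal (\<integral>x. f x \<partial>M) \<le> ennreal (\<integral>x. B x \<partial>M)"
    by (intro ennreal_leI integral_mono_AE f int le)
  then show ?thesis by (simp add: nn_integral_eq_integral[OF int B(2)])
qed (simp add: less_top[symmetric])

text \<open>The setting abstracts from all stochastic integration: \<open>D\<close> is the difference of two solutions, \<open>N\<close> its
  martingale part, \<open>V\<close> the part absolutely continuous in time, \<open>K\<close> and \<open>K'\<close> the reflections. The last
  assumption is what is left of the minimality of the reflections.\<close>

locale reflected_difference = prob_space M for M :: "'a measure" +
  fixes T C1 C2 :: real and D N V K K' :: "real \<Rightarrow> 'a \<Rightarrow> real"
  assumes C1: "0 \<le> C1" and C2: "0 \<le> C2"
    and D_joint: "(\<lambda>(r, \<omega>). D r \<omega>) \<in> borel_measurable (borel \<Otimes>\<^sub>M M)"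
    and D_cont: "\<And>\<omega>. continuous_on UNIV (\<lambda>t. D t \<omega>)"
    and N_cont: "\<And>\<omega>. continuous_on UNIV (\<lambda>t. N t \<omega>)"
    and meas: "\<And>t. N t \<in> borel_measurable M" "\<And>t. V t \<in> borel_measurable M"
      "\<And>t. K t \<in> borel_measurable M" "\<And>t. K' t \<in> borel_measurable M"
    and D_0: "AE \<omega> in M. D 0 \<omega> = 0"
    and D_L2: "(\<integral>\<^sup>+r. N2 M (D r) * indicator {0..<T} r \<partial>lborel) < \<infinity>"
    and decomposition: "AE \<omega> in M. \<forall>t\<in>{0..T}. D t \<omega> = V t \<omega> + N t \<omega> + K t \<omega> - K' t \<omega>"
    and V_dominated: "\<And>a b. 0 \<le> a \<Longrightarrow> a < b \<Longrightarrow> b \<le> T \<Longrightarrow> AE \<omega> in M. ennreal \<bar>V b \<omega> - V a \<omega>\<bar>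
      \<le> ennreal C1 * (\<integral>\<^sup>+r. ennreal \<bar>D r \<omega>\<bar> * indicator {a..<b} r \<partial>lborel)"
    and N_L2: "\<And>a b. 0 \<le> a \<Longrightarrow> a < b \<Longrightarrow> b \<le> T \<Longrightarrow> N2 M (\<lambda>\<omega>. N b \<omega> - N a \<omega>) < \<infinity>"
    and N_orthogonal: "\<And>a b. 0 \<le> a \<Longrightarrow> a < b \<Longrightarrow> b \<le> T \<Longrightarrow> (\<integral>\<omega>. \<phi>' (D a \<omega>) * (N b \<omega> - N a \<omega>) \<partial>M) = 0"
    and N_dominated: "\<And>a b. 0 \<le> a \<Longrightarrow> a < b \<Longrightarrow> b \<le> T \<Longrightarrow> N2 M (\<lambda>\<omega>. \<nu> (D a \<omega>) * (N b \<omega> - N a \<omega>))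
      \<le> ennreal C2 * (\<integral>\<^sup>+r. N2 M (\<lambda>\<omega>. \<nu> (D a \<omega>) * D r \<omega>) * indicator {a..<b} r \<partial>lborel)"
    and K_mono: "AE \<omega> in M. mono_on {0..T} (\<lambda>t. K t \<omega>)" "AE \<omega> in M. mono_on {0..T} (\<lambda>t. K' t \<omega>)"
    and K_integrable: "\<And>t. 0 \<le> t \<Longrightarrow> t < T \<Longrightarrow> integrable M (\<lambda>\<omega>. K t \<omega> - K 0 \<omega>)"
      "\<And>t. 0 \<le> t \<Longrightarrow> t < T \<Longrightarrow> integrable M (\<lambda>\<omega>. K' t \<omega> - K' 0 \<omega>)"
    and reflection: "AE \<omega> in M. \<forall>t\<in>{0<..<T}. \<forall>e>0. \<forall>\<^sub>F m in sequentially.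
      (\<Sum>i<Suc m. \<phi>' (D (upart t m i) \<omega>) *
        ((K (upart t m (Suc i)) \<omega> - K (upart t m i) \<omega>) - (K' (upart t m (Suc i)) \<omega> - K' (upart t m i) \<omega>))) \<le> e"
begin

lemma pair_sigma_finite_lborel: "pair_sigma_finite lborel M" ..

sublocale LM: pair_sigma_finite lborel M by (rule pair_sigma_finite_lborel)

lemma D_joint' [measurable]: "(\<lambda>(r, \<omega>). D r \<omega>) \<in> borel_measurable (lborel \<Otimes>\<^sub>M M)"
proof -
  have "sets (lborel \<Otimes>\<^sub>M M) = sets (borel \<Otimes>\<^sub>M M)" by (rule sets_pair_measure_cong) auto
  then show ?thesis using D_joint by (simp cong: measurable_cong_sets)
qed

lemma D_path_measurable [measurable]: "(\<lambda>r. D r \<omega>) \<in> borel_measurable borel"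
  by (rule borel_measurable_continuous_onI[OF D_cont])

lemmas [measurable] = meas

text \<open>Dominated convergence on the product space. The bound \<open>1 + y\<^sup>2\<close> is integrable because \<open>D\<close> is square
  integrable over time; it involves the value of \<open>D\<close> at the current time only, not at the left point.\<close>

lemma riemann_limit:
  assumes t: "0 < t" "t \<le> T" and h [measurable]: "(\<lambda>(x, y). h x y) \<in> borel_measurable (borel \<Otimes>\<^sub>M borel)"
    and h_cont: "\<And>y. continuous_on UNIV (\<lambda>x. h x y)" and h_bd: "\<And>x y. h x y \<le> 1 + y\<^sup>2"
  shows "(\<lambda>m. \<integral>\<^sup>+r. (\<integral>\<^sup>+\<omega>. ennreal (h (D (left_point t m r) \<omega>) (D r \<omega>)) \<partial>M) * indicator {0..<t} r \<partial>lborel)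
    \<longlonglongrightarrow> (\<integral>\<^sup>+r. (\<integral>\<^sup>+\<omega>. ennreal (h (D r \<omega>) (D r \<omega>)) \<partial>M) * indicator {0..<t} r \<partial>lborel)"
proof -
  let ?Q = "lborel \<Otimes>\<^sub>M M"
  have lp [measurable]: "(\<lambda>(r, \<omega>). D (left_point t m r) \<omega>) \<in> borel_measurable ?Q" for m
  proof -
    have "(\<lambda>x. (left_point t m (fst x), snd x)) \<in> measurable ?Q ?Q" by measurable
    from measurable_compose[OF this D_joint'] show ?thesis by (simp add: case_prod_beta)
  qed
  have hm [measurable]: "(\<lambda>x. h (a x) (b x)) \<in> borel_measurable ?Q"
    if [measurable]: "a \<in> borel_measurable ?Q" "b \<in> borel_measurable ?Q" for a b
  proof -
    have "(\<lambda>x. (a x, b x)) \<in> measurable ?Q (borel \<Otimes>\<^sub>M borel)" by measurable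
    from measurable_compose[OF this h] show ?thesis by simp
  qed
  define F where "F m = (\<lambda>(r, \<omega>). ennreal (h (D (left_point t m r) \<omega>) (D r \<omega>)) * indicator {0..<t} r)" for m
  define F0 where "F0 = (\<lambda>(r, \<omega>). ennreal (h (D r \<omega>) (D r \<omega>)) * indicator {0..<t} r)"
  have [measurable]: "F m \<in> borel_measurable ?Q" for m
  proof -
    have "(\<lambda>x. h ((\<lambda>(r, \<omega>). D (left_point t m r) \<omega>) x) ((\<lambda>(r, \<omega>). D r \<omega>) x)) \<in> borel_measurable ?Q"
      by (rule hm) measurable
    then show ?thesis unfolding F_def case_prod_beta by measurable
  qed
  have [measurable]: "F0 \<in> borel_measurable ?Q"
  proof -
    have "(\<lambda>x. h ((\<lambda>(r, \<omega>). D r \<omega>) x) ((\<lambda>(r, \<omega>). D r \<omega>) x)) \<in> borel_measurable ?Q"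
      by (rule hm) measurable
    then show ?thesis unfolding F0_def case_prod_beta by measurable
  qed
  define w where "w = (\<lambda>(r, \<omega>). ennreal (1 + (D r \<omega>)\<^sup>2) * indicator {0..<t} r)"
  have [measurable]: "w \<in> borel_measurable ?Q" unfolding w_def by measurable
  have iter: "(\<integral>\<^sup>+x. f x \<partial>?Q) = (\<integral>\<^sup>+r. (\<integral>\<^sup>+\<omega>. f (r, \<omega>) \<partial>M) \<partial>lborel)" if "f \<in> borel_measurable ?Q" for f
    using nn_integral_fst[OF that] by simp
  have split: "(\<integral>\<^sup>+\<omega>. g \<omega> * indicator {0..<t} r \<partial>M) = (\<integral>\<^sup>+\<omega>. g \<omega> \<partial>M) * indicator {0..<t} r"
    for g :: "'a \<Rightarrow> ennreal" and r
    by (cases "r \<in> {0..<t}") auto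
  have w_fin: "(\<integral>\<^sup>+x. w x \<partial>?Q) < \<infinity>"
  proof -
    have "(\<integral>\<^sup>+x. w x \<partial>?Q) = (\<integral>\<^sup>+r. (\<integral>\<^sup>+\<omega>. ennreal (1 + (D r \<omega>)\<^sup>2) \<partial>M) * indicator {0..<t} r \<partial>lborel)"
      by (subst iter) (auto simp: w_def split)
    also have "\<dots> = (\<integral>\<^sup>+r. indicator {0..<t} r + N2 M (D r) * indicator {0..<t} r \<partial>lborel)"
      by (intro nn_integral_cong) (simp add: N2_def nn_integral_add emeasure_space_1 indicator_def)
    also have "\<dots> = (\<integral>\<^sup>+r. indicator {0..<t} r \<partial>lborel) + (\<integral>\<^sup>+r. N2 M (D r) * indicator {0..<t} r \<partial>lborel)"
      unfolding N2_def by (intro nn_integral_add) measurable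
    also have "(\<integral>\<^sup>+r. N2 M (D r) * indicator {0..<t} r \<partial>lborel) \<le> (\<integral>\<^sup>+r. N2 M (D r) * indicator {0..<T} r \<partial>lborel)"
      using t by (intro nn_integral_mono) (auto simp: indicator_def)
    finally show ?thesis using D_L2 t by (auto simp: ennreal_add_eq_top less_top[symmetric] top_unique)
  qed
  have "(\<lambda>m. \<integral>\<^sup>+x. F m x \<partial>?Q) \<longlonglongrightarrow> (\<integral>\<^sup>+x. F0 x \<partial>?Q)"
  proof (rule nn_integral_dominated_convergence)
    show "AE x in ?Q. F m x \<le> w x" for m
      by (intro AE_I2) (auto simp: F_def w_def indicator_def intro!: ennreal_leI h_bd simp del: ennreal_plus)
    show "AE x in ?Q. (\<lambda>m. F m x) \<longlonglongrightarrow> F0 x"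
    proof (intro AE_I2)
      fix x :: "real \<times> 'a"
      obtain r \<omega> where x: "x = (r, \<omega>)" by (cases x)
      have "(\<lambda>m. D (left_point t m r) \<omega>) \<longlonglongrightarrow> D r \<omega>"
        by (rule continuous_on_tendsto_compose[OF D_cont left_point_tendsto[OF t(1)]]) auto
      then have "(\<lambda>m. h (D (left_point t m r) \<omega>) (D r \<omega>)) \<longlonglongrightarrow> h (D r \<omega>) (D r \<omega>)"
        by (rule continuous_on_tendsto_compose[OF h_cont]) auto
      then show "(\<lambda>m. F m x) \<longlonglongrightarrow> F0 x"
        unfolding F_def F0_def x by (auto intro!: tendsto_mult_ennreal tendsto_ennrealI simp: indicator_def)
    qed
  qed (use w_fin in auto)
  then show ?thesis
    by (simp add: iter) (simp add: F_def F0_def split)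
qed

context
  fixes t :: real
  assumes t: "0 < t" "t < T"
begin

abbreviation "s \<equiv> upart t"

lemma s_bounds: "0 \<le> s m i" "s m i < s m (Suc i)" "i < Suc m \<Longrightarrow> s m (Suc i) \<le> t" "i < Suc m \<Longrightarrow> s m (Suc i) \<le> T"
proof -
  show "0 \<le> s m i" using t by (simp add: upart_def)
  show "s m i < s m (Suc i)" using upart_mesh[of t m i] t by (simp add: algebra_simps)
  show le: "s m (Suc i) \<le> t" if "i < Suc m"
    using grid_bounds(2)[OF upart_grid[OF t(1)], of "Suc i" m] that by simp
  show "s m (Suc i) \<le> T" if "i < Suc m" using le[OF that] t by simp
qed

lemma s_ends: "s m 0 = 0" "s m (Suc m) = t"
  using upart_grid[OF t(1), of m] by (auto simp: grid_def)

definition "\<Delta>N m i \<omega> = N (s m (Suc i)) \<omega> - N (s m i) \<omega>"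
definition "\<Delta>V m i \<omega> = V (s m (Suc i)) \<omega> - V (s m i) \<omega>"
definition "\<Delta>K m i \<omega> = K (s m (Suc i)) \<omega> - K (s m i) \<omega>"
definition "\<Delta>K' m i \<omega> = K' (s m (Suc i)) \<omega> - K' (s m i) \<omega>"
definition "\<Delta>U m i \<omega> = \<Delta>V m i \<omega> + (\<Delta>K m i \<omega> - \<Delta>K' m i \<omega>)"

lemma \<Delta>_measurable [measurable]: "\<Delta>N m i \<in> borel_measurable M" "\<Delta>V m i \<in> borel_measurable M"
    "\<Delta>K m i \<in> borel_measurable M" "\<Delta>K' m i \<in> borel_measurable M" "\<Delta>U m i \<in> borel_measurable M"
  unfolding \<Delta>N_def[abs_def] \<Delta>V_def[abs_def] \<Delta>K_def[abs_def] \<Delta>K'_def[abs_def] \<Delta>U_def[abs_def] by measurable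

text \<open>The terms of the second order expansion of \<open>\<phi>(D)\<close> along the partition: the martingale part, its
  quadratic term, the absolutely continuous part, the reflections, and the remainder.\<close>

definition "mart_sum m \<omega> = (\<Sum>i<Suc m. \<phi>' (D (s m i) \<omega>) * \<Delta>N m i \<omega>)"
definition "quad_sum m \<omega> = (\<Sum>i<Suc m. (\<nu> (D (s m i) \<omega>) * \<Delta>N m i \<omega>)\<^sup>2)"
definition "drift_sum m \<omega> = (\<Sum>i<Suc m. \<bar>\<phi>' (D (s m i) \<omega>)\<bar> * \<bar>\<Delta>V m i \<omega>\<bar>)"
definition "refl_sum m \<omega> = max 0 (\<Sum>i<Suc m. \<phi>' (D (s m i) \<omega>) * (\<Delta>K m i \<omega> - \<Delta>K' m i \<omega>))"
definition "rem_sum m \<omega> = (\<Sum>i<Suc m. \<bar>\<Delta>U m i \<omega>\<bar> * min 1 (\<bar>\<Delta>N m i \<omega>\<bar> + \<bar>\<Delta>U m i \<omega>\<bar>))"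

lemma sums_measurable [measurable]: "mart_sum m \<in> borel_measurable M" "quad_sum m \<in> borel_measurable M" "drift_sum m \<in> borel_measurable M"
    "refl_sum m \<in> borel_measurable M" "rem_sum m \<in> borel_measurable M"
  unfolding mart_sum_def[abs_def] quad_sum_def[abs_def] drift_sum_def[abs_def] refl_sum_def[abs_def] rem_sum_def[abs_def] by measurable

lemma sums_nonneg: "0 \<le> quad_sum m \<omega>" "0 \<le> drift_sum m \<omega>" "0 \<le> refl_sum m \<omega>" "0 \<le> rem_sum m \<omega>"
  unfolding quad_sum_def drift_sum_def refl_sum_def rem_sum_def by (simp_all add: sum_nonneg del: sum.lessThan_Suc)

lemma D_increment:
  assumes "\<forall>t\<in>{0..T}. D t \<omega> = V t \<omega> + N t \<omega> + K t \<omega> - K' t \<omega>" "i < Suc m"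
  shows "D (s m (Suc i)) \<omega> = D (s m i) \<omega> + \<Delta>N m i \<omega> + \<Delta>U m i \<omega>"
proof -
  have "s m i \<in> {0..T}" "s m (Suc i) \<in> {0..T}"
    using s_bounds(1)[of m i] s_bounds(2)[of m i] s_bounds(4)[OF assms(2)] by auto
  then show ?thesis using assms(1) by (simp add: \<Delta>N_def \<Delta>V_def \<Delta>K_def \<Delta>K'_def \<Delta>U_def)
qed

text \<open>Each increment of \<open>D\<close> is split into the martingale increment, which is expanded to second order, and
  the rest, which is expanded to first order with the derivative at the left end point.\<close>

lemma path_estimate:
  "AE \<omega> in M. \<phi> (D t \<omega>) - mart_sum m \<omega> \<le> quad_sum m \<omega> + drift_sum m \<omega> + refl_sum m \<omega> + 2 * rem_sum m \<omega>"
  using decomposition D_0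
proof eventually_elim
  case (elim \<omega>)
  let ?d = "\<lambda>i. D (s m i) \<omega>"
  have step: "\<phi> (?d (Suc i)) - \<phi> (?d i) \<le> \<phi>' (?d i) * \<Delta>N m i \<omega> + (\<nu> (?d i) * \<Delta>N m i \<omega>)\<^sup>2
      + \<bar>\<phi>' (?d i)\<bar> * \<bar>\<Delta>V m i \<omega>\<bar> + \<phi>' (?d i) * (\<Delta>K m i \<omega> - \<Delta>K' m i \<omega>)
      + 2 * (\<bar>\<Delta>U m i \<omega>\<bar> * min 1 (\<bar>\<Delta>N m i \<omega>\<bar> + \<bar>\<Delta>U m i \<omega>\<bar>))" if "i < Suc m" for i
  proof -
    have 1: "\<phi> (?d (Suc i)) - \<phi> (?d i + \<Delta>N m i \<omega>) \<le> \<phi>' (?d i) * \<Delta>U m i \<omega>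
        + 2 * (\<bar>\<Delta>U m i \<omega>\<bar> * min 1 (\<bar>\<Delta>N m i \<omega>\<bar> + \<bar>\<Delta>U m i \<omega>\<bar>))"
      using \<phi>_increment[of "?d i + \<Delta>N m i \<omega>" "\<Delta>U m i \<omega>" "?d i"]
      unfolding D_increment[OF elim(1) that] by (simp only: add_diff_cancel_left' mult.assoc)
    have 2: "\<phi> (?d i + \<Delta>N m i \<omega>) \<le> \<phi> (?d i) + \<phi>' (?d i) * \<Delta>N m i \<omega> + (\<nu> (?d i) * \<Delta>N m i \<omega>)\<^sup>2"
      by (rule \<phi>_expansion)
    have 3: "\<phi>' (?d i) * \<Delta>U m i \<omega> = \<phi>' (?d i) * \<Delta>V m i \<omega> + \<phi>' (?d i) * (\<Delta>K m i \<omega> - \<Delta>K' m i \<omega>)"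
      unfolding \<Delta>U_def by (rule distrib_left)
    have 4: "\<phi>' (?d i) * \<Delta>V m i \<omega> \<le> \<bar>\<phi>' (?d i)\<bar> * \<bar>\<Delta>V m i \<omega>\<bar>"
      unfolding abs_mult[symmetric] by (rule abs_ge_self)
    from 1 2 3 4 show ?thesis by linarith
  qed
  have "\<phi> (D t \<omega>) = (\<Sum>i<Suc m. \<phi> (?d (Suc i)) - \<phi> (?d i))"
    using sum_lessThan_telescope[of "\<lambda>i. \<phi> (?d i)" "Suc m"] elim(2) by (simp only: s_ends) simp
  also have "\<dots> \<le> (\<Sum>i<Suc m. \<phi>' (?d i) * \<Delta>N m i \<omega> + (\<nu> (?d i) * \<Delta>N m i \<omega>)\<^sup>2
      + \<bar>\<phi>' (?d i)\<bar> * \<bar>\<Delta>V m i \<omega>\<bar> + \<phi>' (?d i) * (\<Delta>K m i \<omega> - \<Delta>K' m i \<omega>)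
      + 2 * (\<bar>\<Delta>U m i \<omega>\<bar> * min 1 (\<bar>\<Delta>N m i \<omega>\<bar> + \<bar>\<Delta>U m i \<omega>\<bar>)))"
    by (intro sum_mono step) simp
  also have "\<dots> = mart_sum m \<omega> + quad_sum m \<omega> + drift_sum m \<omega> + (\<Sum>i<Suc m. \<phi>' (?d i) * (\<Delta>K m i \<omega> - \<Delta>K' m i \<omega>)) + 2 * rem_sum m \<omega>"
    by (simp only: sum.distrib sum_distrib_left[symmetric] mart_sum_def quad_sum_def drift_sum_def rem_sum_def)
  finally show ?case unfolding refl_sum_def by linarith
qed

lemma martingale_part: "integrable M (mart_sum m)" "(\<integral>\<omega>. mart_sum m \<omega> \<partial>M) = 0"
proof -
  have int: "integrable M (\<lambda>\<omega>. \<phi>' (D (s m i) \<omega>) * \<Delta>N m i \<omega>)" if "i < Suc m" for i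
  proof (rule integrable_mult_N2)
    have "N2 M (\<lambda>\<omega>. \<phi>' (D (s m i) \<omega>)) \<le> ennreal (1\<^sup>2) * N2 M (\<lambda>\<omega>. 1)"
      by (rule N2_le_scaled) (auto simp: abs_\<phi>'_le_1)
    also have "\<dots> < \<infinity>" by (simp add: N2_def emeasure_space_1)
    finally show "N2 M (\<lambda>\<omega>. \<phi>' (D (s m i) \<omega>)) < \<infinity>" .
    show "N2 M (\<Delta>N m i) < \<infinity>"
      unfolding \<Delta>N_def[abs_def] using s_bounds that by (intro N_L2) auto
  qed simp_all
  then show "integrable M (mart_sum m)" unfolding mart_sum_def[abs_def] by (intro Bochner_Integration.integrable_sum) simp
  have "(\<integral>\<omega>. mart_sum m \<omega> \<partial>M) = (\<Sum>i<Suc m. \<integral>\<omega>. \<phi>' (D (s m i) \<omega>) * \<Delta>N m i \<omega> \<partial>M)"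
    unfolding mart_sum_def by (intro Bochner_Integration.integral_sum int) simp
  also have "\<dots> = 0"
    unfolding \<Delta>N_def by (intro sum.neutral ballI N_orthogonal) (use s_bounds in auto)
  finally show "(\<integral>\<omega>. mart_sum m \<omega> \<partial>M) = 0" .
qed

lemma expectation_estimate:
  "(\<integral>\<^sup>+\<omega>. ennreal (\<phi> (D t \<omega>)) \<partial>M) \<le> (\<integral>\<^sup>+\<omega>. ennreal (quad_sum m \<omega>) \<partial>M) + (\<integral>\<^sup>+\<omega>. ennreal (drift_sum m \<omega>) \<partial>M)
    + (\<integral>\<^sup>+\<omega>. ennreal (refl_sum m \<omega>) \<partial>M) + 2 * (\<integral>\<^sup>+\<omega>. ennreal (rem_sum m \<omega>) \<partial>M)"
proof -
  have int: "integrable M (\<lambda>\<omega>. \<phi> (D t \<omega>))"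
    by (rule integrable_const_bound[of _ 1]) (auto simp: \<phi>_nonneg \<phi>_le_1)
  have "(\<integral>\<^sup>+\<omega>. ennreal (\<phi> (D t \<omega>)) \<partial>M) = ennreal (\<integral>\<omega>. \<phi> (D t \<omega>) - mart_sum m \<omega> \<partial>M)"
    using int martingale_part[of m] by (simp add: nn_integral_eq_integral \<phi>_nonneg)
  also have "\<dots> \<le> (\<integral>\<^sup>+\<omega>. ennreal (quad_sum m \<omega> + drift_sum m \<omega> + refl_sum m \<omega> + 2 * rem_sum m \<omega>) \<partial>M)"
    using int martingale_part[of m] sums_nonneg[of m] by (intro ennreal_integral_le path_estimate) auto
  also have "\<dots> = (\<integral>\<^sup>+\<omega>. ennreal (quad_sum m \<omega>) + ennreal (drift_sum m \<omega>) + ennreal (refl_sum m \<omega>) + 2 * ennreal (rem_sum m \<omega>) \<partial>M)"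
    using sums_nonneg[of m] by (simp add: ennreal_plus ennreal_mult')
  also have "\<dots> = (\<integral>\<^sup>+\<omega>. ennreal (quad_sum m \<omega>) \<partial>M) + (\<integral>\<^sup>+\<omega>. ennreal (drift_sum m \<omega>) \<partial>M)
    + (\<integral>\<^sup>+\<omega>. ennreal (refl_sum m \<omega>) \<partial>M) + 2 * (\<integral>\<^sup>+\<omega>. ennreal (rem_sum m \<omega>) \<partial>M)"
    by (simp add: nn_integral_add nn_integral_cmult)
  finally show ?thesis .
qed

lemma quad_sum_estimate: "(\<integral>\<^sup>+\<omega>. ennreal (quad_sum m \<omega>) \<partial>M) \<le> ennreal C2 *
  (\<integral>\<^sup>+r. (\<integral>\<^sup>+\<omega>. ennreal ((\<nu> (D (left_point t m r) \<omega>) * D r \<omega>)\<^sup>2) \<partial>M) * indicator {0..<t} r \<partial>lborel)"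
proof -
  let ?\<Phi> = "\<lambda>a r. N2 M (\<lambda>\<omega>. \<nu> (D a \<omega>) * D r \<omega>)"
  have m: "?\<Phi> a \<in> borel_measurable lborel" for a unfolding N2_def by measurable
  have "(\<integral>\<^sup>+\<omega>. ennreal (quad_sum m \<omega>) \<partial>M) = (\<integral>\<^sup>+\<omega>. (\<Sum>i<Suc m. ennreal ((\<nu> (D (s m i) \<omega>) * \<Delta>N m i \<omega>)\<^sup>2)) \<partial>M)"
    unfolding quad_sum_def by (subst sum_ennreal) auto
  also have "\<dots> = (\<Sum>i<Suc m. N2 M (\<lambda>\<omega>. \<nu> (D (s m i) \<omega>) * \<Delta>N m i \<omega>))"
    unfolding N2_def by (rule nn_integral_sum) measurable
  also have "\<dots> \<le> (\<Sum>i<Suc m. ennreal C2 * (\<integral>\<^sup>+r. ?\<Phi> (s m i) r * indicator {s m i..<s m (Suc i)} r \<partial>lborel))"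
    unfolding \<Delta>N_def by (intro sum_mono N_dominated) (use s_bounds in auto)
  also have "\<dots> = ennreal C2 * (\<integral>\<^sup>+r. ?\<Phi> (left_point t m r) r * indicator {0..<t} r \<partial>lborel)"
    unfolding sum_distrib_left[symmetric] sum_cells_nn_integral[OF t(1), of m ?\<Phi>, OF m] ..
  finally show ?thesis by (simp add: N2_def)
qed

lemma drift_sum_estimate: "(\<integral>\<^sup>+\<omega>. ennreal (drift_sum m \<omega>) \<partial>M) \<le> ennreal C1 *
  (\<integral>\<^sup>+r. (\<integral>\<^sup>+\<omega>. ennreal (\<bar>\<phi>' (D (left_point t m r) \<omega>)\<bar> * \<bar>D r \<omega>\<bar>) \<partial>M) * indicator {0..<t} r \<partial>lborel)"
proof -
  let ?\<Phi> = "\<lambda>a r. \<integral>\<^sup>+\<omega>. ennreal (\<bar>\<phi>' (D a \<omega>)\<bar> * \<bar>D r \<omega>\<bar>) \<partial>M"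
  have m: "?\<Phi> a \<in> borel_measurable lborel" for a by measurable
  have one: "(\<integral>\<^sup>+\<omega>. ennreal (\<bar>\<phi>' (D (s m i) \<omega>)\<bar> * \<bar>\<Delta>V m i \<omega>\<bar>) \<partial>M)
      \<le> ennreal C1 * (\<integral>\<^sup>+r. ?\<Phi> (s m i) r * indicator {s m i..<s m (Suc i)} r \<partial>lborel)" if i: "i < Suc m" for i
  proof -
    let ?I = "indicator {s m i..<s m (Suc i)} :: real \<Rightarrow> ennreal"
    have "AE \<omega> in M. ennreal \<bar>\<Delta>V m i \<omega>\<bar> \<le> ennreal C1 * (\<integral>\<^sup>+r. ennreal \<bar>D r \<omega>\<bar> * ?I r \<partial>lborel)"
      unfolding \<Delta>V_def using s_bounds i by (intro V_dominated) auto
    then have "(\<integral>\<^sup>+\<omega>. ennreal (\<bar>\<phi>' (D (s m i) \<omega>)\<bar> * \<bar>\<Delta>V m i \<omega>\<bar>) \<partial>M)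
        \<le> (\<integral>\<^sup>+\<omega>. ennreal C1 * (\<integral>\<^sup>+r. ennreal (\<bar>\<phi>' (D (s m i) \<omega>)\<bar> * \<bar>D r \<omega>\<bar>) * ?I r \<partial>lborel) \<partial>M)"
    proof (intro nn_integral_mono_AE, elim eventually_mono)
      fix \<omega> assume le: "ennreal \<bar>\<Delta>V m i \<omega>\<bar> \<le> ennreal C1 * (\<integral>\<^sup>+r. ennreal \<bar>D r \<omega>\<bar> * ?I r \<partial>lborel)"
      have "ennreal (\<bar>\<phi>' (D (s m i) \<omega>)\<bar> * \<bar>\<Delta>V m i \<omega>\<bar>)
          \<le> ennreal \<bar>\<phi>' (D (s m i) \<omega>)\<bar> * (ennreal C1 * (\<integral>\<^sup>+r. ennreal \<bar>D r \<omega>\<bar> * ?I r \<partial>lborel))"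
        using le by (simp add: ennreal_mult mult_left_mono)
      also have "\<dots> = ennreal C1 * (\<integral>\<^sup>+r. ennreal \<bar>\<phi>' (D (s m i) \<omega>)\<bar> * (ennreal \<bar>D r \<omega>\<bar> * ?I r) \<partial>lborel)"
        by (subst nn_integral_cmult) (auto simp: mult_ac)
      finally show "ennreal (\<bar>\<phi>' (D (s m i) \<omega>)\<bar> * \<bar>\<Delta>V m i \<omega>\<bar>)
          \<le> ennreal C1 * (\<integral>\<^sup>+r. ennreal (\<bar>\<phi>' (D (s m i) \<omega>)\<bar> * \<bar>D r \<omega>\<bar>) * ?I r \<partial>lborel)"
        by (simp add: ennreal_mult mult.assoc)
    qed
    also have "\<dots> = ennreal C1 * (\<integral>\<^sup>+\<omega>. (\<integral>\<^sup>+r. ennreal (\<bar>\<phi>' (D (s m i) \<omega>)\<bar> * \<bar>D r \<omega>\<bar>) * ?I r \<partial>lborel) \<partial>M)"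
      by (rule nn_integral_cmult) measurable
    also have "(\<integral>\<^sup>+\<omega>. (\<integral>\<^sup>+r. ennreal (\<bar>\<phi>' (D (s m i) \<omega>)\<bar> * \<bar>D r \<omega>\<bar>) * ?I r \<partial>lborel) \<partial>M)
        = (\<integral>\<^sup>+r. (\<integral>\<^sup>+\<omega>. ennreal (\<bar>\<phi>' (D (s m i) \<omega>)\<bar> * \<bar>D r \<omega>\<bar>) * ?I r \<partial>M) \<partial>lborel)"
      by (rule LM.Fubini') measurable
    also have "\<dots> = (\<integral>\<^sup>+r. ?\<Phi> (s m i) r * ?I r \<partial>lborel)"
      by (intro nn_integral_cong) (auto simp: indicator_def)
    finally show ?thesis .
  qed
  have "(\<integral>\<^sup>+\<omega>. ennreal (drift_sum m \<omega>) \<partial>M) = (\<integral>\<^sup>+\<omega>. (\<Sum>i<Suc m. ennreal (\<bar>\<phi>' (D (s m i) \<omega>)\<bar> * \<bar>\<Delta>V m i \<omega>\<bar>)) \<partial>M)"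
    unfolding drift_sum_def by (subst sum_ennreal) auto
  also have "\<dots> = (\<Sum>i<Suc m. \<integral>\<^sup>+\<omega>. ennreal (\<bar>\<phi>' (D (s m i) \<omega>)\<bar> * \<bar>\<Delta>V m i \<omega>\<bar>) \<partial>M)"
    by (rule nn_integral_sum) measurable
  also have "\<dots> \<le> (\<Sum>i<Suc m. ennreal C1 * (\<integral>\<^sup>+r. ?\<Phi> (s m i) r * indicator {s m i..<s m (Suc i)} r \<partial>lborel))"
    by (intro sum_mono one) simp
  also have "\<dots> = ennreal C1 * (\<integral>\<^sup>+r. ?\<Phi> (left_point t m r) r * indicator {0..<t} r \<partial>lborel)"
    unfolding sum_distrib_left[symmetric] sum_cells_nn_integral[OF t(1), of m ?\<Phi>, OF m] ..
  finally show ?thesis .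
qed

text \<open>A bound for the variation of the part of finite variation on \<open>[0,t]\<close>, uniform in the partition. It is
  integrable because \<open>t < T\<close>.\<close>

definition "total_var \<omega> = ennreal C1 * (\<integral>\<^sup>+r. ennreal \<bar>D r \<omega>\<bar> * indicator {0..<t} r \<partial>lborel)
    + ennreal ((K t \<omega> - K 0 \<omega>) + (K' t \<omega> - K' 0 \<omega>))"

lemma total_var_measurable [measurable]: "total_var \<in> borel_measurable M"
  unfolding total_var_def[abs_def] by measurable

lemma total_var_finite: "(\<integral>\<^sup>+\<omega>. total_var \<omega> \<partial>M) < \<infinity>"
proof -
  have "(\<integral>\<^sup>+\<omega>. (\<integral>\<^sup>+r. ennreal \<bar>D r \<omega>\<bar> * indicator {0..<t} r \<partial>lborel) \<partial>M)
      = (\<integral>\<^sup>+r. (\<integral>\<^sup>+\<omega>. ennreal \<bar>D r \<omega>\<bar> * indicator {0..<t} r \<partial>M) \<partial>lborel)"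
    by (rule LM.Fubini') measurable
  also have "\<dots> \<le> (\<integral>\<^sup>+r. indicator {0..<t} r + N2 M (D r) * indicator {0..<T} r \<partial>lborel)"
  proof (rule nn_integral_mono)
    fix r
    have "\<bar>x\<bar> \<le> 1 + x\<^sup>2" for x :: real
      using zero_le_power2[of "\<bar>x\<bar> - 1"] by (simp add: power2_eq_square algebra_simps)
    then have "(\<integral>\<^sup>+\<omega>. ennreal \<bar>D r \<omega>\<bar> \<partial>M) \<le> (\<integral>\<^sup>+\<omega>. ennreal (1 + (D r \<omega>)\<^sup>2) \<partial>M)"
      by (intro nn_integral_mono ennreal_leI)
    also have "\<dots> = 1 + N2 M (D r)" by (simp add: N2_def nn_integral_add emeasure_space_1)
    finally show "(\<integral>\<^sup>+\<omega>. ennreal \<bar>D r \<omega>\<bar> * indicator {0..<t} r \<partial>M) \<le> indicator {0..<t} r + N2 M (D r) * indicator {0..<T} r"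
      using t by (auto simp: indicator_def)
  qed
  also have "\<dots> = (\<integral>\<^sup>+r. indicator {0..<t} r \<partial>lborel) + (\<integral>\<^sup>+r. N2 M (D r) * indicator {0..<T} r \<partial>lborel)"
    unfolding N2_def by (intro nn_integral_add) measurable
  also have "\<dots> < \<infinity>" using D_L2 t by (simp add: ennreal_add_eq_top less_top[symmetric])
  finally have 1: "(\<integral>\<^sup>+\<omega>. (\<integral>\<^sup>+r. ennreal \<bar>D r \<omega>\<bar> * indicator {0..<t} r \<partial>lborel) \<partial>M) < \<infinity>" .
  have 2: "(\<integral>\<^sup>+\<omega>. ennreal ((K t \<omega> - K 0 \<omega>) + (K' t \<omega> - K' 0 \<omega>)) \<partial>M) < \<infinity>"
  proof -
    have "integrable M (\<lambda>\<omega>. (K t \<omega> - K 0 \<omega>) + (K' t \<omega> - K' 0 \<omega>))"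
      using K_integrable[of t] t by simp
    then have "(\<integral>\<^sup>+\<omega>. ennreal (norm ((K t \<omega> - K 0 \<omega>) + (K' t \<omega> - K' 0 \<omega>))) \<partial>M) < \<infinity>"
      unfolding integrable_iff_bounded by simp
    then show ?thesis by (rule le_less_trans[rotated]) (intro nn_integral_mono ennreal_leI, simp)
  qed
  have "(\<integral>\<^sup>+\<omega>. total_var \<omega> \<partial>M) = ennreal C1 * (\<integral>\<^sup>+\<omega>. (\<integral>\<^sup>+r. ennreal \<bar>D r \<omega>\<bar> * indicator {0..<t} r \<partial>lborel) \<partial>M)
      + (\<integral>\<^sup>+\<omega>. ennreal ((K t \<omega> - K 0 \<omega>) + (K' t \<omega> - K' 0 \<omega>)) \<partial>M)"
    unfolding total_var_def by (subst nn_integral_add, measurable, subst nn_integral_cmult, measurable)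
  then show ?thesis using 1 2 by (simp add: ennreal_mult_less_top)
qed

lemma increments_sum:
  assumes "mono_on {0..T} (\<lambda>t. K t \<omega>)" "mono_on {0..T} (\<lambda>t. K' t \<omega>)"
  shows "i < Suc m \<Longrightarrow> 0 \<le> \<Delta>K m i \<omega>" "i < Suc m \<Longrightarrow> 0 \<le> \<Delta>K' m i \<omega>"
    "(\<Sum>i<Suc m. \<Delta>K m i \<omega> + \<Delta>K' m i \<omega>) = (K t \<omega> - K 0 \<omega>) + (K' t \<omega> - K' 0 \<omega>)"
proof -
  have mem: "s m i \<in> {0..T}" "s m (Suc i) \<in> {0..T}" "s m i \<le> s m (Suc i)" if "i < Suc m" for i
    using s_bounds(1)[of m i] s_bounds(2)[of m i] s_bounds(4)[OF that] by auto
  show "0 \<le> \<Delta>K m i \<omega>" if "i < Suc m"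
    using mono_onD[OF assms(1) mem[OF that]] by (simp add: \<Delta>K_def)
  show "0 \<le> \<Delta>K' m i \<omega>" if "i < Suc m"
    using mono_onD[OF assms(2) mem[OF that]] by (simp add: \<Delta>K'_def)
  have "(\<Sum>i<Suc m. \<Delta>K m i \<omega> + \<Delta>K' m i \<omega>) = (\<Sum>i<Suc m. \<Delta>K m i \<omega>) + (\<Sum>i<Suc m. \<Delta>K' m i \<omega>)"
    by (rule sum.distrib)
  also have "(\<Sum>i<Suc m. \<Delta>K m i \<omega>) = K t \<omega> - K 0 \<omega>"
    unfolding \<Delta>K_def sum_lessThan_telescope[of "\<lambda>i. K (s m i) \<omega>" "Suc m"] s_ends ..
  also have "(\<Sum>i<Suc m. \<Delta>K' m i \<omega>) = K' t \<omega> - K' 0 \<omega>"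
    unfolding \<Delta>K'_def sum_lessThan_telescope[of "\<lambda>i. K' (s m i) \<omega>" "Suc m"] s_ends ..
  finally show "(\<Sum>i<Suc m. \<Delta>K m i \<omega> + \<Delta>K' m i \<omega>) = (K t \<omega> - K 0 \<omega>) + (K' t \<omega> - K' 0 \<omega>)" .
qed

lemma variation_bound: "AE \<omega> in M. \<forall>m. ennreal (\<Sum>i<Suc m. \<bar>\<Delta>U m i \<omega>\<bar>) \<le> total_var \<omega>"
proof -
  have "AE \<omega> in M. \<forall>m i. i < Suc m \<longrightarrow> ennreal \<bar>\<Delta>V m i \<omega>\<bar>
      \<le> ennreal C1 * (\<integral>\<^sup>+r. ennreal \<bar>D r \<omega>\<bar> * indicator {s m i..<s m (Suc i)} r \<partial>lborel)"
    unfolding AE_all_countable \<Delta>V_def using s_bounds by (auto intro!: V_dominated)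
  then show ?thesis using K_mono
  proof eventually_elim
    case (elim \<omega>)
    show ?case
    proof
      fix m
      note inc = increments_sum[OF elim(2,3), where m = m]
      have "\<bar>\<Delta>U m i \<omega>\<bar> \<le> \<bar>\<Delta>V m i \<omega>\<bar> + (\<Delta>K m i \<omega> + \<Delta>K' m i \<omega>)" if "i < Suc m" for i
        using inc(1,2)[OF that] unfolding \<Delta>U_def by linarith
      then have "(\<Sum>i<Suc m. \<bar>\<Delta>U m i \<omega>\<bar>) \<le> (\<Sum>i<Suc m. \<bar>\<Delta>V m i \<omega>\<bar> + (\<Delta>K m i \<omega> + \<Delta>K' m i \<omega>))"
        by (intro sum_mono) simp
      also have "\<dots> = (\<Sum>i<Suc m. \<bar>\<Delta>V m i \<omega>\<bar>) + ((K t \<omega> - K 0 \<omega>) + (K' t \<omega> - K' 0 \<omega>))"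
        unfolding sum.distrib[of "\<lambda>i. \<bar>\<Delta>V m i \<omega>\<bar>"] inc(3) ..
      finally have "ennreal (\<Sum>i<Suc m. \<bar>\<Delta>U m i \<omega>\<bar>)
          \<le> ennreal ((\<Sum>i<Suc m. \<bar>\<Delta>V m i \<omega>\<bar>) + ((K t \<omega> - K 0 \<omega>) + (K' t \<omega> - K' 0 \<omega>)))"
        by (rule ennreal_leI)
      also have "\<dots> = (\<Sum>i<Suc m. ennreal \<bar>\<Delta>V m i \<omega>\<bar>) + ennreal ((K t \<omega> - K 0 \<omega>) + (K' t \<omega> - K' 0 \<omega>))"
      proof -
        have "0 \<le> (K t \<omega> - K 0 \<omega>) + (K' t \<omega> - K' 0 \<omega>)"
          using mono_onD[OF elim(2), of 0 t] mono_onD[OF elim(3), of 0 t] t by simp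
        then show ?thesis by (subst ennreal_plus) (auto simp: sum_nonneg sum_ennreal simp del: sum.lessThan_Suc)
      qed
      also have "(\<Sum>i<Suc m. ennreal \<bar>\<Delta>V m i \<omega>\<bar>)
          \<le> (\<Sum>i<Suc m. ennreal C1 * (\<integral>\<^sup>+r. ennreal \<bar>D r \<omega>\<bar> * indicator {s m i..<s m (Suc i)} r \<partial>lborel))"
        using elim(1) by (intro sum_mono) simp
      also have "\<dots> = ennreal C1 * (\<integral>\<^sup>+r. ennreal \<bar>D r \<omega>\<bar> * indicator {0..<t} r \<partial>lborel)"
        unfolding sum_distrib_left[symmetric]
        using sum_cells_nn_integral[OF t(1), of m "\<lambda>_ r. ennreal \<bar>D r \<omega>\<bar>"] by simp
      finally show "ennreal (\<Sum>i<Suc m. \<bar>\<Delta>U m i \<omega>\<bar>) \<le> total_var \<omega>"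
        unfolding total_var_def by (simp add: add_right_mono)
    qed
  qed
qed

lemma uniform_increments:
  assumes "continuous_on UNIV X" "0 < (e::real)"
  shows "\<forall>\<^sub>F m in sequentially. \<forall>i<Suc m. \<bar>X (s m (Suc i)) - X (s m i)\<bar> < e"
proof -
  have "uniformly_continuous_on {0..t} X"
    by (rule compact_uniformly_continuous) (use continuous_on_subset[OF assms(1)] in auto)
  then obtain d where d: "d > 0" "\<And>x y. x \<in> {0..t} \<Longrightarrow> y \<in> {0..t} \<Longrightarrow> dist y x < d \<Longrightarrow> dist (X y) (X x) < e"
    using assms(2) unfolding uniformly_continuous_on_def by metis
  have "(\<lambda>m. t / Suc m) \<longlonglongrightarrow> 0" using LIMSEQ_Suc[OF lim_const_over_n[of t]] by simp
  then have "\<forall>\<^sub>F m in sequentially. t / Suc m < d" by (rule order_tendstoD(2)) (rule d(1))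
  then show ?thesis
  proof eventually_elim
    case (elim m)
    show ?case
    proof (intro allI impI)
      fix i assume i: "i < Suc m"
      have "dist (X (s m (Suc i))) (X (s m i)) < e"
        using s_bounds(1)[of m i] s_bounds(2)[of m i] s_bounds(3)[OF i] elim upart_mesh[of t m i] t
        by (intro d(2)) (auto simp: dist_real_def)
      then show "\<bar>X (s m (Suc i)) - X (s m i)\<bar> < e" by (simp add: dist_real_def)
    qed
  qed
qed

text \<open>Along each path the increments tend to 0 uniformly by continuity while their sum stays bounded by the
  total variation.\<close>

lemma rem_sum_limit: "(\<lambda>m. \<integral>\<^sup>+\<omega>. ennreal (rem_sum m \<omega>) \<partial>M) \<longlonglongrightarrow> 0"
proof -
  have Hfin: "AE \<omega> in M. total_var \<omega> \<noteq> \<infinity>"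
    using total_var_finite by (intro nn_integral_noteq_infinite) auto
  have "(\<lambda>m. \<integral>\<^sup>+\<omega>. ennreal (rem_sum m \<omega>) \<partial>M) \<longlonglongrightarrow> (\<integral>\<^sup>+\<omega>. 0 \<partial>M)"
  proof (rule nn_integral_dominated_convergence)
    show "AE \<omega> in M. ennreal (rem_sum m \<omega>) \<le> total_var \<omega>" for m
      using variation_bound
    proof eventually_elim
      case (elim \<omega>)
      have "rem_sum m \<omega> \<le> (\<Sum>i<Suc m. \<bar>\<Delta>U m i \<omega>\<bar>)"
        unfolding rem_sum_def by (intro sum_mono mult_left_le) auto
      then show ?case using elim by (meson ennreal_leI order_trans)
    qed
    show "(\<integral>\<^sup>+\<omega>. total_var \<omega> \<partial>M) < \<infinity>" by (rule total_var_finite)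
    show "AE \<omega> in M. (\<lambda>m. ennreal (rem_sum m \<omega>)) \<longlonglongrightarrow> 0"
      using variation_bound Hfin decomposition
    proof eventually_elim
      case (elim \<omega>)
      obtain h where h: "0 \<le> h" "total_var \<omega> = ennreal h" using elim(2) by (cases "total_var \<omega>") auto
      have var: "(\<Sum>i<Suc m. \<bar>\<Delta>U m i \<omega>\<bar>) \<le> h" for m
        using elim(1) h(1) unfolding h(2) by (simp only: ennreal_le_iff)
      have "(\<lambda>m. rem_sum m \<omega>) \<longlonglongrightarrow> 0"
      proof (rule LIMSEQ_I)
        fix e :: real assume e: "0 < e"
        \<comment> \<open>Three increments of size \<open>d\<close> bound the minimum in each term; adding 1 guards against \<open>h = 0\<close>.\<close>
        define d where "d = e / (3 * (h + 1))"
        have d: "0 < d" "3 * d * h < e"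
        proof -
          show "0 < d" using e h by (simp add: d_def)
          have "3 * d * h = e * (h / (h + 1))" unfolding d_def using h(1) by (simp add: divide_simps)
          also have "\<dots> < e * 1" using e h by (intro mult_strict_left_mono) auto
          finally show "3 * d * h < e" by simp
        qed
        have "\<forall>\<^sub>F m in sequentially. norm (rem_sum m \<omega> - 0) < e"
          using uniform_increments[OF D_cont[of \<omega>] d(1)] uniform_increments[OF N_cont[of \<omega>] d(1)]
        proof eventually_elim
          case (elim m)
          have "\<bar>\<Delta>N m i \<omega>\<bar> + \<bar>\<Delta>U m i \<omega>\<bar> \<le> 3 * d" if i: "i < Suc m" for i
          proof -
            have "\<Delta>U m i \<omega> = (D (s m (Suc i)) \<omega> - D (s m i) \<omega>) - \<Delta>N m i \<omega>"
              using D_increment[OF \<open>\<forall>t\<in>{0..T}. D t \<omega> = V t \<omega> + N t \<omega> + K t \<omega> - K' t \<omega>\<close> i] by simp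
            moreover have "\<bar>\<Delta>N m i \<omega>\<bar> < d" "\<bar>D (s m (Suc i)) \<omega> - D (s m i) \<omega>\<bar> < d"
              using elim i by (auto simp: \<Delta>N_def)
            ultimately show ?thesis by linarith
          qed
          then have "rem_sum m \<omega> \<le> (\<Sum>i<Suc m. \<bar>\<Delta>U m i \<omega>\<bar> * (3 * d))"
            unfolding rem_sum_def by (intro sum_mono mult_left_mono) (auto simp: min_le_iff_disj)
          also have "\<dots> \<le> h * (3 * d)"
            unfolding sum_distrib_right[symmetric] using d(1) by (intro mult_right_mono var) simp
          also have "\<dots> < e" using d(2) by (simp add: mult_ac)
          finally show ?case using sums_nonneg(4)[of m \<omega>] by simp
        qed
        then show "\<exists>no. \<forall>n\<ge>no. norm (rem_sum n \<omega> - 0) < e" by (simp add: eventually_sequentially)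
      qed
      from tendsto_ennrealI[OF this] show "(\<lambda>m. ennreal (rem_sum m \<omega>)) \<longlonglongrightarrow> 0" by simp
    qed
  qed simp_all
  then show ?thesis by simp
qed

text \<open>Minimality gives the pathwise limit; the total variation dominates.\<close>

lemma refl_sum_limit: "(\<lambda>m. \<integral>\<^sup>+\<omega>. ennreal (refl_sum m \<omega>) \<partial>M) \<longlonglongrightarrow> 0"
proof -
  have "(\<lambda>m. \<integral>\<^sup>+\<omega>. ennreal (refl_sum m \<omega>) \<partial>M) \<longlonglongrightarrow> (\<integral>\<^sup>+\<omega>. 0 \<partial>M)"
  proof (rule nn_integral_dominated_convergence)
    show "AE \<omega> in M. ennreal (refl_sum m \<omega>) \<le> total_var \<omega>" for m
      using K_mono
    proof eventually_elim
      case (elim \<omega>)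
      note inc = increments_sum[OF elim, where m = m]
      have "\<phi>' (D (s m i) \<omega>) * (\<Delta>K m i \<omega> - \<Delta>K' m i \<omega>) \<le> \<Delta>K m i \<omega> + \<Delta>K' m i \<omega>" if i: "i < Suc m" for i
      proof -
        have "\<phi>' (D (s m i) \<omega>) * (\<Delta>K m i \<omega> - \<Delta>K' m i \<omega>) \<le> \<bar>\<phi>' (D (s m i) \<omega>)\<bar> * \<bar>\<Delta>K m i \<omega> - \<Delta>K' m i \<omega>\<bar>"
          unfolding abs_mult[symmetric] by (rule abs_ge_self)
        also have "\<dots> \<le> 1 * \<bar>\<Delta>K m i \<omega> - \<Delta>K' m i \<omega>\<bar>" by (rule mult_right_mono[OF abs_\<phi>'_le_1]) simp
        also have "\<dots> \<le> \<Delta>K m i \<omega> + \<Delta>K' m i \<omega>" using inc(1,2)[OF i] by simp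
        finally show ?thesis .
      qed
      then have "(\<Sum>i<Suc m. \<phi>' (D (s m i) \<omega>) * (\<Delta>K m i \<omega> - \<Delta>K' m i \<omega>)) \<le> (\<Sum>i<Suc m. \<Delta>K m i \<omega> + \<Delta>K' m i \<omega>)"
        by (intro sum_mono) simp
      moreover have "0 \<le> (\<Sum>i<Suc m. \<Delta>K m i \<omega> + \<Delta>K' m i \<omega>)"
        by (intro sum_nonneg add_nonneg_nonneg inc(1,2)) simp_all
      ultimately have "refl_sum m \<omega> \<le> (K t \<omega> - K 0 \<omega>) + (K' t \<omega> - K' 0 \<omega>)"
        unfolding refl_sum_def inc(3) by simp
      then have "ennreal (refl_sum m \<omega>) \<le> ennreal ((K t \<omega> - K 0 \<omega>) + (K' t \<omega> - K' 0 \<omega>))" by (rule ennreal_leI)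
      also have "\<dots> \<le> total_var \<omega>" unfolding total_var_def by simp
      finally show ?case .
    qed
    show "(\<integral>\<^sup>+\<omega>. total_var \<omega> \<partial>M) < \<infinity>" by (rule total_var_finite)
    show "AE \<omega> in M. (\<lambda>m. ennreal (refl_sum m \<omega>)) \<longlonglongrightarrow> 0"
      using reflection
    proof eventually_elim
      case (elim \<omega>)
      have "(\<lambda>m. refl_sum m \<omega>) \<longlonglongrightarrow> 0"
      proof (rule order_tendstoI)
        fix a :: real assume "a < 0"
        then show "\<forall>\<^sub>F m in sequentially. a < refl_sum m \<omega>"
          using sums_nonneg(3) by (intro always_eventually allI) (rule less_le_trans)
      next
        fix a :: real assume a: "0 < a"
        have "\<forall>\<^sub>F m in sequentially. (\<Sum>i<Suc m. \<phi>' (D (s m i) \<omega>) * (\<Delta>K m i \<omega> - \<Delta>K' m i \<omega>)) \<le> a / 2"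
          unfolding \<Delta>K_def \<Delta>K'_def using elim[rule_format, of t "a / 2"] a t by simp
        then show "\<forall>\<^sub>F m in sequentially. refl_sum m \<omega> < a"
          by (rule eventually_mono) (use a in \<open>simp add: refl_sum_def del: sum.lessThan_Suc\<close>)
      qed
      from tendsto_ennrealI[OF this] show "(\<lambda>m. ennreal (refl_sum m \<omega>)) \<longlonglongrightarrow> 0" by simp
    qed
  qed simp_all
  then show ?thesis by simp
qed

lemma \<phi>_integral_inequality:
  "(\<integral>\<^sup>+\<omega>. ennreal (\<phi> (D t \<omega>)) \<partial>M)
    \<le> ennreal (C2 + 2 * C1) * (\<integral>\<^sup>+r. (\<integral>\<^sup>+\<omega>. ennreal (\<phi> (D r \<omega>)) \<partial>M) * indicator {0..<t} r \<partial>lborel)"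
proof -
  let ?I = "\<lambda>f. \<integral>\<^sup>+r. (\<integral>\<^sup>+\<omega>. ennreal (f r \<omega>) \<partial>M) * indicator {0..<t} r \<partial>lborel"
  let ?q = "\<lambda>x y. (\<nu> x * y)\<^sup>2" and ?l = "\<lambda>x y. \<bar>\<phi>' x\<bar> * \<bar>y :: real\<bar>"
  have q: "(\<lambda>m. ?I (\<lambda>r \<omega>. ?q (D (left_point t m r) \<omega>) (D r \<omega>))) \<longlonglongrightarrow> ?I (\<lambda>r \<omega>. ?q (D r \<omega>) (D r \<omega>))"
  proof (rule riemann_limit[of t ?q])
    show "?q x y \<le> 1 + y\<^sup>2" for x y
    proof -
      have "(\<nu> x)\<^sup>2 * y\<^sup>2 \<le> 1 * y\<^sup>2"
        using \<nu>_pos[of x] \<nu>_le_1[of x] by (intro mult_right_mono power_le_one) auto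
      then show ?thesis by (simp add: power_mult_distrib)
    qed
  qed (use t in \<open>auto intro!: continuous_intros \<phi>_continuous\<close>)
  have l: "(\<lambda>m. ?I (\<lambda>r \<omega>. ?l (D (left_point t m r) \<omega>) (D r \<omega>))) \<longlonglongrightarrow> ?I (\<lambda>r \<omega>. ?l (D r \<omega>) (D r \<omega>))"
  proof (rule riemann_limit[of t ?l])
    show "?l x y \<le> 1 + y\<^sup>2" for x y
    proof -
      have "?l x y \<le> 1 * \<bar>y\<bar>" by (rule mult_right_mono[OF abs_\<phi>'_le_1]) simp
      also have "\<dots> \<le> 1 + y\<^sup>2"
        using zero_le_power2[of "\<bar>y\<bar> - 1"] by (simp add: power2_eq_square algebra_simps)
      finally show ?thesis .
    qed
  qed (use t in \<open>auto intro!: continuous_intros \<phi>_continuous\<close>)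
  have lim: "(\<lambda>m. ennreal C2 * ?I (\<lambda>r \<omega>. ?q (D (left_point t m r) \<omega>) (D r \<omega>))
      + ennreal C1 * ?I (\<lambda>r \<omega>. ?l (D (left_point t m r) \<omega>) (D r \<omega>))
      + (\<integral>\<^sup>+\<omega>. ennreal (refl_sum m \<omega>) \<partial>M) + 2 * (\<integral>\<^sup>+\<omega>. ennreal (rem_sum m \<omega>) \<partial>M))
    \<longlonglongrightarrow> ennreal C2 * ?I (\<lambda>r \<omega>. ?q (D r \<omega>) (D r \<omega>)) + ennreal C1 * ?I (\<lambda>r \<omega>. ?l (D r \<omega>) (D r \<omega>)) + 0 + 2 * 0"
    by (intro tendsto_add ennreal_tendsto_cmult q l refl_sum_limit rem_sum_limit) auto
  have "(\<integral>\<^sup>+\<omega>. ennreal (\<phi> (D t \<omega>)) \<partial>M)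
      \<le> ennreal C2 * ?I (\<lambda>r \<omega>. ?q (D r \<omega>) (D r \<omega>)) + ennreal C1 * ?I (\<lambda>r \<omega>. ?l (D r \<omega>) (D r \<omega>)) + 0 + 2 * 0"
  proof (rule LIMSEQ_le_const[OF lim], intro exI[of _ 0] allI impI)
    fix m
    show "(\<integral>\<^sup>+\<omega>. ennreal (\<phi> (D t \<omega>)) \<partial>M) \<le> ennreal C2 * ?I (\<lambda>r \<omega>. ?q (D (left_point t m r) \<omega>) (D r \<omega>))
      + ennreal C1 * ?I (\<lambda>r \<omega>. ?l (D (left_point t m r) \<omega>) (D r \<omega>))
      + (\<integral>\<^sup>+\<omega>. ennreal (refl_sum m \<omega>) \<partial>M) + 2 * (\<integral>\<^sup>+\<omega>. ennreal (rem_sum m \<omega>) \<partial>M)"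
      by (rule order_trans[OF expectation_estimate[of m]]) (intro add_right_mono add_mono quad_sum_estimate drift_sum_estimate)
  qed
  also have "\<dots> \<le> ennreal C2 * ?I (\<lambda>r \<omega>. \<phi> (D r \<omega>)) + ennreal C1 * ?I (\<lambda>r \<omega>. 2 * \<phi> (D r \<omega>))"
    unfolding add_0_right mult_zero_right
    by (intro add_mono mult_left_mono nn_integral_mono mult_right_mono ennreal_leI \<nu>_sq_le \<phi>'_le) auto
  also have "?I (\<lambda>r \<omega>. 2 * \<phi> (D r \<omega>)) = 2 * ?I (\<lambda>r \<omega>. \<phi> (D r \<omega>))"
  proof -
    have "(\<integral>\<^sup>+\<omega>. ennreal (2 * \<phi> (D r \<omega>)) \<partial>M) = 2 * (\<integral>\<^sup>+\<omega>. ennreal (\<phi> (D r \<omega>)) \<partial>M)" for r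
      by (simp add: ennreal_mult'[of 2, simplified] nn_integral_cmult)
    then show ?thesis by (simp add: mult.assoc nn_integral_cmult)
  qed
  also have "ennreal C2 * ?I (\<lambda>r \<omega>. \<phi> (D r \<omega>)) + ennreal C1 * (2 * ?I (\<lambda>r \<omega>. \<phi> (D r \<omega>)))
      = ennreal (C2 + 2 * C1) * ?I (\<lambda>r \<omega>. \<phi> (D r \<omega>))"
    using C1 C2 by (simp add: ennreal_plus ennreal_mult' distrib_right mult_ac)
  finally show ?thesis .
qed

end

theorem D_eq_0:
  assumes "0 \<le> t" "t < T"
  shows "AE \<omega> in M. D t \<omega> = 0"
proof -
  define y where "y r = (\<integral>\<^sup>+\<omega>. ennreal (\<phi> (D r \<omega>)) \<partial>M)" for r
  have "y t = 0"
  proof (rule ennreal_gronwall[of T y "C2 + 2 * C1"])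
    show "y r \<le> ennreal (C2 + 2 * C1) * (\<integral>\<^sup>+u. y u * indicator {0..<r} u \<partial>lborel)" if r: "0 \<le> r" "r < T" for r
    proof (cases "r = 0")
      case True
      have "y 0 = (\<integral>\<^sup>+\<omega>. 0 \<partial>M)"
        unfolding y_def by (rule nn_integral_cong_AE) (use D_0 in \<open>auto elim!: eventually_mono\<close>)
      then show ?thesis using True by simp
    next
      case False
      then show ?thesis unfolding y_def using r by (intro \<phi>_integral_inequality) auto
    qed
    show "y r \<le> 1" for r
    proof -
      have "y r \<le> (\<integral>\<^sup>+\<omega>. 1 \<partial>M)"
        unfolding y_def by (intro nn_integral_mono) (simp add: \<phi>_le_1)
      then show ?thesis by (simp add: emeasure_space_1)
    qed
  qed (use C1 C2 assms in auto)
  then have "AE \<omega> in M. ennreal (\<phi> (D t \<omega>)) = 0"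
    unfolding y_def by (subst (asm) nn_integral_0_iff_AE) auto
  then show ?thesis
    by (rule eventually_mono) (metis \<phi>_eq_0_iff \<phi>_nonneg antisym ennreal_eq_0_iff)
qed

end

section \<open>Versions with continuous paths\<close>

lemma AE_lebesgue_dense:
  assumes ae: "AE r in lebesgue. r \<in> {0..T} \<longrightarrow> Q r" and ab: "0 \<le> a" "a < b" "b \<le> T"
  obtains r :: real where "a < r" "r < b" "Q r"
proof -
  have "\<exists>r\<in>{a<..<b}. Q r"
  proof (rule ccontr)
    assume "\<not> ?thesis"
    then have "{a<..<b} \<subseteq> {r \<in> space lebesgue. \<not> (r \<in> {0..T} \<longrightarrow> Q r)}" using ab by auto
    moreover obtain Z where Z: "{r \<in> space lebesgue. \<not> (r \<in> {0..T} \<longrightarrow> Q r)} \<subseteq> Z"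
      "emeasure lebesgue Z = 0" "Z \<in> sets lebesgue"
      by (rule AE_E[OF ae])
    ultimately have "emeasure lebesgue {a<..<b} \<le> emeasure lebesgue Z"
      by (intro emeasure_mono) auto
    with Z(2) have "emeasure lebesgue {a<..<b} = 0" by simp
    then show False using ab by simp
  qed
  then show thesis using that by auto
qed

lemma countable_dense_times:
  assumes ae: "AE r in lebesgue. r \<in> {0..T} \<longrightarrow> Q r" and T: "0 < T"
  obtains R where "countable R" "R \<subseteq> {0..T}" "\<forall>r\<in>R. Q r" "{0..T :: real} \<subseteq> closure R"
proof -
  define S where "S = {r \<in> {0..T}. Q r}"
  obtain R where R: "countable R" "R \<subseteq> S" "S \<subseteq> closure R"
    using separable[of S] by blast
  have "{0..T} \<subseteq> closure S"
  proof
    fix t assume t: "t \<in> {0..T}"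
    show "t \<in> closure S"
      unfolding closure_approachable
    proof (intro allI impI)
      fix e :: real assume e: "0 < e"
      have "0 \<le> max 0 (t - e)" "max 0 (t - e) < min T (t + e)" "min T (t + e) \<le> T" using t e T by auto
      then obtain r where "max 0 (t - e) < r" "r < min T (t + e)" "Q r"
        by (rule AE_lebesgue_dense[OF ae])
      then show "\<exists>y\<in>S. dist y t < e" by (intro bexI[of _ r]) (auto simp: S_def dist_real_def)
    qed
  qed
  also have "closure S \<subseteq> closure R" using R(3) by (simp add: closure_minimal)
  finally show thesis using R by (intro that[of R]) (auto simp: S_def)
qed

context G_framework
begin

text \<open>The family of measures is not empty, since otherwise the supremum that represents \<open>E 0 = 0\<close> would be
  \<open>-\<infinity>\<close>. Hence a vanishing capacity is equivalent to being null under each measure.\<close>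

lemma polar_iff: "polar PG A \<longleftrightarrow> A \<in> sets borel \<and> (\<forall>P\<in>PG. emeasure P A = 0)"
proof -
  have "PG \<noteq> {}"
  proof
    assume "PG = {}"
    moreover have "(\<lambda>_. 0) \<in> L_ip_all" using L_ip_const[of 0] L_ip_all_I by blast
    then have "ereal (E (\<lambda>_. 0)) = (SUP P\<in>PG. ereal (\<integral>\<omega>. 0 \<partial>P))"
      using represents unfolding represents_def by blast
    ultimately show False by (simp add: bot_ereal_def)
  qed
  then have "capacity PG A = 0 \<longleftrightarrow> (\<forall>P\<in>PG. emeasure P A = 0)"
    by (simp add: capacity_def SUP_eq_iff)
  then show ?thesis by (simp add: polar_def)
qed

lemma qs_all_countable:
  assumes "\<And>n::nat. qs PG (Q n)"
  shows "qs PG (\<lambda>\<omega>. \<forall>n. Q n \<omega>)"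
proof -
  have "\<forall>n. \<exists>A. polar PG A \<and> (\<forall>\<omega>. \<omega> \<notin> A \<longrightarrow> Q n \<omega>)"
    using assms by (simp add: qs_def)
  then obtain A where A: "\<And>n. polar PG (A n)" "\<And>n \<omega>. \<omega> \<notin> A n \<Longrightarrow> Q n \<omega>"
    by metis
  have "polar PG (\<Union>n. A n)"
    unfolding polar_iff
  proof (intro conjI ballI)
    show "(\<Union>n. A n) \<in> sets borel" using A(1) by (auto simp: polar_iff)
    fix P assume P: "P \<in> PG"
    show "emeasure P (\<Union>n. A n) = 0"
      using A(1) P PG_props(2)[OF P] by (intro emeasure_UN_eq_0) (auto simp: polar_iff)
  qed
  then show ?thesis unfolding qs_def using A(2) by blast
qed

lemma qs_mono: "qs PG Q \<Longrightarrow> (\<And>\<omega>. Q \<omega> \<Longrightarrow> Q' \<omega>) \<Longrightarrow> qs PG Q'"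
  unfolding qs_def by blast

lemma qs_conj:
  assumes "qs PG Q" "qs PG Q'"
  shows "qs PG (\<lambda>\<omega>. Q \<omega> \<and> Q' \<omega>)"
proof -
  have "qs PG (\<lambda>\<omega>. \<forall>n::nat. (if n = 0 then Q else Q') \<omega>)"
    using assms by (intro qs_all_countable) simp
  then show ?thesis
  proof (rule qs_mono)
    fix \<omega> assume a: "\<forall>n::nat. (if n = 0 then Q else Q') \<omega>"
    show "Q \<omega> \<and> Q' \<omega>" using a[rule_format, of 0] a[rule_format, of 1] by simp
  qed
qed

text \<open>A quasi-surely continuous process that is measurable at almost all times agrees quasi-surely,
  at all times at once, with a process whose paths are all continuous and which is measurable at all
  times. Outside \<open>[0,T]\<close> this version is constant.\<close>

definition clamp_time :: "real \<Rightarrow> real \<Rightarrow> real" where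
  "clamp_time T t = max 0 (min T t)"

definition version :: "real \<Rightarrow> (real \<Rightarrow> path \<Rightarrow> real) \<Rightarrow> (real \<Rightarrow> path \<Rightarrow> real) \<Rightarrow> bool" where
  "version T X X' \<longleftrightarrow> (\<forall>\<omega>. continuous_on UNIV (\<lambda>t. X' t \<omega>)) \<and> (\<forall>t. X' t \<in> borel_measurable borel) \<and>
     (\<forall>t. X' t = X' (clamp_time T t)) \<and> qs PG (\<lambda>\<omega>. \<forall>t\<in>{0..T}. X t \<omega> = X' t \<omega>)"

lemma version_exists:
  assumes X: "X \<in> M_c PG T" and m: "AE r in lebesgue. r \<in> {0..T} \<longrightarrow> qs_measurable PG (X r)" and T: "0 < T"
  obtains X' where "version T X X'"
proof -
  obtain R where R: "countable R" "R \<subseteq> {0..T}" "\<forall>r\<in>R. qs_measurable PG (X r)" "{0..T} \<subseteq> closure R"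
    by (rule countable_dense_times[OF m T])
  have "R \<noteq> {}" using R(4) T by auto
  define rn where "rn = from_nat_into R"
  have rn: "range rn = R" unfolding rn_def by (rule range_from_nat_into[OF \<open>R \<noteq> {}\<close> R(1)])
  have "\<forall>n. \<exists>Y. Y \<in> borel_measurable borel \<and> qs PG (\<lambda>\<omega>. X (rn n) \<omega> = Y \<omega>)"
    using R(3) rn unfolding qs_measurable_def by blast
  then obtain Y where Y: "\<And>n. Y n \<in> borel_measurable borel" "\<And>n. qs PG (\<lambda>\<omega>. X (rn n) \<omega> = Y n \<omega>)"
    by metis
  have "qs PG (\<lambda>\<omega>. continuous_on {0..T} (\<lambda>t. X t \<omega>) \<and> (\<forall>n. X (rn n) \<omega> = Y n \<omega>))"
    using X Y(2) by (intro qs_conj qs_all_countable) (auto simp: M_c_def)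
  then obtain A where A: "polar PG A" "\<And>\<omega>. \<omega> \<notin> A \<Longrightarrow> continuous_on {0..T} (\<lambda>t. X t \<omega>)"
    "\<And>\<omega> n. \<omega> \<notin> A \<Longrightarrow> X (rn n) \<omega> = Y n \<omega>"
    unfolding qs_def by blast
  define X' where "X' t \<omega> = (if \<omega> \<in> A then 0 else X (clamp_time T t) \<omega>)" for t \<omega>
  have clamp: "clamp_time T t \<in> {0..T}" for t using T by (auto simp: clamp_time_def)
  have clamp_id: "clamp_time T t = t" if "t \<in> {0..T}" for t using that by (auto simp: clamp_time_def)
  have "continuous_on UNIV (\<lambda>t. X' t \<omega>)" for \<omega>
  proof (cases "\<omega> \<in> A")
    case False
    have "continuous_on UNIV (\<lambda>t. X (clamp_time T t) \<omega>)"
      by (rule continuous_on_compose2[OF A(2)[OF False]])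
        (use clamp in \<open>auto simp: clamp_time_def[abs_def] intro!: continuous_intros\<close>)
    then show ?thesis using False by (simp add: X'_def)
  qed (simp add: X'_def)
  moreover have "X' t \<in> borel_measurable borel" for t
  proof -
    obtain x where x: "\<And>n. x n \<in> R" "x \<longlonglongrightarrow> clamp_time T t"
      using clamp[of t] R(4) closure_sequential[of "clamp_time T t" R] by blast
    have "\<forall>n. \<exists>k. x n = rn k" using x(1) rn by blast
    then obtain k where k: "\<And>n. x n = rn (k n)" by metis
    have AM [measurable]: "A \<in> sets borel" using A(1) by (simp add: polar_iff)
    note [measurable] = Y(1)
    show ?thesis
    proof (rule borel_measurable_LIMSEQ_real)
      show "(\<lambda>n. if \<omega> \<in> A then 0 else Y (k n) \<omega>) \<longlonglongrightarrow> X' t \<omega>" for \<omega>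
      proof (cases "\<omega> \<in> A")
        case False
        have "x n \<in> {0..T}" for n using x(1) R(2) by blast
        then have "(\<lambda>n. X (x n) \<omega>) \<longlonglongrightarrow> X (clamp_time T t) \<omega>"
          using x(2) clamp by (intro continuous_on_tendsto_compose[OF A(2)[OF False]] always_eventually allI)
        then show ?thesis using False A(3)[OF False] by (simp add: X'_def k)
      qed (simp add: X'_def)
    qed measurable
  qed
  moreover have "X' t = X' (clamp_time T t)" for t
    using clamp_id[OF clamp[of t]] by (simp add: X'_def fun_eq_iff)
  moreover have "qs PG (\<lambda>\<omega>. \<forall>t\<in>{0..T}. X t \<omega> = X' t \<omega>)"
    unfolding qs_def using A(1) by (intro exI[of _ A]) (auto simp: X'_def clamp_id)
  ultimately show thesis by (intro that[of X']) (simp add: version_def)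
qed

end

text \<open>The process is the pointwise limit of its values at left grid points.\<close>

lemma continuous_joint_measurable:
  fixes X :: "real \<Rightarrow> 'a \<Rightarrow> real"
  assumes cont: "\<And>\<omega>. continuous_on UNIV (\<lambda>t. X t \<omega>)" and meas: "\<And>t. X t \<in> borel_measurable M"
  shows "(\<lambda>(r, \<omega>). X r \<omega>) \<in> borel_measurable (borel \<Otimes>\<^sub>M M)"
proof -
  define u where "u n p = X (left_point 1 n (fst p)) (snd p)" for n and p :: "real \<times> 'a"
  have m: "u n \<in> borel_measurable (borel \<Otimes>\<^sub>M M)" for n
  proof -
    note [measurable] = meas
    have "(\<lambda>p. X (of_int i / Suc n) (snd p)) \<in> borel_measurable (borel \<Otimes>\<^sub>M M)" for i :: int
      by measurable
    moreover have "(\<lambda>p::real \<times> 'a. \<lfloor>fst p * Suc n\<rfloor>) \<in> measurable (borel \<Otimes>\<^sub>M M) (count_space UNIV)"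
      by measurable
    ultimately have "(\<lambda>p::real \<times> 'a. X (of_int \<lfloor>fst p * Suc n\<rfloor> / Suc n) (snd p)) \<in> borel_measurable (borel \<Otimes>\<^sub>M M)"
      by (rule measurable_compose_countable)
    then show ?thesis by (simp add: u_def[abs_def] left_point_def)
  qed
  have lim: "(\<lambda>n. u n p) \<longlonglongrightarrow> X (fst p) (snd p)" for p
    unfolding u_def by (rule continuous_on_tendsto_compose[OF cont left_point_tendsto]) auto
  have "(\<lambda>p. X (fst p) (snd p)) \<in> borel_measurable (borel \<Otimes>\<^sub>M M)"
    by (rule borel_measurable_LIMSEQ_real[OF lim m])
  then show ?thesis by (simp add: case_prod_beta')
qed

section \<open>Riemann--Stieltjes sums\<close>

lemma grid_tagged_division:
  assumes g: "grid M \<sigma> a b" and ab: "a < b"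
  shows "(\<lambda>j. (\<sigma> j, {\<sigma> j..\<sigma> (Suc j)})) ` {..<M} tagged_division_of {a..b}"
proof (rule tagged_division_ofI)
  have lt: "\<sigma> j < \<sigma> (Suc j)" if "j < M" for j using g that by (simp add: grid_def)
  fix x K assume "(x, K) \<in> (\<lambda>j. (\<sigma> j, {\<sigma> j..\<sigma> (Suc j)})) ` {..<M}"
  then obtain j where j: "j < M" "x = \<sigma> j" "K = {\<sigma> j..\<sigma> (Suc j)}" by auto
  show "x \<in> K" using lt[OF j(1)] j by simp
  show "K \<subseteq> {a..b}" using grid_bounds[OF g, of j] grid_bounds[OF g, of "Suc j"] j by auto
  show "\<exists>a b. K = cbox a b" using j by auto
next
  fix x1 K1 x2 K2
  assume "(x1, K1) \<in> (\<lambda>j. (\<sigma> j, {\<sigma> j..\<sigma> (Suc j)})) ` {..<M}"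
    "(x2, K2) \<in> (\<lambda>j. (\<sigma> j, {\<sigma> j..\<sigma> (Suc j)})) ` {..<M}" "(x1, K1) \<noteq> (x2, K2)"
  then obtain i j where ij: "i < M" "j < M" "i \<noteq> j" "K1 = {\<sigma> i..\<sigma> (Suc i)}" "K2 = {\<sigma> j..\<sigma> (Suc j)}" by auto
  consider "Suc i \<le> j" | "Suc j \<le> i" using ij(3) by linarith
  then show "interior K1 \<inter> interior K2 = {}"
  proof cases
    case 1
    have "\<sigma> (Suc i) \<le> \<sigma> j" using 1 ij by (intro grid_mono[OF g]) auto
    then show ?thesis using ij by auto
  next
    case 2
    have "\<sigma> (Suc j) \<le> \<sigma> i" using 2 ij by (intro grid_mono[OF g]) auto
    then show ?thesis using ij by auto
  qed
next
  show "\<Union>{K. \<exists>x. (x, K) \<in> (\<lambda>j. (\<sigma> j, {\<sigma> j..\<sigma> (Suc j)})) ` {..<M}} = {a..b}"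
  proof
    show "\<Union>{K. \<exists>x. (x, K) \<in> (\<lambda>j. (\<sigma> j, {\<sigma> j..\<sigma> (Suc j)})) ` {..<M}} \<subseteq> {a..b}"
    proof
      fix r assume "r \<in> \<Union>{K. \<exists>x. (x, K) \<in> (\<lambda>j. (\<sigma> j, {\<sigma> j..\<sigma> (Suc j)})) ` {..<M}}"
      then obtain j where j: "j < M" "r \<in> {\<sigma> j..\<sigma> (Suc j)}" by auto
      then show "r \<in> {a..b}" using grid_bounds(1)[OF g, of j] grid_bounds(2)[OF g, of "Suc j"] by auto
    qed
    show "{a..b} \<subseteq> \<Union>{K. \<exists>x. (x, K) \<in> (\<lambda>j. (\<sigma> j, {\<sigma> j..\<sigma> (Suc j)})) ` {..<M}}"
    proof
      fix r assume r: "r \<in> {a..b}"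
      show "r \<in> \<Union>{K. \<exists>x. (x, K) \<in> (\<lambda>j. (\<sigma> j, {\<sigma> j..\<sigma> (Suc j)})) ` {..<M}}"
      proof (cases "r < b")
        case True
        then obtain j where "j < M" "\<sigma> j \<le> r" "r < \<sigma> (Suc j)" using r by (elim grid_cell[OF g, rotated 1]) auto
        then show ?thesis by (intro UnionI[of "{\<sigma> j..\<sigma> (Suc j)}"]) auto
      next
        case False
        then have "r = b" using r by simp
        moreover obtain k where k: "M = Suc k" using g ab by (cases M) (auto simp: grid_def)
        ultimately have "r \<in> {\<sigma> k..\<sigma> (Suc k)}"
          using g by (auto simp: grid_def intro: less_imp_le)
        then show ?thesis using k by (intro UnionI[of "{\<sigma> k..\<sigma> (Suc k)}"]) auto
      qed
    qed
  qed
qed simp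

text \<open>If a nonnegative function has integral 0 against an increasing one, then so do all left Riemann
  sums over subintervals, in the limit: any such sum is part of a sum over the whole interval.\<close>

lemma RS_left_sums:
  assumes int: "has_RS_integral f k 0 T 0" and f: "\<And>x. x \<in> {0..T} \<Longrightarrow> 0 \<le> f x" and k: "mono_on {0..T} k"
    and t: "0 < t" "t < T" and e: "0 < e"
  shows "\<forall>\<^sub>F m in sequentially. (\<Sum>i<Suc m. f (upart t m i) * (k (upart t m (Suc i)) - k (upart t m i))) \<le> e"
proof -
  obtain d where d: "d > 0" "\<And>D. D tagged_division_of {0..T} \<Longrightarrow> (\<forall>(x, J)\<in>D. diameter J < d) \<Longrightarrow>
      \<bar>(\<Sum>(x, J)\<in>D. f x * (k (Sup J) - k (Inf J))) - 0\<bar> < e"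
    using int e unfolding has_RS_integral_def by blast
  have small: "\<forall>\<^sub>F m in sequentially. c / Suc m < d" for c :: real
  proof -
    have "(\<lambda>m. c / Suc m) \<longlonglongrightarrow> 0" using LIMSEQ_Suc[OF lim_const_over_n[of c]] by simp
    then show ?thesis by (rule order_tendstoD(2)) (rule d(1))
  qed
  show ?thesis
    using small[of t] small[of "T - t"]
  proof eventually_elim
    case (elim m)
    define \<sigma> where "\<sigma> j = (if j \<le> Suc m then upart t m j else t + upart (T - t) m (j - Suc m))" for j
    have end1: "upart t m (Suc m) = t" and z: "upart c m 0 = 0" and end2: "upart (T - t) m (Suc m) = T - t" for c
      by (simp_all add: upart_def)
    have step: "\<sigma> (Suc j) - \<sigma> j = (if j < Suc m then t / Suc m else (T - t) / Suc m)" for j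
    proof (cases "j < Suc m")
      case True
      then show ?thesis using upart_mesh[of t m j] by (simp add: \<sigma>_def)
    next
      case False
      then have "\<sigma> j = t + upart (T - t) m (j - Suc m)"
        using end1 z[of "T - t"] by (cases "j = Suc m") (auto simp: \<sigma>_def)
      moreover have "j - m = Suc (j - Suc m)" using False by linarith
      then have "\<sigma> (Suc j) = t + upart (T - t) m (Suc (j - Suc m))"
        using False by (simp add: \<sigma>_def)
      ultimately show ?thesis using False upart_mesh[of "T - t" m "j - Suc m"] by simp
    qed
    have lt: "\<sigma> j < \<sigma> (Suc j)" for j
    proof -
      have "0 < \<sigma> (Suc j) - \<sigma> j" unfolding step using t by simp
      then show ?thesis by simp
    qed
    have g: "grid (Suc m + Suc m) \<sigma> 0 T"
      unfolding grid_def using lt z[of t] end2 by (simp add: \<sigma>_def)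
    let ?c = "\<lambda>j. (\<sigma> j, {\<sigma> j..\<sigma> (Suc j)})"
    let ?D = "?c ` {..<Suc m + Suc m}"
    have "?D tagged_division_of {0..T}" by (rule grid_tagged_division[OF g]) (use t in simp)
    moreover have "\<forall>(x, J)\<in>?D. diameter J < d"
      using elim d(1) by (auto simp: step)
    ultimately have bound: "\<bar>(\<Sum>(x, J)\<in>?D. f x * (k (Sup J) - k (Inf J))) - 0\<bar> < e" by (rule d(2))
    have inj: "inj_on ?c {..<Suc m + Suc m}"
    proof (rule inj_onI)
      fix i j assume "i \<in> {..<Suc m + Suc m}" "j \<in> {..<Suc m + Suc m}" "?c i = ?c j"
      then show "i = j"
        using grid_strict_mono[OF g, of i j] grid_strict_mono[OF g, of j i] by (cases i j rule: linorder_cases) auto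
    qed
    have "(\<Sum>(x, J)\<in>?D. f x * (k (Sup J) - k (Inf J))) = (\<Sum>j<Suc m + Suc m. f (\<sigma> j) * (k (\<sigma> (Suc j)) - k (\<sigma> j)))"
      unfolding sum.reindex[OF inj] using lt by (intro sum.cong) (auto simp: less_imp_le)
    with bound have tot: "(\<Sum>j<Suc m + Suc m. f (\<sigma> j) * (k (\<sigma> (Suc j)) - k (\<sigma> j))) < e" by simp
    have nonneg: "0 \<le> f (\<sigma> j) * (k (\<sigma> (Suc j)) - k (\<sigma> j))" if "j < Suc m + Suc m" for j
    proof -
      have "\<sigma> j \<in> {0..T}" "\<sigma> (Suc j) \<in> {0..T}"
        using grid_bounds[OF g, of j] grid_bounds[OF g, of "Suc j"] that by auto
      then show ?thesis
        using f mono_onD[OF k, of "\<sigma> j" "\<sigma> (Suc j)"] lt[of j] by (intro mult_nonneg_nonneg) auto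
    qed
    have "(\<Sum>i<Suc m. f (upart t m i) * (k (upart t m (Suc i)) - k (upart t m i)))
        = (\<Sum>j<Suc m. f (\<sigma> j) * (k (\<sigma> (Suc j)) - k (\<sigma> j)))"
      by (intro sum.cong) (auto simp: \<sigma>_def)
    also have "\<dots> \<le> (\<Sum>j<Suc m + Suc m. f (\<sigma> j) * (k (\<sigma> (Suc j)) - k (\<sigma> j)))"
      by (rule sum_mono2) (use nonneg in auto)
    finally show ?case using tot by linarith
  qed
qed

text \<open>At a left point where \<open>D = X - X'\<close> is positive, \<open>X\<close> is above the obstacle by at least \<open>D\<close>. So the pushes of \<open>K\<close>
  and \<open>K'\<close> can only bring the two solutions closer, up to sums that vanish by minimality.\<close>

lemma reflection_sums:
  assumes int: "has_RS_integral (\<lambda>t. X t - S t) K 0 T 0" "has_RS_integral (\<lambda>t. X' t - S t) K' 0 T 0"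
    and S: "\<And>t. t \<in> {0..T} \<Longrightarrow> S t \<le> X t" "\<And>t. t \<in> {0..T} \<Longrightarrow> S t \<le> X' t"
    and K: "mono_on {0..T} K" "mono_on {0..T} K'" and t: "0 < t" "t < T" and e: "0 < (e :: real)"
  shows "\<forall>\<^sub>F m in sequentially. (\<Sum>i<Suc m. \<phi>' (X (upart t m i) - X' (upart t m i)) *
    ((K (upart t m (Suc i)) - K (upart t m i)) - (K' (upart t m (Suc i)) - K' (upart t m i)))) \<le> e"
proof -
  have e4: "0 < e / 4" using e by simp
  have "\<forall>\<^sub>F m in sequentially. (\<Sum>i<Suc m. (X (upart t m i) - S (upart t m i)) * (K (upart t m (Suc i)) - K (upart t m i))) \<le> e / 4"
    by (rule RS_left_sums[OF int(1) _ K(1) t e4]) (use S(1) in auto)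
  moreover have "\<forall>\<^sub>F m in sequentially. (\<Sum>i<Suc m. (X' (upart t m i) - S (upart t m i)) * (K' (upart t m (Suc i)) - K' (upart t m i))) \<le> e / 4"
    by (rule RS_left_sums[OF int(2) _ K(2) t e4]) (use S(2) in auto)
  ultimately show ?thesis
  proof eventually_elim
    case (elim m)
    let ?s = "upart t m"
    have \<phi>'_le: "\<phi>' x \<le> 2 * y" if "x \<le> y" "0 \<le> y" for x y
    proof (cases "0 \<le> x")
      case True
      have "(\<nu> x)\<^sup>2 \<le> 1" using \<nu>_pos[of x] \<nu>_le_1[of x] by (intro power_le_one) auto
      then have "2 * x * (\<nu> x)\<^sup>2 \<le> 2 * x * 1" using True by (intro mult_left_mono) auto
      then show ?thesis using that by (simp add: \<phi>'_eq)
    next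
      case False
      then have "2 * x * (\<nu> x)\<^sup>2 \<le> 0" by (simp add: mult_le_0_iff)
      then show ?thesis using that by (simp add: \<phi>'_eq)
    qed
    have odd: "\<phi>' (- x) = - \<phi>' x" for x by (simp add: \<phi>'_def)
    have summand: "\<phi>' (X (?s i) - X' (?s i)) * ((K (?s (Suc i)) - K (?s i)) - (K' (?s (Suc i)) - K' (?s i)))
      \<le> 2 * ((X (?s i) - S (?s i)) * (K (?s (Suc i)) - K (?s i)))
        + 2 * ((X' (?s i) - S (?s i)) * (K' (?s (Suc i)) - K' (?s i)))" if i: "i < Suc m" for i
    proof -
      have mem: "?s i \<in> {0..T}" "?s (Suc i) \<in> {0..T}" "?s i \<le> ?s (Suc i)"
        using grid_bounds[OF upart_grid[OF t(1)], of i m] grid_bounds[OF upart_grid[OF t(1)], of "Suc i" m]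
          grid_mono[OF upart_grid[OF t(1)], of i "Suc i" m] i t by auto
      have dK: "0 \<le> K (?s (Suc i)) - K (?s i)" "0 \<le> K' (?s (Suc i)) - K' (?s i)"
        using mono_onD[OF K(1) mem] mono_onD[OF K(2) mem] by auto
      have "\<phi>' (X (?s i) - X' (?s i)) \<le> 2 * (X (?s i) - S (?s i))"
        by (rule \<phi>'_le) (use S(1)[OF mem(1)] S(2)[OF mem(1)] in auto)
      from mult_right_mono[OF this dK(1)]
      have 1: "\<phi>' (X (?s i) - X' (?s i)) * (K (?s (Suc i)) - K (?s i)) \<le> 2 * ((X (?s i) - S (?s i)) * (K (?s (Suc i)) - K (?s i)))"
        by (simp only: mult.assoc)
      have "- \<phi>' (X (?s i) - X' (?s i)) \<le> 2 * (X' (?s i) - S (?s i))"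
        unfolding odd[symmetric] by (rule \<phi>'_le) (use S(1)[OF mem(1)] S(2)[OF mem(1)] in auto)
      from mult_right_mono[OF this dK(2)]
      have 2: "- \<phi>' (X (?s i) - X' (?s i)) * (K' (?s (Suc i)) - K' (?s i)) \<le> 2 * ((X' (?s i) - S (?s i)) * (K' (?s (Suc i)) - K' (?s i)))"
        by (simp only: mult.assoc)
      from 1 2 show ?thesis unfolding right_diff_distrib by linarith
    qed
    have "(\<Sum>i<Suc m. \<phi>' (X (?s i) - X' (?s i)) * ((K (?s (Suc i)) - K (?s i)) - (K' (?s (Suc i)) - K' (?s i))))
      \<le> (\<Sum>i<Suc m. 2 * ((X (?s i) - S (?s i)) * (K (?s (Suc i)) - K (?s i)))
        + 2 * ((X' (?s i) - S (?s i)) * (K' (?s (Suc i)) - K' (?s i))))"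
      by (intro sum_mono summand) simp
    also have "\<dots> = 2 * (\<Sum>i<Suc m. (X (?s i) - S (?s i)) * (K (?s (Suc i)) - K (?s i)))
        + 2 * (\<Sum>i<Suc m. (X' (?s i) - S (?s i)) * (K' (?s (Suc i)) - K' (?s i)))"
      by (simp only: sum.distrib sum_distrib_left)
    also have "\<dots> \<le> 2 * (e / 4) + 2 * (e / 4)" using elim by (intro add_mono mult_left_mono) auto
    finally show ?case by simp
  qed
qed

section \<open>The quadratic variation\<close>

text \<open>Countably many almost sure inequalities become simultaneous in time by this lemma.\<close>

lemma continuous_le_from_rationals:
  assumes g: "continuous_on {a..b} g" and q: "\<And>r. r \<in> \<rat> \<Longrightarrow> a < r \<Longrightarrow> r < b \<Longrightarrow> g r \<le> (0 :: real)" and ab: "a < (b :: real)"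
    and t: "t \<in> {a..b}"
  shows "g t \<le> 0"
proof -
  have "closed {t \<in> {a..b}. g t \<le> 0}"
    using continuous_closed_preimage[OF g closed_atLeastAtMost closed_atMost[of 0]] by (simp add: vimage_def Int_def)
  then have "closure ({a<..<b} \<inter> \<rat>) \<subseteq> {t \<in> {a..b}. g t \<le> 0}"
    by (rule closure_minimal[rotated]) (use q in auto)
  moreover have "{a<..<b} \<subseteq> closure ({a<..<b} \<inter> \<rat>)"
    using open_Int_closure_subset[of "{a<..<b}" \<rat>] by (simp add: Rats_closure_real)
  then have "closure {a<..<b} \<subseteq> closure ({a<..<b} \<inter> \<rat>)" by (rule closure_minimal) simp
  ultimately show ?thesis using t ab by auto
qed

context G_measure
begin

lemma increment_fourth_moment:
  assumes st: "0 \<le> s" "s \<le> t"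
  shows "(\<integral>\<omega>. (canon t \<omega> - canon s \<omega>) ^ 4 \<partial>P) \<le> c4 * (t - s)\<^sup>2"
proof -
  have "integrable P (\<lambda>\<omega>. (canon t \<omega> - canon s \<omega>) ^ 4)"
    using st by (intro L_ip_P_integrable[of _ t] L_ip_power increment_in_L_ip) auto
  moreover have "(\<integral>\<omega>. 1 * ((canon t \<omega> - canon s \<omega>) ^ (2 * 2) - B_moment E (2 * 2) * (t - s) ^ 2) \<partial>P) \<le> 0"
    by (rule integral_increment_power[OF P_in L_ip_const[OF st(1)] _ st]) simp
  ultimately show ?thesis by (simp add: c4_def prob_space[unfolded space_P])
qed

text \<open>The sums of the squared increments, centred at the largest possible variance, form a
  supermartingale. Its positive part is therefore controlled by the fourth moments, and vanishes as
  the mesh tends to 0.\<close>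

lemma squared_increments_bound:
  assumes \<tau>: "\<And>j. j < m \<Longrightarrow> \<tau> j \<le> \<tau> (Suc j)" and 0: "0 \<le> \<tau> 0"
  shows "(\<lambda>\<omega>. \<Sum>j<m. (canon (\<tau> (Suc j)) \<omega> - canon (\<tau> j) \<omega>)\<^sup>2 - c2 * (\<tau> (Suc j) - \<tau> j)) \<in> L_ip (\<tau> m)"
    and "N2 P (\<lambda>\<omega>. max 0 (\<Sum>j<m. (canon (\<tau> (Suc j)) \<omega> - canon (\<tau> j) \<omega>)\<^sup>2 - c2 * (\<tau> (Suc j) - \<tau> j)))
      \<le> ennreal ((c4 + c2\<^sup>2) * (\<Sum>j<m. (\<tau> (Suc j) - \<tau> j)\<^sup>2))"
proof -
  define Y where "Y j \<omega> = (canon (\<tau> (Suc j)) \<omega> - canon (\<tau> j) \<omega>)\<^sup>2 - c2 * (\<tau> (Suc j) - \<tau> j)" for j \<omega>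
  define U where "U k \<omega> = (\<Sum>j<k. Y j \<omega>)" for k \<omega>
  have nonneg: "0 \<le> \<tau> k" if "k \<le> m" for k
    using that
  proof (induction k)
    case (Suc k)
    then show ?case using \<tau>[of k] by simp
  qed (rule 0)
  have Y: "Y k \<in> L_ip (\<tau> (Suc k))" if "k < m" for k
    unfolding Y_def[abs_def] using \<tau>[OF that] nonneg[of k] nonneg[of "Suc k"] that
    by (intro L_ip_diff L_ip_power L_ip_const increment_in_L_ip) auto
  have pos_lip: "(\<lambda>\<omega>. max 0 (X \<omega>)) \<in> L_ip s" if "X \<in> L_ip s" for X s
    by (rule L_ip_lipschitz[OF that, of "max 0" 1]) auto
  have *: "U k \<in> L_ip (\<tau> k) \<and> (\<integral>\<omega>. (max 0 (U k \<omega>))\<^sup>2 \<partial>P) \<le> (c4 + c2\<^sup>2) * (\<Sum>j<k. (\<tau> (Suc j) - \<tau> j)\<^sup>2)"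
    if "k \<le> m" for k
    using that
  proof (induction k)
    case 0
    show ?case using L_ip_const[OF assms(2), of 0] by (simp add: U_def[abs_def])
  next
    case (Suc k)
    then have k: "k < m" and IH: "U k \<in> L_ip (\<tau> k)"
      "(\<integral>\<omega>. (max 0 (U k \<omega>))\<^sup>2 \<partial>P) \<le> (c4 + c2\<^sup>2) * (\<Sum>j<k. (\<tau> (Suc j) - \<tau> j)\<^sup>2)" by auto
    let ?d = "\<tau> (Suc k) - \<tau> k"
    have le: "\<tau> k \<le> \<tau> (Suc k)" and nn: "0 \<le> \<tau> k" "0 \<le> \<tau> (Suc k)" using \<tau>[OF k] nonneg[of k] nonneg[of "Suc k"] k by auto
    have U': "U k \<in> L_ip (\<tau> (Suc k))" using IH(1) L_ip_mono[OF le] by blast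
    have eq: "U (Suc k) = (\<lambda>\<omega>. U k \<omega> + Y k \<omega>)" by (rule ext) (simp add: U_def)
    have US: "U (Suc k) \<in> L_ip (\<tau> (Suc k))" unfolding eq by (rule L_ip_add[OF U' Y[OF k]])
    have int: "integrable P (\<lambda>\<omega>. (max 0 (U (Suc k) \<omega>))\<^sup>2)" "integrable P (\<lambda>\<omega>. (max 0 (U k \<omega>))\<^sup>2)"
      "integrable P (\<lambda>\<omega>. max 0 (U k \<omega>) * Y k \<omega>)" "integrable P (\<lambda>\<omega>. (Y k \<omega>)\<^sup>2)"
      by (rule L_ip_P_integrable, rule L_ip_power[OF nn(2) pos_lip[OF US]])
        (rule L_ip_P_integrable, rule L_ip_power[OF nn(2) pos_lip[OF U']],
         rule L_ip_P_integrable, rule L_ip_mult[OF pos_lip[OF U'] Y[OF k]],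
         rule L_ip_P_integrable, rule L_ip_power[OF nn(2) Y[OF k]])
    \<comment> \<open>Only the nonnegative factor \<open>max 0 U\<close> gives the mixed term a sign: the variance is known from above only.\<close>
    have cross: "(\<integral>\<omega>. max 0 (U k \<omega>) * Y k \<omega> \<partial>P) \<le> 0"
      using integral_increment_power[OF P_in pos_lip[OF IH(1)] _ nn(1) le, of 1] by (simp add: Y_def c2_def)
    have Y2: "(\<integral>\<omega>. (Y k \<omega>)\<^sup>2 \<partial>P) \<le> (c4 + c2\<^sup>2) * ?d\<^sup>2"
    proof -
      have i4: "integrable P (\<lambda>\<omega>. (canon (\<tau> (Suc k)) \<omega> - canon (\<tau> k) \<omega>) ^ 4)"
        using nn le by (intro L_ip_P_integrable[of _ "\<tau> (Suc k)"] L_ip_power increment_in_L_ip) auto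
      have "(Y k \<omega>)\<^sup>2 \<le> (canon (\<tau> (Suc k)) \<omega> - canon (\<tau> k) \<omega>) ^ 4 + c2\<^sup>2 * ?d\<^sup>2" for \<omega>
      proof -
        define q where "q = (canon (\<tau> (Suc k)) \<omega> - canon (\<tau> k) \<omega>)\<^sup>2"
        have "0 \<le> 2 * q * (c2 * ?d)" using le by (simp add: q_def)
        then have "(q - c2 * ?d)\<^sup>2 \<le> q\<^sup>2 + (c2 * ?d)\<^sup>2"
          by (simp add: power2_eq_square algebra_simps)
        moreover have "q\<^sup>2 = (canon (\<tau> (Suc k)) \<omega> - canon (\<tau> k) \<omega>) ^ 4"
          unfolding q_def power_mult[symmetric] by simp
        ultimately show ?thesis by (simp add: Y_def q_def[symmetric] power_mult_distrib)
      qed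
      then have "(\<integral>\<omega>. (Y k \<omega>)\<^sup>2 \<partial>P) \<le> (\<integral>\<omega>. (canon (\<tau> (Suc k)) \<omega> - canon (\<tau> k) \<omega>) ^ 4 + c2\<^sup>2 * ?d\<^sup>2 \<partial>P)"
        using i4 int(4) by (intro integral_mono) auto
      also have "\<dots> = (\<integral>\<omega>. (canon (\<tau> (Suc k)) \<omega> - canon (\<tau> k) \<omega>) ^ 4 \<partial>P) + c2\<^sup>2 * ?d\<^sup>2"
        using i4 by (simp add: prob_space[unfolded space_P])
      also have "\<dots> \<le> c4 * ?d\<^sup>2 + c2\<^sup>2 * ?d\<^sup>2"
        using increment_fourth_moment[OF nn(1) le] by simp
      finally show ?thesis by (simp add: distrib_right)
    qed
    \<comment> \<open>The positive part is subadditive, and its square does not exceed that of the full sum.\<close>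
    have "(max 0 (U (Suc k) \<omega>))\<^sup>2 \<le> (max 0 (U k \<omega>))\<^sup>2 + 2 * (max 0 (U k \<omega>) * Y k \<omega>) + (Y k \<omega>)\<^sup>2" for \<omega>
    proof -
      define a where "a = max 0 (U k \<omega>)"
      have "\<bar>max 0 (U (Suc k) \<omega>)\<bar> \<le> \<bar>a + Y k \<omega>\<bar>" unfolding eq a_def by (auto simp: max_def)
      then have "(max 0 (U (Suc k) \<omega>))\<^sup>2 \<le> (a + Y k \<omega>)\<^sup>2" by (simp only: abs_le_square_iff)
      then show ?thesis unfolding a_def[symmetric] by (simp add: power2_eq_square algebra_simps)
    qed
    then have "(\<integral>\<omega>. (max 0 (U (Suc k) \<omega>))\<^sup>2 \<partial>P)
        \<le> (\<integral>\<omega>. (max 0 (U k \<omega>))\<^sup>2 + 2 * (max 0 (U k \<omega>) * Y k \<omega>) + (Y k \<omega>)\<^sup>2 \<partial>P)"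
      using int by (intro integral_mono) auto
    also have "\<dots> = (\<integral>\<omega>. (max 0 (U k \<omega>))\<^sup>2 \<partial>P) + 2 * (\<integral>\<omega>. max 0 (U k \<omega>) * Y k \<omega> \<partial>P) + (\<integral>\<omega>. (Y k \<omega>)\<^sup>2 \<partial>P)"
      using int by simp
    also have "\<dots> \<le> (c4 + c2\<^sup>2) * (\<Sum>j<k. (\<tau> (Suc j) - \<tau> j)\<^sup>2) + 0 + (c4 + c2\<^sup>2) * ?d\<^sup>2"
      using cross by (intro add_mono IH(2) Y2) simp
    finally have "(\<integral>\<omega>. (max 0 (U (Suc k) \<omega>))\<^sup>2 \<partial>P) \<le> (c4 + c2\<^sup>2) * (\<Sum>j<Suc k. (\<tau> (Suc j) - \<tau> j)\<^sup>2)"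
      by (simp add: distrib_left)
    with US show ?case by (rule conjI)
  qed
  show "(\<lambda>\<omega>. \<Sum>j<m. (canon (\<tau> (Suc j)) \<omega> - canon (\<tau> j) \<omega>)\<^sup>2 - c2 * (\<tau> (Suc j) - \<tau> j)) \<in> L_ip (\<tau> m)"
    using *[of m] unfolding U_def[abs_def] Y_def by simp
  have "integrable P (\<lambda>\<omega>. (max 0 (U m \<omega>))\<^sup>2)"
    using *[of m] nonneg[of m] by (intro L_ip_P_integrable[of _ "\<tau> m"] L_ip_power pos_lip) auto
  then have "N2 P (\<lambda>\<omega>. max 0 (U m \<omega>)) = ennreal (\<integral>\<omega>. (max 0 (U m \<omega>))\<^sup>2 \<partial>P)"
    unfolding N2_def by (intro nn_integral_eq_integral) auto
  also have "\<dots> \<le> ennreal ((c4 + c2\<^sup>2) * (\<Sum>j<m. (\<tau> (Suc j) - \<tau> j)\<^sup>2))"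
    using *[of m] by (intro ennreal_leI) simp
  finally show "N2 P (\<lambda>\<omega>. max 0 (\<Sum>j<m. (canon (\<tau> (Suc j)) \<omega> - canon (\<tau> j) \<omega>)\<^sup>2 - c2 * (\<tau> (Suc j) - \<tau> j)))
      \<le> ennreal ((c4 + c2\<^sup>2) * (\<Sum>j<m. (\<tau> (Suc j) - \<tau> j)\<^sup>2))"
    unfolding U_def Y_def .
qed

lemma N2_0_AE:
  assumes [measurable]: "W \<in> borel_measurable P" and "N2 P W = 0"
  shows "AE \<omega> in P. W \<omega> = 0"
proof -
  have "AE \<omega> in P. ennreal ((W \<omega>)\<^sup>2) = 0"
    using assms(2) unfolding N2_def by (subst (asm) nn_integral_0_iff_AE) auto
  then show ?thesis by (rule eventually_mono) simp
qed

lemma upart_shift_grid: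
  assumes "a < b"
  shows "grid (Suc m) (\<lambda>j. a + upart (b - a) m j) a b"
  using upart_grid[of "b - a" m] assms by (auto simp: grid_def)

text \<open>The Ito integral of \<open>B\<close> is the limit of its left Riemann sums, because the latter integrate step
  processes that approximate \<open>B\<close> with an error of the order of the mesh.\<close>

lemma canon_integral_riemann:
  assumes J: "\<And>t. t \<in> {0..T} \<Longrightarrow> has_G_integral PG 2 T canon canon t (J t)" and T: "0 < T"
    and J': "\<And>t. t \<in> {0..T} \<Longrightarrow> J' t \<in> borel_measurable P" "\<And>t. t \<in> {0..T} \<Longrightarrow> AE \<omega> in P. J t \<omega> = J' t \<omega>"
    and ab: "0 \<le> a" "a < b" "b \<le> T"
  shows "N2 P (\<lambda>\<omega>. (J' b \<omega> - J' a \<omega>) - (\<Sum>j<Suc m. canon (a + upart (b - a) m j) \<omega> *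
      (canon (a + upart (b - a) m (Suc j)) \<omega> - canon (a + upart (b - a) m j) \<omega>)))
    \<le> ennreal (16 * c2\<^sup>2 * (b - a)\<^sup>2 / Suc m)"
proof -
  obtain G JJ e where ap: "approx T 2 canon G JJ e"
    and e: "\<forall>n. \<forall>r\<in>{0..<T}. Lq P 2 (\<lambda>\<omega>. G n r \<omega> - canon r \<omega>) \<le> e n r"
    and lim: "\<forall>t\<in>{0..T}. (\<lambda>n. Lq P 2 (\<lambda>\<omega>. JJ n t \<omega> - J' t \<omega>)) \<longlonglongrightarrow> 0"
    by (rule integral_process_approx[OF J integrator_B _ T J']) auto
  let ?\<tau> = "\<lambda>j. a + upart (b - a) m j"
  have g: "grid (Suc m) ?\<tau> a b" by (rule upart_shift_grid[OF ab(2)])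
  have \<tau>b: "0 \<le> ?\<tau> j" "?\<tau> j \<le> T" "a \<le> ?\<tau> j" "?\<tau> j \<le> b" if "j \<le> Suc m" for j
    using grid_bounds[OF g that] ab by auto
  define h where "h = (b - a) / Suc m"
  have h: "0 \<le> h" using ab by (simp add: h_def)
  have mesh: "?\<tau> (Suc j) - ?\<tau> j = h" for j using upart_mesh[of "b - a" m j] by (simp add: h_def)
  define B where "B = step_process (Suc m) ?\<tau> (\<lambda>j. canon (?\<tau> j))"
  define S where "S = step_integral canon (Suc m) ?\<tau> (\<lambda>j. canon (?\<tau> j))"
  have st: "step_on (?\<tau> ` {..Suc m}) canon B S"
    unfolding B_def S_def by (rule step_process_step_on) (rule grid_mono[OF g], auto)
  have B_val: "B r = canon (?\<tau> j)" if "j < Suc m" "r \<in> {?\<tau> j..<?\<tau> (Suc j)}" for r j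
    unfolding B_def step_process_def by (rule ext, rule grid_step_value[OF g that])
  have B_zero: "B r = (\<lambda>_. 0)" if "r \<notin> {a..<b}" for r
  proof -
    have "r \<notin> {?\<tau> j..<?\<tau> (Suc j)}" if "j < Suc m" for j
      using \<tau>b[of j] \<tau>b[of "Suc j"] that \<open>r \<notin> {a..<b}\<close> by auto
    then show ?thesis unfolding B_def step_process_def by (intro ext sum.neutral) simp
  qed
  have canonHS: "canon r \<in> HS P r" if "0 \<le> r" for r using that by (intro L_ip_HS L_ip_canon) auto
  have B_ad: "B r \<in> HS P r" if r: "0 \<le> r" for r
  proof (cases "r \<in> {a..<b}")
    case True
    then have ar: "a \<le> r" "r < b" by auto
    obtain j where j: "j < Suc m" "?\<tau> j \<le> r" "r < ?\<tau> (Suc j)"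
      by (rule grid_cell[OF g ar])
    then have "B r = canon (?\<tau> j)" by (intro B_val) auto
    then show ?thesis using canonHS[of "?\<tau> j"] j(2) \<tau>b(1)[of j] j(1) by (auto intro: HS_monoD)
  next
    case False
    then show ?thesis using B_zero[OF False] HS_const[OF r, of 0] by simp
  qed
  have B_err: "N2 P (\<lambda>\<omega>. canon r \<omega> - B r \<omega>) \<le> ennreal (2 * c2 * h)" if r: "r \<in> {a..<b}" for r
  proof -
    have ar: "a \<le> r" "r < b" using r by auto
    obtain j where j: "j < Suc m" "?\<tau> j \<le> r" "r < ?\<tau> (Suc j)"
      by (rule grid_cell[OF g ar])
    have "N2 P (\<lambda>\<omega>. canon r \<omega> - canon (?\<tau> j) \<omega>) \<le> ennreal (2 * c2 * (r - ?\<tau> j)) * N2 P (\<lambda>_. 1)"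
      using HS_increment_N2[OF HS_const[of "?\<tau> j" 1] j(2)] \<tau>b(1)[of j] j(1) by simp
    also have "\<dots> = ennreal (2 * c2 * (r - ?\<tau> j))" by (simp add: N2_def emeasure_space_1[unfolded space_P])
    also have "\<dots> \<le> ennreal (2 * c2 * h)"
      using j mesh[of j] by (intro ennreal_leI mult_left_mono) auto
    finally show ?thesis using B_val[of j r] j by simp
  qed
  have [measurable]: "J' a \<in> borel_measurable P" "J' b \<in> borel_measurable P" using J'(1) ab by auto
  have [measurable]: "JJ n a \<in> borel_measurable P" "JJ n b \<in> borel_measurable P" for n
    using ap ab by (auto simp: approx_def)
  have SS: "S b \<omega> - S a \<omega> = (\<Sum>j<Suc m. canon (?\<tau> j) \<omega> * (canon (?\<tau> (Suc j)) \<omega> - canon (?\<tau> j) \<omega>))" for \<omega>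
    unfolding S_def step_integral_def sum_subtractf[symmetric]
  proof (rule sum.cong[OF refl])
    fix j assume "j \<in> {..<Suc m}"
    then have "min (?\<tau> (Suc j)) b = ?\<tau> (Suc j)" "min (?\<tau> j) b = ?\<tau> j" "min (?\<tau> (Suc j)) a = a" "min (?\<tau> j) a = a"
      using \<tau>b[of j] \<tau>b[of "Suc j"] by auto
    then show "canon (?\<tau> j) \<omega> * (canon (min (?\<tau> (Suc j)) b) \<omega> - canon (min (?\<tau> j) b) \<omega>) -
        canon (?\<tau> j) \<omega> * (canon (min (?\<tau> (Suc j)) a) \<omega> - canon (min (?\<tau> j) a) \<omega>)
      = canon (?\<tau> j) \<omega> * (canon (?\<tau> (Suc j)) \<omega> - canon (?\<tau> j) \<omega>)" by simp
  qed
  define R where "R \<omega> = (\<Sum>j<Suc m. canon (?\<tau> j) \<omega> * (canon (?\<tau> (Suc j)) \<omega> - canon (?\<tau> j) \<omega>))" for \<omega>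
  have [measurable]: "R \<in> borel_measurable P"
    unfolding R_def[abs_def]
  proof (rule borel_measurable_sum)
    fix j assume "j \<in> {..<Suc m}"
    then have [measurable]: "canon (?\<tau> j) \<in> borel_measurable P" "canon (?\<tau> (Suc j)) \<in> borel_measurable P"
      using \<tau>b[of j] \<tau>b[of "Suc j"] by auto
    show "(\<lambda>\<omega>. canon (?\<tau> j) \<omega> * (canon (?\<tau> (Suc j)) \<omega> - canon (?\<tau> j) \<omega>)) \<in> borel_measurable P" by measurable
  qed
  have em [measurable]: "e n \<in> borel_measurable lebesgue" for n using ap by (auto simp: approx_def)
  have Gad: "G n r \<in> HS P r" if "r \<in> {0..<T}" for n r
    using ap that by (auto simp: approx_def adapted_def)
  have bound: "N2 P (\<lambda>\<omega>. (J' b \<omega> - J' a \<omega>) - R \<omega>)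
      \<le> (4 * Lq P 2 (\<lambda>\<omega>. JJ n b \<omega> - J' b \<omega>) + 4 * Lq P 2 (\<lambda>\<omega>. JJ n a \<omega> - J' a \<omega>)
        + ennreal (8 * c2) * (\<integral>\<^sup>+r. e n r \<partial>lebesgue)) + ennreal (16 * c2\<^sup>2 * (b - a)\<^sup>2 / Suc m)" for n
  proof -
    obtain F where F: "step_on F canon (G n) (JJ n)" using ap unfolding approx_def by blast
    have 1: "N2 P (\<lambda>\<omega>. (JJ n b \<omega> - JJ n a \<omega>) - R \<omega>)
        \<le> ennreal (2 * c2) * (\<integral>\<^sup>+r. N2 P (\<lambda>\<omega>. G n r \<omega> - B r \<omega>) * indicator {a..<b} r \<partial>lebesgue)"
    proof -
      have "N2 P (\<lambda>\<omega>. 1 * ((JJ n b \<omega> - S b \<omega>) - (JJ n a \<omega> - S a \<omega>)))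
        \<le> ennreal (2 * c2) * (\<integral>\<^sup>+r. N2 P (\<lambda>\<omega>. 1 * (G n r \<omega> - B r \<omega>)) * indicator {a..<b} r \<partial>lebesgue)"
        by (rule elementary_integral_B(3)[OF step_on_diff[OF F st] _ ab HS_const[OF ab(1)], of 1])
          (auto intro!: HS_diff Gad B_ad)
      moreover have "(JJ n b \<omega> - S b \<omega>) - (JJ n a \<omega> - S a \<omega>) = (JJ n b \<omega> - JJ n a \<omega>) - R \<omega>" for \<omega>
        using SS[of \<omega>] unfolding R_def by simp
      ultimately show ?thesis by simp
    qed
    also have "(\<integral>\<^sup>+r. N2 P (\<lambda>\<omega>. G n r \<omega> - B r \<omega>) * indicator {a..<b} r \<partial>lebesgue)
        \<le> (\<integral>\<^sup>+r. 2 * e n r + ennreal (4 * c2 * h) * indicator {a..<b} r \<partial>lebesgue)"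
    proof (rule nn_integral_mono)
      fix r
      show "N2 P (\<lambda>\<omega>. G n r \<omega> - B r \<omega>) * indicator {a..<b} r \<le> 2 * e n r + ennreal (4 * c2 * h) * indicator {a..<b} r"
      proof (cases "r \<in> {a..<b}")
        case True
        then have r: "r \<in> {0..<T}" using ab by auto
        have "N2 P (\<lambda>\<omega>. G n r \<omega> - B r \<omega>) \<le> 2 * N2 P (\<lambda>\<omega>. G n r \<omega> - canon r \<omega>) + 2 * N2 P (\<lambda>\<omega>. canon r \<omega> - B r \<omega>)"
          using r by (intro N2_triangle HS_measurable[OF Gad] HS_measurable[OF B_ad] canon_measurable) auto
        also have "\<dots> \<le> 2 * e n r + 2 * ennreal (2 * c2 * h)"
          using e r B_err[OF True] by (intro add_mono mult_left_mono) (auto simp: Lq_2)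
        also have "2 * ennreal (2 * c2 * h) = ennreal (4 * c2 * h)"
          using ennreal_mult'[of 2 "2 * c2 * h"] by (simp add: mult.assoc)
        finally show ?thesis using True by simp
      qed simp
    qed
    also have "\<dots> = 2 * (\<integral>\<^sup>+r. e n r \<partial>lebesgue) + ennreal (4 * c2 * h * (b - a))"
      using ab h by (simp add: nn_integral_add nn_integral_cmult nn_integral_cmult_indicator ennreal_mult')
    finally have 2: "N2 P (\<lambda>\<omega>. (JJ n b \<omega> - JJ n a \<omega>) - R \<omega>)
        \<le> ennreal (2 * c2) * (2 * (\<integral>\<^sup>+r. e n r \<partial>lebesgue) + ennreal (4 * c2 * h * (b - a)))"
      by (simp add: mult_left_mono)
    have 3: "N2 P (\<lambda>\<omega>. (J' b \<omega> - J' a \<omega>) - (JJ n b \<omega> - JJ n a \<omega>))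
        \<le> 2 * Lq P 2 (\<lambda>\<omega>. JJ n b \<omega> - J' b \<omega>) + 2 * Lq P 2 (\<lambda>\<omega>. JJ n a \<omega> - J' a \<omega>)"
      unfolding Lq_2[symmetric] by (rule Lq_le_add) auto
    have "N2 P (\<lambda>\<omega>. (J' b \<omega> - J' a \<omega>) - R \<omega>) \<le> 2 * N2 P (\<lambda>\<omega>. (J' b \<omega> - J' a \<omega>) - (JJ n b \<omega> - JJ n a \<omega>))
        + 2 * N2 P (\<lambda>\<omega>. (JJ n b \<omega> - JJ n a \<omega>) - R \<omega>)"
      by (rule N2_triangle) auto
    also have "\<dots> \<le> 2 * (2 * Lq P 2 (\<lambda>\<omega>. JJ n b \<omega> - J' b \<omega>) + 2 * Lq P 2 (\<lambda>\<omega>. JJ n a \<omega> - J' a \<omega>))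
        + 2 * (ennreal (2 * c2) * (2 * (\<integral>\<^sup>+r. e n r \<partial>lebesgue) + ennreal (4 * c2 * h * (b - a))))"
      by (intro add_mono mult_left_mono 2 3) auto
    also have "\<dots> = (4 * Lq P 2 (\<lambda>\<omega>. JJ n b \<omega> - J' b \<omega>) + 4 * Lq P 2 (\<lambda>\<omega>. JJ n a \<omega> - J' a \<omega>)
        + ennreal (8 * c2) * (\<integral>\<^sup>+r. e n r \<partial>lebesgue)) + ennreal (16 * c2\<^sup>2 * (b - a)\<^sup>2 / Suc m)"
    proof -
      have i: "2 * (ennreal (2 * c2) * (2 * x)) = ennreal (8 * c2) * x" for x
      proof -
        have "2 * (ennreal (2 * c2) * (2 * x)) = (ennreal 4 * ennreal (2 * c2)) * x"
          by (simp add: mult.assoc mult.left_commute)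
        also have "ennreal 4 * ennreal (2 * c2) = ennreal (8 * c2)"
          by (subst ennreal_mult'[symmetric]) auto
        finally show ?thesis .
      qed
      have j: "2 * (ennreal (2 * c2) * ennreal (4 * c2 * h * (b - a))) = ennreal (16 * c2\<^sup>2 * (b - a)\<^sup>2 / Suc m)"
      proof -
        have "2 * (ennreal (2 * c2) * ennreal (4 * c2 * h * (b - a))) = ennreal 2 * (ennreal (2 * c2) * ennreal (4 * c2 * h * (b - a)))"
          by simp
        also have "\<dots> = ennreal (2 * (2 * c2 * (4 * c2 * h * (b - a))))"
          using h ab by (simp only: ennreal_mult[symmetric] c2_nonneg mult_nonneg_nonneg zero_le_numeral diff_ge_0_iff_ge less_imp_le)
        also have "2 * (2 * c2 * (4 * c2 * h * (b - a))) = 16 * c2\<^sup>2 * (b - a)\<^sup>2 / Suc m"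
          by (simp add: h_def power2_eq_square)
        finally show ?thesis .
      qed
      show ?thesis by (simp only: distrib_left i j add.assoc) (simp add: mult.assoc[symmetric] add.assoc)
    qed
    finally show ?thesis .
  qed
  have "(\<lambda>n. 4 * Lq P 2 (\<lambda>\<omega>. JJ n b \<omega> - J' b \<omega>) + 4 * Lq P 2 (\<lambda>\<omega>. JJ n a \<omega> - J' a \<omega>)
        + ennreal (8 * c2) * (\<integral>\<^sup>+r. e n r \<partial>lebesgue)) \<longlonglongrightarrow> 4 * 0 + 4 * 0 + ennreal (8 * c2) * 0"
    using lim ab ap by (intro tendsto_add ennreal_tendsto_cmult) (auto simp: approx_def)
  from tendsto_add[OF this tendsto_const]
  have "N2 P (\<lambda>\<omega>. (J' b \<omega> - J' a \<omega>) - R \<omega>) \<le> (4 * 0 + 4 * 0 + ennreal (8 * c2) * 0) + ennreal (16 * c2\<^sup>2 * (b - a)\<^sup>2 / Suc m)"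
    by (rule LIMSEQ_le_const) (use bound in blast)
  then show ?thesis unfolding R_def by simp
qed

text \<open>The increment of \<open>\<langle>B\<rangle>\<close> is the sum \<open>Q\<close> of the squared increments of \<open>B\<close> minus twice the error \<open>I\<close> of the Riemann
  sums for the Ito integral. As the mesh tends to 0 the error tends to 0, and \<open>Q\<close> stays between 0 and
  \<open>c2 (b - a)\<close> up to an error that vanishes in norm.\<close>

lemma quadratic_variation_increment:
  assumes J: "\<And>t. t \<in> {0..T} \<Longrightarrow> has_G_integral PG 2 T canon canon t (J t)" and T: "0 < T"
    and J': "\<And>t. t \<in> {0..T} \<Longrightarrow> J' t \<in> borel_measurable P" "\<And>t. t \<in> {0..T} \<Longrightarrow> AE \<omega> in P. J t \<omega> = J' t \<omega>"
    and ab: "0 \<le> a" "a < b" "b \<le> T"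
  shows "AE \<omega> in P. \<bar>((canon b \<omega>)\<^sup>2 - 2 * J' b \<omega>) - ((canon a \<omega>)\<^sup>2 - 2 * J' a \<omega>)\<bar> \<le> c2 * (b - a)"
proof -
  define q where "q \<omega> = ((canon b \<omega>)\<^sup>2 - 2 * J' b \<omega>) - ((canon a \<omega>)\<^sup>2 - 2 * J' a \<omega>)" for \<omega>
  define \<tau> where "\<tau> m j = a + upart (b - a) m j" for m j
  define Q where "Q m \<omega> = (\<Sum>j<Suc m. (canon (\<tau> m (Suc j)) \<omega> - canon (\<tau> m j) \<omega>)\<^sup>2)" for m \<omega>
  define R where "R m \<omega> = (\<Sum>j<Suc m. canon (\<tau> m j) \<omega> * (canon (\<tau> m (Suc j)) \<omega> - canon (\<tau> m j) \<omega>))" for m \<omega>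
  define I where "I m \<omega> = (J' b \<omega> - J' a \<omega>) - R m \<omega>" for m \<omega>
  have g: "grid (Suc m) (\<tau> m) a b" for m unfolding \<tau>_def by (rule upart_shift_grid[OF ab(2)])
  have mesh: "\<tau> m (Suc j) - \<tau> m j = (b - a) / Suc m" for m j
    using upart_mesh[of "b - a" m j] by (simp add: \<tau>_def)
  have \<tau>0: "0 \<le> \<tau> m j" if "j \<le> Suc m" for m j using grid_bounds[OF g that] ab by simp
  have \<tau>mono: "\<tau> m j \<le> \<tau> m (Suc j)" if "j < Suc m" for m j using that by (intro grid_mono[OF g]) auto
  have qQ: "q \<omega> = Q m \<omega> - 2 * I m \<omega>" for m \<omega>
  proof -
    have "Q m \<omega> + 2 * R m \<omega> = (\<Sum>j<Suc m. (canon (\<tau> m (Suc j)) \<omega>)\<^sup>2 - (canon (\<tau> m j) \<omega>)\<^sup>2)"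
      unfolding Q_def R_def sum_distrib_left sum.distrib[symmetric]
      by (intro sum.cong refl) (simp add: power2_eq_square algebra_simps)
    also have "\<dots> = (canon b \<omega>)\<^sup>2 - (canon a \<omega>)\<^sup>2"
      using sum_lessThan_telescope[of "\<lambda>j. (canon (\<tau> m j) \<omega>)\<^sup>2" "Suc m"] g[of m] by (simp only: grid_def)
    finally show ?thesis by (simp add: q_def I_def)
  qed
  have [measurable]: "J' a \<in> borel_measurable P" "J' b \<in> borel_measurable P" "canon a \<in> borel_measurable P" "canon b \<in> borel_measurable P"
    using J'(1) ab by auto
  have qm [measurable]: "q \<in> borel_measurable P" unfolding q_def[abs_def] by measurable
  have Qx: "(\<lambda>\<omega>. max 0 (Q m \<omega> - c2 * (b - a))) \<in> borel_measurable P"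
    and Qle: "N2 P (\<lambda>\<omega>. max 0 (Q m \<omega> - c2 * (b - a))) \<le> ennreal ((c4 + c2\<^sup>2) * (b - a)\<^sup>2 / Suc m)" for m
  proof -
    have "(\<Sum>j<Suc m. \<tau> m (Suc j) - \<tau> m j) = b - a"
      using sum_lessThan_telescope[of "\<tau> m" "Suc m"] g[of m] by (simp only: grid_def)
    then have eq: "(\<Sum>j<Suc m. (canon (\<tau> m (Suc j)) \<omega> - canon (\<tau> m j) \<omega>)\<^sup>2 - c2 * (\<tau> m (Suc j) - \<tau> m j)) = Q m \<omega> - c2 * (b - a)" for \<omega>
      unfolding Q_def sum_subtractf sum_distrib_left[symmetric] by (simp only:)
    note sq = squared_increments_bound[of "Suc m" "\<tau> m", OF \<tau>mono \<tau>0[of 0], unfolded eq]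
    have [measurable]: "(\<lambda>\<omega>. Q m \<omega> - c2 * (b - a)) \<in> borel_measurable P" using L_ip_measurable[OF sq(1)] by simp
    show "(\<lambda>\<omega>. max 0 (Q m \<omega> - c2 * (b - a))) \<in> borel_measurable P" by measurable
    have "(\<Sum>j<Suc m. (\<tau> m (Suc j) - \<tau> m j)\<^sup>2) = (b - a)\<^sup>2 / Suc m"
      unfolding mesh by (simp add: power_divide power2_eq_square[of "1 + real m"] del: sum.lessThan_Suc)
    then show "N2 P (\<lambda>\<omega>. max 0 (Q m \<omega> - c2 * (b - a))) \<le> ennreal ((c4 + c2\<^sup>2) * (b - a)\<^sup>2 / Suc m)"
      using sq(2) by simp
  qed
  have Im: "I m \<in> borel_measurable P" for m
  proof -
    have "I m = (\<lambda>\<omega>. (Q m \<omega> - q \<omega>) / 2)" by (rule ext) (simp add: qQ[of _ m])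
    moreover have "Q m \<in> borel_measurable P"
      unfolding Q_def[abs_def]
    proof (rule borel_measurable_sum)
      fix j assume "j \<in> {..<Suc m}"
      then have [measurable]: "canon (\<tau> m j) \<in> borel_measurable P" "canon (\<tau> m (Suc j)) \<in> borel_measurable P"
        using \<tau>0[of j m] \<tau>0[of "Suc j" m] by auto
      show "(\<lambda>\<omega>. (canon (\<tau> m (Suc j)) \<omega> - canon (\<tau> m j) \<omega>)\<^sup>2) \<in> borel_measurable P" by measurable
    qed
    ultimately show ?thesis by simp
  qed
  define W where "W \<omega> = max 0 (\<bar>q \<omega>\<bar> - c2 * (b - a))" for \<omega>
  have Wm: "W \<in> borel_measurable P" unfolding W_def[abs_def] by measurable
  have "N2 P W \<le> ennreal 4 * ennreal (2 * (16 * c2\<^sup>2 * (b - a)\<^sup>2) / Suc m) + ennreal 2 * ennreal ((c4 + c2\<^sup>2) * (b - a)\<^sup>2 / Suc m)" for m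
  proof -
    have "N2 P W \<le> 2 * Lq P 2 (\<lambda>\<omega>. 2 * I m \<omega>) + 2 * Lq P 2 (\<lambda>\<omega>. max 0 (Q m \<omega> - c2 * (b - a)))"
      unfolding Lq_2[symmetric]
    proof (rule Lq_le_add)
      have "0 \<le> Q m \<omega>" for \<omega> unfolding Q_def by (intro sum_nonneg) simp
      moreover have "\<bar>max 0 (\<bar>x - 2 * y\<bar> - c)\<bar> \<le> \<bar>2 * y\<bar> + \<bar>max 0 (x - c)\<bar>" if "0 \<le> x" for x y c :: real
        using that by (auto simp: max_def abs_if)
      ultimately have "\<bar>W \<omega>\<bar> \<le> \<bar>2 * I m \<omega>\<bar> + \<bar>max 0 (Q m \<omega> - c2 * (b - a))\<bar>" for \<omega>
        unfolding W_def qQ[of \<omega> m] by blast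
      then show "AE \<omega> in P. \<bar>W \<omega>\<bar> \<le> \<bar>2 * I m \<omega>\<bar> + \<bar>max 0 (Q m \<omega> - c2 * (b - a))\<bar>" by simp
    qed (use Im Qx in auto)
    also have "\<dots> \<le> 2 * (ennreal (2\<^sup>2) * N2 P (I m)) + 2 * N2 P (\<lambda>\<omega>. max 0 (Q m \<omega> - c2 * (b - a)))"
      unfolding Lq_2 by (intro add_mono mult_left_mono N2_le_scaled Im) (auto simp: abs_mult)
    also have "\<dots> \<le> 2 * (ennreal (2\<^sup>2) * ennreal (16 * c2\<^sup>2 * (b - a)\<^sup>2 / Suc m)) + 2 * ennreal ((c4 + c2\<^sup>2) * (b - a)\<^sup>2 / Suc m)"
      using canon_integral_riemann[OF J T J' ab, of m] Qle[of m] unfolding I_def R_def \<tau>_def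
      by (intro add_mono mult_left_mono) auto
    also have "2 * (ennreal (2\<^sup>2) * ennreal (16 * c2\<^sup>2 * (b - a)\<^sup>2 / Suc m)) = ennreal 4 * ennreal (2 * (16 * c2\<^sup>2 * (b - a)\<^sup>2) / Suc m)"
      using ennreal_mult'[of 2 "16 * c2\<^sup>2 * (b - a)\<^sup>2 / Suc m"] by (simp add: mult_ac)
    finally show ?thesis by simp
  qed
  moreover have "(\<lambda>m. ennreal 4 * ennreal (2 * (16 * c2\<^sup>2 * (b - a)\<^sup>2) / Suc m) + ennreal 2 * ennreal ((c4 + c2\<^sup>2) * (b - a)\<^sup>2 / Suc m))
      \<longlonglongrightarrow> ennreal 4 * ennreal 0 + ennreal 2 * ennreal 0"
    by (intro tendsto_add ennreal_tendsto_cmult tendsto_ennrealI LIMSEQ_Suc[OF lim_const_over_n]) auto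
  ultimately have "N2 P W \<le> ennreal 4 * ennreal 0 + ennreal 2 * ennreal 0"
    by (intro LIMSEQ_le_const) auto
  then have "AE \<omega> in P. W \<omega> = 0" by (intro N2_0_AE[OF Wm]) simp
  then show ?thesis
    by (rule eventually_mono) (auto simp: W_def q_def max_def split: if_splits)
qed

text \<open>Continuity of the paths makes the bound simultaneous in both time points.\<close>

lemma quadratic_variation_Lipschitz:
  assumes J: "\<And>t. t \<in> {0..T} \<Longrightarrow> has_G_integral PG 2 T canon canon t (J t)" and T: "0 < T"
    and J': "\<And>t. t \<in> {0..T} \<Longrightarrow> J' t \<in> borel_measurable P" "\<And>t. t \<in> {0..T} \<Longrightarrow> AE \<omega> in P. J t \<omega> = J' t \<omega>"
      "\<And>\<omega>. continuous_on UNIV (\<lambda>t. J' t \<omega>)"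
  defines "V \<equiv> (\<lambda>t \<omega>. (canon t \<omega>)\<^sup>2 - 2 * J' t \<omega>)"
  shows "AE \<omega> in P. \<forall>s t. 0 \<le> s \<longrightarrow> s \<le> t \<longrightarrow> t \<le> T \<longrightarrow> \<bar>V t \<omega> - V s \<omega>\<bar> \<le> c2 * (t - s)"
proof -
  have "AE \<omega> in P. \<forall>a\<in>\<rat>. \<forall>b\<in>\<rat>. 0 \<le> a \<longrightarrow> a < b \<longrightarrow> b \<le> T \<longrightarrow> \<bar>V b \<omega> - V a \<omega>\<bar> \<le> c2 * (b - a)"
    unfolding V_def
    by (intro AE_ball_countable' countable_rat AE_impI quadratic_variation_increment[OF J T J'(1,2)])
  then show ?thesis
  proof (rule eventually_mono, intro allI impI)
    fix \<omega> s t
    assume rat: "\<forall>a\<in>\<rat>. \<forall>b\<in>\<rat>. 0 \<le> a \<longrightarrow> a < b \<longrightarrow> b \<le> T \<longrightarrow> \<bar>V b \<omega> - V a \<omega>\<bar> \<le> c2 * (b - a)"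
      and st: "0 \<le> s" "s \<le> t" "t \<le> T"
    have cont: "continuous_on {0..T} (\<lambda>t. V t \<omega>)"
    proof -
      have "continuous_on {0..T} (\<lambda>t. canon t \<omega>)"
        using continuous_on_subset[of "{0..}" "\<lambda>t. canon t \<omega>" "{0..T}"] Rep_path[of \<omega>] by (simp add: canon_def)
      then show ?thesis
        unfolding V_def using continuous_on_subset[OF J'(3)] by (intro continuous_intros) auto
    qed
    have *: "\<bar>V t \<omega> - V a \<omega>\<bar> - c2 * (t - a) \<le> 0" if a: "a \<in> \<rat>" "0 \<le> a" "a < T" "t \<in> {a..T}" for a t
      by (rule continuous_le_from_rationals[of a T "\<lambda>t. \<bar>V t \<omega> - V a \<omega>\<bar> - c2 * (t - a)"])
        (use a rat cont in \<open>auto intro!: continuous_intros intro: continuous_on_subset\<close>)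
    show "\<bar>V t \<omega> - V s \<omega>\<bar> \<le> c2 * (t - s)"
    proof (cases "t = 0")
      case False
      have "\<bar>V t \<omega> - V s \<omega>\<bar> - c2 * (t - s) \<le> 0"
        by (rule continuous_le_from_rationals[of 0 t "\<lambda>s. \<bar>V t \<omega> - V s \<omega>\<bar> - c2 * (t - s)"])
          (use False st * cont in \<open>auto intro!: continuous_intros intro: continuous_on_subset\<close>)
      then show ?thesis by simp
    qed (use st in simp)
  qed
qed

end

section \<open>Processes in the completion are adapted at almost all times\<close>

context G_measure
begin

text \<open>Norm convergence of the approximating step processes gives, by Fatou's lemma, approximations
  that come arbitrarily close at almost every single time.\<close>

lemma M_G_square_integrable_adapted:
  assumes X: "X \<in> M_G PG p T" and p: "2 \<le> p" and T: "0 < T"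
    and X': "\<And>t. X' t \<in> borel_measurable P" "AE \<omega> in P. \<forall>t\<in>{0..T}. X t \<omega> = X' t \<omega>"
  shows "AE r in lebesgue. r \<in> {0..<T} \<longrightarrow> X' r \<in> HS P r"
    and "(\<integral>\<^sup>+r. N2 P (X' r) * indicator {0..<T} r \<partial>lebesgue) < \<infinity>"
proof -
  obtain N \<tau> \<xi> where sd: "\<And>n. step_data PG p T (N n) (\<tau> n) (\<xi> n)"
    and Mt: "M_G_tendsto PG p T (\<lambda>n. step_process (N n) (\<tau> n) (\<xi> n)) X"
    using X unfolding M_G_def by blast
  have grid: "grid (N n) (\<tau> n) 0 T" for n
    using sd[of n] by (simp add: step_data_def grid_def)
  obtain \<zeta> e where \<zeta>: "\<forall>n. \<forall>k<N n. \<zeta> n k \<in> adapted p (\<tau> n k)"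
    and e: "\<forall>n. e n \<in> borel_measurable lebesgue" and e_lim: "(\<lambda>n. \<integral>\<^sup>+r. e n r \<partial>lebesgue) \<longlonglongrightarrow> 0"
    and err: "\<forall>n. \<forall>r\<in>{0..<T}. Lq P p (\<lambda>\<omega>. step_process (N n) (\<tau> n) (\<zeta> n) r \<omega> - X r \<omega>) \<le> e n r"
    by (rule M_G_tendsto_approx[OF sd Mt T])
  have \<zeta>HS: "\<zeta> n k \<in> HS P (\<tau> n k)" if "k < N n" for n k using \<zeta> that p by (auto simp: adapted_def)
  have em [measurable]: "e n \<in> borel_measurable lebesgue" for n using e by blast
  have cell: "\<exists>k<N n. \<zeta> n k \<in> HS P r \<and> Lq P p (\<lambda>\<omega>. X' r \<omega> - \<zeta> n k \<omega>) \<le> e n r" if r: "r \<in> {0..<T}" for n r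
  proof -
    obtain k where k: "k < N n" "\<tau> n k \<le> r" "step_process (N n) (\<tau> n) (\<zeta> n) r = \<zeta> n k"
      by (rule step_process_cell[OF grid r])
    have "AE \<omega> in P. X' r \<omega> - \<zeta> n k \<omega> = X r \<omega> - \<zeta> n k \<omega>"
      using X'(2) by (rule eventually_mono) (use r in auto)
    then have "Lq P p (\<lambda>\<omega>. X' r \<omega> - \<zeta> n k \<omega>) = Lq P p (\<lambda>\<omega>. X r \<omega> - \<zeta> n k \<omega>)" by (rule Lq_cong_AE)
    also have "\<dots> = Lq P p (\<lambda>\<omega>. \<zeta> n k \<omega> - X r \<omega>)" by (rule Lq_commute)
    also have "\<dots> \<le> e n r" using err r unfolding k(3)[symmetric] by blast
    finally show ?thesis using k HS_monoD[OF \<zeta>HS[OF k(1)] k(2)] by blast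
  qed
  \<comment> \<open>By Fatou's lemma the errors come arbitrarily close to 0 at almost every single time.\<close>
  have "(\<integral>\<^sup>+r. liminf (\<lambda>n. e n r) \<partial>lebesgue) \<le> liminf (\<lambda>n. \<integral>\<^sup>+r. e n r \<partial>lebesgue)"
    by (rule nn_integral_liminf) simp
  also have "\<dots> = 0" by (rule lim_imp_Liminf[OF _ e_lim]) simp
  finally have "(\<integral>\<^sup>+r. liminf (\<lambda>n. e n r) \<partial>lebesgue) = 0" by simp
  then have "AE r in lebesgue. liminf (\<lambda>n. e n r) = 0"
    by (subst (asm) nn_integral_0_iff_AE) auto
  then show "AE r in lebesgue. r \<in> {0..<T} \<longrightarrow> X' r \<in> HS P r"
  proof (rule eventually_mono, intro impI)
    fix r assume l: "liminf (\<lambda>n. e n r) = 0" and r: "r \<in> {0..<T}"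
    show "X' r \<in> HS P r"
    proof (rule HS_closed_eps[OF X'(1)])
      fix \<epsilon> :: real assume \<epsilon>: "0 < \<epsilon>"
      obtain d where d: "0 < d" "\<forall>Z\<in>borel_measurable P. Lq P p Z \<le> ennreal d \<longrightarrow> N2 P Z \<le> ennreal \<epsilon>"
        by (rule N2_small[OF \<epsilon> p])
      have "\<exists>n. e n r \<le> ennreal d"
      proof (rule ccontr)
        assume "\<not> ?thesis"
        then have "ennreal d \<le> liminf (\<lambda>n. e n r)"
          by (intro Liminf_bounded always_eventually) (auto simp: not_le less_imp_le)
        then show False using l d(1) by simp
      qed
      then obtain n where n: "e n r \<le> ennreal d" by blast
      obtain k where k: "\<zeta> n k \<in> HS P r" "Lq P p (\<lambda>\<omega>. X' r \<omega> - \<zeta> n k \<omega>) \<le> e n r"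
        using cell[OF r, of n] by blast
      have "(\<lambda>\<omega>. X' r \<omega> - \<zeta> n k \<omega>) \<in> borel_measurable P" using X'(1) HS_measurable[OF k(1)] by simp
      then have "N2 P (\<lambda>\<omega>. X' r \<omega> - \<zeta> n k \<omega>) \<le> ennreal \<epsilon>" using d(2) order_trans[OF k(2) n] by blast
      with k(1) show "\<exists>W\<in>HS P r. N2 P (\<lambda>\<omega>. X' r \<omega> - W \<omega>) \<le> ennreal \<epsilon>" by blast
    qed
  qed
  obtain n where n: "(\<integral>\<^sup>+r. e n r \<partial>lebesgue) < 1"
    using eventually_happens'[OF sequentially_bot order_tendstoD(2)[OF e_lim zero_less_one]] by blast
  define B where "B = (\<Sum>k<N n. N2 P (\<zeta> n k))"
  have B: "B < \<infinity>" unfolding B_def using HS_N2[OF \<zeta>HS] by (simp add: less_top)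
  have "(\<integral>\<^sup>+r. N2 P (X' r) * indicator {0..<T} r \<partial>lebesgue)
      \<le> (\<integral>\<^sup>+r. (2 + 2 * B) * indicator {0..<T} r + 2 * e n r \<partial>lebesgue)"
  proof (rule nn_integral_mono)
    fix r
    show "N2 P (X' r) * indicator {0..<T} r \<le> (2 + 2 * B) * indicator {0..<T} r + 2 * e n r"
    proof (cases "r \<in> {0..<T}")
      case True
      obtain k where k: "k < N n" "\<zeta> n k \<in> HS P r" "Lq P p (\<lambda>\<omega>. X' r \<omega> - \<zeta> n k \<omega>) \<le> e n r"
        using cell[OF True, of n] by blast
      note [measurable] = X'(1) HS_measurable[OF k(2)]
      have "N2 P (X' r) \<le> 2 * N2 P (\<lambda>\<omega>. X' r \<omega> - \<zeta> n k \<omega>) + 2 * N2 P (\<zeta> n k)"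
        using N2_add[of "\<lambda>\<omega>. X' r \<omega> - \<zeta> n k \<omega>" P "\<zeta> n k"] by simp
      also have "\<dots> \<le> 2 * (1 + e n r) + 2 * B"
      proof (intro add_mono mult_left_mono)
        have "N2 P (\<lambda>\<omega>. X' r \<omega> - \<zeta> n k \<omega>) \<le> ennreal 1 + ennreal (1 powr (1 - p / 2)) * Lq P p (\<lambda>\<omega>. X' r \<omega> - \<zeta> n k \<omega>)"
          by (rule N2_le_Lq) (use p in auto)
        also have "\<dots> \<le> 1 + e n r" using k(3) by simp
        finally show "N2 P (\<lambda>\<omega>. X' r \<omega> - \<zeta> n k \<omega>) \<le> 1 + e n r" .
        show "N2 P (\<zeta> n k) \<le> B" unfolding B_def using k(1) by (intro member_le_sum) auto
      qed auto
      finally show ?thesis using True by (simp add: distrib_left add_ac)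
    qed simp
  qed
  also have "\<dots> = (2 + 2 * B) * ennreal T + 2 * (\<integral>\<^sup>+r. e n r \<partial>lebesgue)"
    using T by (simp add: nn_integral_add nn_integral_cmult nn_integral_cmult_indicator)
  also have "\<dots> < \<infinity>"
    using n B by (auto simp: ennreal_mult_less_top ennreal_add_eq_top less_top[symmetric] ennreal_mult_eq_top_iff top_unique)
  finally show "(\<integral>\<^sup>+r. N2 P (X' r) * indicator {0..<T} r \<partial>lebesgue) < \<infinity>" .
qed

text \<open>By continuity of the paths, bounded functions of the process are adapted at every time.\<close>

lemma HS_compose_continuous:
  assumes D: "\<And>\<omega>. continuous_on UNIV (\<lambda>t. D t \<omega>)" "\<And>t. D t \<in> borel_measurable P" "AE \<omega> in P. D 0 \<omega> = 0"
    and ad: "AE r in lebesgue. r \<in> {0..<T} \<longrightarrow> D r \<in> HS P r"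
    and u: "\<And>a b :: real. \<bar>u a - u b\<bar> \<le> L * \<bar>a - b\<bar>" "\<And>x. \<bar>u x\<bar> \<le> R" "continuous_on UNIV u"
    and t: "0 \<le> t" "t < T"
  shows "(\<lambda>\<omega>. u (D t \<omega>)) \<in> HS P t"
proof -
  have um [measurable]: "u \<in> borel_measurable borel" by (rule borel_measurable_continuous_onI[OF u(3)])
  note [measurable] = D(2)
  show ?thesis
  proof (cases "t = 0")
    case True
    have "AE \<omega> in P. u 0 = u (D 0 \<omega>)" using D(3) by (rule eventually_mono) simp
    then show ?thesis
      unfolding True by (intro HS_cong_AE[OF HS_const[of 0 "u 0"]]) auto
  next
    case False
    have ad': "AE r in lebesgue. r \<in> {0..t} \<longrightarrow> (r < t \<longrightarrow> D r \<in> HS P r)"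
      using ad by (rule eventually_mono) (use t in auto)
    have "\<forall>n. \<exists>r. t - t / Suc n \<le> r \<and> r < t \<and> D r \<in> HS P r"
    proof
      fix n
      have "0 \<le> t - t / Suc n" "t - t / Suc n < t"
        using t False by (auto simp: divide_simps)
      then obtain r where "t - t / Suc n < r" "r < t" "r < t \<longrightarrow> D r \<in> HS P r"
        by (rule AE_lebesgue_dense[OF ad' _ _ order_refl])
      then show "\<exists>r. t - t / Suc n \<le> r \<and> r < t \<and> D r \<in> HS P r" by (intro exI[of _ r]) auto
    qed
    then obtain r where r: "\<And>n. t - t / Suc n \<le> r n" "\<And>n. r n < t" "\<And>n. D (r n) \<in> HS P (r n)" by metis
    have r_lim: "r \<longlonglongrightarrow> t"
    proof (rule tendsto_sandwich[OF _ _ _ tendsto_const])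
      show "(\<lambda>n. t - t / Suc n) \<longlonglongrightarrow> t"
        using tendsto_diff[OF tendsto_const LIMSEQ_Suc[OF lim_const_over_n[of t]], of t] by simp
    qed (use r in \<open>auto intro!: always_eventually less_imp_le\<close>)
    have "(\<lambda>n. \<integral>\<^sup>+\<omega>. ennreal ((u (D t \<omega>) - u (D (r n) \<omega>))\<^sup>2) \<partial>P) \<longlonglongrightarrow> (\<integral>\<^sup>+\<omega>. 0 \<partial>P)"
    proof (rule nn_integral_dominated_convergence[where w = "\<lambda>_. ennreal ((2 * R)\<^sup>2)"])
      show "AE \<omega> in P. ennreal ((u (D t \<omega>) - u (D (r n) \<omega>))\<^sup>2) \<le> ennreal ((2 * R)\<^sup>2)" for n
      proof (rule AE_I2, rule ennreal_leI)
        fix \<omega>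
        have "\<bar>u (D t \<omega>) - u (D (r n) \<omega>)\<bar> \<le> \<bar>2 * R\<bar>"
          using u(2)[of "D t \<omega>"] u(2)[of "D (r n) \<omega>"] by linarith
        then show "(u (D t \<omega>) - u (D (r n) \<omega>))\<^sup>2 \<le> (2 * R)\<^sup>2" by (simp only: abs_le_square_iff)
      qed
      show "AE \<omega> in P. (\<lambda>n. ennreal ((u (D t \<omega>) - u (D (r n) \<omega>))\<^sup>2)) \<longlonglongrightarrow> 0"
      proof (rule AE_I2)
        fix \<omega>
        have "(\<lambda>n. D (r n) \<omega>) \<longlonglongrightarrow> D t \<omega>"
          by (rule continuous_on_tendsto_compose[OF D(1) r_lim]) auto
        then have "(\<lambda>n. u (D (r n) \<omega>)) \<longlonglongrightarrow> u (D t \<omega>)"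
          by (rule continuous_on_tendsto_compose[OF u(3)]) auto
        then have "(\<lambda>n. (u (D t \<omega>) - u (D (r n) \<omega>))\<^sup>2) \<longlonglongrightarrow> (u (D t \<omega>) - u (D t \<omega>))\<^sup>2"
          by (intro tendsto_power tendsto_diff tendsto_const)
        from tendsto_ennrealI[OF this] show "(\<lambda>n. ennreal ((u (D t \<omega>) - u (D (r n) \<omega>))\<^sup>2)) \<longlonglongrightarrow> 0" by simp
      qed
    qed (auto simp: emeasure_space_1[unfolded space_P] ennreal_mult_less_top)
    then have lim: "(\<lambda>n. N2 P (\<lambda>\<omega>. u (D t \<omega>) - u (D (r n) \<omega>))) \<longlonglongrightarrow> 0" by (simp add: N2_def)
    have "(\<lambda>\<omega>. u (D (r n) \<omega>)) \<in> HS P t" for n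
      by (rule HS_monoD[OF HS_lipschitz[OF r(3) u(1) um] less_imp_le[OF r(2)]])
    then show ?thesis by (intro HS_closed[OF _ _ lim]) simp
  qed
qed

lemma AE_zero_all_times:
  assumes D: "\<And>\<omega>. continuous_on UNIV (\<lambda>t. D t \<omega>)" and T: "(0 :: real) < T"
    and z: "\<And>t. 0 \<le> t \<Longrightarrow> t < T \<Longrightarrow> AE \<omega> in P. D t \<omega> = (0 :: real)"
  shows "AE \<omega> in P. \<forall>t\<in>{0..T}. D t \<omega> = 0"
proof -
  have "AE \<omega> in P. \<forall>r\<in>\<rat>. 0 \<le> r \<longrightarrow> r < T \<longrightarrow> D r \<omega> = 0"
    by (intro AE_ball_countable' countable_rat AE_impI z)
  then show ?thesis
  proof (rule eventually_mono, intro ballI)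
    fix \<omega> t assume rat: "\<forall>r\<in>\<rat>. 0 \<le> r \<longrightarrow> r < T \<longrightarrow> D r \<omega> = 0" and t: "t \<in> {0..T}"
    have "continuous_on {0..T} (\<lambda>t. \<bar>D t \<omega>\<bar>)" using continuous_on_subset[OF D] by (intro continuous_intros) auto
    then have "\<bar>D t \<omega>\<bar> \<le> 0" by (rule continuous_le_from_rationals[OF _ _ T t]) (use rat in auto)
    then show "D t \<omega> = 0" by simp
  qed
qed

lemma dominated_integral_0:
  assumes N: "dominated_integral T q A C D N" and q: "q = 1 \<or> q = 2" and T: "0 < T"
    and [measurable]: "N 0 \<in> borel_measurable P"
  shows "AE \<omega> in P. N 0 \<omega> = 0"
proof -
  obtain G J e where ap: "approx T q A G J e" and lim: "(\<lambda>n. Lq P q (\<lambda>\<omega>. J n 0 \<omega> - N 0 \<omega>)) \<longlonglongrightarrow> 0"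
    using N T unfolding dominated_integral_def by auto
  have "J n 0 \<omega> = 0" for n \<omega> using ap by (simp add: approx_def)
  then have "Lq P q (\<lambda>\<omega>. 0 - N 0 \<omega>) = 0" using lim by (simp add: LIMSEQ_const_iff)
  then have "AE \<omega> in P. ennreal (\<bar>N 0 \<omega>\<bar> powr q) = 0"
    unfolding Lq_def by (subst (asm) nn_integral_0_iff_AE) auto
  then show ?thesis by (rule eventually_mono) (auto simp: ennreal_eq_0_iff)
qed

lemma version_AE:
  assumes "version T X X'"
  shows "AE \<omega> in P. \<forall>t\<in>{0..T}. X t \<omega> = X' t \<omega>" "\<And>t. X' t \<in> borel_measurable P"
    "\<And>\<omega>. continuous_on UNIV (\<lambda>t. X' t \<omega>)"
  using assms qs_AE[OF P_in] borel_measurable_P unfolding version_def by blast+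

lemma integral_processes_dominated:
  assumes int: "G_integral_process PG q T A \<eta> I" "G_integral_process PG q T A \<eta>' I'"
    and v: "version T I I1" "version T I' I1'" and A1: "integrator T q A1"
    and AA1: "AE \<omega> in P. \<forall>t\<in>{0..T}. A t \<omega> = A1 t \<omega>" and T: "0 < T"
    and dom: "\<And>r. r \<in> {0..T} \<Longrightarrow> AE \<omega> in P. \<bar>\<eta> r \<omega> - \<eta>' r \<omega>\<bar> \<le> C * \<bar>D r \<omega>\<bar>"
  shows "dominated_integral T q A1 C D (\<lambda>t \<omega>. I1 t \<omega> - I1' t \<omega>)"
proof -
  have i: "has_G_integral PG q T A \<eta> t (I t)" "has_G_integral PG q T A \<eta>' t (I' t)" if "t \<in> {0..T}" for t
    using int that by (auto simp: G_integral_process_def)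
  have eq: "AE \<omega> in P. I t \<omega> = I1 t \<omega>" "AE \<omega> in P. I' t \<omega> = I1' t \<omega>" if "t \<in> {0..T}" for t
    using eventually_mono[OF version_AE(1)[OF v(1)], of "\<lambda>\<omega>. I t \<omega> = I1 t \<omega>"]
      eventually_mono[OF version_AE(1)[OF v(2)], of "\<lambda>\<omega>. I' t \<omega> = I1' t \<omega>"] that by auto
  obtain G J e where 1: "approx T q A1 G J e"
    "\<forall>n. \<forall>r\<in>{0..<T}. Lq P q (\<lambda>\<omega>. G n r \<omega> - \<eta> r \<omega>) \<le> e n r"
    "\<forall>t\<in>{0..T}. (\<lambda>n. Lq P q (\<lambda>\<omega>. J n t \<omega> - I1 t \<omega>)) \<longlonglongrightarrow> 0"
    by (rule integral_process_approx[OF i(1) A1 AA1 T version_AE(2)[OF v(1)] eq(1)])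
  obtain G' J' e' where 2: "approx T q A1 G' J' e'"
    "\<forall>n. \<forall>r\<in>{0..<T}. Lq P q (\<lambda>\<omega>. G' n r \<omega> - \<eta>' r \<omega>) \<le> e' n r"
    "\<forall>t\<in>{0..T}. (\<lambda>n. Lq P q (\<lambda>\<omega>. J' n t \<omega> - I1' t \<omega>)) \<longlonglongrightarrow> 0"
    by (rule integral_process_approx[OF i(2) A1 AA1 T version_AE(2)[OF v(2)] eq(2)])
  have T0: "T \<in> {0..T}" using T by simp
  show ?thesis
    by (rule approx_difference[OF A1 1(1) 2(1) 1(2) 2(2) 1(3) 2(3)
          has_G_integral_AE_time_measurable[OF i(1)[OF T0]] has_G_integral_AE_time_measurable[OF i(2)[OF T0]]
          version_AE(2)[OF v(1)] version_AE(2)[OF v(2)] dom])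
qed

end

section \<open>Uniqueness\<close>

context G_framework
begin

lemma M_G_version:
  assumes "X \<in> M_G PG p T" "X \<in> M_c PG T" "0 < T"
  obtains X' where "version T X X'"
proof -
  obtain H where "M_G_tendsto PG p T H X" using assms(1) unfolding M_G_def by blast
  then obtain X' where "version T X X'"
    by (rule version_exists[OF assms(2) M_G_tendsto_qs_measurable assms(3)])
  then show thesis by (rule that)
qed

lemma G_integral_process_version:
  assumes I: "G_integral_process PG q T A \<eta> I" and T: "0 < T"
  obtains I' where "version T I I'"
proof -
  have "I \<in> M_c PG T" using I by (simp add: G_integral_process_def)
  moreover have "AE r in lebesgue. r \<in> {0..T} \<longrightarrow> qs_measurable PG (I r)"
    using I by (intro AE_I2) (simp add: G_integral_process_def has_G_integral_def)
  ultimately obtain I' where "version T I I'" by (rule version_exists[OF _ _ T])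
  then show thesis by (rule that)
qed

text \<open>Neither the definition of a solution nor that of \<open>M_G\<close> asks for continuous paths of \<open>X\<close>; they come from the
  equation, all of whose terms are quasi-surely continuous.\<close>

lemma solution_versions:
  assumes sol: "reflected_GSDE_solution PG p T qv x f h g S X K" and T: "0 < T"
  obtains X1 K1 where "version T X X1" "version T K K1"
proof -
  obtain If Ih Ig where I: "dt_integral PG T (\<lambda>s \<omega>. f s (X s \<omega>) \<omega>) If"
      "dQV_integral PG T qv (\<lambda>s \<omega>. h s (X s \<omega>) \<omega>) Ih" "dB_integral PG T (\<lambda>s \<omega>. g s (X s \<omega>) \<omega>) Ig"
    and eq: "qs PG (\<lambda>\<omega>. \<forall>t\<in>{0..T}. X t \<omega> = x + If t \<omega> + Ih t \<omega> + Ig t \<omega> + K t \<omega>)"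
    and X: "X \<in> M_G PG p T" and K: "K \<in> M_c PG T" "K \<in> M_G PG p T"
    using sol unfolding reflected_GSDE_solution_def M_I_def by blast
  have "qs PG (\<lambda>\<omega>. (continuous_on {0..T} (\<lambda>t. If t \<omega>) \<and> continuous_on {0..T} (\<lambda>t. Ih t \<omega>) \<and>
      continuous_on {0..T} (\<lambda>t. Ig t \<omega>) \<and> continuous_on {0..T} (\<lambda>t. K t \<omega>)) \<and>
      (\<forall>t\<in>{0..T}. X t \<omega> = x + If t \<omega> + Ih t \<omega> + Ig t \<omega> + K t \<omega>))"
    using I K(1) eq by (intro qs_conj) (auto simp: G_integral_process_def M_c_def)
  then have "qs PG (\<lambda>\<omega>. continuous_on {0..T} (\<lambda>t. X t \<omega>))"
  proof (rule qs_mono)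
    fix \<omega> assume "(continuous_on {0..T} (\<lambda>t. If t \<omega>) \<and> continuous_on {0..T} (\<lambda>t. Ih t \<omega>) \<and>
      continuous_on {0..T} (\<lambda>t. Ig t \<omega>) \<and> continuous_on {0..T} (\<lambda>t. K t \<omega>)) \<and>
      (\<forall>t\<in>{0..T}. X t \<omega> = x + If t \<omega> + Ih t \<omega> + Ig t \<omega> + K t \<omega>)"
    then show "continuous_on {0..T} (\<lambda>t. X t \<omega>)"
      by (subst continuous_on_cong[OF refl, of _ _ "\<lambda>t. x + If t \<omega> + Ih t \<omega> + Ig t \<omega> + K t \<omega>"])
        (auto intro!: continuous_intros)
  qed
  then have "X \<in> M_c PG T" by (simp add: M_c_def)
  then obtain X1 where X1: "version T X X1" by (rule M_G_version[OF X _ T])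
  obtain K1 where K1: "version T K K1" by (rule M_G_version[OF K(2,1) T])
  from X1 K1 show thesis by (rule that)
qed

lemma solution_integral_versions:
  assumes sol: "reflected_GSDE_solution PG p T qv x f h g S X K" and T: "0 < T"
    and v: "version T X X1" "version T K K1"
  obtains If Ih Ig If1 Ih1 Ig1 where
    "dt_integral PG T (\<lambda>s \<omega>. f s (X s \<omega>) \<omega>) If" "dQV_integral PG T qv (\<lambda>s \<omega>. h s (X s \<omega>) \<omega>) Ih"
    "dB_integral PG T (\<lambda>s \<omega>. g s (X s \<omega>) \<omega>) Ig"
    "version T If If1" "version T Ih Ih1" "version T Ig Ig1"
    "qs PG (\<lambda>\<omega>. \<forall>t\<in>{0..T}. X1 t \<omega> = x + If1 t \<omega> + Ih1 t \<omega> + Ig1 t \<omega> + K1 t \<omega>)"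
proof -
  obtain If Ih Ig where I: "dt_integral PG T (\<lambda>s \<omega>. f s (X s \<omega>) \<omega>) If"
      "dQV_integral PG T qv (\<lambda>s \<omega>. h s (X s \<omega>) \<omega>) Ih" "dB_integral PG T (\<lambda>s \<omega>. g s (X s \<omega>) \<omega>) Ig"
    and eq: "qs PG (\<lambda>\<omega>. \<forall>t\<in>{0..T}. X t \<omega> = x + If t \<omega> + Ih t \<omega> + Ig t \<omega> + K t \<omega>)"
    using sol unfolding reflected_GSDE_solution_def by blast
  obtain If1 where If1: "version T If If1" by (rule G_integral_process_version[OF I(1) T])
  obtain Ih1 where Ih1: "version T Ih Ih1" by (rule G_integral_process_version[OF I(2) T])
  obtain Ig1 where Ig1: "version T Ig Ig1" by (rule G_integral_process_version[OF I(3) T])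
  have "qs PG (\<lambda>\<omega>. (\<forall>t\<in>{0..T}. X t \<omega> = x + If t \<omega> + Ih t \<omega> + Ig t \<omega> + K t \<omega>) \<and>
      (\<forall>t\<in>{0..T}. X t \<omega> = X1 t \<omega>) \<and> (\<forall>t\<in>{0..T}. K t \<omega> = K1 t \<omega>) \<and> (\<forall>t\<in>{0..T}. If t \<omega> = If1 t \<omega>) \<and>
      (\<forall>t\<in>{0..T}. Ih t \<omega> = Ih1 t \<omega>) \<and> (\<forall>t\<in>{0..T}. Ig t \<omega> = Ig1 t \<omega>))"
    using eq v If1 Ih1 Ig1 unfolding version_def by (intro qs_conj) simp_all
  then have "qs PG (\<lambda>\<omega>. \<forall>t\<in>{0..T}. X1 t \<omega> = x + If1 t \<omega> + Ih1 t \<omega> + Ig1 t \<omega> + K1 t \<omega>)"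
  proof (rule qs_mono, elim conjE, intro ballI)
    fix \<omega> t
    assume a: "\<forall>t\<in>{0..T}. X t \<omega> = x + If t \<omega> + Ih t \<omega> + Ig t \<omega> + K t \<omega>" "\<forall>t\<in>{0..T}. X t \<omega> = X1 t \<omega>"
      "\<forall>t\<in>{0..T}. K t \<omega> = K1 t \<omega>" "\<forall>t\<in>{0..T}. If t \<omega> = If1 t \<omega>" "\<forall>t\<in>{0..T}. Ih t \<omega> = Ih1 t \<omega>"
      "\<forall>t\<in>{0..T}. Ig t \<omega> = Ig1 t \<omega>" and t: "t \<in> {0..T}"
    show "X1 t \<omega> = x + If1 t \<omega> + Ih1 t \<omega> + Ig1 t \<omega> + K1 t \<omega>"
      using a(1)[rule_format, OF t] a(2)[rule_format, OF t] a(3)[rule_format, OF t] a(4)[rule_format, OF t]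
        a(5)[rule_format, OF t] a(6)[rule_format, OF t] by linarith
  qed
  with that[OF I If1 Ih1 Ig1] show thesis by blast
qed

text \<open>Equality under each measure at each time becomes quasi-sure at rational times, because the exceptional
  set is Borel and does not depend on the measure, and extends to all times by continuity.\<close>

lemma version_qs_eq:
  assumes X: "version T X X1" "version T X' X1'" and T: "0 < T"
    and eq: "\<And>P t. P \<in> PG \<Longrightarrow> t \<in> {0..T} \<Longrightarrow> AE \<omega> in P. X1 t \<omega> = X1' t \<omega>"
  shows "qs PG (\<lambda>\<omega>. \<forall>t\<in>{0..T}. X t \<omega> = X' t \<omega>)"
proof -
  have [measurable]: "X1 t \<in> borel_measurable borel" "X1' t \<in> borel_measurable borel" for t
    using X unfolding version_def by blast+
  define q :: "nat \<Rightarrow> real" where "q n = of_rat (from_nat_into UNIV n)" for n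
  have q: "\<exists>n. q n = of_rat r" for r
    unfolding q_def using from_nat_into_surj[of "UNIV :: rat set" r] by auto
  have "qs PG (\<lambda>\<omega>. X1 t \<omega> = X1' t \<omega>)" for t
  proof -
    have t: "clamp_time T t \<in> {0..T}" using T by (auto simp: clamp_time_def)
    have cl: "X1 t = X1 (clamp_time T t)" "X1' t = X1' (clamp_time T t)"
      using X unfolding version_def by blast+
    have A: "{\<omega>. X1 t \<omega> \<noteq> X1' t \<omega>} \<in> sets borel" by measurable
    have "emeasure P {\<omega>. X1 t \<omega> \<noteq> X1' t \<omega>} = 0" if "P \<in> PG" for P
    proof -
      have "AE \<omega> in P. \<omega> \<notin> {\<omega>. X1 t \<omega> \<noteq> X1' t \<omega>}" using eq[OF that t] cl by simp
      then show ?thesis using A PG_props(2)[OF that] by (subst (asm) AE_iff_measurable[OF _ refl]) (auto simp: sets_eq_imp_space_eq)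
    qed
    then have "polar PG {\<omega>. X1 t \<omega> \<noteq> X1' t \<omega>}" using A by (simp add: polar_iff)
    then show ?thesis unfolding qs_def by (intro exI[of _ "{\<omega>. X1 t \<omega> \<noteq> X1' t \<omega>}"]) simp
  qed
  then have "qs PG (\<lambda>\<omega>. (\<forall>n. X1 (q n) \<omega> = X1' (q n) \<omega>) \<and>
      (\<forall>t\<in>{0..T}. X t \<omega> = X1 t \<omega>) \<and> (\<forall>t\<in>{0..T}. X' t \<omega> = X1' t \<omega>))"
    using X unfolding version_def by (intro qs_conj qs_all_countable) simp_all
  then show ?thesis
  proof (rule qs_mono, elim conjE, intro ballI)
    fix \<omega> t
    assume eq: "\<forall>n. X1 (q n) \<omega> = X1' (q n) \<omega>" and v: "\<forall>t\<in>{0..T}. X t \<omega> = X1 t \<omega>" "\<forall>t\<in>{0..T}. X' t \<omega> = X1' t \<omega>"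
      and t: "t \<in> {0..T}"
    have c: "continuous_on UNIV (\<lambda>t. X1 t \<omega>)" "continuous_on UNIV (\<lambda>t. X1' t \<omega>)"
      using X unfolding version_def by blast+
    have "\<bar>X1 t \<omega> - X1' t \<omega>\<bar> \<le> 0"
    proof (rule continuous_le_from_rationals[OF _ _ T t])
      show "continuous_on {0..T} (\<lambda>t. \<bar>X1 t \<omega> - X1' t \<omega>\<bar>)"
        using continuous_on_subset[OF c(1)] continuous_on_subset[OF c(2)] by (intro continuous_intros) auto
      fix r :: real assume "r \<in> \<rat>"
      then obtain s where "r = of_rat s" by (auto simp: Rats_def)
      then obtain n where n: "q n = r" using q[of s] by auto
      show "\<bar>X1 r \<omega> - X1' r \<omega>\<bar> \<le> 0" using eq[rule_format, of n] unfolding n by simp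
    qed
    then show "X t \<omega> = X' t \<omega>" using v t by simp
  qed
qed

end

context G_measure
begin

text \<open>Square integrability is known at almost every time only. Monotonicity transfers it from a
  later time \<open>r < T\<close> to \<open>t\<close>; this is why the estimates are made on \<open>[0,T)\<close>.\<close>

lemma reflection_term_integrable:
  assumes K: "K \<in> M_G PG p T" "K \<in> M_I PG T" and v: "version T K K1"
    and K0: "qs PG (\<lambda>\<omega>. K 0 \<omega> = 0)" and p: "2 \<le> p" and t: "0 \<le> t" "t < T"
  shows "integrable P (\<lambda>\<omega>. K1 t \<omega> - K1 0 \<omega>)"
    and "AE \<omega> in P. mono_on {0..T} (\<lambda>t. K1 t \<omega>)" and "AE \<omega> in P. K1 0 \<omega> = 0"
proof -
  have T: "0 < T" using t by simp
  note m [measurable] = version_AE(2)[OF v]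
  have "AE \<omega> in P. mono_on {0..T} (\<lambda>t. K t \<omega>)" using K(2) qs_AE[OF P_in] unfolding M_I_def by blast
  with version_AE(1)[OF v] show mono: "AE \<omega> in P. mono_on {0..T} (\<lambda>t. K1 t \<omega>)"
    by eventually_elim (auto simp: mono_on_def)
  show z: "AE \<omega> in P. K1 0 \<omega> = 0"
    using version_AE(1)[OF v] qs_AE[OF P_in K0]
  proof eventually_elim
    case (elim \<omega>)
    have "K 0 \<omega> = K1 0 \<omega>" using elim(1) T by simp
    then show ?case using elim(2) by simp
  qed
  have "AE r in lebesgue. r \<in> {0..T} \<longrightarrow> (r < T \<longrightarrow> K1 r \<in> HS P r)"
    using M_G_square_integrable_adapted(1)[OF K(1) p T m version_AE(1)[OF v]]
    by (rule eventually_mono) auto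
  then obtain r where r: "t < r" "r < T" "r < T \<longrightarrow> K1 r \<in> HS P r"
    by (rule AE_lebesgue_dense[OF _ t order_refl])
  have "integrable P (\<lambda>\<omega>. (K1 r \<omega>)\<^sup>2)" using HS_N2[of "K1 r" r] N2_finite_iff[OF m, of r] r by auto
  then have int: "integrable P (K1 r)" by (rule square_integrable_imp_integrable[OF m])
  show "integrable P (\<lambda>\<omega>. K1 t \<omega> - K1 0 \<omega>)"
  proof (rule Bochner_Integration.integrable_bound[OF int])
    show "AE \<omega> in P. norm (K1 t \<omega> - K1 0 \<omega>) \<le> norm (K1 r \<omega>)"
      using mono z
    proof eventually_elim
      case (elim \<omega>)
      have "K1 0 \<omega> \<le> K1 t \<omega>" "K1 t \<omega> \<le> K1 r \<omega>"
        using mono_onD[OF elim(1), of 0 t] mono_onD[OF elim(1), of t r] t r by auto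
      then show ?case using elim(2) by simp
    qed
  qed measurable
qed


text \<open>The hypotheses of \<open>reflected_difference\<close> are verified for the continuous versions. Afterwards both
  integrals of a vanishing difference vanish, which leaves \<open>K = K'\<close>.\<close>

lemma solutions_agree_AE:
  assumes T: "0 < T" and p: "2 \<le> p" and qv: "quadratic_variation PG T qv"
    and lip: "\<And>t. t \<in> {0..T} \<Longrightarrow> qs PG (\<lambda>\<omega>. \<forall>y y'.
      \<bar>f t y \<omega> - f t y' \<omega>\<bar> + \<bar>h t y \<omega> - h t y' \<omega>\<bar> + \<bar>g t y \<omega> - g t y' \<omega>\<bar> \<le> C\<^sub>L * \<bar>y - y'\<bar>)"
    and sol: "reflected_GSDE_solution PG p T qv x f h g S X K"
    and sol': "reflected_GSDE_solution PG p T qv x f h g S X' K'"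
    and vX: "version T X X1" "version T X' X1'" and vK: "version T K K1" "version T K' K1'"
    and t: "t \<in> {0..T}"
  shows "AE \<omega> in P. X1 t \<omega> = X1' t \<omega> \<and> K1 t \<omega> = K1' t \<omega>"
proof -
  obtain If Ih Ig F1 H1 G1 where I: "dt_integral PG T (\<lambda>s \<omega>. f s (X s \<omega>) \<omega>) If"
      "dQV_integral PG T qv (\<lambda>s \<omega>. h s (X s \<omega>) \<omega>) Ih" "dB_integral PG T (\<lambda>s \<omega>. g s (X s \<omega>) \<omega>) Ig"
    and vI: "version T If F1" "version T Ih H1" "version T Ig G1"
    and eq: "qs PG (\<lambda>\<omega>. \<forall>t\<in>{0..T}. X1 t \<omega> = x + F1 t \<omega> + H1 t \<omega> + G1 t \<omega> + K1 t \<omega>)"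
    by (rule solution_integral_versions[OF sol T vX(1) vK(1)])
  obtain If' Ih' Ig' F1' H1' G1' where I': "dt_integral PG T (\<lambda>s \<omega>. f s (X' s \<omega>) \<omega>) If'"
      "dQV_integral PG T qv (\<lambda>s \<omega>. h s (X' s \<omega>) \<omega>) Ih'" "dB_integral PG T (\<lambda>s \<omega>. g s (X' s \<omega>) \<omega>) Ig'"
    and vI': "version T If' F1'" "version T Ih' H1'" "version T Ig' G1'"
    and eq': "qs PG (\<lambda>\<omega>. \<forall>t\<in>{0..T}. X1' t \<omega> = x + F1' t \<omega> + H1' t \<omega> + G1' t \<omega> + K1' t \<omega>)"
    by (rule solution_integral_versions[OF sol' T vX(2) vK(2)])
  have XX: "X \<in> M_G PG p T" "X' \<in> M_G PG p T" and KK: "K \<in> M_G PG p T" "K \<in> M_I PG T"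
      "K' \<in> M_G PG p T" "K' \<in> M_I PG T"
    and K0: "qs PG (\<lambda>\<omega>. K 0 \<omega> = 0)" "qs PG (\<lambda>\<omega>. K' 0 \<omega> = 0)"
    and S: "AE \<omega> in P. \<forall>t\<in>{0..T}. X t \<omega> \<ge> S t \<omega>" "AE \<omega> in P. \<forall>t\<in>{0..T}. X' t \<omega> \<ge> S t \<omega>"
    and RS: "AE \<omega> in P. has_RS_integral (\<lambda>t. X t \<omega> - S t \<omega>) (\<lambda>t. K t \<omega>) 0 T 0"
      "AE \<omega> in P. has_RS_integral (\<lambda>t. X' t \<omega> - S t \<omega>) (\<lambda>t. K' t \<omega>) 0 T 0"
    using sol sol' qs_AE[OF P_in] unfolding reflected_GSDE_solution_def by blast+
  define D where "D t \<omega> = X1 t \<omega> - X1' t \<omega>" for t \<omega>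
  define F where "F t \<omega> = F1 t \<omega> - F1' t \<omega>" for t \<omega>
  define H where "H t \<omega> = H1 t \<omega> - H1' t \<omega>" for t \<omega>
  define N where "N t \<omega> = G1 t \<omega> - G1' t \<omega>" for t \<omega>
  define V where "V t \<omega> = F t \<omega> + H t \<omega>" for t \<omega>
  define C where "C = \<bar>C\<^sub>L\<bar>"
  have C_nonneg: "0 \<le> C" by (simp add: C_def)
  note meas = version_AE(2)[OF vX(1)] version_AE(2)[OF vX(2)] version_AE(2)[OF vK(1)] version_AE(2)[OF vK(2)]
    version_AE(2)[OF vI(1)] version_AE(2)[OF vI(2)] version_AE(2)[OF vI(3)]
    version_AE(2)[OF vI'(1)] version_AE(2)[OF vI'(2)] version_AE(2)[OF vI'(3)]
  note [measurable] = meas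
  have Dm [measurable]: "D t \<in> borel_measurable P" and Fm [measurable]: "F t \<in> borel_measurable P"
    and Hm [measurable]: "H t \<in> borel_measurable P" and Nm [measurable]: "N t \<in> borel_measurable P" for t
    unfolding D_def[abs_def] F_def[abs_def] H_def[abs_def] N_def[abs_def] by measurable
  have Vm [measurable]: "V t \<in> borel_measurable P" for t unfolding V_def[abs_def] by measurable
  have D_cont: "continuous_on UNIV (\<lambda>t. D t \<omega>)" for \<omega>
    unfolding D_def by (intro continuous_on_diff version_AE(3)[OF vX(1)] version_AE(3)[OF vX(2)])
  have N_cont: "continuous_on UNIV (\<lambda>t. N t \<omega>)" for \<omega>
    unfolding N_def by (intro continuous_on_diff version_AE(3)[OF vI(3)] version_AE(3)[OF vI'(3)])
  have D_joint: "(\<lambda>(r, \<omega>). D r \<omega>) \<in> borel_measurable (borel \<Otimes>\<^sub>M P)"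
    by (rule continuous_joint_measurable[OF D_cont Dm])
  have decomposition: "AE \<omega> in P. \<forall>t\<in>{0..T}. D t \<omega> = V t \<omega> + N t \<omega> + K1 t \<omega> - K1' t \<omega>"
    using qs_AE[OF P_in eq] qs_AE[OF P_in eq']
    by eventually_elim (simp add: D_def V_def N_def F_def H_def)
  have Lip: "AE \<omega> in P. \<bar>f r (X r \<omega>) \<omega> - f r (X' r \<omega>) \<omega>\<bar> \<le> C * \<bar>D r \<omega>\<bar> \<and>
      \<bar>h r (X r \<omega>) \<omega> - h r (X' r \<omega>) \<omega>\<bar> \<le> C * \<bar>D r \<omega>\<bar> \<and>
      \<bar>g r (X r \<omega>) \<omega> - g r (X' r \<omega>) \<omega>\<bar> \<le> C * \<bar>D r \<omega>\<bar>" if r: "r \<in> {0..T}" for r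
    using qs_AE[OF P_in lip[OF r]] version_AE(1)[OF vX(1)] version_AE(1)[OF vX(2)]
  proof eventually_elim
    case (elim \<omega>)
    have "D r \<omega> = X r \<omega> - X' r \<omega>" using elim(2,3) r by (simp add: D_def)
    moreover have "C\<^sub>L * \<bar>X r \<omega> - X' r \<omega>\<bar> \<le> C * \<bar>X r \<omega> - X' r \<omega>\<bar>"
      unfolding C_def by (rule mult_right_mono) auto
    ultimately show ?case using elim(1)[rule_format, of "X r \<omega>" "X' r \<omega>"] by auto
  qed
  obtain J where J: "dB_integral PG T canon J" and qv_eq: "\<And>t \<omega>. qv t \<omega> = (canon t \<omega>)\<^sup>2 - 2 * J t \<omega>"
    using qv unfolding quadratic_variation_def by blast
  obtain J1 where vJ: "version T J J1" by (rule G_integral_process_version[OF J T])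
  \<comment> \<open>a version of \<open>\<langle>B\<rangle>\<close> with continuous paths on \<open>[0,T]\<close>\<close>
  define Q where "Q t \<omega> = (canon t \<omega>)\<^sup>2 - 2 * J1 t \<omega>" for t \<omega>
  have Q_lip: "AE \<omega> in P. \<forall>s t. 0 \<le> s \<longrightarrow> s \<le> t \<longrightarrow> t \<le> T \<longrightarrow> \<bar>Q t \<omega> - Q s \<omega>\<bar> \<le> c2 * (t - s)"
    unfolding Q_def
  proof (rule quadratic_variation_Lipschitz[OF _ T version_AE(2)[OF vJ] _ version_AE(3)[OF vJ]])
    fix t assume "t \<in> {0..T}"
    then show "has_G_integral PG 2 T canon canon t (J t)" "AE \<omega> in P. J t \<omega> = J1 t \<omega>"
      using J eventually_mono[OF version_AE(1)[OF vJ], of "\<lambda>\<omega>. J t \<omega> = J1 t \<omega>"]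
      by (auto simp: G_integral_process_def)
  qed
  have Qm: "Q t \<in> borel_measurable P" if "t \<in> {0..T}" for t
  proof -
    have [measurable]: "canon t \<in> borel_measurable P" "J1 t \<in> borel_measurable P"
      using that version_AE(2)[OF vJ] by auto
    show ?thesis unfolding Q_def[abs_def] by measurable
  qed
  have qvQ: "AE \<omega> in P. \<forall>t\<in>{0..T}. qv t \<omega> = Q t \<omega>"
    using version_AE(1)[OF vJ] by (rule eventually_mono) (simp add: qv_eq Q_def)
  have t_lip: "AE \<omega> in P. \<forall>s t. 0 \<le> s \<longrightarrow> s \<le> t \<longrightarrow> t \<le> T \<longrightarrow> \<bar>t - s\<bar> \<le> 1 * (t - s)" by simp
  have F_dom: "dominated_integral T 1 (\<lambda>t \<omega>. t) C D F"
    unfolding F_def by (rule integral_processes_dominated[OF I(1) I'(1) vI(1) vI'(1)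
          integrator_Lipschitz[OF t_lip] _ T]) (use Lip in \<open>auto elim: eventually_mono\<close>)
  have H_dom: "dominated_integral T 1 Q C D H"
    unfolding H_def by (rule integral_processes_dominated[OF I(2) I'(2) vI(2) vI'(2)
          integrator_Lipschitz[OF Q_lip Qm] qvQ T]) (use Lip in \<open>auto elim: eventually_mono\<close>)
  have N_dom: "dominated_integral T 2 canon C D N"
    unfolding N_def by (rule integral_processes_dominated[OF I(3) I'(3) vI(3) vI'(3)
          integrator_B _ T]) (use Lip in \<open>auto elim: eventually_mono\<close>)
  have zero: "AE \<omega> in P. F 0 \<omega> = 0" "AE \<omega> in P. H 0 \<omega> = 0" "AE \<omega> in P. N 0 \<omega> = 0"
    using dominated_integral_0[OF F_dom _ T Fm] dominated_integral_0[OF H_dom _ T Hm]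
      dominated_integral_0[OF N_dom _ T Nm] by auto
  note K_facts = reflection_term_integrable[OF KK(1,2) vK(1) K0(1) p]
    reflection_term_integrable[OF KK(3,4) vK(2) K0(2) p]
  have K_mono: "AE \<omega> in P. mono_on {0..T} (\<lambda>t. K1 t \<omega>)" "AE \<omega> in P. mono_on {0..T} (\<lambda>t. K1' t \<omega>)"
    and K_0: "AE \<omega> in P. K1 0 \<omega> = 0" "AE \<omega> in P. K1' 0 \<omega> = 0"
    using K_facts(2,3,5,6)[of 0] T by auto
  have D_0: "AE \<omega> in P. D 0 \<omega> = 0"
    using decomposition zero K_0
  proof eventually_elim
    case (elim \<omega>)
    then show ?case using T by (simp add: V_def)
  qed
  \<comment> \<open>The integrator \<open>t\<close> has Lipschitz constant 1 and \<open>\<langle>B\<rangle>\<close> has \<open>c2\<close>.\<close>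
  have V_dominated: "AE \<omega> in P. ennreal \<bar>V b \<omega> - V a \<omega>\<bar>
      \<le> ennreal ((1 + c2) * C) * (\<integral>\<^sup>+r. ennreal \<bar>D r \<omega>\<bar> * indicator {a..<b} r \<partial>lborel)"
    if ab: "0 \<le> a" "a < b" "b \<le> T" for a b
    using dominated_integral_Lipschitz[OF F_dom C_nonneg zero_le_one Fm t_lip D_joint ab]
      dominated_integral_Lipschitz[OF H_dom C_nonneg c2_nonneg Hm Q_lip D_joint ab]
  proof eventually_elim
    fix \<omega>
    let ?I = "\<integral>\<^sup>+r. ennreal \<bar>D r \<omega>\<bar> * indicator {a..<b} r \<partial>lborel"
    assume le: "ennreal \<bar>F b \<omega> - F a \<omega>\<bar> \<le> ennreal (1 * C) * ?I" "ennreal \<bar>H b \<omega> - H a \<omega>\<bar> \<le> ennreal (c2 * C) * ?I"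
    have "ennreal \<bar>V b \<omega> - V a \<omega>\<bar> \<le> ennreal (\<bar>F b \<omega> - F a \<omega>\<bar> + \<bar>H b \<omega> - H a \<omega>\<bar>)"
      by (rule ennreal_leI) (simp add: V_def)
    also have "\<dots> \<le> ennreal (1 * C) * ?I + ennreal (c2 * C) * ?I"
      using add_mono[OF le] by (simp add: ennreal_plus)
    also have "\<dots> = ennreal ((1 + c2) * C) * ?I"
      using c2_nonneg by (simp add: C_def algebra_simps ennreal_plus[symmetric] distrib_right[symmetric] del: ennreal_plus)
    finally show "ennreal \<bar>V b \<omega> - V a \<omega>\<bar> \<le> ennreal ((1 + c2) * C) * ?I" .
  qed
  note X_HS = M_G_square_integrable_adapted[OF XX(1) p T meas(1) version_AE(1)[OF vX(1)]]
    M_G_square_integrable_adapted[OF XX(2) p T meas(2) version_AE(1)[OF vX(2)]]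
  have D_HS: "AE r in lebesgue. r \<in> {0..<T} \<longrightarrow> D r \<in> HS P r"
    using X_HS(1,3) by eventually_elim (auto simp: D_def[abs_def] intro: HS_diff)
  have D_L2: "(\<integral>\<^sup>+r. N2 P (D r) * indicator {0..<T} r \<partial>lborel) < \<infinity>"
  proof -
    have jm: "(\<lambda>r. N2 P (Y r)) \<in> borel_measurable borel" if v: "version T Y0 Y" for Y0 Y
    proof -
      have [measurable]: "(\<lambda>(r, \<omega>). Y r \<omega>) \<in> borel_measurable (borel \<Otimes>\<^sub>M P)"
        by (rule continuous_joint_measurable[OF version_AE(3)[OF v] version_AE(2)[OF v]])
      show ?thesis unfolding N2_def by measurable
    qed
    note [measurable] = jm[OF vX(1)] jm[OF vX(2)]
    have "(\<integral>\<^sup>+r. N2 P (D r) * indicator {0..<T} r \<partial>lborel)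
        \<le> (\<integral>\<^sup>+r. 2 * (N2 P (X1 r) * indicator {0..<T} r) + 2 * (N2 P (X1' r) * indicator {0..<T} r) \<partial>lborel)"
      using N2_diff[OF meas(1,2)] by (intro nn_integral_mono) (auto simp: D_def[abs_def] indicator_def)
    also have "\<dots> = 2 * (\<integral>\<^sup>+r. N2 P (X1 r) * indicator {0..<T} r \<partial>lborel) +
        2 * (\<integral>\<^sup>+r. N2 P (X1' r) * indicator {0..<T} r \<partial>lborel)"
      by (simp add: nn_integral_add nn_integral_cmult)
    also have "\<dots> < \<infinity>"
      using X_HS(2,4) by (simp add: nn_integral_completion ennreal_mult_less_top)
    finally show ?thesis .
  qed
  have bounds: "\<bar>\<nu> x\<bar> \<le> 1" for x using \<nu>_pos[of x] \<nu>_le_1[of x] by simp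
  have \<phi>'_HS: "(\<lambda>\<omega>. \<phi>' (D a \<omega>)) \<in> HS P a" and \<nu>_HS: "(\<lambda>\<omega>. \<nu> (D a \<omega>)) \<in> HS P a" if "0 \<le> a" "a < T" for a
    by (rule HS_compose_continuous[OF D_cont Dm D_0 D_HS \<phi>'_lipschitz abs_\<phi>'_le_1 \<phi>_continuous(2) that])
      (rule HS_compose_continuous[OF D_cont Dm D_0 D_HS \<nu>_lipschitz bounds \<phi>_continuous(3) that])
  have reflection: "AE \<omega> in P. \<forall>t\<in>{0<..<T}. \<forall>e>0. \<forall>\<^sub>F m in sequentially. (\<Sum>i<Suc m. \<phi>' (D (upart t m i) \<omega>) *
      ((K1 (upart t m (Suc i)) \<omega> - K1 (upart t m i) \<omega>) - (K1' (upart t m (Suc i)) \<omega> - K1' (upart t m i) \<omega>))) \<le> e"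
    using S RS K_mono version_AE(1)[OF vX(1)] version_AE(1)[OF vX(2)] version_AE(1)[OF vK(1)] version_AE(1)[OF vK(2)]
  proof (eventually_elim, intro ballI allI impI)
    fix \<omega> t and e :: real
    assume S: "\<forall>t\<in>{0..T}. X t \<omega> \<ge> S t \<omega>" "\<forall>t\<in>{0..T}. X' t \<omega> \<ge> S t \<omega>"
      and RS: "has_RS_integral (\<lambda>t. X t \<omega> - S t \<omega>) (\<lambda>t. K t \<omega>) 0 T 0"
        "has_RS_integral (\<lambda>t. X' t \<omega> - S t \<omega>) (\<lambda>t. K' t \<omega>) 0 T 0"
      and m: "mono_on {0..T} (\<lambda>t. K1 t \<omega>)" "mono_on {0..T} (\<lambda>t. K1' t \<omega>)"
      and v: "\<forall>t\<in>{0..T}. X t \<omega> = X1 t \<omega>" "\<forall>t\<in>{0..T}. X' t \<omega> = X1' t \<omega>"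
        "\<forall>t\<in>{0..T}. K t \<omega> = K1 t \<omega>" "\<forall>t\<in>{0..T}. K' t \<omega> = K1' t \<omega>"
      and t: "t \<in> {0<..<T}" and e: "0 < e"
    have m': "mono_on {0..T} (\<lambda>t. K t \<omega>)" "mono_on {0..T} (\<lambda>t. K' t \<omega>)"
      using m v(3,4) unfolding mono_on_def by simp_all
    have t': "0 < t" "t < T" using t by auto
    have up: "upart t m i \<in> {0..T}" if "i \<le> Suc m" for m i
    proof -
      have "upart t m i \<in> {0..t}" using grid_bounds[OF upart_grid[OF t'(1)] that] by auto
      then show ?thesis using t' by auto
    qed
    have sums: "(\<Sum>i<Suc m. \<phi>' (X (upart t m i) \<omega> - X' (upart t m i) \<omega>) *
        ((K (upart t m (Suc i)) \<omega> - K (upart t m i) \<omega>) - (K' (upart t m (Suc i)) \<omega> - K' (upart t m i) \<omega>)))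
      = (\<Sum>i<Suc m. \<phi>' (D (upart t m i) \<omega>) *
        ((K1 (upart t m (Suc i)) \<omega> - K1 (upart t m i) \<omega>) - (K1' (upart t m (Suc i)) \<omega> - K1' (upart t m i) \<omega>)))" for m
    proof (rule sum.cong[OF refl])
      fix i assume "i \<in> {..<Suc m}"
      then have "upart t m i \<in> {0..T}" "upart t m (Suc i) \<in> {0..T}" using up[of i m] up[of "Suc i" m] by auto
      then show "\<phi>' (X (upart t m i) \<omega> - X' (upart t m i) \<omega>) *
        ((K (upart t m (Suc i)) \<omega> - K (upart t m i) \<omega>) - (K' (upart t m (Suc i)) \<omega> - K' (upart t m i) \<omega>))
        = \<phi>' (D (upart t m i) \<omega>) *
        ((K1 (upart t m (Suc i)) \<omega> - K1 (upart t m i) \<omega>) - (K1' (upart t m (Suc i)) \<omega> - K1' (upart t m i) \<omega>))"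
        using v by (simp add: D_def)
    qed
    have "\<forall>\<^sub>F m in sequentially. (\<Sum>i<Suc m. \<phi>' (X (upart t m i) \<omega> - X' (upart t m i) \<omega>) *
        ((K (upart t m (Suc i)) \<omega> - K (upart t m i) \<omega>) - (K' (upart t m (Suc i)) \<omega> - K' (upart t m i) \<omega>))) \<le> e"
      using S by (intro reflection_sums[OF RS _ _ m' t' e]) auto
    then show "\<forall>\<^sub>F m in sequentially. (\<Sum>i<Suc m. \<phi>' (D (upart t m i) \<omega>) *
        ((K1 (upart t m (Suc i)) \<omega> - K1 (upart t m i) \<omega>) - (K1' (upart t m (Suc i)) \<omega> - K1' (upart t m i) \<omega>))) \<le> e"
      unfolding sums .
  qed
  have one: "(\<lambda>_. 1) \<in> HS P a" if "0 \<le> a" for a by (rule HS_const[OF that])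
  note N_int = dominated_integral_B[OF N_dom Nm D_joint]
  interpret reflected_difference P T "(1 + c2) * C" "8 * c2 * C\<^sup>2" D N V K1 K1'
  proof
    show "0 \<le> (1 + c2) * C" "0 \<le> 8 * c2 * C\<^sup>2" using c2_nonneg by (auto simp: C_def)
    fix a b assume ab: "0 \<le> a" "a < b" "b \<le> T"
    have a: "a < T" using ab by simp
    show "N2 P (\<lambda>\<omega>. N b \<omega> - N a \<omega>) < \<infinity>"
      by (rule N_int(1)[OF ab one[OF ab(1)], of 1]) simp
    show "(\<integral>\<omega>. \<phi>' (D a \<omega>) * (N b \<omega> - N a \<omega>) \<partial>P) = 0"
      by (rule N_int(2)[OF ab \<phi>'_HS[OF ab(1) a] abs_\<phi>'_le_1])
    show "N2 P (\<lambda>\<omega>. \<nu> (D a \<omega>) * (N b \<omega> - N a \<omega>)) \<le> ennreal (8 * c2 * C\<^sup>2) *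
        (\<integral>\<^sup>+r. N2 P (\<lambda>\<omega>. \<nu> (D a \<omega>) * D r \<omega>) * indicator {a..<b} r \<partial>lborel)"
      using N_int(3)[OF ab \<nu>_HS[OF ab(1) a] bounds] by (simp add: nn_integral_completion)
  qed (fact D_joint D_cont N_cont Nm Vm meas D_0 D_L2 decomposition V_dominated K_mono reflection
      K_facts(1) K_facts(4))+
  \<comment> \<open>The end point \<open>T\<close> is reached by continuity.\<close>
  have D_zero: "AE \<omega> in P. \<forall>t\<in>{0..T}. D t \<omega> = 0"
    by (rule AE_zero_all_times[OF D_cont T D_eq_0])
  show ?thesis
  proof (cases "t = 0")
    case True
    show ?thesis using D_0 K_0 by eventually_elim (simp add: True D_def)
  next
    case False
    have t': "0 \<le> (0::real)" "0 < t" "t \<le> T" using False t by auto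
    have "AE \<omega> in P. V t \<omega> - V 0 \<omega> = 0"
      using V_dominated[OF t'] D_zero
    proof eventually_elim
      case (elim \<omega>)
      have "(\<integral>\<^sup>+r. ennreal \<bar>D r \<omega>\<bar> * indicator {0..<t} r \<partial>lborel) = (\<integral>\<^sup>+r. 0 \<partial>(lborel :: real measure))"
        using elim(2) t'(3) by (intro nn_integral_cong) (auto simp: indicator_def)
      then show ?case using elim(1) by simp
    qed
    moreover have "AE \<omega> in P. N t \<omega> - N 0 \<omega> = 0"
    proof (rule N2_0_AE)
      have "N2 P (D r) * indicator {0..<t} r = 0" for r
      proof (cases "r \<in> {0..<t}")
        case True
        then have r: "r \<in> {0..T}" using t'(3) by auto
        have "N2 P (D r) = N2 P (\<lambda>_. 0)"
          by (rule N2_cong_AE) (use D_zero r in \<open>auto elim: eventually_mono\<close>)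
        then show ?thesis by (simp add: N2_def)
      qed simp
      then have z: "(\<lambda>r. N2 P (D r) * indicator {0..<t} r) = (\<lambda>_. 0)" by (rule ext)
      have "N2 P (\<lambda>\<omega>. N t \<omega> - N 0 \<omega>)
          \<le> ennreal (8 * c2 * C\<^sup>2) * (\<integral>\<^sup>+r. N2 P (D r) * indicator {0..<t} r \<partial>lebesgue)"
        using N_int(3)[OF t' one[OF order_refl], of 1] by simp
      then show "N2 P (\<lambda>\<omega>. N t \<omega> - N 0 \<omega>) = 0" unfolding z by simp
    qed measurable
    ultimately show ?thesis
      using D_zero decomposition zero K_0
    proof eventually_elim
      case (elim \<omega>)
      have "D t \<omega> = 0" "D t \<omega> = V t \<omega> + N t \<omega> + K1 t \<omega> - K1' t \<omega>" using elim(3,4) t by auto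
      moreover have "V t \<omega> = 0" "N t \<omega> = 0" using elim by (auto simp: V_def)
      ultimately show ?case by (simp add: D_def)
    qed
  qed
qed

end

theorem theorem5p3:
  fixes T p \<sigma> x S0 C\<^sub>L :: real
    and E :: "(path \<Rightarrow> real) \<Rightarrow> real"
    and PG :: "path measure set"
    and qv S X K X' K' :: "real \<Rightarrow> path \<Rightarrow> real"
    and f h g :: "real \<Rightarrow> real \<Rightarrow> path \<Rightarrow> real"
  assumes "0 < T" and "0 \<le> \<sigma>" and "\<sigma> \<le> 1" and "2 < p"
    and "G_expectation \<sigma> E" and "represents PG E"
    and "quadratic_variation PG T qv"
    and "\<And>y. (\<lambda>t. f t y) \<in> M_G PG p T"
    and "\<And>y. (\<lambda>t. h t y) \<in> M_G PG p T"
    and "\<And>y. (\<lambda>t. g t y) \<in> M_G PG p T"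
    and "\<And>t. t \<in> {0..T} \<Longrightarrow> qs PG (\<lambda>\<omega>. \<forall>y y'.
           \<bar>f t y \<omega> - f t y' \<omega>\<bar> + \<bar>h t y \<omega> - h t y' \<omega>\<bar> + \<bar>g t y \<omega> - g t y' \<omega>\<bar> \<le> C\<^sub>L * \<bar>y - y'\<bar>)"
    and "G_Ito_process PG p T qv S0 S" and "S0 \<le> x"
    and "reflected_GSDE_solution PG p T qv x f h g S X K"
    and "reflected_GSDE_solution PG p T qv x f h g S X' K'"
  shows "qs PG (\<lambda>\<omega>. \<forall>t\<in>{0..T}. X t \<omega> = X' t \<omega> \<and> K t \<omega> = K' t \<omega>)"
proof -
  interpret G_framework \<sigma> E PG by unfold_locales fact+
  obtain X1 K1 where v: "version T X X1" "version T K K1"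
    by (rule solution_versions[OF assms(14,1)])
  obtain X1' K1' where v': "version T X' X1'" "version T K' K1'"
    by (rule solution_versions[OF assms(15,1)])
  have agree: "AE \<omega> in P. X1 t \<omega> = X1' t \<omega> \<and> K1 t \<omega> = K1' t \<omega>" if P: "P \<in> PG" and t: "t \<in> {0..T}" for P t
  proof -
    interpret G_measure \<sigma> E PG P by unfold_locales fact
    show ?thesis
      by (rule solutions_agree_AE[OF assms(1) _ assms(7,11,14,15) v(1) v'(1) v(2) v'(2) t]) (use assms(4) in auto)
  qed
  have "qs PG (\<lambda>\<omega>. \<forall>t\<in>{0..T}. X t \<omega> = X' t \<omega>)"
    by (rule version_qs_eq[OF v(1) v'(1) assms(1)]) (use agree in \<open>auto elim: eventually_mono\<close>)
  moreover have "qs PG (\<lambda>\<omega>. \<forall>t\<in>{0..T}. K t \<omega> = K' t \<omega>)"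
    by (rule version_qs_eq[OF v(2) v'(2) assms(1)]) (use agree in \<open>auto elim: eventually_mono\<close>)
  ultimately have "qs PG (\<lambda>\<omega>. (\<forall>t\<in>{0..T}. X t \<omega> = X' t \<omega>) \<and> (\<forall>t\<in>{0..T}. K t \<omega> = K' t \<omega>))"
    by (rule qs_conj)
  then show ?thesis by (rule qs_mono) simp
qed

end
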